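(* Let $K/k$ be an extension of (formally) real fields of degree $d=[K:k]<\infty$, and assume that every ordering of $k$ extends to $d$ different orderings of $K$. Then there exist sums of squares $c_1,\dots,c_d$ in $k$ with $c_1=1$ and with the following property: for every commutative $k$-algebra $A$, every $m\ge 1$ and every $f\in A$ which is a sum of $m$ squares in $A_K=A\otimes_k K$, there exist $f_1,\dots,f_d\in A$ such that each $f_i$ is a sum of $m$ squares in $A$, and such that $$f=\sum_{i=1}^d c_i f_i.$$ In particular, $f$ is a sum of $dm\cdot p(k)$ squares in $A$.
   Context: A field is (formally) real if it admits an ordering. $p(k)$ denotes the Pythagoras number of $k$, i.e. the smallest number $p$ such that every sum of squares in $k$ is a sum of $p$ squares in $k$; if no such number exists, $p(k)=\infty$ (and then the last assertion is void). $A$ is regarded as a subring of $A_K=A\otimes_k K$ via $a\mapsto a\otimes 1$. *)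

theory Defs
  imports "HOL-Algebra.Algebra" "HOL-Library.Extended_Nat"
begin

section \<open>Orderings, sums of squares and the Pythagoras number\<close>

text \<open>An ordering of a field is given by its set of nonnegative elements.  In this form an ordering
  \<open>Q\<close> of an extension field extends the ordering \<open>P\<close> of the subfield \<open>F\<close> iff \<open>Q \<inter> F = P\<close>.\<close>

definition field_ordering :: "('a, 'm) ring_scheme \<Rightarrow> 'a set \<Rightarrow> bool" where
  "field_ordering R P \<longleftrightarrow>
     P \<subseteq> carrier R \<and>
     (\<forall>x\<in>P. \<forall>y\<in>P. x \<oplus>\<^bsub>R\<^esub> y \<in> P \<and> x \<otimes>\<^bsub>R\<^esub> y \<in> P) \<and>
     (\<forall>x\<in>carrier R. x \<in> P \<or> \<ominus>\<^bsub>R\<^esub> x \<in> P) \<and>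
     (\<forall>x\<in>P. \<ominus>\<^bsub>R\<^esub> x \<in> P \<longrightarrow> x = \<zero>\<^bsub>R\<^esub>)"

definition real_field :: "('a, 'm) ring_scheme \<Rightarrow> bool" where
  "real_field R \<longleftrightarrow> field R \<and> (\<exists>P. field_ordering R P)"

definition sum_of_n_squares :: "('a, 'm) ring_scheme \<Rightarrow> nat \<Rightarrow> 'a \<Rightarrow> bool" where
  "sum_of_n_squares R n x \<longleftrightarrow>
     (\<exists>g \<in> {..<n} \<rightarrow> carrier R. x = (\<Oplus>\<^bsub>R\<^esub>i\<in>{..<n}. g i \<otimes>\<^bsub>R\<^esub> g i))"

definition sum_of_squares :: "('a, 'm) ring_scheme \<Rightarrow> 'a \<Rightarrow> bool" where
  "sum_of_squares R x \<longleftrightarrow> (\<exists>n. sum_of_n_squares R n x)"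

text \<open>The infimum of the empty set in \<^typ>\<open>enat\<close> is \<open>\<infinity>\<close>.\<close>

definition pythagoras_number :: "('a, 'm) ring_scheme \<Rightarrow> enat" where
  "pythagoras_number R =
     Inf {enat p |p. \<forall>x. sum_of_squares R x \<longrightarrow> sum_of_n_squares R p x}"


section \<open>Tensor products of commutative algebras\<close>

text \<open>The free abelian group on \<open>carrier A \<times> carrier B\<close>, made into a ring by extending
  \<open>(a, b) (a', b') = (a a', b b')\<close> biadditively.\<close>

definition pair_mult ::
  "('a, 'm) ring_scheme \<Rightarrow> ('b, 'n) ring_scheme \<Rightarrow>
   ('a \<times> 'b \<Rightarrow>\<^sub>0 int) \<Rightarrow> ('a \<times> 'b \<Rightarrow>\<^sub>0 int) \<Rightarrow> ('a \<times> 'b \<Rightarrow>\<^sub>0 int)" where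
  "pair_mult A B u v =
     frag_extend (\<lambda>p. frag_extend (\<lambda>q. frag_of (fst p \<otimes>\<^bsub>A\<^esub> fst q, snd p \<otimes>\<^bsub>B\<^esub> snd q)) v) u"

definition pair_ring ::
  "('a, 'm) ring_scheme \<Rightarrow> ('b, 'n) ring_scheme \<Rightarrow> ('a \<times> 'b \<Rightarrow>\<^sub>0 int) ring" where
  "pair_ring A B =
     \<lparr>carrier = carrier (free_Abelian_group (carrier A \<times> carrier B)),
      monoid.mult = pair_mult A B, one = frag_of (\<one>\<^bsub>A\<^esub>, \<one>\<^bsub>B\<^esub>), ring.zero = 0, ring.add = (+)\<rparr>"

definition tensor_relators ::
  "('r, 'l) ring_scheme \<Rightarrow> ('r, 'a, 'm) module_scheme \<Rightarrow> ('r, 'b, 'n) module_scheme \<Rightarrow>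
   ('a \<times> 'b \<Rightarrow>\<^sub>0 int) set" where
  "tensor_relators R A B =
     {frag_of (a \<oplus>\<^bsub>A\<^esub> a', b) - frag_of (a, b) - frag_of (a', b) |a a' b.
        a \<in> carrier A \<and> a' \<in> carrier A \<and> b \<in> carrier B} \<union>
     {frag_of (a, b \<oplus>\<^bsub>B\<^esub> b') - frag_of (a, b) - frag_of (a, b') |a b b'.
        a \<in> carrier A \<and> b \<in> carrier B \<and> b' \<in> carrier B} \<union>
     {frag_of (r \<odot>\<^bsub>A\<^esub> a, b) - frag_of (a, r \<odot>\<^bsub>B\<^esub> b) |r a b.
        r \<in> carrier R \<and> a \<in> carrier A \<and> b \<in> carrier B}"

text \<open>Note that \<open>tensor_ideal\<close> is only generated as an additive subgroup; that it is an ideal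
  of \<open>pair_ring\<close> is proved below.\<close>

definition tensor_ideal ::
  "('r, 'l) ring_scheme \<Rightarrow> ('r, 'a, 'm) module_scheme \<Rightarrow> ('r, 'b, 'n) module_scheme \<Rightarrow>
   ('a \<times> 'b \<Rightarrow>\<^sub>0 int) set" where
  "tensor_ideal R A B =
     generate (free_Abelian_group (carrier A \<times> carrier B)) (tensor_relators R A B)"

definition tensor_ring ::
  "('r, 'l) ring_scheme \<Rightarrow> ('r, 'a, 'm) module_scheme \<Rightarrow> ('r, 'b, 'n) module_scheme \<Rightarrow>
   (('a \<times> 'b \<Rightarrow>\<^sub>0 int) set) ring" where
  "tensor_ring R A B = pair_ring A B Quot tensor_ideal R A B"

definition pure_tensor ::
  "('r, 'l) ring_scheme \<Rightarrow> ('r, 'a, 'm) module_scheme \<Rightarrow> ('r, 'b, 'n) module_scheme \<Rightarrow>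
   'a \<Rightarrow> 'b \<Rightarrow> ('a \<times> 'b \<Rightarrow>\<^sub>0 int) set" where
  "pure_tensor R A B a b = tensor_ideal R A B +>\<^bsub>pair_ring A B\<^esub> frag_of (a, b)"

lemma pair_mult_of [simp]:
  "pair_mult A B (frag_of p) (frag_of q) = frag_of (fst p \<otimes>\<^bsub>A\<^esub> fst q, snd p \<otimes>\<^bsub>B\<^esub> snd q)"
  by (simp add: pair_mult_def)

lemma pair_mult_0 [simp]: "pair_mult A B 0 v = 0" "pair_mult A B u 0 = 0"
  by (auto simp: pair_mult_def intro: frag_extend_eq_0)

lemma pair_mult_diff_left: "pair_mult A B (u - u') v = pair_mult A B u v - pair_mult A B u' v"
  by (simp add: pair_mult_def frag_extend_diff)

lemma pair_mult_diff_right: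
  fixes A :: "('a, 'm) ring_scheme" and B :: "('b, 'n) ring_scheme"
  shows "pair_mult A B u (v - v') = pair_mult A B u v - pair_mult A B u v'"
proof -
  have "frag_extend (\<lambda>p. f p - g p) u = frag_extend f u - frag_extend g u"
    for f g :: "'a \<times> 'b \<Rightarrow> ('a \<times> 'b \<Rightarrow>\<^sub>0 int)"
    by (induction u rule: frag_induction [OF subset_UNIV]) (auto simp: frag_extend_diff)
  then show ?thesis
    by (simp add: pair_mult_def frag_extend_diff)
qed

lemmas pair_mult_diff = pair_mult_diff_left pair_mult_diff_right

lemma pair_mult_add_left: "pair_mult A B (u + u') v = pair_mult A B u v + pair_mult A B u' v"
  using pair_mult_diff_left [of A B u "- u'" v] pair_mult_diff_left [of A B 0 u' v] by simp

lemma pair_mult_add_right: "pair_mult A B u (v + v') = pair_mult A B u v + pair_mult A B u v'"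
  using pair_mult_diff_right [of A B u v "- v'"] pair_mult_diff_right [of A B u 0 v'] by simp

locale algebra_pair = A: algebra R A + B: algebra R B
  for R (structure) and A :: "('r, 'a, 'm) module_scheme" and B :: "('r, 'b, 'n) module_scheme"
begin

abbreviation "S \<equiv> carrier A \<times> carrier B"

lemmas M_assoc =
  monoid.m_assoc [OF ring.axioms(2) [OF cring.axioms(1) [OF A.M_cring]]]
  monoid.m_assoc [OF ring.axioms(2) [OF cring.axioms(1) [OF B.M_cring]]]

lemmas M_comm =
  comm_monoid.m_comm [OF cring.axioms(2) [OF A.M_cring]]
  comm_monoid.m_comm [OF cring.axioms(2) [OF B.M_cring]]

lemmas M_distr =
  ring.ring_simprules(23) [OF cring.axioms(1) [OF A.M_cring]]
  ring.ring_simprules(23) [OF cring.axioms(1) [OF B.M_cring]]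

lemma pair_mult_closed:
  assumes "Poly_Mapping.keys u \<subseteq> S" "Poly_Mapping.keys v \<subseteq> S"
  shows "Poly_Mapping.keys (pair_mult A B u v) \<subseteq> S"
proof -
  have "Poly_Mapping.keys (pair_mult A B (frag_of p) v) \<subseteq> S" if "p \<in> S" for p
    using assms(2)
  proof (induction v rule: frag_induction)
    case (one q)
    with that show ?case by (auto simp: mem_Times_iff)
  next
    case (diff a b)
    then show ?case by (auto simp: pair_mult_diff dest!: subsetD [OF keys_diff])
  qed auto
  with assms(1) show ?thesis
    by (induction u rule: frag_induction)
       (auto simp: pair_mult_diff dest!: subsetD [OF keys_diff])
qed

lemma pair_mult_comm:
  assumes "Poly_Mapping.keys u \<subseteq> S" "Poly_Mapping.keys v \<subseteq> S"
  shows "pair_mult A B u v = pair_mult A B v u"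
proof -
  have "pair_mult A B (frag_of p) v = pair_mult A B v (frag_of p)" if "p \<in> S" for p
    using assms(2)
    by (induction v rule: frag_induction)
       (use that in \<open>auto simp: pair_mult_diff M_comm\<close>)
  with assms(1) show ?thesis
    by (induction u rule: frag_induction) (auto simp: pair_mult_diff)
qed

lemma pair_mult_assoc:
  assumes "Poly_Mapping.keys u \<subseteq> S" "Poly_Mapping.keys v \<subseteq> S" "Poly_Mapping.keys w \<subseteq> S"
  shows "pair_mult A B (pair_mult A B u v) w = pair_mult A B u (pair_mult A B v w)"
proof -
  have 1: "pair_mult A B (pair_mult A B (frag_of p) (frag_of q)) w =
      pair_mult A B (frag_of p) (pair_mult A B (frag_of q) w)" if "p \<in> S" "q \<in> S" for p q
    using assms(3)
    by (induction w rule: frag_induction)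
       (use that in \<open>auto simp: pair_mult_diff M_assoc simp del: pair_mult_of,
          auto simp: M_assoc\<close>)
  have 2: "pair_mult A B (pair_mult A B (frag_of p) v) w =
      pair_mult A B (frag_of p) (pair_mult A B v w)" if "p \<in> S" for p
    using assms(2)
    by (induction v rule: frag_induction)
       (use that 1 in \<open>auto simp: pair_mult_diff simp del: pair_mult_of\<close>)
  from assms(1) show ?thesis
    by (induction u rule: frag_induction) (use 2 in \<open>auto simp: pair_mult_diff\<close>)
qed

lemma pair_mult_one:
  assumes "Poly_Mapping.keys u \<subseteq> S"
  shows "pair_mult A B (frag_of (\<one>\<^bsub>A\<^esub>, \<one>\<^bsub>B\<^esub>)) u = u"
  using assms by (induction u rule: frag_induction) (auto simp: pair_mult_diff)

lemma cring_pair_ring: "cring (pair_ring A B)"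
proof (rule cringI)
  show "abelian_group (pair_ring A B)"
  proof (rule abelian_groupI)
    show "\<exists>y\<in>carrier (pair_ring A B). y \<oplus>\<^bsub>pair_ring A B\<^esub> x = \<zero>\<^bsub>pair_ring A B\<^esub>"
      if "x \<in> carrier (pair_ring A B)" for x
      using that by (intro bexI [of _ "- x"]) (auto simp: pair_ring_def)
  qed (auto simp: pair_ring_def dest!: subsetD [OF keys_add])
  show "comm_monoid (pair_ring A B)"
    by (rule comm_monoidI)
       (auto simp: pair_ring_def pair_mult_one pair_mult_assoc
             intro: pair_mult_comm dest: subsetD [OF pair_mult_closed])
qed (simp add: pair_ring_def pair_mult_add_left)

lemma tensor_relators_subset: "tensor_relators R A B \<subseteq> carrier (free_Abelian_group S)"
  by (auto simp: tensor_relators_def dest!: subsetD [OF keys_diff])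

lemma ideal_tensor_ideal: "ideal (tensor_ideal R A B) (pair_ring A B)"
proof -
  interpret P: cring "pair_ring A B" by (rule cring_pair_ring)
  interpret G: group "free_Abelian_group S" by simp
  have G: "add_monoid (pair_ring A B) = free_Abelian_group S"
    by (simp add: pair_ring_def free_Abelian_group_def)
  have sub: "subgroup (tensor_ideal R A B) (free_Abelian_group S)"
    unfolding tensor_ideal_def by (rule G.generate_is_subgroup [OF tensor_relators_subset])
  have I_diff: "u - v \<in> tensor_ideal R A B"
    if "u \<in> tensor_ideal R A B" "v \<in> tensor_ideal R A B" for u v
  proof -
    have "inv\<^bsub>free_Abelian_group S\<^esub> v = - v"
      using subgroup.mem_carrier [OF sub that(2)] by simp
    with subgroup.m_closed [OF sub that(1) subgroup.m_inv_closed [OF sub that(2)]]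
    show ?thesis by simp
  qed
  have I_0: "0 \<in> tensor_ideal R A B"
    using subgroup.one_closed [OF sub] by simp
  have rel: "pair_mult A B (frag_of p) u \<in> tensor_relators R A B"
    if u: "u \<in> tensor_relators R A B" and "p \<in> S" for u p
  proof -
    obtain x y where p: "p = (x, y)" and xy: "x \<in> carrier A" "y \<in> carrier B"
      using \<open>p \<in> S\<close> by auto
    from u consider
      (1) a a' b where "u = frag_of (a \<oplus>\<^bsub>A\<^esub> a', b) - frag_of (a, b) - frag_of (a', b)"
         "a \<in> carrier A" "a' \<in> carrier A" "b \<in> carrier B"
      | (2) a b b' where "u = frag_of (a, b \<oplus>\<^bsub>B\<^esub> b') - frag_of (a, b) - frag_of (a, b')"
         "a \<in> carrier A" "b \<in> carrier B" "b' \<in> carrier B"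
      | (3) r a b where "u = frag_of (r \<odot>\<^bsub>A\<^esub> a, b) - frag_of (a, r \<odot>\<^bsub>B\<^esub> b)"
         "r \<in> carrier R" "a \<in> carrier A" "b \<in> carrier B"
      unfolding tensor_relators_def by blast
    then show ?thesis
    proof cases
      case 1
      then have "pair_mult A B (frag_of p) u =
          frag_of (x \<otimes>\<^bsub>A\<^esub> a \<oplus>\<^bsub>A\<^esub> x \<otimes>\<^bsub>A\<^esub> a', y \<otimes>\<^bsub>B\<^esub> b)
          - frag_of (x \<otimes>\<^bsub>A\<^esub> a, y \<otimes>\<^bsub>B\<^esub> b) - frag_of (x \<otimes>\<^bsub>A\<^esub> a', y \<otimes>\<^bsub>B\<^esub> b)"
        using xy by (simp add: p pair_mult_diff M_distr)
      moreover have "x \<otimes>\<^bsub>A\<^esub> a \<in> carrier A" "x \<otimes>\<^bsub>A\<^esub> a' \<in> carrier A" "y \<otimes>\<^bsub>B\<^esub> b \<in> carrier B"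
        using 1 xy by auto
      ultimately show ?thesis unfolding tensor_relators_def by blast
    next
      case 2
      then have "pair_mult A B (frag_of p) u =
          frag_of (x \<otimes>\<^bsub>A\<^esub> a, y \<otimes>\<^bsub>B\<^esub> b \<oplus>\<^bsub>B\<^esub> y \<otimes>\<^bsub>B\<^esub> b')
          - frag_of (x \<otimes>\<^bsub>A\<^esub> a, y \<otimes>\<^bsub>B\<^esub> b) - frag_of (x \<otimes>\<^bsub>A\<^esub> a, y \<otimes>\<^bsub>B\<^esub> b')"
        using xy by (simp add: p pair_mult_diff M_distr)
      moreover have "x \<otimes>\<^bsub>A\<^esub> a \<in> carrier A" "y \<otimes>\<^bsub>B\<^esub> b \<in> carrier B" "y \<otimes>\<^bsub>B\<^esub> b' \<in> carrier B"
        using 2 xy by auto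
      ultimately show ?thesis unfolding tensor_relators_def by blast
    next
      case 3
      have "x \<otimes>\<^bsub>A\<^esub> (r \<odot>\<^bsub>A\<^esub> a) = r \<odot>\<^bsub>A\<^esub> (x \<otimes>\<^bsub>A\<^esub> a)"
        using 3 xy A.smult_assoc2 [of r a x] by (simp add: M_comm)
      moreover have "y \<otimes>\<^bsub>B\<^esub> (r \<odot>\<^bsub>B\<^esub> b) = r \<odot>\<^bsub>B\<^esub> (y \<otimes>\<^bsub>B\<^esub> b)"
        using 3 xy B.smult_assoc2 [of r b y] by (simp add: M_comm)
      ultimately have "pair_mult A B (frag_of p) u =
          frag_of (r \<odot>\<^bsub>A\<^esub> (x \<otimes>\<^bsub>A\<^esub> a), y \<otimes>\<^bsub>B\<^esub> b) - frag_of (x \<otimes>\<^bsub>A\<^esub> a, r \<odot>\<^bsub>B\<^esub> (y \<otimes>\<^bsub>B\<^esub> b))"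
        using 3 by (simp add: p pair_mult_diff)
      moreover have "x \<otimes>\<^bsub>A\<^esub> a \<in> carrier A" "y \<otimes>\<^bsub>B\<^esub> b \<in> carrier B"
        using 3 xy by auto
      ultimately show ?thesis using 3(2) unfolding tensor_relators_def by blast
    qed
  qed
  have gen: "pair_mult A B (frag_of p) u \<in> tensor_ideal R A B"
    if "u \<in> tensor_ideal R A B" and p: "p \<in> S" for u p
    using that(1) unfolding tensor_ideal_def
  proof (induction u rule: generate.induct)
    case one
    then show ?case using generate.one [of "free_Abelian_group S"] by simp
  next
    case (incl h)
    then show ?case using rel [OF _ p] by (simp add: generate.incl)
  next
    case (inv h)
    then have "h \<in> tensor_ideal R A B" "pair_mult A B (frag_of p) h \<in> tensor_ideal R A B"
      using rel [OF _ p] by (simp_all add: tensor_ideal_def generate.incl)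
    moreover have "inv\<^bsub>free_Abelian_group S\<^esub> h = 0 - h"
      using subsetD [OF tensor_relators_subset inv] by (subst inv_free_Abelian_group) auto
    ultimately show ?case
      using I_diff [OF I_0] by (simp only: pair_mult_diff pair_mult_0 tensor_ideal_def)
  next
    case (eng h1 h2)
    then show ?case
      using generate.eng [of "pair_mult A B (frag_of p) h1" "free_Abelian_group S"]
      by (simp add: pair_mult_add_right)
  qed
  have left: "pair_mult A B x a \<in> tensor_ideal R A B"
    if a: "a \<in> tensor_ideal R A B" and "x \<in> carrier (pair_ring A B)" for a x
  proof -
    from that(2) have "Poly_Mapping.keys x \<subseteq> S" by (simp add: pair_ring_def)
    then show ?thesis
      by (induction x rule: frag_induction) (auto simp: gen [OF a] pair_mult_diff I_diff I_0)
  qed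
  show ?thesis
  proof (rule idealI)
    show "ring (pair_ring A B)" by (rule P.ring_axioms)
    show "subgroup (tensor_ideal R A B) (add_monoid (pair_ring A B))"
      using sub by (simp only: G)
    fix a x assume a: "a \<in> tensor_ideal R A B" and x: "x \<in> carrier (pair_ring A B)"
    from left [OF this] show "x \<otimes>\<^bsub>pair_ring A B\<^esub> a \<in> tensor_ideal R A B"
      by (simp add: pair_ring_def)
    moreover have "a \<in> carrier (pair_ring A B)"
      using subgroup.mem_carrier [OF sub a] by (simp add: pair_ring_def)
    ultimately show "a \<otimes>\<^bsub>pair_ring A B\<^esub> x \<in> tensor_ideal R A B"
      using x by (simp add: P.m_comm)
  qed
qed

lemma cring_tensor_ring: "cring (tensor_ring R A B)"
  unfolding tensor_ring_def
  by (rule ideal.quotient_is_cring [OF ideal_tensor_ideal cring_pair_ring])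

end


section \<open>Base change of an algebra along a field extension\<close>

definition extension_algebra :: "('a, 'm) ring_scheme \<Rightarrow> ('a, 'a) module" where
  "extension_algebra K =
     \<lparr>carrier = carrier K, monoid.mult = monoid.mult K, one = one K, ring.zero = ring.zero K, ring.add = ring.add K,
      smult = monoid.mult K\<rparr>"

lemma algebra_extension_algebra:
  assumes "field K" "subfield F K"
  shows "algebra (K\<lparr>carrier := F\<rparr>) (extension_algebra K)"
proof -
  interpret K: field K by fact
  interpret F: subfield F K by fact
  have F: "x \<in> carrier K" if "x \<in> F" for x
    using that F.subset by auto
  show ?thesis
  proof (rule algebraI)
    show "cring (K\<lparr>carrier := F\<rparr>)"
      using K.subfield_iff(2)[OF assms(2)] by (simp add: fieldE)
    show "cring (extension_algebra K)"
      unfolding extension_algebra_def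
      by (intro cringI abelian_groupI comm_monoidI)
         (auto simp: K.a_ac K.m_ac K.l_distr K.r_distr
               intro: bexI [of _ "\<ominus>\<^bsub>K\<^esub> _"] K.l_neg)
  qed (auto simp: extension_algebra_def F K.l_distr K.r_distr K.m_assoc)
qed

definition base_change ::
  "('k, 'm) ring_scheme \<Rightarrow> 'k set \<Rightarrow> ('k, 'a, 'n) module_scheme \<Rightarrow> (('a \<times> 'k \<Rightarrow>\<^sub>0 int) set) ring" where
  "base_change K F A = tensor_ring (K\<lparr>carrier := F\<rparr>) A (extension_algebra K)"

definition to_base_change ::
  "('k, 'm) ring_scheme \<Rightarrow> 'k set \<Rightarrow> ('k, 'a, 'n) module_scheme \<Rightarrow> 'a \<Rightarrow> ('a \<times> 'k \<Rightarrow>\<^sub>0 int) set" where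
  "to_base_change K F A a = pure_tensor (K\<lparr>carrier := F\<rparr>) A (extension_algebra K) a \<one>\<^bsub>K\<^esub>"

definition squares_descend ::
  "('k, 'm) ring_scheme \<Rightarrow> 'k set \<Rightarrow> nat \<Rightarrow> (nat \<Rightarrow> 'k) \<Rightarrow> ('k, 'a, 'n) module_scheme \<Rightarrow> bool" where
  "squares_descend K F d c A \<longleftrightarrow>
     (\<forall>m\<ge>1. \<forall>f\<in>carrier A.
        sum_of_n_squares (base_change K F A) m (to_base_change K F A f) \<longrightarrow>
        (\<exists>g \<in> {1..d} \<rightarrow> carrier A.
           (\<forall>i\<in>{1..d}. sum_of_n_squares A m (g i)) \<and>
           f = (\<Oplus>\<^bsub>A\<^esub>i\<in>{1..d}. c i \<odot>\<^bsub>A\<^esub> g i)))"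

definition descent_coefficients ::
  "'a itself \<Rightarrow> ('k, 'm) ring_scheme \<Rightarrow> 'k set \<Rightarrow> nat \<Rightarrow> (nat \<Rightarrow> 'k) \<Rightarrow> bool" where
  "descent_coefficients (_ :: 'a itself) K F d c \<longleftrightarrow>
     c 1 = \<one>\<^bsub>K\<^esub> \<and>
     (\<forall>i\<in>{1..d}. sum_of_squares (K\<lparr>carrier := F\<rparr>) (c i)) \<and>
     (\<forall>A :: ('k, 'a) module. algebra (K\<lparr>carrier := F\<rparr>) A \<longrightarrow> squares_descend K F d c A)"

text \<open>A single choice of \<open>c\<close> has to serve all algebras \<open>A\<close>, over carriers of all types, but
  \<open>\<exists>c. descent_coefficients TYPE('a) K F d c\<close> would allow \<open>c\<close> to depend on \<open>'a\<close>.  Since HOL has no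
  quantifier over types inside a formula, "there is \<open>c\<close> that works for all types \<open>'a\<close>" is
  expressed by the two facts
    \<open>\<exists>c. descent_coefficients TYPE(nat \<Rightarrow> 'k) K F d c\<close> and
    \<open>\<forall>c. descent_coefficients TYPE(nat \<Rightarrow> 'k) K F d c \<longrightarrow> descent_coefficients TYPE('a) K F d c\<close>,
  where \<open>'a\<close> is an arbitrary type.  Together they provide \<open>c\<close> chosen before \<open>'a\<close>.
  The type \<open>nat \<Rightarrow> 'k\<close> is large enough for this: every algebra of countable dimension is
  isomorphic to one with carrier in that type (finitely supported coordinate sequences), and a
  representation of \<open>f\<close> as a sum of squares in \<open>A \<otimes> K\<close> only involves a finitely generated
  subalgebra of \<open>A\<close>.\<close>

end

theory Submission
  imports
    Defs
    "HOL-Computational_Algebra.Computational_Algebra"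
    "HOL-Analysis.Continuum_Not_Denumerable"
    "HOL-Library.Nat_Bijection"
    "Jordan_Normal_Form.Char_Poly"
begin

text \<open>Write \<open>k\<close> for the field on \<open>F\<close>.  The trace of \<open>K/k\<close> divided by the trace of \<open>1\<close> is a \<open>k\<close>-linear
  functional \<open>t\<close> with \<open>t 1 = 1\<close>.  Suppose that \<open>t (x\<^sup>2)\<close> is a sum of squares in \<open>k\<close> for every \<open>x\<close> in \<open>K\<close>,
  and let \<open>u\<^sub>0 = 1, \<dots>, u\<^sub>d\<^sub>-\<^sub>1\<close> be a basis of \<open>K\<close> that is orthogonal for the form \<open>t (x y)\<close>.  If
  \<open>f \<otimes> 1 = \<Sum>\<^sub>j g\<^sub>j\<^sup>2\<close> in \<open>A\<^sub>K\<close> and \<open>g\<^sub>j = \<Sum>\<^sub>i g\<^sub>j\<^sub>i \<otimes> u\<^sub>i\<close>, then \<open>id \<otimes> t\<close> sends the left side to \<open>f\<close> and the right side to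
  \<open>\<Sum>\<^sub>i t (u\<^sub>i\<^sup>2) (\<Sum>\<^sub>j g\<^sub>j\<^sub>i\<^sup>2)\<close>.  So the elements \<open>t (u\<^sub>i\<^sup>2)\<close> are coefficients that serve all \<open>A\<close> at once
  (\<open>squares_descend_orthogonal\<close>).  Each of them is a sum of \<open>p(k)\<close> squares, and a sum of \<open>p\<close> squares
  times a sum of \<open>m\<close> squares is a sum of \<open>p m\<close> squares; this is the last assertion.

  By Artin's theorem (\<open>artin\<close>) it remains to see that \<open>t (x\<^sup>2)\<close> is nonnegative at every ordering \<open>P\<close> of
  \<open>k\<close>, and this is where the orderings of \<open>K\<close> enter (\<open>trace_of_square_positive\<close>).  Put \<open>(k, P)\<close> into a
  real closed field \<open>R\<close>.  Each of the \<open>d\<close> orderings of \<open>K\<close> above \<open>P\<close> comes from an embedding \<open>\<sigma>\<close> of \<open>K\<close>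
  into \<open>R\<close> over \<open>k\<close> (\<open>order_embedding\<close>), and different orderings come from different embeddings.  A
  family of \<open>d\<close> different embeddings of an extension of degree \<open>d\<close> adds up to the trace
  (\<open>trace_eq_sum_embeddings\<close>), so the trace of \<open>x\<^sup>2\<close> is the sum of the squares \<open>\<sigma>(x)\<^sup>2\<close>.

  All ordered fields of this argument are subsets of one algebraically closed field, whose maximal
  ordered subfields serve as the real closed fields (\<open>max_ordered_subfield\<close>).  For this, \<open>K\<close> is first replaced by a
  countable subfield that contains the finitely many elements in question and is closed under taking
  coordinates; such a field embeds into the complex numbers (\<open>countable_field_embeds_complex\<close>).

  That coefficients which serve the algebras on one type serve all algebras is a matter of size.  The
  equation \<open>f \<otimes> 1 = \<Sum>\<^sub>j g\<^sub>j\<^sup>2\<close> says that finitely many coordinates in \<open>A\<close> satisfy finitely many polynomial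
  equations.  It thus already holds over a finitely generated subalgebra, whose elements can be coded
  by functions from the natural numbers to \<open>K\<close> (\<open>squares_descend_all_types\<close>).\<close>

(* The short names are to mean the coefficients, monomials and multiples of univariate polynomials. *)
hide_const (open) up_ring.coeff up_ring.monom module.smult

section \<open>Preorderings extend to orderings\<close>

context field
begin

definition preordering :: "'a set \<Rightarrow> bool" where
  "preordering T \<longleftrightarrow> T \<subseteq> carrier R \<and>
     (\<forall>x\<in>T. \<forall>y\<in>T. x \<oplus> y \<in> T \<and> x \<otimes> y \<in> T) \<and>
     (\<forall>x\<in>carrier R. x \<otimes> x \<in> T) \<and> \<ominus> \<one> \<notin> T"

text \<open>The set of all \<open>s + a t\<close> is closed under products because \<open>a\<^sup>2\<close> lies in \<open>T\<close>; thus it is a preordering as soon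
  as it misses \<open>-1\<close>.\<close>

lemma preordering_adjoin:
  assumes T: "preordering T" and a: "a \<in> carrier R"
    and m1: "\<And>s t. s \<in> T \<Longrightarrow> t \<in> T \<Longrightarrow> \<ominus> \<one> \<noteq> s \<oplus> a \<otimes> t"
  shows "preordering {s \<oplus> a \<otimes> t |s t. s \<in> T \<and> t \<in> T}" (is "preordering ?T'")
    and "T \<subseteq> {s \<oplus> a \<otimes> t |s t. s \<in> T \<and> t \<in> T}" and "a \<in> {s \<oplus> a \<otimes> t |s t. s \<in> T \<and> t \<in> T}"
proof -
  have Tc: "x \<in> T \<Longrightarrow> x \<in> carrier R" and Ta: "x \<in> T \<Longrightarrow> y \<in> T \<Longrightarrow> x \<oplus> y \<in> T"
    and Tm: "x \<in> T \<Longrightarrow> y \<in> T \<Longrightarrow> x \<otimes> y \<in> T" and Ts: "x \<in> carrier R \<Longrightarrow> x \<otimes> x \<in> T" for x y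
    using T unfolding preordering_def by auto
  have T0: "\<zero> \<in> T" and T1: "\<one> \<in> T" using Ts[of \<zero>] Ts[of \<one>] by auto
  show sub: "T \<subseteq> ?T'"
  proof
    fix x assume "x \<in> T"
    moreover have "x = x \<oplus> a \<otimes> \<zero>" using Tc[OF \<open>x \<in> T\<close>] a by simp
    ultimately show "x \<in> ?T'" using T0 by blast
  qed
  show "a \<in> ?T'"
    using T0 T1 a by (intro CollectI exI[of _ \<zero>] exI[of _ \<one>]) auto
  have "x \<oplus> y \<in> ?T' \<and> x \<otimes> y \<in> ?T'" if "x \<in> ?T'" "y \<in> ?T'" for x y
  proof -
    from that obtain s t s' t' where st: "s \<in> T" "t \<in> T" "s' \<in> T" "t' \<in> T"
      and x: "x = s \<oplus> a \<otimes> t" and y: "y = s' \<oplus> a \<otimes> t'" by blast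
    note c = Tc[OF st(1)] Tc[OF st(2)] Tc[OF st(3)] Tc[OF st(4)] a
    have "x \<oplus> y = (s \<oplus> s') \<oplus> a \<otimes> (t \<oplus> t')"
      unfolding x y using c by (simp add: r_distr a_ac)
    moreover have "x \<otimes> y = (s \<otimes> s' \<oplus> (a \<otimes> a) \<otimes> (t \<otimes> t')) \<oplus> a \<otimes> (s \<otimes> t' \<oplus> t \<otimes> s')"
      unfolding x y using c by (simp add: r_distr l_distr a_ac m_ac)
    moreover have "s \<oplus> s' \<in> T" "t \<oplus> t' \<in> T" "s \<otimes> s' \<oplus> (a \<otimes> a) \<otimes> (t \<otimes> t') \<in> T"
      "s \<otimes> t' \<oplus> t \<otimes> s' \<in> T" using st Ta Tm Ts[OF a] by simp_all
    ultimately show ?thesis by blast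
  qed
  moreover have "?T' \<subseteq> carrier R" using Tc a by auto
  moreover have "\<ominus> \<one> \<notin> ?T'" using m1 by auto
  ultimately show "preordering ?T'"
    unfolding preordering_def using sub Ts by blast
qed

text \<open>A maximal preordering \<open>M\<close> is an ordering: if it contained neither \<open>x\<close> nor \<open>-x\<close>, then by maximality
  \<open>-1 = s + x t = s' - x t'\<close> with all of \<open>s, t, s', t'\<close> in \<open>M\<close>, and the product of \<open>x t = -(1 + s)\<close> and \<open>x t' = 1 + s'\<close>
  would show that \<open>-1\<close> is in \<open>M\<close>.\<close>

theorem preordering_extends:
  assumes T: "preordering T"
  shows "\<exists>P. T \<subseteq> P \<and> field_ordering R P"
proof -
  define AA where "AA = {S. T \<subseteq> S \<and> preordering S}"
  have "\<exists>M\<in>AA. \<forall>V\<in>AA. M \<subseteq> V \<longrightarrow> V = M"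
  proof (rule subset_Zorn_nonempty)
    show "AA \<noteq> {}" using T unfolding AA_def by auto
  next
    fix C assume "C \<noteq> {}" and C: "subset.chain AA C"
    have sub: "V \<subseteq> W \<or> W \<subseteq> V" if "V \<in> C" "W \<in> C" for V W
      using that C unfolding subset_chain_def by blast
    have inA: "V \<in> AA" if "V \<in> C" for V using C that unfolding subset_chain_def by blast
    have "x \<oplus> y \<in> \<Union>C \<and> x \<otimes> y \<in> \<Union>C" if "x \<in> \<Union>C" "y \<in> \<Union>C" for x y
    proof -
      from that obtain V W where VW: "V \<in> C" "W \<in> C" "x \<in> V" "y \<in> W" by blast
      with sub obtain Z where "Z \<in> C" "x \<in> Z" "y \<in> Z" by blast
      with inA[of Z] show ?thesis unfolding AA_def preordering_def by blast
    qed
    moreover have "\<Union>C \<subseteq> carrier R" "\<ominus> \<one> \<notin> \<Union>C"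
      using inA unfolding AA_def preordering_def by blast+
    moreover have "T \<subseteq> \<Union>C" "\<forall>x\<in>carrier R. x \<otimes> x \<in> \<Union>C"
      using \<open>C \<noteq> {}\<close> inA unfolding AA_def preordering_def by blast+
    ultimately show "\<Union>C \<in> AA" unfolding AA_def preordering_def by auto
  qed
  then obtain M where TM: "T \<subseteq> M" and M: "preordering M"
    and max: "\<And>V. preordering V \<Longrightarrow> M \<subseteq> V \<Longrightarrow> V = M" unfolding AA_def by (smt (verit) mem_Collect_eq subset_trans)
  have Tc: "x \<in> M \<Longrightarrow> x \<in> carrier R" and Ta: "x \<in> M \<Longrightarrow> y \<in> M \<Longrightarrow> x \<oplus> y \<in> M"
    and Tm: "x \<in> M \<Longrightarrow> y \<in> M \<Longrightarrow> x \<otimes> y \<in> M" and Ts: "x \<in> carrier R \<Longrightarrow> x \<otimes> x \<in> M"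
    and m1: "\<ominus> \<one> \<notin> M" for x y
    using M unfolding preordering_def by auto
  have "x \<in> M \<or> \<ominus> x \<in> M" if x: "x \<in> carrier R" for x
  proof (rule ccontr)
    assume not: "\<not> (x \<in> M \<or> \<ominus> x \<in> M)"
    have "\<exists>s\<in>M. \<exists>t\<in>M. \<ominus> \<one> = s \<oplus> y \<otimes> t" if "y \<in> carrier R" "y \<notin> M" for y
    proof (rule ccontr)
      assume "\<not> ?thesis"
      then have *: "\<And>s t. s \<in> M \<Longrightarrow> t \<in> M \<Longrightarrow> \<ominus> \<one> \<noteq> s \<oplus> y \<otimes> t" by blast
      from max[OF preordering_adjoin(1,2)[OF M that(1) *]] preordering_adjoin(3)[OF M that(1) *] that(2)
      show False by blast
    qed
    from this[of x] this[of "\<ominus> x"] not x obtain s t s' t'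
      where st: "s \<in> M" "t \<in> M" "s' \<in> M" "t' \<in> M"
      and e1: "\<ominus> \<one> = s \<oplus> x \<otimes> t" and e2: "\<ominus> \<one> = s' \<oplus> (\<ominus> x) \<otimes> t'" by (metis a_inv_closed)
    note c = Tc[OF st(1)] Tc[OF st(2)] Tc[OF st(3)] Tc[OF st(4)] x
    have x1: "x \<otimes> t = \<ominus> \<one> \<ominus> s"
      unfolding e1 using c a_assoc[of s "x \<otimes> t" "\<ominus> s"] a_comm[of "x \<otimes> t" "\<ominus> s"]
      r_neg2[of s "x \<otimes> t"]
      by (simp add: a_minus_def)
    have "\<ominus> \<one> = s' \<oplus> \<ominus> (x \<otimes> t')" using e2 c by (simp add: l_minus)
    then have "\<ominus> \<one> \<oplus> x \<otimes> t' = s'" using c by (simp add: a_assoc l_neg)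
    then have x2: "x \<otimes> t' = \<one> \<oplus> s'" using c r_neg2[of \<one> "x \<otimes> t'"] by simp
    define w where "w = s \<oplus> s' \<oplus> s \<otimes> s'"
    have w: "w \<in> carrier R" using c by (simp add: w_def)
    have "(x \<otimes> x) \<otimes> (t \<otimes> t') = (x \<otimes> t) \<otimes> (x \<otimes> t')" using c by (simp add: m_ac)
    also have "\<dots> = \<ominus> ((\<one> \<oplus> s) \<otimes> (\<one> \<oplus> s'))"
      using c by (simp add: x1 x2 a_minus_def l_minus[symmetric] minus_add)
    also have "(\<one> \<oplus> s) \<otimes> (\<one> \<oplus> s') = \<one> \<oplus> w"
      unfolding w_def using c by (simp add: r_distr l_distr a_ac)
    finally have "(x \<otimes> x) \<otimes> (t \<otimes> t') \<oplus> w = \<ominus> \<one>"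
      using w by (simp add: minus_add a_assoc l_neg)
    moreover have "w \<in> M" "(x \<otimes> x) \<otimes> (t \<otimes> t') \<in> M"
      unfolding w_def using st Ta Tm Ts[OF x] by simp_all
    ultimately show False using Ta m1 by metis
  qed
  moreover have "x = \<zero>" if x: "x \<in> M" "\<ominus> x \<in> M" for x
  proof (rule ccontr)
    assume "x \<noteq> \<zero>"
    then have u: "inv x \<in> carrier R" "x \<otimes> inv x = \<one>" using Tc[OF x(1)] field_Units by auto
    have "(x \<otimes> x) \<otimes> (inv x \<otimes> inv x) = (x \<otimes> inv x) \<otimes> (x \<otimes> inv x)"
      using u(1) Tc[OF x(1)] by (simp add: m_ac)
    then have "(x \<otimes> \<ominus> x) \<otimes> (inv x \<otimes> inv x) = \<ominus> ((x \<otimes> inv x) \<otimes> (x \<otimes> inv x))"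
      using u(1) Tc[OF x(1)] by (simp add: r_minus l_minus)
    then have "(x \<otimes> \<ominus> x) \<otimes> (inv x \<otimes> inv x) = \<ominus> \<one>" using u by simp
    moreover have "(x \<otimes> \<ominus> x) \<otimes> (inv x \<otimes> inv x) \<in> M"
      using x Tm Ts[OF u(1)] by blast
    ultimately show False using m1 by simp
  qed
  moreover have "M \<subseteq> carrier R" "\<forall>x\<in>M. \<forall>y\<in>M. x \<oplus> y \<in> M \<and> x \<otimes> y \<in> M"
    using M unfolding preordering_def by simp_all
  ultimately have "field_ordering R M" unfolding field_ordering_def by simp
  with TM show ?thesis by blast
qed

end

section \<open>Ordered subfields and polynomials over them\<close>

text \<open>Subrings and subfields are sets in an ambient field type, so that subfields with different orderings
  can be compared and chains of them can be united.\<close>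

locale subring_set =
  fixes M :: "'a::field set"
  assumes zero: "0 \<in> M" and one: "1 \<in> M"
    and add: "x \<in> M \<Longrightarrow> y \<in> M \<Longrightarrow> x + y \<in> M"
    and mult: "x \<in> M \<Longrightarrow> y \<in> M \<Longrightarrow> x * y \<in> M"
    and neg: "x \<in> M \<Longrightarrow> - x \<in> M"
begin

lemma diff: "x \<in> M \<Longrightarrow> y \<in> M \<Longrightarrow> x - y \<in> M"
  using add[of x "- y"] neg[of y] by simp

lemma of_nat: "of_nat n \<in> M"
  by (induction n) (auto simp: zero one add)

lemma sum: "(\<And>i. i \<in> A \<Longrightarrow> f i \<in> M) \<Longrightarrow> sum f A \<in> M"
  by (induction A rule: infinite_finite_induct) (auto simp: zero add)

end

locale subfield_set = subring_set M for M :: "'a::field set" +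
  assumes inv: "x \<in> M \<Longrightarrow> inverse x \<in> M"
begin

lemma divide: "x \<in> M \<Longrightarrow> y \<in> M \<Longrightarrow> x / y \<in> M"
  using mult[of x "inverse y"] inv[of y] by (simp add: field_simps)

lemmas closed = zero one add mult neg inv diff divide sum of_nat

end

text \<open>The sign in the ordering with the nonnegative elements \<open>P\<close>.  Being an integer, it turns a change of
  sign into the equation \<open>sg x * sg y = - 1\<close>.  Elements outside the ordered field get the sign \<open>- 1\<close>.\<close>

definition sgn_in :: "'a::zero set \<Rightarrow> 'a \<Rightarrow> int" where
  "sgn_in P x = (if x = 0 then 0 else if x \<in> P then 1 else - 1)"

abbreviation less_in :: "'a::field set \<Rightarrow> 'a \<Rightarrow> 'a \<Rightarrow> bool" where
  "less_in P x y \<equiv> sgn_in P (y - x) = 1"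

lemma sgn_in_0 [simp]: "sgn_in P 0 = 0"
  by (simp add: sgn_in_def)

lemma sgn_in_eq_0_iff [simp]: "sgn_in P x = 0 \<longleftrightarrow> x = 0"
  by (simp add: sgn_in_def)

lemma sgn_in_cases: "sgn_in P x = 0 \<or> sgn_in P x = 1 \<or> sgn_in P x = - 1"
  by (simp add: sgn_in_def)

locale ordered_subfield = subfield_set M for M :: "'a::field_char_0 set" +
  fixes P :: "'a set"
  assumes P_sub: "P \<subseteq> M"
    and P_add: "x \<in> P \<Longrightarrow> y \<in> P \<Longrightarrow> x + y \<in> P"
    and P_mult: "x \<in> P \<Longrightarrow> y \<in> P \<Longrightarrow> x * y \<in> P"
    and P_total: "x \<in> M \<Longrightarrow> x \<in> P \<or> - x \<in> P"
    and P_antisym: "x \<in> P \<Longrightarrow> - x \<in> P \<Longrightarrow> x = 0"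
begin

abbreviation "sg \<equiv> sgn_in P"
abbreviation "lt \<equiv> less_in P"

lemma sg_neg: "x \<in> M \<Longrightarrow> sg (- x) = - sg x"
  using P_total[of x] P_antisym[of x] by (auto simp: sgn_in_def)

lemma sg_mult:
  assumes "x \<in> M" "y \<in> M"
  shows "sg (x * y) = sg x * sg y"
proof -
  have pos: "sg (x * y) = 1" if "x \<in> P" "y \<in> P" "x \<noteq> 0" "y \<noteq> 0" for x y
    using that P_mult by (auto simp: sgn_in_def)
  show ?thesis
  proof (cases "x = 0 \<or> y = 0")
    case False
    with assms consider "x \<in> P" "y \<in> P" | "- x \<in> P" "y \<in> P" | "x \<in> P" "- y \<in> P" | "- x \<in> P" "- y \<in> P"
      using P_total by blast
    then show ?thesis
    proof cases
      case 1 with pos[of x y] False show ?thesis by (simp add: sgn_in_def)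
    next
      case 2
      with pos[of "- x" y] False sg_neg[of "x * y"] sg_neg[of x] assms mult show ?thesis
        by (auto simp: sgn_in_def split: if_splits)
    next
      case 3
      with pos[of x "- y"] False sg_neg[of "x * y"] sg_neg[of y] assms mult show ?thesis
        by (auto simp: sgn_in_def split: if_splits)
    next
      case 4
      with pos[of "- x" "- y"] False sg_neg[of x] sg_neg[of y] assms show ?thesis
        by (auto simp: sgn_in_def split: if_splits)
    qed
  qed auto
qed

lemma sg_one [simp]: "sg 1 = 1"
proof -
  have "sg 1 * sg 1 = sg 1" using sg_mult[OF one one] by simp
  then show ?thesis using sgn_in_cases[of P 1] by auto
qed

lemma P_iff_sg: "x \<in> M \<Longrightarrow> x \<in> P \<longleftrightarrow> sg x \<ge> 0"
  using P_total[of 0] zero by (auto simp: sgn_in_def)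

lemma zero_P: "0 \<in> P"
  using P_iff_sg[OF zero] by simp

lemma one_P: "1 \<in> P"
  using P_iff_sg[OF one] by simp

lemma square_P: "x \<in> M \<Longrightarrow> x * x \<in> P"
  using P_iff_sg[OF mult] sg_mult[of x x] by (simp add: zero_le_mult_iff linorder_linear)

lemma sg_add_pos: "sg x = 1 \<Longrightarrow> y \<in> P \<Longrightarrow> sg (x + y) = 1"
  using P_add[of x y] P_antisym[of x] P_add[of y "- (x + y)"]
  by (auto simp: sgn_in_def zero_P split: if_splits) (metis add_eq_0_iff)

lemma sg_one_P: "sg x = 1 \<Longrightarrow> x \<in> P"
  by (auto simp: sgn_in_def split: if_splits)

lemma lt_trans: "lt x y \<Longrightarrow> lt y z \<Longrightarrow> lt x z"
  using sg_add_pos[of "y - x" "z - y"] sg_one_P by simp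

lemma lt_irrefl: "\<not> lt x x"
  by simp

lemma lt_linear: "x \<in> M \<Longrightarrow> y \<in> M \<Longrightarrow> lt x y \<or> x = y \<or> lt y x"
  using sg_neg[OF diff, of x y] sgn_in_cases[of P "x - y"] by auto

lemma lt_antisym: "lt x y \<Longrightarrow> \<not> lt y x"
  using lt_trans lt_irrefl by blast

lemma sg_minus_iff: "x \<in> M \<Longrightarrow> y \<in> M \<Longrightarrow> sg (y - x) = - sg (x - y)"
  using sg_neg[OF diff, of x y] by simp

lemma sg_sum_nonneg:
  "(\<And>i. i \<in> A \<Longrightarrow> f i \<in> P) \<Longrightarrow> sum f A \<in> P"
  by (induction A rule: infinite_finite_induct) (auto simp: zero_P P_add)

lemma sg_numeral_2: "sg 2 = 1"
  using sg_add_pos[OF sg_one one_P] by simp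

lemma lt_mid:
  assumes "x \<in> M" "y \<in> M" "lt x y"
  shows "(x + y) / 2 \<in> M" "lt x ((x + y) / 2)" "lt ((x + y) / 2) y"
proof -
  have two: "2 \<in> M" using of_nat[of 2] by simp
  show m: "(x + y) / 2 \<in> M" using assms two closed by simp
  have "sg 2 * sg (y / 2 - x / 2) = sg (y - x)"
    using sg_mult[OF two, of "y / 2 - x / 2"] assms two closed by (simp add: algebra_simps)
  then have h: "sg (y / 2 - x / 2) = 1" using assms sg_numeral_2 by simp
  have "(x + y) / 2 - x = y / 2 - x / 2" "y - (x + y) / 2 = y / 2 - x / 2"
    by (simp_all add: field_simps)
  then show "lt x ((x + y) / 2)" "lt ((x + y) / 2) y" using h by simp_all
qed

end

definition poly_over :: "'a::zero set \<Rightarrow> 'a poly set" where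
  "poly_over M = {p. \<forall>i. coeff p i \<in> M}"

context subring_set
begin

lemma poly_over_pCons: "pCons c p \<in> poly_over M \<longleftrightarrow> c \<in> M \<and> p \<in> poly_over M"
  by (auto simp: poly_over_def coeff_pCons split: nat.splits)

lemma poly_over_0: "0 \<in> poly_over M"
  by (simp add: poly_over_def zero)

lemma poly_over_1: "1 \<in> poly_over M"
  unfolding one_pCons by (simp add: poly_over_pCons poly_over_0 one)

lemma poly_over_add: "p \<in> poly_over M \<Longrightarrow> q \<in> poly_over M \<Longrightarrow> p + q \<in> poly_over M"
  by (simp add: poly_over_def add)

lemma poly_over_diff: "p \<in> poly_over M \<Longrightarrow> q \<in> poly_over M \<Longrightarrow> p - q \<in> poly_over M"
  by (simp add: poly_over_def diff)

lemma poly_over_uminus: "p \<in> poly_over M \<Longrightarrow> - p \<in> poly_over M"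
  by (simp add: poly_over_def neg)

lemma poly_over_mult: "p \<in> poly_over M \<Longrightarrow> q \<in> poly_over M \<Longrightarrow> p * q \<in> poly_over M"
  by (simp add: poly_over_def coeff_mult sum mult)

lemma poly_over_smult: "c \<in> M \<Longrightarrow> q \<in> poly_over M \<Longrightarrow> smult c q \<in> poly_over M"
  by (simp add: poly_over_def mult)

lemma poly_over_monom: "c \<in> M \<Longrightarrow> monom c n \<in> poly_over M"
  by (simp add: poly_over_def zero)

lemma poly_over_pderiv: "p \<in> poly_over M \<Longrightarrow> pderiv p \<in> poly_over M"
  by (simp add: poly_over_def coeff_pderiv mult of_nat del: of_nat_Suc)

lemmas poly_over = poly_over_0 poly_over_1 poly_over_add poly_over_diff poly_over_uminus
  poly_over_mult poly_over_smult poly_over_monom poly_over_pderiv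

lemma poly_in: "p \<in> poly_over M \<Longrightarrow> x \<in> M \<Longrightarrow> poly p x \<in> M"
  by (induction p) (auto simp: poly_over_pCons add mult zero)

text \<open>Division with remainder over a subring, after multiplication by a power of the leading coefficient
  of \<open>m\<close>.  The subrings that occur below as domains of partial embeddings are not fields.\<close>

lemma poly_over_pseudo_division:
  assumes m: "m \<in> poly_over M" "m \<noteq> 0" and "g \<in> poly_over M"
  shows "\<exists>c\<in>M. \<exists>q\<in>poly_over M. \<exists>r\<in>poly_over M.
    c \<noteq> 0 \<and> smult c g = m * q + r \<and> (r = 0 \<or> degree r < degree m)"
  using \<open>g \<in> poly_over M\<close>
proof (induction "degree g" arbitrary: g rule: less_induct)
  case less
  show ?case
  proof (cases "g = 0 \<or> degree g < degree m")
    case True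
    then show ?thesis using less.prems poly_over_0 one
      by (intro bexI[of _ 1] bexI[of _ 0] bexI[of _ g]) auto
  next
    case False
    define t where "t = monom (lead_coeff g) (degree g - degree m)"
    have lcM: "lead_coeff g \<in> M" "lead_coeff m \<in> M"
      using less.prems m by (auto simp: poly_over_def)
    have t: "t \<in> poly_over M" unfolding t_def by (rule poly_over_monom[OF lcM(1)])
    define g' where "g' = smult (lead_coeff m) g - m * t"
    have g': "g' \<in> poly_over M" unfolding g'_def by (intro poly_over_diff poly_over_mult poly_over_smult less.prems m t lcM)
    have t0: "t \<noteq> 0" using False m by (simp add: t_def)
    have dt: "degree t = degree g - degree m" using False m unfolding t_def
      by (intro degree_monom_eq) simp
    have deg: "degree (m * t) = degree g" "degree (smult (lead_coeff m) g) = degree g"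
      using t0 m False by (simp_all add: degree_mult_eq dt)
    have lc: "lead_coeff (m * t) = lead_coeff m * lead_coeff g"
      using lead_coeff_monom[of "lead_coeff g" "degree g - degree m"]
      unfolding lead_coeff_mult t_def[symmetric] by simp
    have dl: "degree g' \<le> degree g" unfolding g'_def using deg by (metis degree_diff_le_max max.idem)
    have "coeff g' (degree g) = 0" unfolding g'_def using deg lc by simp
    then have "g' = 0 \<or> degree g' < degree g"
      using dl by (metis le_neq_implies_less leading_coeff_0_iff)
    then have "\<exists>c\<in>M. \<exists>q\<in>poly_over M. \<exists>r\<in>poly_over M. c \<noteq> 0 \<and> smult c g' = m * q + r \<and> (r = 0 \<or> degree r < degree m)"
    proof
      assume "g' = 0"
      then show ?thesis using poly_over_0 one by (intro bexI[of _ 1] bexI[of _ 0]) auto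
    qed (use less.hyps g' in blast)
    then obtain c q r where c: "c \<in> M" "c \<noteq> 0" and qr: "q \<in> poly_over M" "r \<in> poly_over M"
      "smult c g' = m * q + r" "r = 0 \<or> degree r < degree m" by blast
    have "smult (c * lead_coeff m) g = m * (q + smult c t) + r"
      using qr(3) unfolding g'_def by (simp add: algebra_simps smult_diff_right)
    moreover have "c * lead_coeff m \<in> M" "c * lead_coeff m \<noteq> 0" using c lcM m mult by auto
    moreover have "q + smult c t \<in> poly_over M" by (intro poly_over_add poly_over_smult qr c t)
    ultimately show ?thesis using qr by blast
  qed
qed

end

context subfield_set
begin

lemma poly_over_division:
  assumes "m \<in> poly_over M" "m \<noteq> 0" "g \<in> poly_over M"
  shows "\<exists>q\<in>poly_over M. \<exists>r\<in>poly_over M. g = m * q + r \<and> (r = 0 \<or> degree r < degree m)"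
proof -
  obtain c q r where c: "c \<in> M" "c \<noteq> 0" and qr: "q \<in> poly_over M" "r \<in> poly_over M"
    and e: "smult c g = m * q + r" and r: "r = 0 \<or> degree r < degree m"
    using poly_over_pseudo_division[OF assms] by blast
  have "g = smult (inverse c) (smult c g)" using c by simp
  also have "\<dots> = m * smult (inverse c) q + smult (inverse c) r" unfolding e by (simp add: smult_add_right)
  finally show ?thesis
    using c qr r by (intro bexI[of _ "smult (inverse c) q"] bexI[of _ "smult (inverse c) r"])
      (auto intro: poly_over_smult inv)
qed

lemma poly_over_div_root:
  assumes "g \<in> poly_over M" "a \<in> M" "poly g a = 0"
  shows "\<exists>q\<in>poly_over M. g = [:- a, 1:] * q"
proof -
  have "[:- a, 1:] \<in> poly_over M" using assms by (simp add: poly_over_pCons closed poly_over_0)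
  then obtain q r where q: "q \<in> poly_over M" and g: "g = [:- a, 1:] * q + r"
    and r: "r = 0 \<or> degree r < degree [:- a, 1:]"
    using poly_over_division[OF _ _ assms(1), of "[:- a, 1:]"] by auto
  have "degree r = 0" using r by auto
  then obtain c where c: "r = [:c:]" using degree_eq_zeroE by blast
  have "poly r a = 0" using assms(3) unfolding g by simp
  then show ?thesis using q g c by auto
qed

definition algebraic_over :: "'a \<Rightarrow> bool" where
  "algebraic_over x \<longleftrightarrow> (\<exists>p\<in>poly_over M. p \<noteq> 0 \<and> poly p x = 0)"

text \<open>A least annihilating polynomial is unique only up to a scalar: it need not be monic.\<close>

definition min_poly :: "'a \<Rightarrow> 'a poly \<Rightarrow> bool" where
  "min_poly x m \<longleftrightarrow> m \<in> poly_over M \<and> m \<noteq> 0 \<and> poly m x = 0 \<and>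
     (\<forall>p\<in>poly_over M. poly p x = 0 \<longrightarrow> p = 0 \<or> degree m \<le> degree p)"

lemma min_poly_exists:
  assumes "algebraic_over x"
  shows "\<exists>m. min_poly x m"
proof -
  let ?P = "\<lambda>p. p \<in> poly_over M \<and> p \<noteq> 0 \<and> poly p x = 0"
  have "\<exists>p. ?P p" using assms by (auto simp: algebraic_over_def)
  then obtain m where "?P m" "\<And>p. ?P p \<Longrightarrow> degree m \<le> degree p"
    using exists_least_iff[of "\<lambda>n. \<exists>p. ?P p \<and> degree p = n"] by (metis not_less)
  then show ?thesis unfolding min_poly_def by blast
qed

lemma min_poly_dvd:
  assumes "min_poly x m" "g \<in> poly_over M" "poly g x = 0"
  shows "\<exists>q\<in>poly_over M. g = m * q"
proof -
  obtain q r where q: "q \<in> poly_over M" "r \<in> poly_over M" and g: "g = m * q + r"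
    and r: "r = 0 \<or> degree r < degree m"
    using poly_over_division[of m g] assms unfolding min_poly_def by blast
  have "poly r x = 0" using assms unfolding g min_poly_def by simp
  then have "r = 0" using assms(1) q r unfolding min_poly_def by fastforce
  with q g show ?thesis by auto
qed

lemma min_poly_degree_pos: "min_poly x m \<Longrightarrow> degree m > 0"
  unfolding min_poly_def by (cases m rule: pCons_cases) (auto split: if_splits)

definition adjoin :: "'a \<Rightarrow> 'a set" where
  "adjoin x = {poly g x |g. g \<in> poly_over M}"

lemma adjoin_incl: "M \<subseteq> adjoin x"
proof
  fix a assume "a \<in> M"
  then show "a \<in> adjoin x"
    unfolding adjoin_def by (intro CollectI exI[of _ "[:a:]"]) (simp add: poly_over_pCons poly_over_0)
qed

lemma adjoin_self: "x \<in> adjoin x"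
  unfolding adjoin_def by (intro CollectI exI[of _ "[:0, 1:]"]) (simp add: poly_over_pCons closed poly_over_0)

text \<open>The remainder of \<open>m\<close> modulo \<open>g\<close> has the value \<open>- g x * q x\<close> at \<open>x\<close>, where \<open>q\<close> is the quotient.  This is not zero,
  since otherwise \<open>q\<close> would be an annihilating polynomial of smaller degree; so \<open>g x\<close> divides an
  element that is invertible by induction.\<close>

lemma min_poly_inverse:
  assumes m: "min_poly x m" and "g \<in> poly_over M" "poly g x \<noteq> 0" "degree g < degree m"
  shows "\<exists>u\<in>poly_over M. poly u x * poly g x = 1"
  using assms(2-)
proof (induction "degree g" arbitrary: g rule: less_induct)
  case less
  have m': "m \<in> poly_over M" "m \<noteq> 0" "poly m x = 0" using m by (auto simp: min_poly_def)
  show ?case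
  proof (cases "degree g = 0")
    case True
    then obtain c where c: "g = [:c:]" by (metis degree_eq_zeroE)
    with less.prems have "[:inverse c:] \<in> poly_over M"
      by (auto simp: poly_over_pCons closed poly_over_0)
    then show ?thesis using c less.prems by (intro bexI[of _ "[:inverse c:]"]) auto
  next
    case False
    have g0: "g \<noteq> 0" using less.prems by auto
    obtain q r where qr: "q \<in> poly_over M" "r \<in> poly_over M" and e: "m = g * q + r"
      and r: "r = 0 \<or> degree r < degree g"
      using poly_over_division[OF less.prems(1) g0 m'(1)] by blast
    have ev: "poly r x = - (poly g x * poly q x)"
      using m'(3) unfolding e by (simp add: eq_neg_iff_add_eq_0 add.commute)
    have rx: "poly r x \<noteq> 0"
    proof
      assume "poly r x = 0"
      then have "r = 0" using m qr(2) r less.prems(3) unfolding min_poly_def by fastforce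
      with e m'(2) have "m = g * q" "q \<noteq> 0" by auto
      moreover have "poly q x = 0" using ev \<open>poly r x = 0\<close> less.prems(2) by simp
      ultimately have "degree m \<le> degree q" "degree m = degree g + degree q"
        using m qr(1) g0 unfolding min_poly_def by (auto simp: degree_mult_eq)
      with False show False by simp
    qed
    then have "degree r < degree g" using r by auto
    with less.hyps[OF this qr(2) rx] less.prems(3) obtain u where
      u: "u \<in> poly_over M" "poly u x * poly r x = 1" by auto
    then show ?thesis using qr(1) ev
      by (intro bexI[of _ "- (u * q)"]) (auto simp: algebra_simps intro!: poly_over)
  qed
qed

lemma adjoin_subfield:
  assumes "algebraic_over x"
  shows "subfield_set (adjoin x)"
proof -
  obtain m where m: "min_poly x m" using min_poly_exists[OF assms] by blast
  have "inverse y \<in> adjoin x" if "y \<in> adjoin x" for y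
  proof (cases "y = 0")
    case False
    from that obtain g where g: "g \<in> poly_over M" "y = poly g x" by (auto simp: adjoin_def)
    obtain q r where qr: "q \<in> poly_over M" "r \<in> poly_over M" "g = m * q + r" and r: "r = 0 \<or> degree r < degree m"
      using poly_over_division[of m g] m g unfolding min_poly_def by blast
    have y: "y = poly r x" using g qr m by (simp add: min_poly_def)
    with False r have "degree r < degree m" "poly r x \<noteq> 0" by auto
    with min_poly_inverse[OF m qr(2)] obtain u where "u \<in> poly_over M" "poly u x * poly r x = 1" by blast
    then have "u \<in> poly_over M" "inverse y = poly u x"
      using inverse_unique[of y "poly u x"] by (auto simp: y mult.commute)
    then show ?thesis unfolding adjoin_def by blast
  qed (use adjoin_incl zero in auto)
  moreover have "a + b \<in> adjoin x" "a * b \<in> adjoin x" "- a \<in> adjoin x" if "a \<in> adjoin x" "b \<in> adjoin x" for a b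
    using that unfolding adjoin_def by (auto; metis poly_add poly_mult poly_minus poly_over)+
  moreover have "0 \<in> adjoin x" "1 \<in> adjoin x" using adjoin_incl zero one by blast+
  ultimately show ?thesis by unfold_locales auto
qed

end

section \<open>Extending an ordering along a sign change\<close>

text \<open>The same field as a record, to which \<open>preordering_extends\<close> applies.\<close>

definition subfield_ring :: "'a::field set \<Rightarrow> 'a ring" where
  "subfield_ring M = \<lparr>carrier = M, monoid.mult = (*), one = 1, ring.zero = 0, ring.add = (+)\<rparr>"

lemma (in subfield_set) field_subfield_ring: "field (subfield_ring M)"
proof -
  have c: "cring (subfield_ring M)"
    by (intro cringI abelian_groupI comm_monoidI)
       (auto simp: subfield_ring_def closed algebra_simps intro: bexI[of _ "- _"])
  have "Units (subfield_ring M) = carrier (subfield_ring M) - {\<zero>\<^bsub>subfield_ring M\<^esub>}"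
  proof (intro equalityI subsetI)
    fix x assume "x \<in> carrier (subfield_ring M) - {\<zero>\<^bsub>subfield_ring M\<^esub>}"
    then show "x \<in> Units (subfield_ring M)"
      unfolding Units_def subfield_ring_def by (auto intro!: bexI[of _ "inverse x"] inv)
  qed (auto simp: Units_def subfield_ring_def)
  then show ?thesis by (intro cring.cring_fieldI c)
qed

lemma (in subfield_set) uminus_subfield_ring:
  assumes "x \<in> M"
  shows "\<ominus>\<^bsub>subfield_ring M\<^esub> x = - x"
proof -
  interpret K: field "subfield_ring M" by (rule field_subfield_ring)
  have "- x \<oplus>\<^bsub>subfield_ring M\<^esub> x = \<zero>\<^bsub>subfield_ring M\<^esub>" by (simp add: subfield_ring_def)
  then show ?thesis by (rule K.minus_equality) (use assms in \<open>auto simp: subfield_ring_def neg\<close>)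
qed

lemma preordering_extends_subfield:
  fixes M :: "'a::field_char_0 set"
  assumes "subfield_set M" and "T \<subseteq> M" "\<And>x y. x \<in> T \<Longrightarrow> y \<in> T \<Longrightarrow> x + y \<in> T" "\<And>x y. x \<in> T \<Longrightarrow> y \<in> T \<Longrightarrow> x * y \<in> T"
    and "\<And>x. x \<in> M \<Longrightarrow> x * x \<in> T" "- 1 \<notin> T"
  shows "\<exists>P. T \<subseteq> P \<and> ordered_subfield M P"
proof -
  interpret subfield_set M by fact
  interpret K: field "subfield_ring M" by (rule field_subfield_ring)
  have "K.preordering T"
    unfolding K.preordering_def using assms one uminus_subfield_ring[OF one]
    by (auto simp: subfield_ring_def)
  then obtain P where TP: "T \<subseteq> P" and P: "field_ordering (subfield_ring M) P"
    using K.preordering_extends by blast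
  have PM: "P \<subseteq> M" using P by (simp add: field_ordering_def subfield_ring_def)
  have "x \<in> P \<or> - x \<in> P" if "x \<in> M" for x
    using P that uminus_subfield_ring[OF that] by (auto simp: field_ordering_def subfield_ring_def)
  moreover have "x = 0" if "x \<in> P" "- x \<in> P" for x
    using P that uminus_subfield_ring[of x] PM by (auto simp: field_ordering_def subfield_ring_def)
  ultimately have "ordered_subfield M P"
    using P PM by unfold_locales (auto simp: field_ordering_def subfield_ring_def)
  with TP show ?thesis by blast
qed

text \<open>The sums of products \<open>c y\<^sup>2\<close> with \<open>c\<close> in \<open>P\<close> and \<open>y\<close> in \<open>N\<close>.  For an extension field \<open>N\<close> this is the preordering
  generated by \<open>P\<close>.  It is also used for a set \<open>N\<close> of polynomials of bounded degree, which is not closed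
  under multiplication.\<close>

inductive_set sq_cone :: "'a::comm_ring_1 set \<Rightarrow> 'a set \<Rightarrow> 'a set" for P N where
  zero: "0 \<in> sq_cone P N"
| step: "c \<in> P \<Longrightarrow> y \<in> N \<Longrightarrow> x \<in> sq_cone P N \<Longrightarrow> c * (y * y) + x \<in> sq_cone P N"

lemma sq_cone_add: "x \<in> sq_cone P N \<Longrightarrow> y \<in> sq_cone P N \<Longrightarrow> x + y \<in> sq_cone P N"
  by (induction rule: sq_cone.induct) (auto simp: add.assoc intro: sq_cone.step)

lemma sq_cone_mult:
  assumes P: "\<And>x y. x \<in> P \<Longrightarrow> y \<in> P \<Longrightarrow> x * y \<in> P" and N: "\<And>x y. x \<in> N \<Longrightarrow> y \<in> N \<Longrightarrow> x * y \<in> N"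
    and "x \<in> sq_cone P N" and y: "y \<in> sq_cone P N"
  shows "x * y \<in> sq_cone P N"
  using assms(3)
proof (induction rule: sq_cone.induct)
  case zero
  then show ?case by (simp add: sq_cone.zero)
next
  case (step c z x)
  have "c * (z * z) * y \<in> sq_cone P N"
    using y
  proof (induction rule: sq_cone.induct)
    case zero
    then show ?case by (simp add: sq_cone.zero)
  next
    case (step c' z' y)
    have "(c * c') * ((z * z') * (z * z')) + c * (z * z) * y \<in> sq_cone P N"
      using step \<open>c \<in> P\<close> \<open>z \<in> N\<close> P N by (intro sq_cone.step)
    then show ?case by (simp add: algebra_simps)
  qed
  from sq_cone_add[OF this step.IH] show ?case by (simp add: algebra_simps)
qed

context ordered_subfield
begin

text \<open>Elements of \<open>M(x)\<close> are values at \<open>x\<close> of polynomials of degree less than \<open>degree m\<close>, so a representation by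
  weighted squares in \<open>M(x)\<close> lifts to one by polynomials of bounded degree.\<close>

lemma sq_cone_adjoin_poly:
  assumes m: "min_poly x m" and "y \<in> sq_cone P (adjoin x)"
  shows "\<exists>G\<in>sq_cone ((\<lambda>c. [:c:]) ` P) {g \<in> poly_over M. g = 0 \<or> degree g < degree m}. poly G x = y"
  using assms(2)
proof (induction rule: sq_cone.induct)
  case zero
  then show ?case by (intro bexI[of _ 0]) (auto intro: sq_cone.zero)
next
  case (step c y z)
  then obtain G where G: "G \<in> sq_cone ((\<lambda>c. [:c:]) ` P) {g \<in> poly_over M. g = 0 \<or> degree g < degree m}"
    "poly G x = z" by blast
  from \<open>y \<in> adjoin x\<close> obtain g where g: "g \<in> poly_over M" "y = poly g x" by (auto simp: adjoin_def)
  obtain q r where qr: "q \<in> poly_over M" "r \<in> poly_over M" "g = m * q + r" and r: "r = 0 \<or> degree r < degree m"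
    using poly_over_division[of m g] m g unfolding min_poly_def by blast
  have y: "y = poly r x" using g qr m by (simp add: min_poly_def)
  have "[:c:] * (r * r) + G \<in> sq_cone ((\<lambda>c. [:c:]) ` P) {g \<in> poly_over M. g = 0 \<or> degree g < degree m}"
    using step(1) qr(2) r G(1) by (intro sq_cone.step) auto
  then show ?case using G(2) y by (intro bexI[of _ "[:c:] * (r * r) + G"]) auto
qed

lemma sq_cone_poly:
  assumes "G \<in> sq_cone ((\<lambda>c. [:c:]) ` P) {g \<in> poly_over M. g = 0 \<or> degree g < n}"
  shows "G \<in> poly_over M" "degree G \<le> 2 * n - 2"
    and "ordered_subfield M' P' \<Longrightarrow> M \<subseteq> M' \<Longrightarrow> P \<subseteq> P' \<Longrightarrow> t \<in> M' \<Longrightarrow> poly G t \<in> P'"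
  using assms
proof (induction rule: sq_cone.induct)
  case zero
  { case 1 show ?case by (rule poly_over_0)
  next case 2 show ?case by simp
  next case 3
    then interpret O: ordered_subfield M' P' by simp
    show ?case by (simp add: O.zero_P) }
next
  case (step c y G)
  then obtain e where e: "e \<in> P" "c = [:e:]" by auto
  { case 1
    have "[:e:] \<in> poly_over M" using e P_sub by (auto simp: poly_over_pCons poly_over_0)
    moreover have "y * y \<in> poly_over M" "G \<in> poly_over M" using step by (auto intro: poly_over_mult)
    ultimately show ?case unfolding e(2) by (blast intro: poly_over_add poly_over_mult)
  next case 2
    have "degree (c * (y * y)) \<le> degree (y * y)" using e by (simp add: degree_smult_le)
    also have "\<dots> \<le> 2 * n - 2" using step(2) degree_mult_le[of y y] by auto
    finally show ?case using step(5) by (intro degree_add_le) auto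
  next case 3
    then interpret O: ordered_subfield M' P' by simp
    have "y \<in> poly_over M'" using step(2) \<open>M \<subseteq> M'\<close> by (auto simp: poly_over_def)
    then have "poly y t * poly y t \<in> P'" using O.poly_in 3 O.square_P by blast
    then show ?case using step(6) 3 e by (auto intro!: O.P_add O.P_mult) }
qed

end

text \<open>Induction on the degree of \<open>p\<close>.  A proper factor of \<open>p\<close> that changes sign is dealt with by induction, so
  let \<open>p\<close> be a minimal polynomial \<open>m\<close> of its root \<open>x\<close>, up to a constant.  If the ordering does not extend to
  \<open>M(x)\<close>, then \<open>-1\<close> is a weighted sum of squares there, which means \<open>1 + G = m h\<close> with a polynomial \<open>G\<close> that
  is such a sum and has degree at most \<open>2 degree m - 2\<close>.  Now \<open>1 + G\<close> is positive at \<open>a\<close> and \<open>b\<close>, so that \<open>h\<close>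
  changes sign with \<open>m\<close>, and \<open>h\<close> has smaller degree than \<open>m\<close>.  By induction \<open>h\<close> has a root in some ordered
  extension, but \<open>1 + G\<close> is positive in every ordered extension.\<close>

theorem sign_change_extension:
  fixes M :: "'a::{alg_closed_field, field_char_0} set"
  assumes "ordered_subfield M P" and "p \<in> poly_over M" and ab: "a \<in> M" "b \<in> M"
    and "sgn_in P (poly p a) * sgn_in P (poly p b) = - 1"
  shows "\<exists>x M' P'. poly p x = 0 \<and> x \<in> M' \<and> M \<subseteq> M' \<and> P \<subseteq> P' \<and> ordered_subfield M' P'"
  using assms(2,5)
proof (induction "degree p" arbitrary: p rule: less_induct)
  case less
  interpret ordered_subfield M P by fact
  have p0: "p \<noteq> 0" using less.prems by auto
  have "degree p > 0"
  proof (rule ccontr)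
    assume "\<not> ?thesis"
    then obtain c where "p = [:c:]" using degree_eq_zeroE by blast
    with less.prems(2) show False using sgn_in_cases[of P c] by auto
  qed
  then obtain x where x: "poly p x = 0" using alg_closed_imp_poly_has_root by blast
  have alg: "algebraic_over x" unfolding algebraic_over_def using less.prems p0 x by blast
  obtain m where m: "min_poly x m" using min_poly_exists[OF alg] by blast
  obtain q where q: "q \<in> poly_over M" "p = m * q"
    using min_poly_dvd[OF m less.prems(1) x] by blast
  have m': "m \<in> poly_over M" "m \<noteq> 0" "poly m x = 0" "degree m > 0"
    using m min_poly_degree_pos by (auto simp: min_poly_def)
  have q0: "q \<noteq> 0" using p0 q by auto
  have deg: "degree p = degree m + degree q" unfolding q(2) by (rule degree_mult_eq[OF m'(2) q0])
  note pin = poly_in[OF _ ab(1)] poly_in[OF _ ab(2)]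
  have split: "sg (poly p a) * sg (poly p b) = (sg (poly m a) * sg (poly m b)) * (sg (poly q a) * sg (poly q b))"
    unfolding q(2) poly_mult using sg_mult pin q(1) m'(1) by (simp add: mult_ac)
  consider "degree q > 0" "sg (poly m a) * sg (poly m b) = - 1"
    | "degree q = 0" "sg (poly m a) * sg (poly m b) = - 1"
    | "sg (poly q a) * sg (poly q b) = - 1"
    using split less.prems(2) sgn_in_cases[of P "poly m a"] sgn_in_cases[of P "poly m b"]
      sgn_in_cases[of P "poly q a"] sgn_in_cases[of P "poly q b"] by fastforce
  then show ?case
  proof cases
    case 1
    then obtain x M' P' where "poly m x = 0" "x \<in> M'" "M \<subseteq> M'" "P \<subseteq> P'" "ordered_subfield M' P'"
      using less.hyps[of m] deg m'(1) by auto
    then show ?thesis using q(2) by (metis mult_zero_left poly_mult)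
  next
    case 3
    then obtain x M' P' where "poly q x = 0" "x \<in> M'" "M \<subseteq> M'" "P \<subseteq> P'" "ordered_subfield M' P'"
      using less.hyps[of q] deg m'(4) q(1) by auto
    then show ?thesis using q(2) by (metis mult_zero_right poly_mult)
  next
    case 2
    interpret N: subfield_set "adjoin x" by (rule adjoin_subfield[OF alg])
    let ?T = "sq_cone P (adjoin x)"
    have sub: "P \<subseteq> ?T"
    proof
      fix c assume "c \<in> P"
      then have "c * (1 * 1) + 0 \<in> ?T" by (intro sq_cone.intros N.one)
      then show "c \<in> ?T" by simp
    qed
    have "?T \<subseteq> adjoin x"
    proof
      fix y assume "y \<in> ?T"
      then show "y \<in> adjoin x"
        by (induction rule: sq_cone.induct) (use P_sub adjoin_incl in \<open>auto intro!: N.closed\<close>)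
    qed
    moreover have sq: "y * y \<in> ?T" if "y \<in> adjoin x" for y
      using sq_cone.step[OF one_P that sq_cone.zero] by simp
    moreover have "- 1 \<notin> ?T"
    proof
      assume "- 1 \<in> ?T"
      then obtain G where G: "G \<in> sq_cone ((\<lambda>c. [:c:]) ` P) {g \<in> poly_over M. g = 0 \<or> degree g < degree m}"
        "poly G x = - 1" using sq_cone_adjoin_poly[OF m] by blast
      have Gp: "G + 1 \<in> poly_over M" "poly (G + 1) x = 0"
        using sq_cone_poly(1)[OF G(1)] G(2) by (auto intro!: poly_over)
      then obtain h where h: "h \<in> poly_over M" "G + 1 = m * h" using min_poly_dvd[OF m] by blast
      have pos: "sg (poly (G + 1) t) = 1" if "t \<in> M" for t
        using sg_add_pos[OF sg_one sq_cone_poly(3)[OF G(1) ordered_subfield_axioms _ _ that]]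
        by (simp add: add.commute)
      have "h \<noteq> 0" using pos[OF ab(1)] h(2) by auto
      then have "degree (G + 1) = degree m + degree h" unfolding h(2) by (rule degree_mult_eq[OF m'(2)])
      moreover have "degree (G + 1) \<le> 2 * degree m - 2"
        using sq_cone_poly(2)[OF G(1)] by (intro degree_add_le) auto
      ultimately have "degree h < degree p" using deg m'(4) by linarith
      moreover have "sg (poly h a) * sg (poly h b) = - 1"
        using pos[OF ab(1)] pos[OF ab(2)] 2(2) unfolding h(2) poly_mult
        using sg_mult pin h(1) m'(1) sgn_in_cases[of P "poly m a"] sgn_in_cases[of P "poly m b"]
        by auto
      ultimately obtain z M' P' where z: "poly h z = 0" "z \<in> M'" "M \<subseteq> M'" "P \<subseteq> P'"
        and ord: "ordered_subfield M' P'" using less.hyps h(1) by blast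
      interpret O: ordered_subfield M' P' by fact
      have "poly (G + 1) z = 0" unfolding h(2) using z(1) by simp
      moreover have "O.sg (poly (G + 1) z) = 1"
        using O.sg_add_pos[OF O.sg_one sq_cone_poly(3)[OF G(1) ord z(3,4,2)]]
        by (simp add: add.commute)
      ultimately show False by simp
    qed
    moreover have "y * z \<in> ?T" if "y \<in> ?T" "z \<in> ?T" for y z
      using that by (intro sq_cone_mult P_mult N.mult)
    ultimately have "\<exists>P'. ?T \<subseteq> P' \<and> ordered_subfield (adjoin x) P'"
      using preordering_extends_subfield[OF N.subfield_set_axioms, of ?T] sq_cone_add[of _ P "adjoin x"]
      by simp
    then obtain P' where "?T \<subseteq> P'" "ordered_subfield (adjoin x) P'" by blast
    then show ?thesis using x adjoin_self[of x] adjoin_incl[of x] sub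
      by (intro exI[of _ x] exI[of _ "adjoin x"] exI[of _ P'] conjI) auto
  qed
qed

section \<open>Maximal ordered subfields\<close>

text \<open>Such a subfield is real closed: a root could be adjoined wherever a polynomial changes sign
  (\<open>sign_change_extension\<close>), so by maximality the root is already there.\<close>

locale max_ordered_subfield = ordered_subfield R S
  for R :: "'a::{alg_closed_field, field_char_0} set" and S +
  assumes maximal: "ordered_subfield R' S' \<Longrightarrow> R \<subseteq> R' \<Longrightarrow> S \<subseteq> S' \<Longrightarrow> R' = R"

lemma (in ordered_subfield) carrier_eq: "M = {x. x \<in> P \<or> - x \<in> P}"
  using P_total P_sub neg by force

text \<open>An ordered subfield is determined by its nonnegative elements, so Zorn's lemma can be applied to these
  sets alone.\<close>

lemma max_ordered_subfield_exists:
  fixes M :: "'a::{alg_closed_field, field_char_0} set"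
  assumes "ordered_subfield M P"
  shows "\<exists>R S. M \<subseteq> R \<and> P \<subseteq> S \<and> max_ordered_subfield R S"
proof -
  \<comment> \<open>recovers the field from its nonnegative elements\<close>
  define car :: "'a set \<Rightarrow> 'a set" where "car S = {x. x \<in> S \<or> - x \<in> S}" for S
  define AA where "AA = {S. P \<subseteq> S \<and> ordered_subfield (car S) S}"
  have car: "car S = R" if "ordered_subfield R S" for R S
    using ordered_subfield.carrier_eq[OF that] by (simp add: car_def)
  have "\<exists>S\<in>AA. \<forall>V\<in>AA. S \<subseteq> V \<longrightarrow> V = S"
  proof (rule subset_Zorn_nonempty)
    show "AA \<noteq> {}" using assms car[OF assms] unfolding AA_def by auto
  next
    fix C assume "C \<noteq> {}" and C: "subset.chain AA C"
    have sub: "V \<subseteq> W \<or> W \<subseteq> V" if "V \<in> C" "W \<in> C" for V W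
      using that C unfolding subset_chain_def by blast
    have inA: "P \<subseteq> V" "ordered_subfield (car V) V" if "V \<in> C" for V
      using C that unfolding subset_chain_def AA_def by auto
    have two: "\<exists>V\<in>C. x \<in> car V \<and> y \<in> car V" if "x \<in> car (\<Union>C)" "y \<in> car (\<Union>C)" for x y
    proof -
      from that obtain V W where "V \<in> C" "W \<in> C" "x \<in> car V" "y \<in> car W" unfolding car_def by blast
      then show ?thesis using sub[of V W] unfolding car_def by blast
    qed
    have twoP: "\<exists>V\<in>C. x \<in> V \<and> y \<in> V" if "x \<in> \<Union>C" "y \<in> \<Union>C" for x y
      using that sub by (meson Union_iff subset_iff)
    have up: "car V \<subseteq> car (\<Union>C)" if "V \<in> C" for V using that unfolding car_def by blast
    obtain V0 where V0: "V0 \<in> C" using \<open>C \<noteq> {}\<close> by blast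
    interpret V0: ordered_subfield "car V0" V0 by (rule inA(2)[OF V0])
    have "ordered_subfield (car (\<Union>C)) (\<Union>C)"
    proof unfold_locales
      fix x y assume xy: "x \<in> car (\<Union>C)" "y \<in> car (\<Union>C)"
      then obtain V where V: "V \<in> C" "x \<in> car V" "y \<in> car V" using two by blast
      interpret V: ordered_subfield "car V" V by (rule inA(2)[OF V(1)])
      show "x + y \<in> car (\<Union>C)" "x * y \<in> car (\<Union>C)"
        using V up[OF V(1)] V.add V.mult by blast+
    next
      fix x assume xy: "x \<in> car (\<Union>C)"
      then obtain V where V: "V \<in> C" "x \<in> car V" using two[of x x] by blast
      interpret V: ordered_subfield "car V" V by (rule inA(2)[OF V(1)])
      show "- x \<in> car (\<Union>C)" "inverse x \<in> car (\<Union>C)"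
        using V up[OF V(1)] V.neg V.inv by blast+
      show "x \<in> \<Union>C \<or> - x \<in> \<Union>C" using V V.P_total by blast
    next
      fix x y assume "x \<in> \<Union>C" "y \<in> \<Union>C"
      then obtain V where V: "V \<in> C" "x \<in> V" "y \<in> V" using twoP by blast
      interpret V: ordered_subfield "car V" V by (rule inA(2)[OF V(1)])
      show "x + y \<in> \<Union>C" "x * y \<in> \<Union>C" using V V.P_add V.P_mult by blast+
    next
      fix x assume "x \<in> \<Union>C" "- x \<in> \<Union>C"
      then obtain V where V: "V \<in> C" "x \<in> V" "- x \<in> V" using twoP by blast
      interpret V: ordered_subfield "car V" V by (rule inA(2)[OF V(1)])
      show "x = 0" using V V.P_antisym by blast
    next
      show "0 \<in> car (\<Union>C)" "1 \<in> car (\<Union>C)" using up[OF V0] V0.zero V0.one by blast+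
    qed (auto simp: car_def)
    then show "\<Union>C \<in> AA" using V0 inA(1)[OF V0] unfolding AA_def by blast
  qed
  then obtain S where "S \<in> AA" and max: "\<And>V. V \<in> AA \<Longrightarrow> S \<subseteq> V \<Longrightarrow> V = S" by blast
  then have PS: "P \<subseteq> S" and S: "ordered_subfield (car S) S" unfolding AA_def by simp_all
  interpret S: ordered_subfield "car S" S by (rule S)
  have max': "R' = car S" if ord: "ordered_subfield R' S'" and "S \<subseteq> S'" for R' S'
  proof -
    have e: "car S' = R'" by (rule car[OF ord])
    have "S' \<in> AA" using ord \<open>S \<subseteq> S'\<close> PS unfolding AA_def by (simp add: e)
    from max[OF this \<open>S \<subseteq> S'\<close>] e show ?thesis by simp
  qed
  have "max_ordered_subfield (car S) S"
    by (rule max_ordered_subfield.intro[OF S], rule max_ordered_subfield_axioms.intro) (rule max')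
  moreover have "M \<subseteq> car S" using PS car[OF assms] unfolding car_def by blast
  ultimately show ?thesis using PS by blast
qed

context max_ordered_subfield
begin

lemma sign_change_root:
  assumes "p \<in> poly_over R" "a \<in> R" "b \<in> R" "sg (poly p a) * sg (poly p b) = - 1"
  shows "\<exists>x\<in>R. poly p x = 0"
  using sign_change_extension[OF ordered_subfield_axioms assms] maximal by blast

text \<open>Some root \<open>x\<close> exists in \<open>R\<close>.  If it does not lie between \<open>a\<close> and \<open>b\<close>, then \<open>a - x\<close> and \<open>b - x\<close> have the same
  sign, and the quotient of \<open>p\<close> by the factor of \<open>x\<close> still changes sign.\<close>

theorem intermediate_value:
  assumes "p \<in> poly_over R" "a \<in> R" "b \<in> R" "lt a b" "sg (poly p a) * sg (poly p b) = - 1"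
  shows "\<exists>x\<in>R. lt a x \<and> lt x b \<and> poly p x = 0"
  using assms(1,5)
proof (induction "degree p" arbitrary: p rule: less_induct)
  case less
  obtain x where x: "x \<in> R" "poly p x = 0" using sign_change_root assms less.prems by blast
  obtain q where q: "q \<in> poly_over R" "p = [:- x, 1:] * q" using poly_over_div_root less.prems(1) x by blast
  have q0: "q \<noteq> 0" using less.prems q by auto
  show ?case
  proof (cases "lt a x \<and> lt x b")
    case False
    have "x \<noteq> a" "x \<noteq> b" using less.prems(2) x by auto
    then consider "lt x a" "lt x b" | "lt a x" "lt b x"
      using False lt_linear[OF x(1) assms(2)] lt_linear[OF x(1) assms(3)] lt_trans[OF _ assms(4)]
        lt_trans[OF assms(4)] by blast
    then have "sg (a - x) * sg (b - x) = 1"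
      using sg_minus_iff[OF x(1) assms(2)] sg_minus_iff[OF x(1) assms(3)] by cases simp_all
    moreover have "poly p a = (a - x) * poly q a" "poly p b = (b - x) * poly q b" by (simp_all add: q algebra_simps)
    then have "sg (poly p a) = sg (a - x) * sg (poly q a)" "sg (poly p b) = sg (b - x) * sg (poly q b)"
      using sg_mult[OF diff[OF assms(2) x(1)] poly_in[OF q(1) assms(2)]]
        sg_mult[OF diff[OF assms(3) x(1)] poly_in[OF q(1) assms(3)]] by simp_all
    then have "(sg (a - x) * sg (b - x)) * (sg (poly q a) * sg (poly q b)) = - 1"
      using less.prems(2) by (simp add: mult_ac)
    ultimately have "sg (poly q a) * sg (poly q b) = - 1" by simp
    moreover have "degree q < degree p" unfolding q(2) using q0 by (subst degree_mult_eq) auto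
    ultimately obtain y where "y \<in> R" "lt a y" "lt y b" "poly q y = 0" using less.hyps q(1) by blast
    then show ?thesis by (intro bexI[of _ y]) (auto simp: q(2))
  qed (use x in blast)
qed

end

lemma (in ordered_subfield) finite_has_min:
  assumes "finite Z" "Z \<subseteq> M" "Z \<noteq> {}"
  shows "\<exists>u\<in>Z. \<forall>z\<in>Z. z = u \<or> lt u z"
  using assms(1,3,2)
proof (induction Z rule: finite_ne_induct)
  case (insert z Z)
  then obtain u where u: "u \<in> Z" "\<forall>z\<in>Z. z = u \<or> lt u z" by auto
  have "z \<in> M" "u \<in> M" using insert.prems u by auto
  then consider "lt z u" | "z = u" | "lt u z" using lt_linear by blast
  then show ?case
  proof cases
    case 1
    then show ?thesis using u lt_trans[OF 1] by (intro bexI[of _ z]) auto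
  qed (use u in \<open>auto intro!: bexI[of _ u]\<close>)
qed simp

lemma (in ordered_subfield) finite_has_max:
  assumes "finite Z" "Z \<subseteq> M" "Z \<noteq> {}"
  shows "\<exists>u\<in>Z. \<forall>z\<in>Z. z = u \<or> lt z u"
  using assms(1,3,2)
proof (induction Z rule: finite_ne_induct)
  case (insert z Z)
  then obtain u where u: "u \<in> Z" "\<forall>z\<in>Z. z = u \<or> lt z u" by auto
  have "z \<in> M" "u \<in> M" using insert.prems u by auto
  then consider "lt u z" | "z = u" | "lt z u" using lt_linear by blast
  then show ?case
  proof cases
    case 1
    then show ?thesis using u lt_trans[OF _ 1] by (intro bexI[of _ z]) auto
  qed (use u in \<open>auto intro!: bexI[of _ u]\<close>)
qed simp

context max_ordered_subfield
begin

text \<open>Let \<open>u\<close> be the first root after \<open>a\<close>, and \<open>f = (X - a) (X - u) r\<close>.  Between \<open>a\<close> and \<open>u\<close> the factor \<open>r\<close> does not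
  change sign, so \<open>f'(a) = (a - u) r(a)\<close> and \<open>f'(u) = (u - a) r(u)\<close> have opposite signs; as the roots are simple,
  neither is zero.\<close>

lemma rolle:
  assumes f: "f \<in> poly_over R" "f \<noteq> 0" and ab: "a \<in> R" "b \<in> R" "lt a b" "poly f a = 0" "poly f b = 0"
    and simple: "\<And>x. x \<in> R \<Longrightarrow> poly f x = 0 \<Longrightarrow> poly (pderiv f) x \<noteq> 0"
  shows "\<exists>c\<in>R. lt a c \<and> lt c b \<and> poly (pderiv f) c = 0"
proof -
  let ?Z = "{x \<in> R. lt a x \<and> poly f x = 0}"
  have "finite ?Z" using poly_roots_finite[OF f(2)] by (auto intro: finite_subset)
  then obtain u where u: "u \<in> R" "lt a u" "poly f u = 0" and umin: "\<And>z. z \<in> R \<Longrightarrow> lt a z \<Longrightarrow> poly f z = 0 \<Longrightarrow> z = u \<or> lt u z"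
    using finite_has_min[of ?Z] ab by blast
  obtain q where q: "q \<in> poly_over R" "f = [:- a, 1:] * q" using poly_over_div_root f ab by blast
  have "poly q u = 0" using u lt_irrefl[of a] by (auto simp: q)
  then obtain r where r: "r \<in> poly_over R" "q = [:- u, 1:] * r" using poly_over_div_root q u by blast
  have fe: "f = [:- a, 1:] * ([:- u, 1:] * r)" using q r by simp
  have da: "poly (pderiv f) a = (a - u) * poly r a" and du: "poly (pderiv f) u = (u - a) * poly r u"
    unfolding fe pderiv_mult by (simp_all add: pderiv_pCons algebra_simps)
  have nz: "poly (pderiv f) a \<noteq> 0" "poly (pderiv f) u \<noteq> 0" using simple ab u by auto
  have "sg (poly r a) * sg (poly r u) \<noteq> - 1"
  proof
    assume "sg (poly r a) * sg (poly r u) = - 1"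
    then obtain x where "x \<in> R" "lt a x" "lt x u" "poly r x = 0" using intermediate_value r(1) ab(1) u by blast
    then show False using umin[of x] lt_antisym[of x u] by (auto simp: fe)
  qed
  moreover have "sg (poly (pderiv f) a) = sg (a - u) * sg (poly r a)" "sg (poly (pderiv f) u) = sg (u - a) * sg (poly r u)"
    unfolding da du by (intro sg_mult diff poly_in ab u r)+
  moreover have "sg (u - a) = 1" "sg (a - u) = - 1" using u sg_minus_iff[of u a] ab by auto
  ultimately have "sg (poly (pderiv f) a) * sg (poly (pderiv f) u) = - 1"
    using nz sgn_in_cases[of S "poly r a"] sgn_in_cases[of S "poly r u"] da du by auto
  then obtain c where "c \<in> R" "lt a c" "lt c u" "poly (pderiv f) c = 0"
    using intermediate_value[OF poly_over_pderiv[OF f(1)] ab(1) u(1,2)] by blast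
  moreover have "u = b \<or> lt u b" using umin ab by blast
  ultimately show ?thesis using lt_trans by blast
qed

end

section \<open>Cuts of algebraic elements\<close>

context ordered_subfield
begin

text \<open>The bound \<open>B\<close> is found in the field of coefficients \<open>k\<close> by Horner's scheme.  This is why an element that is
  algebraic over \<open>k\<close> lies between two elements of \<open>k\<close>, even if \<open>M\<close> is not archimedean.\<close>

lemma poly_eventually_greater:
  assumes k: "subfield_set k" "k \<subseteq> M" and "p \<in> poly_over k" "degree p > 0" "sg (lead_coeff p) = 1" "C \<in> k"
  shows "\<exists>B\<in>k. \<forall>x\<in>M. lt B x \<longrightarrow> lt C (poly p x)"
  using assms(3-)
proof (induction p arbitrary: C)
  case (pCons c q)
  interpret k: subfield_set k by fact
  have kM: "x \<in> k \<Longrightarrow> x \<in> M" for x using k by blast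
  have cq: "c \<in> k" "q \<in> poly_over k" using pCons.prems by (simp_all add: k.poly_over_pCons)
  have q0: "q \<noteq> 0" using pCons.prems by auto
  show ?case
  proof (cases "degree q = 0")
    case True
    then obtain e where e: "q = [:e:]" using degree_eq_zeroE by blast
    have e1: "e \<in> k" "sg e = 1" "e \<noteq> 0" using cq pCons.prems(3) e q0 by (auto simp: k.poly_over_pCons)
    have "lt C (poly (pCons c q) x)" if "x \<in> M" "lt ((C - c) / e) x" for x
    proof -
      have "poly (pCons c q) x - C = e * (x - (C - c) / e)" using e1 e by (simp add: field_simps)
      moreover have "(C - c) / e \<in> M"
        by (intro kM k.divide k.diff e1(1) pCons.prems(4) cq(1))
      ultimately show ?thesis using sg_mult[OF kM[OF e1(1)] diff[OF that(1)]] that(2) e1 by simp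
    qed
    moreover have "(C - c) / e \<in> k"
      by (intro k.divide k.diff e1(1) pCons.prems(4) cq(1))
    ultimately show ?thesis by blast
  next
    case False
    then obtain B where B: "B \<in> k" "\<And>x. x \<in> M \<Longrightarrow> lt B x \<Longrightarrow> lt 1 (poly q x)"
      using pCons.IH[of 1] cq pCons.prems(3) q0 k.one by auto
    have Zk: "{B, C - c, 0} \<subseteq> k" using B(1) k.diff[OF pCons.prems(4) cq(1)] k.zero by simp
    then have "{B, C - c, 0} \<subseteq> M" using k(2) by blast
    from finite_has_max[OF _ this] obtain B' where B'0: "B' \<in> {B, C - c, 0}"
      and B'1: "\<forall>b\<in>{B, C - c, 0}. b = B' \<or> lt b B'" by blast
    have B': "B' \<in> k" "\<And>b. b \<in> {B, C - c, 0} \<Longrightarrow> b = B' \<or> lt b B'"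
      using B'0 B'1 Zk by blast+
    have "lt C (poly (pCons c q) x)" if x: "x \<in> M" "lt B' x" for x
    proof -
      have gt': "lt b x" if "b \<in> {B, C - c, 0}" for b
        using B'(2)[OF that] lt_trans[OF _ x(2)] x(2) by blast
      have gt: "lt B x" "lt (C - c) x" "lt 0 x" by (rule gt'; simp)+
      have qx: "lt 1 (poly q x)" using B(2) x(1) gt(1) by blast
      have qM: "poly q x \<in> M" using cq(2) k(2) x(1) by (intro poly_in) (auto simp: poly_over_def)
      have "sg (x * (poly q x - 1)) = 1"
        using sg_mult[OF x(1) diff[OF qM one]] gt(3) qx by simp
      then have "sg ((x - (C - c)) + x * (poly q x - 1)) = 1"
        using gt(2) sg_add_pos sg_one_P by blast
      then show ?thesis by (simp add: algebra_simps)
    qed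
    with B'(1) show ?thesis by blast
  qed
qed simp

lemma algebraic_upper_bound:
  assumes k: "subfield_set k" "k \<subseteq> M" and a: "a \<in> M" "a \<notin> k" and p: "p \<in> poly_over k" "p \<noteq> 0" "poly p a = 0"
  shows "\<exists>B\<in>k. lt a B"
proof -
  interpret k: subfield_set k by fact
  have deg: "degree p > 0"
    using p by (cases p rule: pCons_cases) (auto split: if_splits)
  have lc: "lead_coeff p \<in> M" "lead_coeff p \<noteq> 0" using p k(2) by (auto simp: poly_over_def)
  obtain q where q: "q \<in> poly_over k" "degree q > 0" "sg (lead_coeff q) = 1" "poly q a = 0"
  proof (cases "sg (lead_coeff p) = 1")
    case False
    then have "sg (lead_coeff (- p)) = 1"
      using lc sg_neg[OF lc(1)] sgn_in_cases[of P "lead_coeff p"] by auto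
    then show ?thesis using that[of "- p"] p deg k.poly_over_uminus by simp
  qed (use p deg that in blast)
  obtain B where B: "B \<in> k" "\<And>x. x \<in> M \<Longrightarrow> lt B x \<Longrightarrow> lt 0 (poly q x)"
    using poly_eventually_greater[OF k q(1-3) k.zero] by blast
  have "\<not> lt B a" using B(2)[OF a(1)] q(4) by auto
  with B(1) show ?thesis using lt_linear[of a B] a k(2) by blast
qed

lemma poly_over_reflect:
  assumes "subfield_set k" "p \<in> poly_over k"
  shows "pcompose p [:0, - 1:] \<in> poly_over k"
proof -
  interpret k: subfield_set k by fact
  have X: "[:0, - 1:] \<in> poly_over k" by (simp add: k.poly_over_pCons k.closed k.poly_over_0)
  show ?thesis using assms(2)
  proof (induction p)
    case (pCons c p)
    then have c: "[:c:] \<in> poly_over k" "p \<circ>\<^sub>p [:0, - 1:] \<in> poly_over k"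
      by (simp_all add: k.poly_over_pCons k.poly_over_0)
    show ?case unfolding pcompose_pCons by (intro k.poly_over_add k.poly_over_mult c X)
  qed (simp add: k.poly_over_0)
qed

lemma algebraic_bounds:
  assumes k: "subfield_set k" "k \<subseteq> M" and a: "a \<in> M" "a \<notin> k" and p: "p \<in> poly_over k" "p \<noteq> 0" "poly p a = 0"
  shows "\<exists>l\<in>k. \<exists>u\<in>k. lt l a \<and> lt a u"
proof -
  interpret k: subfield_set k by fact
  have "\<exists>B\<in>k. lt (- a) B"
  proof (rule algebraic_upper_bound[OF k])
    show "- a \<in> M" using a neg by blast
    show "- a \<notin> k" using a k.neg[of "- a"] by auto
    show "pcompose p [:0, - 1:] \<in> poly_over k" using poly_over_reflect k(1) p(1) by blast
    show "pcompose p [:0, - 1:] \<noteq> 0" using p(2) by (simp add: pcompose_eq_0_iff)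
    show "poly (pcompose p [:0, - 1:]) (- a) = 0" using p(3) by (simp add: poly_pcompose)
  qed
  then obtain B where "B \<in> k" "lt (- a) B" by blast
  then have "- B \<in> k" "lt (- B) a" using k.neg by (auto simp: add.commute)
  then show ?thesis using algebraic_upper_bound[OF assms] by blast
qed

lemma finite_sandwich:
  assumes "finite Z" "Z \<subseteq> M" "a \<in> M" "a \<notin> Z" "l \<in> Z" "lt l a" "u \<in> Z" "lt a u"
  shows "\<exists>l'\<in>Z. \<exists>u'\<in>Z. lt l' a \<and> lt a u' \<and> (\<forall>z\<in>Z. \<not> (lt l' z \<and> lt z u'))"
proof -
  obtain l' where l': "l' \<in> Z" "lt l' a" "\<And>z. z \<in> Z \<Longrightarrow> lt z a \<Longrightarrow> z = l' \<or> lt z l'"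
    using finite_has_max[of "{z \<in> Z. lt z a}"] assms by fastforce
  obtain u' where u': "u' \<in> Z" "lt a u'" "\<And>z. z \<in> Z \<Longrightarrow> lt a z \<Longrightarrow> z = u' \<or> lt u' z"
    using finite_has_min[of "{z \<in> Z. lt a z}"] assms by fastforce
  have "\<not> (lt l' z \<and> lt z u')" if z: "z \<in> Z" for z
  proof
    assume b: "lt l' z \<and> lt z u'"
    have "z = a \<or> lt z a \<or> lt a z" using lt_linear assms z by blast
    with b l'(3)[OF z] u'(3)[OF z] lt_antisym[of l' z] lt_antisym[of z u'] lt_irrefl assms(4) z
    show False by auto
  qed
  with l' u' show ?thesis by blast
qed

end

context max_ordered_subfield
begin

lemma constant_sign:
  assumes g: "g \<in> poly_over R" and no_root: "\<And>x. x \<in> R \<Longrightarrow> poly g x = 0 \<Longrightarrow> \<not> (lt l x \<and> lt x u)"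
    and x: "x \<in> R" "lt l x" "lt x u" and y: "y \<in> R" "lt l y" "lt y u"
  shows "sg (poly g x) = sg (poly g y)"
proof (rule ccontr)
  assume ne: "sg (poly g x) \<noteq> sg (poly g y)"
  have "poly g x \<noteq> 0" "poly g y \<noteq> 0" using no_root x y by blast+
  with ne have m: "sg (poly g x) * sg (poly g y) = - 1" "sg (poly g y) * sg (poly g x) = - 1"
    using sgn_in_cases[of S "poly g x"] sgn_in_cases[of S "poly g y"] by auto
  have "x \<noteq> y" using ne by auto
  then consider "lt x y" | "lt y x" using lt_linear x y by blast
  then show False
  proof cases
    case 1
    then obtain z where "z \<in> R" "lt x z" "lt z y" "poly g z = 0"
      using intermediate_value[OF g x(1) y(1)] m by blast
    then show False using no_root[of z] lt_trans[OF x(2)] lt_trans[OF _ y(3)] by blast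
  next
    case 2
    then obtain z where "z \<in> R" "lt y z" "lt z x" "poly g z = 0"
      using intermediate_value[OF g y(1) x(1)] m by blast
    then show False using no_root[of z] lt_trans[OF y(2)] lt_trans[OF _ x(3)] by blast
  qed
qed

lemma at_most_one_root:
  assumes f: "f \<in> poly_over R" "f \<noteq> 0"
    and simple: "\<And>x. x \<in> R \<Longrightarrow> poly f x = 0 \<Longrightarrow> poly (pderiv f) x \<noteq> 0"
    and no_crit: "\<And>x. x \<in> R \<Longrightarrow> poly (pderiv f) x = 0 \<Longrightarrow> \<not> (lt l x \<and> lt x u)"
    and x: "x \<in> R" "lt l x" "lt x u" "poly f x = 0" and y: "y \<in> R" "lt l y" "lt y u" "poly f y = 0"
  shows "x = y"
proof (rule ccontr)
  assume "x \<noteq> y"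
  then consider "lt x y" | "lt y x" using lt_linear x y by blast
  then show False
  proof cases
    case 1
    then obtain z where "z \<in> R" "lt x z" "lt z y" "poly (pderiv f) z = 0"
      using rolle[OF f x(1) y(1)] simple x(4) y(4) by blast
    then show False using no_crit[of z] lt_trans[OF x(2)] lt_trans[OF _ y(3)] by blast
  next
    case 2
    then obtain z where "z \<in> R" "lt y z" "lt z x" "poly (pderiv f) z = 0"
      using rolle[OF f y(1) x(1)] simple x(4) y(4) by blast
    then show False using no_crit[of z] lt_trans[OF y(2)] lt_trans[OF _ x(3)] by blast
  qed
qed

lemma sign_change_at_root:
  assumes f: "f \<in> poly_over R" "f \<noteq> 0"
    and simple: "\<And>x. x \<in> R \<Longrightarrow> poly f x = 0 \<Longrightarrow> poly (pderiv f) x \<noteq> 0"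
    and no_crit: "\<And>x. x \<in> R \<Longrightarrow> poly (pderiv f) x = 0 \<Longrightarrow> \<not> (lt l x \<and> lt x u)"
    and lu: "l \<in> R" "u \<in> R" "poly f l \<noteq> 0" "poly f u \<noteq> 0"
    and x: "x \<in> R" "lt l x" "lt x u" "poly f x = 0"
  shows "sg (poly f l) * sg (poly f u) = - 1"
proof -
  obtain h where h: "h \<in> poly_over R" "f = [:- x, 1:] * h" using poly_over_div_root f x by blast
  have "sg (poly h l) * sg (poly h u) \<noteq> - 1"
  proof
    assume "sg (poly h l) * sg (poly h u) = - 1"
    then obtain c where c: "c \<in> R" "lt l c" "lt c u" "poly h c = 0"
      using intermediate_value[OF h(1) lu(1,2) lt_trans[OF x(2,3)]] by blast
    then have "poly f c = 0" using h by simp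
    then have "c = x" using at_most_one_root[OF f simple no_crit c(1-3) _ x] by blast
    then have "poly (pderiv f) x = 0" using c(4) unfolding h(2) pderiv_mult by (simp add: pderiv_pCons)
    then show False using simple x by blast
  qed
  moreover have e: "poly f l = (l - x) * poly h l" "poly f u = (u - x) * poly h u"
    by (simp_all add: h algebra_simps)
  moreover have "sg (l - x) = - 1" using sg_minus_iff[OF x(1) lu(1)] x(2) by simp
  then have "sg (poly f l) = - sg (poly h l)" "sg (poly f u) = sg (poly h u)"
    unfolding e using sg_mult[OF diff[OF lu(1) x(1)] poly_in[OF h(1) lu(1)]]
      sg_mult[OF diff[OF lu(2) x(1)] poly_in[OF h(1) lu(2)]] x(3) by simp_all
  moreover have "sg (poly h l) = 1 \<or> sg (poly h l) = - 1" "sg (poly h u) = 1 \<or> sg (poly h u) = - 1"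
    using lu(3,4) unfolding e by (auto simp: sgn_in_def)
  ultimately show ?thesis by (elim disjE) simp_all
qed

text \<open>On an interval that isolates the root \<open>x\<close> of \<open>f\<close>, the sign of \<open>f c\<close> tells on which side of \<open>x\<close> the point \<open>c\<close> lies.
  The cut that \<open>x\<close> makes in a field of coefficients can thus be read off in that field, and carried to
  another one along an order isomorphism.\<close>

lemma cut_by_sign:
  assumes f: "f \<in> poly_over R" and lu: "l \<in> R" "u \<in> R" "sg (poly f l) * sg (poly f u) = - 1"
    and x: "x \<in> R" "lt l x" "lt x u" "poly f x = 0"
    and unique: "\<And>y. y \<in> R \<Longrightarrow> lt l y \<Longrightarrow> lt y u \<Longrightarrow> poly f y = 0 \<Longrightarrow> y = x"
    and c: "c \<in> R" "lt l c" "lt c u" "poly f c \<noteq> 0"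
  shows "lt c x \<longleftrightarrow> sg (poly f c) = sg (poly f l)"
proof
  assume cx: "lt c x"
  show "sg (poly f c) = sg (poly f l)"
  proof (rule ccontr)
    assume "sg (poly f c) \<noteq> sg (poly f l)"
    then have "sg (poly f l) * sg (poly f c) = - 1"
      using lu c sgn_in_cases[of S "poly f c"] sgn_in_cases[of S "poly f l"] by auto
    then obtain z where "z \<in> R" "lt l z" "lt z c" "poly f z = 0"
      using intermediate_value[OF f lu(1) c(1,2)] by blast
    then show False using unique[of z] lt_trans[OF _ c(3)] cx lt_antisym by blast
  qed
next
  assume eq: "sg (poly f c) = sg (poly f l)"
  show "lt c x"
  proof (rule ccontr)
    assume "\<not> lt c x"
    moreover have "c \<noteq> x" using c x by auto
    ultimately have xc: "lt x c" using lt_linear c x by blast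
    obtain z where "z \<in> R" "lt c z" "lt z u" "poly f z = 0"
      using intermediate_value[OF f c(1) lu(2) c(3)] eq lu(3) by auto
    then show False using unique[of z] lt_trans[OF c(2)] xc lt_antisym by blast
  qed
qed

end

section \<open>Amalgamation of ordered fields\<close>

text \<open>An order isomorphism between subfields of two real closed fields is represented by its graph, so that
  extension is inclusion.  The sign condition makes the graph single-valued in both directions: a
  difference with sign zero on one side has sign zero on the other.\<close>

locale partial_order_iso = A: max_ordered_subfield R1 S1 + B: max_ordered_subfield R2 S2
  for R1 :: "'a::{alg_closed_field, field_char_0} set" and S1 and R2 :: "'a set" and S2 +
  fixes G :: "('a \<times> 'a) set"
  assumes G_sub: "(x, y) \<in> G \<Longrightarrow> x \<in> R1 \<and> y \<in> R2"
    and G_zero: "(0, 0) \<in> G" and G_one: "(1, 1) \<in> G"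
    and G_add: "(x, y) \<in> G \<Longrightarrow> (x', y') \<in> G \<Longrightarrow> (x + x', y + y') \<in> G"
    and G_mult: "(x, y) \<in> G \<Longrightarrow> (x', y') \<in> G \<Longrightarrow> (x * x', y * y') \<in> G"
    and G_neg: "(x, y) \<in> G \<Longrightarrow> (- x, - y) \<in> G"
    and G_inv: "(x, y) \<in> G \<Longrightarrow> (inverse x, inverse y) \<in> G"
    and G_sgn: "(x, y) \<in> G \<Longrightarrow> sgn_in S1 x = sgn_in S2 y"
begin

lemma converse: "partial_order_iso R2 S2 R1 S1 (G\<inverse>)"
  by unfold_locales (auto simp: G_sub G_zero G_one G_add G_mult G_neg G_inv G_sgn)

lemma G_diff: "(x, y) \<in> G \<Longrightarrow> (x', y') \<in> G \<Longrightarrow> (x - x', y - y') \<in> G"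
  using G_add[of x y "- x'" "- y'"] G_neg[of x' y'] by simp

lemma G_zero_iff: "(x, y) \<in> G \<Longrightarrow> x = 0 \<longleftrightarrow> y = 0"
  using G_sgn[of x y] by (metis sgn_in_eq_0_iff)

lemma G_fun: "(x, y) \<in> G \<Longrightarrow> (x, y') \<in> G \<Longrightarrow> y = y'"
  using G_zero_iff[OF G_diff] by fastforce

lemma G_less: "(x, y) \<in> G \<Longrightarrow> (x', y') \<in> G \<Longrightarrow> A.lt x x' \<longleftrightarrow> B.lt y y'"
  using G_sgn[OF G_diff] by fastforce

lemma G_sum: "(\<And>i. i \<in> I \<Longrightarrow> (f i, g i) \<in> G) \<Longrightarrow> (sum f I, sum g I) \<in> G"
  by (induction I rule: infinite_finite_induct) (auto simp: G_zero G_add)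

lemma G_of_nat: "(of_nat n, of_nat n) \<in> G"
  by (induction n) (auto simp: G_zero G_one G_add)

lemma Domain_subfield: "subfield_set (Domain G)"
  by unfold_locales (auto intro: G_zero G_one G_add G_mult G_neg G_inv)

sublocale D: subfield_set "Domain G" by (rule Domain_subfield)

lemma Domain_sub: "Domain G \<subseteq> R1" and Range_sub: "Range G \<subseteq> R2"
  using G_sub by auto

definition poly_rel :: "'a poly \<Rightarrow> 'a poly \<Rightarrow> bool" where
  "poly_rel p q \<longleftrightarrow> (\<forall>i. (coeff p i, coeff q i) \<in> G)"

lemma poly_rel_over: "poly_rel p q \<Longrightarrow> p \<in> poly_over (Domain G)" "poly_rel p q \<Longrightarrow> q \<in> poly_over (Range G)"
  unfolding poly_rel_def poly_over_def by auto

lemma poly_rel_over_R: "poly_rel p q \<Longrightarrow> p \<in> poly_over R1" "poly_rel p q \<Longrightarrow> q \<in> poly_over R2"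
  unfolding poly_rel_def poly_over_def using G_sub by auto

lemma poly_rel_partner:
  assumes "p \<in> poly_over (Domain G)"
  shows "\<exists>q. poly_rel p q"
proof -
  define \<phi> where "\<phi> x = (THE y. (x, y) \<in> G)" for x
  have \<phi>: "(x, \<phi> x) \<in> G" if "x \<in> Domain G" for x
    using that G_fun unfolding \<phi>_def by (metis (no_types, lifting) Domain.cases theI)
  have "\<phi> 0 = 0" using G_fun[OF \<phi> G_zero] G_zero by blast
  then have "poly_rel p (map_poly \<phi> p)"
    using \<phi> assms by (auto simp: poly_rel_def coeff_map_poly poly_over_def)
  then show ?thesis by blast
qed

lemma poly_rel_unique: "poly_rel p q \<Longrightarrow> poly_rel p q' \<Longrightarrow> q = q'"
  unfolding poly_rel_def poly_eq_iff using G_fun by blast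

lemma poly_rel_0: "poly_rel 0 0"
  by (simp add: poly_rel_def G_zero)

lemma poly_rel_add: "poly_rel p q \<Longrightarrow> poly_rel p' q' \<Longrightarrow> poly_rel (p + p') (q + q')"
  by (simp add: poly_rel_def G_add)

lemma poly_rel_uminus: "poly_rel p q \<Longrightarrow> poly_rel (- p) (- q)"
  by (simp add: poly_rel_def G_neg)

lemma poly_rel_mult: "poly_rel p q \<Longrightarrow> poly_rel p' q' \<Longrightarrow> poly_rel (p * p') (q * q')"
  by (simp add: poly_rel_def coeff_mult G_sum G_mult)

lemma poly_rel_pderiv: "poly_rel p q \<Longrightarrow> poly_rel (pderiv p) (pderiv q)"
  by (simp add: poly_rel_def coeff_pderiv G_mult G_of_nat del: of_nat_Suc)

lemma poly_rel_pCons: "poly_rel (pCons a p) (pCons b q) \<longleftrightarrow> (a, b) \<in> G \<and> poly_rel p q"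
  by (auto simp: poly_rel_def coeff_pCons split: nat.splits)

lemma poly_rel_degree: "poly_rel p q \<Longrightarrow> degree p = degree q"
  unfolding poly_rel_def
  by (intro order.antisym degree_le) (use G_zero_iff coeff_eq_0 in blast)+

lemma poly_rel_zero_iff: "poly_rel p q \<Longrightarrow> p = 0 \<longleftrightarrow> q = 0"
  unfolding poly_rel_def poly_eq_iff using G_zero_iff by auto

lemma poly_rel_eval:
  assumes "poly_rel p q" "(x, y) \<in> G"
  shows "(poly p x, poly q y) \<in> G"
  using assms(1)
proof (induction p arbitrary: q)
  case 0
  then show ?case using poly_rel_zero_iff[of 0 q] by (simp add: G_zero)
next
  case (pCons a p)
  obtain b r where q: "q = pCons b r" by (cases q)
  then show ?case using pCons by (auto simp: poly_rel_pCons intro!: G_add G_mult assms(2))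
qed

end

context partial_order_iso
begin

text \<open>One step of the extension adjoins an element \<open>a\<close> whose degree \<open>n\<close> over the domain of \<open>G\<close> is least possible: by
  \<open>small1\<close> and \<open>small2\<close> the roots of polynomials of smaller degree lie in the domain and in the range
  already.  In particular this holds for the roots of the derivative of \<open>f\<close>.\<close>

context
  fixes n :: nat and f :: "'a poly" and f2 and a
  assumes small1: "\<And>p x. p \<in> poly_over (Domain G) \<Longrightarrow> p \<noteq> 0 \<Longrightarrow> degree p < n \<Longrightarrow> x \<in> R1 \<Longrightarrow>
      poly p x = 0 \<Longrightarrow> x \<in> Domain G"
    and small2: "\<And>p y. p \<in> poly_over (Range G) \<Longrightarrow> p \<noteq> 0 \<Longrightarrow> degree p < n \<Longrightarrow> y \<in> R2 \<Longrightarrow>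
      poly p y = 0 \<Longrightarrow> y \<in> Range G"
    and f: "poly_rel f f2" "f \<noteq> 0" "degree f = n" and a: "a \<in> R1" "a \<notin> Domain G" "poly f a = 0"
begin

lemma f_over: "f \<in> poly_over (Domain G)" "f \<in> poly_over R1" "f2 \<in> poly_over R2" "f2 \<noteq> 0"
  using poly_rel_over[OF f(1)] poly_rel_over_R[OF f(1)] poly_rel_zero_iff[OF f(1)] f(2) by auto

lemma deg_pos: "n > 0"
proof (rule ccontr)
  assume "\<not> ?thesis"
  then obtain c where "f = [:c:]" using f(3) degree_eq_zeroE by blast
  with f(2) a(3) show False by simp
qed

lemma no_root_Domain: "x \<in> Domain G \<Longrightarrow> poly f x \<noteq> 0"
proof
  assume x: "x \<in> Domain G" "poly f x = 0"
  obtain q where q: "q \<in> poly_over (Domain G)" "f = [:- x, 1:] * q"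
    using D.poly_over_div_root[OF f_over(1) x] by blast
  have q0: "q \<noteq> 0" using q f(2) by auto
  have "degree f = 1 + degree q" unfolding q(2) using q0 by (subst degree_mult_eq) auto
  moreover have "a - x \<noteq> 0" using a(2) x(1) by auto
  then have "poly q a = 0" using a(3) unfolding q(2) by simp
  ultimately show False using small1[OF q(1) q0 _ a(1)] a(2) f(3) by auto
qed

lemma no_root_Range: "y \<in> Range G \<Longrightarrow> poly f2 y \<noteq> 0"
  using no_root_Domain G_zero_iff[OF poly_rel_eval[OF f(1)]] by blast

lemma pderiv_f: "poly_rel (pderiv f) (pderiv f2)" "pderiv f \<noteq> 0" "degree (pderiv f) < n"
    "pderiv f2 \<noteq> 0" "degree (pderiv f2) < n"
proof -
  show r: "poly_rel (pderiv f) (pderiv f2)" by (rule poly_rel_pderiv[OF f(1)])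
  show n0: "pderiv f \<noteq> 0" using f(3) deg_pos by (simp add: pderiv_eq_0_iff)
  show d: "degree (pderiv f) < n" using f(3) deg_pos by (simp add: degree_pderiv)
  show "pderiv f2 \<noteq> 0" "degree (pderiv f2) < n"
    using n0 d poly_rel_zero_iff[OF r] poly_rel_degree[OF r] by auto
qed

lemma crit1: "x \<in> R1 \<Longrightarrow> poly (pderiv f) x = 0 \<Longrightarrow> x \<in> Domain G"
  using small1 poly_rel_over[OF pderiv_f(1)] pderiv_f by blast

lemma crit2: "y \<in> R2 \<Longrightarrow> poly (pderiv f2) y = 0 \<Longrightarrow> y \<in> Range G"
  using small2 poly_rel_over[OF pderiv_f(1)] pderiv_f by blast

lemma simple1: "x \<in> R1 \<Longrightarrow> poly f x = 0 \<Longrightarrow> poly (pderiv f) x \<noteq> 0"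
  using crit1 no_root_Domain by blast

lemma simple2: "y \<in> R2 \<Longrightarrow> poly f2 y = 0 \<Longrightarrow> poly (pderiv f2) y \<noteq> 0"
  using crit2 no_root_Range by blast

text \<open>The critical points of \<open>f\<close> lie in the domain of \<open>G\<close>, so those next to \<open>a\<close> bound an interval with end points in
  the domain; \<open>G\<close> carries critical points to critical points.\<close>

lemma isolating_interval:
  shows "\<exists>l u l2 u2. (l, l2) \<in> G \<and> (u, u2) \<in> G \<and> A.lt l a \<and> A.lt a u \<and>
     (\<forall>x\<in>R1. poly (pderiv f) x = 0 \<longrightarrow> \<not> (A.lt l x \<and> A.lt x u)) \<and>
     (\<forall>y\<in>R2. poly (pderiv f2) y = 0 \<longrightarrow> \<not> (B.lt l2 y \<and> B.lt y u2))"
proof -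
  obtain l0 u0 where lu0: "l0 \<in> Domain G" "u0 \<in> Domain G" "A.lt l0 a" "A.lt a u0"
    using A.algebraic_bounds[OF Domain_subfield Domain_sub a(1,2) f_over(1) f(2) a(3)] by blast
  let ?Z = "{x \<in> R1. poly (pderiv f) x = 0} \<union> {l0, u0}"
  have "finite ?Z" using poly_roots_finite[OF pderiv_f(2)] by (auto intro: finite_subset)
  moreover have ZD: "?Z \<subseteq> Domain G" using crit1 lu0 by blast
  ultimately obtain l u where lu: "l \<in> ?Z" "u \<in> ?Z" "A.lt l a" "A.lt a u"
    and none: "\<forall>z\<in>?Z. \<not> (A.lt l z \<and> A.lt z u)"
    using A.finite_sandwich[of ?Z a l0 u0] Domain_sub lu0 a(1,2) by blast
  obtain l2 u2 where lu2: "(l, l2) \<in> G" "(u, u2) \<in> G" using lu(1,2) ZD by blast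
  have "\<not> (B.lt l2 y \<and> B.lt y u2)" if y: "y \<in> R2" "poly (pderiv f2) y = 0" for y
  proof -
    obtain x where x: "(x, y) \<in> G" using crit2[OF y] by blast
    then have "poly (pderiv f) x = 0"
      using G_zero_iff[OF poly_rel_eval[OF pderiv_f(1) x]] y by simp
    then have "x \<in> ?Z" using G_sub[OF x] by simp
    then show ?thesis using none G_less[OF lu2(1) x] G_less[OF x lu2(2)] by blast
  qed
  then show ?thesis using lu lu2 none by blast
qed

text \<open>By Rolle's theorem \<open>a\<close> is the only root of \<open>f\<close> in the isolating interval, and \<open>f\<close> changes sign on it.  So \<open>f2\<close>
  changes sign on the corresponding interval and has a root \<open>b\<close> there.  The cuts of \<open>a\<close> and \<open>b\<close> are given by
  the signs of values of \<open>f\<close> and \<open>f2\<close>, which correspond under \<open>G\<close>.\<close>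

lemma matching_root:
  shows "\<exists>b\<in>R2. poly f2 b = 0 \<and> (\<forall>x y. (x, y) \<in> G \<longrightarrow> A.lt x a = B.lt y b)"
proof -
  obtain l u l2 u2 where G: "(l, l2) \<in> G" "(u, u2) \<in> G" and lu: "A.lt l a" "A.lt a u"
    and crit: "\<And>x. x \<in> R1 \<Longrightarrow> poly (pderiv f) x = 0 \<Longrightarrow> \<not> (A.lt l x \<and> A.lt x u)"
      "\<And>y. y \<in> R2 \<Longrightarrow> poly (pderiv f2) y = 0 \<Longrightarrow> \<not> (B.lt l2 y \<and> B.lt y u2)"
    using isolating_interval by metis
  have R: "l \<in> R1" "u \<in> R1" "l2 \<in> R2" "u2 \<in> R2" using G G_sub by auto
  have nz: "poly f l \<noteq> 0" "poly f u \<noteq> 0" using no_root_Domain G by auto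
  have sc: "A.sg (poly f l) * A.sg (poly f u) = - 1"
    using A.sign_change_at_root[OF f_over(2) f(2) simple1 crit(1) R(1,2) nz a(1) lu a(3)] .
  have sc2: "B.sg (poly f2 l2) * B.sg (poly f2 u2) = - 1"
    using sc G_sgn[OF poly_rel_eval[OF f(1) G(1)]] G_sgn[OF poly_rel_eval[OF f(1) G(2)]] by simp
  have lu2: "B.lt l2 u2" using A.lt_trans[OF lu] G_less[OF G] by simp
  obtain b where b: "b \<in> R2" "B.lt l2 b" "B.lt b u2" "poly f2 b = 0"
    using B.intermediate_value[OF f_over(3) R(3,4) lu2 sc2] by blast
  have "A.lt x a = B.lt y b" if xy: "(x, y) \<in> G" for x y
  proof -
    have xR: "x \<in> R1" "y \<in> R2" using xy G_sub by auto
    note less = G_less[OF G(1) xy] G_less[OF xy G(2)]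
    consider "\<not> A.lt l x" | "\<not> A.lt x u" | "A.lt l x" "A.lt x u" by blast
    then show ?thesis
    proof cases
      case 1
      then have "x = l \<or> A.lt x l" "y = l2 \<or> B.lt y l2"
        using A.lt_linear[OF xR(1) R(1)] B.lt_linear[OF xR(2) R(3)] less by blast+
      then show ?thesis using lu(1) b(2) A.lt_trans B.lt_trans by blast
    next
      case 2
      then have "x = u \<or> A.lt u x" "y = u2 \<or> B.lt u2 y"
        using A.lt_linear[OF xR(1) R(2)] B.lt_linear[OF xR(2) R(4)] less by blast+
      then show ?thesis using lu(2) b(3) A.lt_antisym B.lt_antisym A.lt_trans B.lt_trans by blast
    next
      case 3
      have "A.lt x a \<longleftrightarrow> A.sg (poly f x) = A.sg (poly f l)"
        by (rule A.cut_by_sign[OF f_over(2) R(1,2) sc a(1) lu a(3) _ xR(1) 3])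
          (use A.at_most_one_root[OF f_over(2) f(2) simple1 crit(1) _ _ _ _ a(1) lu a(3)]
            no_root_Domain xy in blast)+
      moreover have "B.lt y b \<longleftrightarrow> B.sg (poly f2 y) = B.sg (poly f2 l2)"
        by (rule B.cut_by_sign[OF f_over(3) R(3,4) sc2 b _ xR(2)])
          (use B.at_most_one_root[OF f_over(3,4) simple2 crit(2) _ _ _ _ b]
            no_root_Range xy 3 less in blast)+
      ultimately show ?thesis
        using G_sgn[OF poly_rel_eval[OF f(1) G(1)]] G_sgn[OF poly_rel_eval[OF f(1) xy]] by simp
    qed
  qed
  with b show ?thesis by blast
qed

text \<open>The roots of \<open>g\<close> lie in the domain of \<open>G\<close>, so \<open>g\<close> has constant sign on an interval around \<open>a\<close> with end points in the
  domain.  The sign at \<open>a\<close> is the sign at the midpoint, and this one is preserved by \<open>G\<close>.\<close>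

lemma matching_signs_small:
  assumes b: "b \<in> R2" "poly f2 b = 0" "\<And>x y. (x, y) \<in> G \<Longrightarrow> A.lt x a = B.lt y b"
    and g: "poly_rel g g2" "g \<noteq> 0" "degree g < n"
  shows "A.sg (poly g a) = B.sg (poly g2 b)"
proof -
  have bG: "b \<notin> Range G" using no_root_Range b(2) by blast
  have g2: "g2 \<noteq> 0" "degree g2 < n" using g poly_rel_zero_iff poly_rel_degree by auto
  obtain l0 u0 where lu0: "l0 \<in> Domain G" "u0 \<in> Domain G" "A.lt l0 a" "A.lt a u0"
    using A.algebraic_bounds[OF Domain_subfield Domain_sub a(1,2) f_over(1) f(2) a(3)] by blast
  let ?Z = "{x \<in> R1. poly g x = 0} \<union> {l0, u0}"
  have "finite ?Z" using poly_roots_finite[OF g(2)] by (auto intro: finite_subset)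
  moreover have ZD: "?Z \<subseteq> Domain G" using small1[OF poly_rel_over(1)[OF g(1)] g(2,3)] lu0 by blast
  ultimately obtain l u where lu: "l \<in> ?Z" "u \<in> ?Z" "A.lt l a" "A.lt a u"
    and none: "\<forall>z\<in>?Z. \<not> (A.lt l z \<and> A.lt z u)"
    using A.finite_sandwich[of ?Z a l0 u0] Domain_sub lu0 a(1,2) by blast
  obtain l2 u2 where lu2: "(l, l2) \<in> G" "(u, u2) \<in> G" using lu(1,2) ZD by blast
  have R: "l \<in> R1" "u \<in> R1" "l2 \<in> R2" "u2 \<in> R2" using lu2 G_sub by auto
  have none2: "\<not> (B.lt l2 y \<and> B.lt y u2)" if y: "y \<in> R2" "poly g2 y = 0" for y
  proof -
    obtain x where x: "(x, y) \<in> G" using small2[OF poly_rel_over(2)[OF g(1)] g2 y] by blast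
    then have "poly g x = 0"
      using G_zero_iff[OF poly_rel_eval[OF g(1) x]] y by simp
    then have "x \<in> ?Z" using G_sub[OF x] by simp
    then show ?thesis using none G_less[OF lu2(1) x] G_less[OF x lu2(2)] by blast
  qed
  have lb: "B.lt l2 b" using b(3)[OF lu2(1)] lu(3) by simp
  have ub: "B.lt b u2"
  proof -
    have "\<not> B.lt u2 b" using b(3)[OF lu2(2)] A.lt_antisym[OF lu(4)] by simp
    moreover have "u2 \<noteq> b" using bG lu2(2) by blast
    ultimately show ?thesis using B.lt_linear[OF R(4) b(1)] by blast
  qed
  have two: "(2, 2) \<in> G" using G_of_nat[of 2] by simp
  have "((l + u) * inverse 2, (l2 + u2) * inverse 2) \<in> G" by (intro G_mult G_add lu2 G_inv two)
  then have mid: "((l + u) / 2, (l2 + u2) / 2) \<in> G" by (simp only: divide_inverse)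
  note m1 = A.lt_mid[OF R(1,2) A.lt_trans[OF lu(3,4)]]
  note m2 = B.lt_mid[OF R(3,4) B.lt_trans[OF lb ub]]
  have "A.sg (poly g a) = A.sg (poly g ((l + u) / 2))"
    by (rule A.constant_sign[OF poly_rel_over_R(1)[OF g(1)] _ a(1) lu(3,4) m1]) (use none in blast)
  moreover have "B.sg (poly g2 b) = B.sg (poly g2 ((l2 + u2) / 2))"
    by (rule B.constant_sign[OF poly_rel_over_R(2)[OF g(1)] _ b(1) lb ub m2]) (use none2 in blast)
  ultimately show ?thesis using G_sgn[OF poly_rel_eval[OF g(1) mid]] by simp
qed

lemma matching_signs:
  assumes b: "b \<in> R2" "poly f2 b = 0" "\<And>x y. (x, y) \<in> G \<Longrightarrow> A.lt x a = B.lt y b"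
    and g: "poly_rel g g2"
  shows "A.sg (poly g a) = B.sg (poly g2 b)"
proof -
  obtain q r where qr: "q \<in> poly_over (Domain G)" "r \<in> poly_over (Domain G)" "g = f * q + r"
    and r: "r = 0 \<or> degree r < n"
    using D.poly_over_division[OF f_over(1) f(2) poly_rel_over(1)[OF g]] f(3) by blast
  obtain q2 r2 where rel: "poly_rel q q2" "poly_rel r r2" using poly_rel_partner qr by blast
  have "poly_rel g (f2 * q2 + r2)" unfolding qr(3) by (intro poly_rel_add poly_rel_mult f(1) rel)
  then have g2: "g2 = f2 * q2 + r2" using poly_rel_unique g by blast
  have "poly g a = poly r a" "poly g2 b = poly r2 b" using a(3) b(2) by (simp_all add: qr(3) g2)
  moreover have "A.sg (poly r a) = B.sg (poly r2 b)"
  proof (cases "r = 0")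
    case True
    then show ?thesis using poly_rel_zero_iff[OF rel(2)] by simp
  next
    case False
    with r show ?thesis using matching_signs_small[OF b rel(2)] by simp
  qed
  ultimately show ?thesis by simp
qed

text \<open>The map that sends \<open>g a\<close> to \<open>g2 b\<close> for corresponding polynomials preserves signs by \<open>matching_signs\<close>; in
  particular it is well defined.\<close>

lemma extension_step:
  shows "\<exists>G'. partial_order_iso R1 S1 R2 S2 G' \<and> G \<subseteq> G' \<and> a \<in> Domain G'"
proof -
  obtain b where b: "b \<in> R2" "poly f2 b = 0" "\<And>x y. (x, y) \<in> G \<Longrightarrow> A.lt x a = B.lt y b"
    using matching_root by blast
  define G' where "G' = {(poly g a, poly g2 b) |g g2. poly_rel g g2}"
  have I: "(poly g a, poly g2 b) \<in> G'" if "poly_rel g g2" for g g2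
    using that unfolding G'_def by blast
  have E: "\<exists>g g2. poly_rel g g2 \<and> x = poly g a \<and> y = poly g2 b" if "(x, y) \<in> G'" for x y
    using that unfolding G'_def by blast
  have sgn': "A.sg x = B.sg y" if "(x, y) \<in> G'" for x y
    using E[OF that] matching_signs[OF b] by auto
  have sub': "x \<in> R1 \<and> y \<in> R2" if "(x, y) \<in> G'" for x y
    using E[OF that] A.poly_in[OF _ a(1)] B.poly_in[OF _ b(1)] poly_rel_over_R by auto
  have add': "(x + x', y + y') \<in> G'" if "(x, y) \<in> G'" "(x', y') \<in> G'" for x y x' y'
    using E[OF that(1)] E[OF that(2)] poly_rel_add I poly_add by metis
  have mult': "(x * x', y * y') \<in> G'" if "(x, y) \<in> G'" "(x', y') \<in> G'" for x y x' y'
    using E[OF that(1)] E[OF that(2)] poly_rel_mult I poly_mult by metis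
  have neg': "(- x, - y) \<in> G'" if "(x, y) \<in> G'" for x y
    using E[OF that(1)] poly_rel_uminus I poly_minus by metis
  have incl: "G \<subseteq> G'"
  proof (rule subrelI)
    fix x y assume "(x, y) \<in> G"
    then have "poly_rel [:x:] [:y:]" by (simp add: poly_rel_pCons poly_rel_0)
    from I[OF this] show "(x, y) \<in> G'" by simp
  qed
  have "poly_rel [:0, 1:] [:0, 1:]" by (simp add: poly_rel_pCons poly_rel_0 G_zero G_one)
  from I[OF this] have ab: "(a, b) \<in> G'" by simp
  have alg: "D.algebraic_over a" unfolding D.algebraic_over_def using f_over(1) f(2) a(3) by blast
  interpret N: subfield_set "D.adjoin a" by (rule D.adjoin_subfield[OF alg])
  have inv': "(inverse x, inverse y) \<in> G'" if xy: "(x, y) \<in> G'" for x y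
  proof (cases "x = 0")
    case True
    then show ?thesis using sgn'[OF xy] xy by (metis inverse_zero sgn_in_eq_0_iff)
  next
    case False
    have "x \<in> D.adjoin a" using E[OF xy] poly_rel_over(1) unfolding D.adjoin_def by blast
    then obtain u where u: "u \<in> poly_over (Domain G)" "inverse x = poly u a"
      using N.inv unfolding D.adjoin_def by blast
    obtain u2 where "poly_rel u u2" using poly_rel_partner[OF u(1)] by blast
    from I[OF this] have z: "(inverse x, poly u2 b) \<in> G'" using u(2) by simp
    have "(x * inverse x - 1, y * poly u2 b - 1) \<in> G'"
      using add'[OF mult'[OF xy z] neg'] incl G_one by fastforce
    then have "y * poly u2 b = 1" using sgn' False by fastforce
    then have "inverse y = poly u2 b" by (rule inverse_unique)
    with z show ?thesis by simp
  qed
  have "partial_order_iso R1 S1 R2 S2 G'"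
  proof unfold_locales
    show "(0, 0) \<in> G'" "(1, 1) \<in> G'" using incl G_zero G_one by blast+
  qed (fact sub' add' mult' neg' inv' sgn')+
  with incl ab show ?thesis by blast
qed

end

lemma maximal_exists:
  "\<exists>G'. G \<subseteq> G' \<and> partial_order_iso R1 S1 R2 S2 G' \<and>
     (\<forall>H. partial_order_iso R1 S1 R2 S2 H \<longrightarrow> G' \<subseteq> H \<longrightarrow> H = G')"
proof -
  define AA where "AA = {H. G \<subseteq> H \<and> partial_order_iso R1 S1 R2 S2 H}"
  have "\<exists>H\<in>AA. \<forall>V\<in>AA. H \<subseteq> V \<longrightarrow> V = H"
  proof (rule subset_Zorn_nonempty)
    show "AA \<noteq> {}" using partial_order_iso_axioms unfolding AA_def by auto
  next
    fix C assume "C \<noteq> {}" and C: "subset.chain AA C"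
    have sub: "V \<subseteq> W \<or> W \<subseteq> V" if "V \<in> C" "W \<in> C" for V W
      using that C unfolding subset_chain_def by blast
    have inA: "G \<subseteq> V" "partial_order_iso R1 S1 R2 S2 V" if "V \<in> C" for V
      using C that unfolding subset_chain_def AA_def by auto
    have two: "\<exists>V\<in>C. p \<in> V \<and> q \<in> V" if "p \<in> \<Union>C" "q \<in> \<Union>C" for p q
      using that sub by (meson Union_iff subset_iff)
    obtain V0 where V0: "V0 \<in> C" using \<open>C \<noteq> {}\<close> by blast
    have "partial_order_iso R1 S1 R2 S2 (\<Union>C)"
    proof unfold_locales
      show "(0, 0) \<in> \<Union>C" "(1, 1) \<in> \<Union>C" using V0 inA(1)[OF V0] G_zero G_one by blast+
    next
      fix x y x' y' assume "(x, y) \<in> \<Union>C" "(x', y') \<in> \<Union>C"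
      then obtain V where V: "V \<in> C" "(x, y) \<in> V" "(x', y') \<in> V" using two by blast
      interpret V: partial_order_iso R1 S1 R2 S2 V by (rule inA(2)[OF V(1)])
      show "(x + x', y + y') \<in> \<Union>C" "(x * x', y * y') \<in> \<Union>C"
        using V.G_add[OF V(2,3)] V.G_mult[OF V(2,3)] V(1) by blast+
    next
      fix x y assume "(x, y) \<in> \<Union>C"
      then obtain V where V: "V \<in> C" "(x, y) \<in> V" by blast
      interpret V: partial_order_iso R1 S1 R2 S2 V by (rule inA(2)[OF V(1)])
      show "(- x, - y) \<in> \<Union>C" "(inverse x, inverse y) \<in> \<Union>C" "x \<in> R1 \<and> y \<in> R2" "A.sg x = B.sg y"
        using V.G_neg[OF V(2)] V.G_inv[OF V(2)] V.G_sub[OF V(2)] V.G_sgn[OF V(2)] V(1) by blast+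
    qed
    then show "\<Union>C \<in> AA" using V0 inA(1)[OF V0] unfolding AA_def by blast
  qed
  then obtain H where "H \<in> AA" and max: "\<And>V. V \<in> AA \<Longrightarrow> H \<subseteq> V \<Longrightarrow> V = H" by blast
  then have H: "G \<subseteq> H" "partial_order_iso R1 S1 R2 S2 H" unfolding AA_def by simp_all
  have "V = H" if "partial_order_iso R1 S1 R2 S2 V" "H \<subseteq> V" for V
    by (rule max) (use that H(1) in \<open>auto simp: AA_def\<close>)
  with H show ?thesis by blast
qed

text \<open>The extension step in degree \<open>n\<close> requires that no root of smaller degree is missing on either side, so
  the induction on the degree runs over the domain and the range simultaneously; for the range the
  step is applied to the converse.\<close>

lemma maximal_is_algebraically_closed:
  assumes max: "\<And>H. partial_order_iso R1 S1 R2 S2 H \<Longrightarrow> G \<subseteq> H \<Longrightarrow> H = G"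
  shows "x \<in> R1 \<Longrightarrow> p \<in> poly_over (Domain G) \<Longrightarrow> p \<noteq> 0 \<Longrightarrow> poly p x = 0 \<Longrightarrow> x \<in> Domain G"
proof -
  interpret C: partial_order_iso R2 S2 R1 S1 "G\<inverse>" by (rule converse)
  define bad1 where "bad1 p \<longleftrightarrow> p \<in> poly_over (Domain G) \<and> p \<noteq> 0 \<and> (\<exists>x\<in>R1. poly p x = 0 \<and> x \<notin> Domain G)" for p
  define bad2 where "bad2 p \<longleftrightarrow> p \<in> poly_over (Range G) \<and> p \<noteq> 0 \<and> (\<exists>x\<in>R2. poly p x = 0 \<and> x \<notin> Range G)" for p
  have "\<not> bad1 p \<and> \<not> bad2 p" for p
  proof (induction "degree p" arbitrary: p rule: less_induct)
    case less
    have s1: "x \<in> Domain G" if "q \<in> poly_over (Domain G)" "q \<noteq> 0" "degree q < degree p" "x \<in> R1" "poly q x = 0" for q x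
      using less[OF that(3)] that unfolding bad1_def by blast
    have s2: "x \<in> Range G" if "q \<in> poly_over (Range G)" "q \<noteq> 0" "degree q < degree p" "x \<in> R2" "poly q x = 0" for q x
      using less[OF that(3)] that unfolding bad2_def by blast
    have "\<not> bad1 p"
    proof
      assume "bad1 p"
      then obtain x where p: "p \<in> poly_over (Domain G)" "p \<noteq> 0" "x \<in> R1" "poly p x = 0" "x \<notin> Domain G"
        unfolding bad1_def by blast
      obtain p2 where rel: "poly_rel p p2" using poly_rel_partner p(1) by blast
      have "\<exists>G'. partial_order_iso R1 S1 R2 S2 G' \<and> G \<subseteq> G' \<and> x \<in> Domain G'"
        by (rule extension_step[OF _ _ rel p(2) refl p(3,5,4)]) (fact s1 s2)+
      then show False using max p(5) by blast
    qed
    moreover have "\<not> bad2 p"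
    proof
      assume "bad2 p"
      then obtain x where p: "p \<in> poly_over (Domain (G\<inverse>))" "p \<noteq> 0" "x \<in> R2" "poly p x = 0" "x \<notin> Domain (G\<inverse>)"
        unfolding bad2_def by auto
      obtain p2 where rel: "C.poly_rel p p2" using C.poly_rel_partner p(1) by blast
      have "\<exists>G'. partial_order_iso R2 S2 R1 S1 G' \<and> G\<inverse> \<subseteq> G' \<and> x \<in> Domain G'"
        by (rule C.extension_step[OF _ _ rel p(2) refl p(3,5,4)])
          (simp_all only: Domain_converse Range_converse, (fact s1 s2)+)
      then obtain G' where G': "partial_order_iso R2 S2 R1 S1 G'" "G\<inverse> \<subseteq> G'" "x \<in> Domain G'" by blast
      interpret C': partial_order_iso R2 S2 R1 S1 G' by (rule G'(1))
      have "G \<subseteq> G'\<inverse>" using G'(2) by auto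
      then have "G'\<inverse> = G" by (rule max[OF C'.converse])
      with G'(3) p(5) show False by auto
    qed
    ultimately show ?case by blast
  qed
  then show "x \<in> R1 \<Longrightarrow> p \<in> poly_over (Domain G) \<Longrightarrow> p \<noteq> 0 \<Longrightarrow> poly p x = 0 \<Longrightarrow> x \<in> Domain G"
    unfolding bad1_def by blast
qed

end

text \<open>Put \<open>K\<close> into a real closed field \<open>R1\<close> and extend the identity of \<open>k\<close> to a maximal partial order isomorphism
  between \<open>R1\<close> and \<open>R\<close>.  Its domain contains every element of \<open>R1\<close> that is algebraic over \<open>k\<close>, hence all of \<open>K\<close>.\<close>

theorem order_embedding:
  fixes R :: "'a::{alg_closed_field, field_char_0} set"
  assumes "max_ordered_subfield R S" and "ordered_subfield K Q" and "subfield_set k"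
    and k: "k \<subseteq> K" "k \<subseteq> R" "\<And>x. x \<in> k \<Longrightarrow> x \<in> Q \<longleftrightarrow> x \<in> S"
    and alg: "\<And>x. x \<in> K \<Longrightarrow> \<exists>p\<in>poly_over k. p \<noteq> 0 \<and> poly p x = 0"
  shows "\<exists>\<sigma>. (\<forall>x\<in>k. \<sigma> x = x) \<and> (\<forall>x\<in>K. \<forall>y\<in>K. \<sigma> (x + y) = \<sigma> x + \<sigma> y \<and> \<sigma> (x * y) = \<sigma> x * \<sigma> y) \<and>
     (\<forall>x\<in>K. \<sigma> x \<in> R \<and> (x \<in> Q \<longleftrightarrow> \<sigma> x \<in> S))"
proof -
  interpret B: max_ordered_subfield R S by fact
  interpret K: ordered_subfield K Q by fact
  interpret k: subfield_set k by fact
  obtain R1 S1 where R1: "K \<subseteq> R1" "Q \<subseteq> S1" and "max_ordered_subfield R1 S1"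
    using max_ordered_subfield_exists[OF assms(2)] by blast
  interpret A: max_ordered_subfield R1 S1 by fact
  have QS: "x \<in> Q \<longleftrightarrow> x \<in> S1" if "x \<in> K" for x
    using that K.P_total[OF that] R1 A.P_antisym[of x] K.zero_P by blast
  interpret I: partial_order_iso R1 S1 R S "Id_on k"
    by unfold_locales
      (use k QS R1 in \<open>auto intro: k.closed simp: sgn_in_def\<close>)
  obtain G where G: "Id_on k \<subseteq> G" "partial_order_iso R1 S1 R S G"
    and max: "\<And>H. partial_order_iso R1 S1 R S H \<Longrightarrow> G \<subseteq> H \<Longrightarrow> H = G"
    using I.maximal_exists by blast
  interpret G: partial_order_iso R1 S1 R S G by (rule G(2))
  have kD: "poly_over k \<subseteq> poly_over (Domain G)" using G(1) by (auto simp: poly_over_def)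
  have KD: "x \<in> Domain G" if "x \<in> K" for x
    using G.maximal_is_algebraically_closed[OF max, of x] alg[OF that] kD R1 that by blast
  define \<sigma> where "\<sigma> x = (SOME y. (x, y) \<in> G)" for x
  have \<sigma>: "(x, \<sigma> x) \<in> G" if "x \<in> K" for x
    unfolding \<sigma>_def by (rule someI_ex) (use KD[OF that] in blast)
  have eq: "\<sigma> x = y" if "(x, y) \<in> G" "x \<in> K" for x y
    using G.G_fun[OF \<sigma>[OF that(2)] that(1)] .
  have "\<sigma> (x + y) = \<sigma> x + \<sigma> y \<and> \<sigma> (x * y) = \<sigma> x * \<sigma> y" if "x \<in> K" "y \<in> K" for x y
    using eq[OF G.G_add[OF \<sigma> \<sigma>] K.add] eq[OF G.G_mult[OF \<sigma> \<sigma>] K.mult] that by blast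
  moreover have "\<sigma> x = x" if "x \<in> k" for x
    using eq[of x x] that k(1) G(1) by blast
  moreover have "\<sigma> x \<in> R \<and> (x \<in> Q \<longleftrightarrow> \<sigma> x \<in> S)" if "x \<in> K" for x
    using G.G_sub[OF \<sigma>[OF that]] G.G_sgn[OF \<sigma>[OF that]] A.P_iff_sg[of x] B.P_iff_sg[of "\<sigma> x"] QS[OF that] by simp
  ultimately show ?thesis by blast
qed

section \<open>The trace form of a finite extension\<close>

lemma (in subring_set) poly_over_sum: "(\<And>i. i \<in> A \<Longrightarrow> f i \<in> poly_over M) \<Longrightarrow> sum f A \<in> poly_over M"
  by (induction A rule: infinite_finite_induct) (auto simp: poly_over_0 poly_over_add)

lemma (in subring_set) poly_over_prod: "(\<And>i. i \<in> A \<Longrightarrow> f i \<in> poly_over M) \<Longrightarrow> prod f A \<in> poly_over M"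
  by (induction A rule: infinite_finite_induct) (auto simp: poly_over_1 poly_over_mult)

lemma (in subfield_set) char_poly_over:
  assumes A: "A \<in> carrier_mat n n" and "\<And>i j. i < n \<Longrightarrow> j < n \<Longrightarrow> A $$ (i, j) \<in> M"
  shows "char_poly A \<in> poly_over M"
proof -
  have e: "char_poly_matrix A $$ (i, j) \<in> poly_over M" if "i < n" "j < n" for i j
  proof -
    have "char_poly_matrix A $$ (i, j) = (if i = j then [:0, 1:] else 0) + [:- (A $$ (i, j)):]"
      using A that by (auto simp: char_poly_matrix_def)
    also have "\<dots> \<in> poly_over M"
      using assms(2)[OF that] by (auto simp: poly_over_pCons poly_over_0 closed)
    finally show ?thesis .
  qed
  have s: "signof p \<in> poly_over M" for p
    by (auto simp: sign_def intro: poly_over_1 poly_over_uminus)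
  have "dim_row (char_poly_matrix A) = n" "dim_col (char_poly_matrix A) = n"
    using char_poly_matrix_closed[OF A] by auto
  then show ?thesis unfolding char_poly_def det_def
    using e by (auto intro!: poly_over_sum poly_over_mult poly_over_prod s dest: permutes_in_image)
qed

text \<open>The equations say that \<open>x\<close> is an eigenvalue of the matrix of multiplication by \<open>x\<close>, so it is a root of
  the characteristic polynomial.\<close>

lemma finite_extension_algebraic:
  fixes x :: "'a::{alg_closed_field, field_char_0}" and d :: nat
  assumes "subfield_set k" and lam: "\<And>i j. i < d \<Longrightarrow> j < d \<Longrightarrow> m i j \<in> k"
    and x: "\<And>i. i < d \<Longrightarrow> x * e i = (\<Sum>j<d. m i j * e j)" and "i < d" "e i \<noteq> 0"
  shows "\<exists>p\<in>poly_over k. p \<noteq> 0 \<and> poly p x = 0"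
proof -
  interpret k: subfield_set k by fact
  define A where "A = mat d d (\<lambda>(i, j). m i j)"
  define v where "v = vec d e"
  have A: "A \<in> carrier_mat d d" by (simp add: A_def)
  have "A *\<^sub>v v = x \<cdot>\<^sub>v v"
    by (intro eq_vecI) (auto simp: A_def v_def scalar_prod_def x atLeast0LessThan)
  moreover have "v \<noteq> 0\<^sub>v d"
    using assms(4,5) unfolding v_def by (metis index_vec index_zero_vec(1))
  ultimately have "eigenvalue A x"
    unfolding eigenvalue_def eigenvector_def by (intro exI[of _ v]) (auto simp: A_def v_def)
  then have "poly (char_poly A) x = 0" using eigenvalue_root_char_poly[OF A] by simp
  moreover have "char_poly A \<in> poly_over k"
    by (rule k.char_poly_over[OF A]) (simp add: A_def lam)
  moreover have "char_poly A \<noteq> 0"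
    using degree_monic_char_poly[OF A] by auto
  ultimately show ?thesis by blast
qed

locale field_embeddings =
  fixes K :: "'a::field set" and k :: "'a set" and d :: nat and e :: "nat \<Rightarrow> 'a" and coord :: "nat \<Rightarrow> 'a \<Rightarrow> 'a"
    and \<sigma> :: "nat \<Rightarrow> 'a \<Rightarrow> 'a"
  assumes K: "subfield_set K" and kK: "k \<subseteq> K"
    and e_in: "i < d \<Longrightarrow> e i \<in> K"
    and coord_in: "x \<in> K \<Longrightarrow> i < d \<Longrightarrow> coord i x \<in> k"
    and expand: "x \<in> K \<Longrightarrow> x = (\<Sum>i<d. coord i x * e i)"
    and \<sigma>_fix: "x \<in> k \<Longrightarrow> l < d \<Longrightarrow> \<sigma> l x = x"
    and \<sigma>_add: "x \<in> K \<Longrightarrow> y \<in> K \<Longrightarrow> l < d \<Longrightarrow> \<sigma> l (x + y) = \<sigma> l x + \<sigma> l y"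
    and \<sigma>_mult: "x \<in> K \<Longrightarrow> y \<in> K \<Longrightarrow> l < d \<Longrightarrow> \<sigma> l (x * y) = \<sigma> l x * \<sigma> l y"
    and \<sigma>_zero: "l < d \<Longrightarrow> \<sigma> l 0 = 0"
    and \<sigma>_one: "l < d \<Longrightarrow> \<sigma> l 1 = 1"
    and \<sigma>_distinct: "l < d \<Longrightarrow> j < d \<Longrightarrow> l \<noteq> j \<Longrightarrow> \<exists>y\<in>K. \<sigma> l y \<noteq> \<sigma> j y"
begin

sublocale K: subfield_set K by (rule K)

lemma \<sigma>_expand:
  assumes "x \<in> K" "l < d"
  shows "\<sigma> l x = (\<Sum>i<d. coord i x * \<sigma> l (e i))"
proof -
  have "\<sigma> l (\<Sum>i\<in>I. coord i x * e i) = (\<Sum>i\<in>I. coord i x * \<sigma> l (e i)) \<and> (\<Sum>i\<in>I. coord i x * e i) \<in> K"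
    if "finite I" "I \<subseteq> {..<d}" for I
    using that
  proof (induction I rule: finite_induct)
    case (insert i I)
    then have "coord i x \<in> k" "coord i x \<in> K" "e i \<in> K" using coord_in[OF assms(1)] kK e_in by auto
    then show ?case using insert assms by (auto simp: \<sigma>_add \<sigma>_mult \<sigma>_fix K.closed)
  qed (use assms \<sigma>_zero K.zero in auto)
  from this[of "{..<d}"] show ?thesis using expand[OF assms(1)] by simp
qed

text \<open>This is the linear independence of different embeddings, in the form of a vector \<open>r\<close> dual to \<open>\<sigma> l\<close>.  Suppose \<open>r\<close>
  separates \<open>\<sigma> l\<close> from the embeddings in \<open>J\<close>, and let \<open>y\<close> distinguish \<open>\<sigma> l\<close> from \<open>\<sigma> j0\<close>.  Multiplication by
  \<open>y - \<sigma> j0 y\<close>, written in coordinates, scales the value at \<open>\<sigma> j\<close> by \<open>\<sigma> j y - \<sigma> j0 y\<close>: it keeps the zeros, adds one at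
  \<open>j0\<close>, and does not kill the value at \<open>l\<close>.\<close>

lemma separating_vector:
  assumes "l < d" "finite J" "J \<subseteq> {..<d} - {l}"
  shows "\<exists>r. (\<Sum>i<d. r i * \<sigma> l (e i)) = 1 \<and> (\<forall>j\<in>J. (\<Sum>i<d. r i * \<sigma> j (e i)) = 0)"
  using assms(2,3)
proof (induction J rule: finite_induct)
  case empty
  show ?case using \<sigma>_expand[OF K.one assms(1)] \<sigma>_one[OF assms(1)] by (intro exI[of _ "\<lambda>i. coord i 1"]) simp
next
  case (insert j0 J)
  then obtain r where r: "(\<Sum>i<d. r i * \<sigma> l (e i)) = 1" "\<And>j. j \<in> J \<Longrightarrow> (\<Sum>i<d. r i * \<sigma> j (e i)) = 0" by auto
  have j0: "j0 < d" "j0 \<noteq> l" using insert.prems by auto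
  then obtain y where y: "y \<in> K" "\<sigma> l y \<noteq> \<sigma> j0 y" using \<sigma>_distinct[OF assms(1), of j0] by auto
  \<comment> \<open>the coordinates of the product of \<open>y - \<sigma> j0 y\<close> and \<open>\<Sum>h<d. r h * e h\<close>\<close>
  define s where "s i = (\<Sum>h<d. r h * coord i (y * e h)) - \<sigma> j0 y * r i" for i
  define c where "c = \<sigma> l y - \<sigma> j0 y"
  have s: "(\<Sum>i<d. s i * \<sigma> j (e i)) = (\<sigma> j y - \<sigma> j0 y) * (\<Sum>i<d. r i * \<sigma> j (e i))" if j: "j < d" for j
  proof -
    have "(\<Sum>i<d. (\<Sum>h<d. r h * coord i (y * e h)) * \<sigma> j (e i)) = (\<Sum>h<d. r h * (\<Sum>i<d. coord i (y * e h) * \<sigma> j (e i)))"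
      unfolding sum_distrib_left sum_distrib_right by (subst sum.swap) (simp add: mult_ac)
    also have "\<dots> = (\<Sum>h<d. r h * (\<sigma> j y * \<sigma> j (e h)))"
      using j y(1) by (intro sum.cong refl) (simp add: \<sigma>_expand[symmetric] \<sigma>_mult[symmetric] K.mult e_in)
    finally show ?thesis
      unfolding s_def left_diff_distrib sum_subtractf by (simp add: sum_distrib_left mult_ac)
  qed
  have "(\<Sum>i<d. s i / c * \<sigma> j (e i)) = (\<sigma> j y - \<sigma> j0 y) / c * (\<Sum>i<d. r i * \<sigma> j (e i))" if "j < d" for j
    using s[OF that] by (simp add: sum_divide_distrib[symmetric] field_simps)
  moreover have "c \<noteq> 0" using y by (simp add: c_def)
  ultimately show ?case using r assms(1) j0 insert.prems
    by (intro exI[of _ "\<lambda>i. s i / c"]) (auto simp: c_def[symmetric])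
qed

text \<open>The vectors dual to the embeddings form a left inverse of the matrix \<open>S\<close> with the entries \<open>\<sigma> l (e i)\<close>.  As \<open>S\<close> is
  square, it is a right inverse as well, and thus \<open>S\<close> conjugates the matrix of multiplication by \<open>x\<close> to the
  diagonal matrix of the \<open>\<sigma> l x\<close>.\<close>

lemma trace_eq_sum_embeddings:
  assumes x: "x \<in> K"
  shows "(\<Sum>i<d. coord i (x * e i)) = (\<Sum>l<d. \<sigma> l x)"
proof -
  have "\<forall>l. \<exists>r. l < d \<longrightarrow> (\<forall>j<d. (\<Sum>i<d. r i * \<sigma> j (e i)) = (if l = j then 1 else 0))"
  proof
    fix l
    show "\<exists>r. l < d \<longrightarrow> (\<forall>j<d. (\<Sum>i<d. r i * \<sigma> j (e i)) = (if l = j then 1 else 0))"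
    proof (cases "l < d")
      case True
      then obtain r where "(\<Sum>i<d. r i * \<sigma> l (e i)) = 1" "\<forall>j\<in>{..<d} - {l}. (\<Sum>i<d. r i * \<sigma> j (e i)) = 0"
        using separating_vector[of l "{..<d} - {l}"] by auto
      then show ?thesis by (intro exI[of _ r]) auto
    qed auto
  qed
  then obtain r where r: "\<And>l j. l < d \<Longrightarrow> j < d \<Longrightarrow> (\<Sum>i<d. r l i * \<sigma> j (e i)) = (if l = j then 1 else 0)"
    by metis
  define S where "S = mat d d (\<lambda>(i, l). \<sigma> l (e i))"
  define T where "T = mat d d (\<lambda>(l, i). r l i)"
  have ST: "S \<in> carrier_mat d d" "T \<in> carrier_mat d d" by (simp_all add: S_def T_def)
  have "T * S = 1\<^sub>m d"
    by (intro eq_matI) (auto simp: S_def T_def scalar_prod_def r atLeast0LessThan)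
  then have "S * T = 1\<^sub>m d" by (rule mat_mult_left_right_inverse[OF ST(2,1)])
  then have inv: "(\<Sum>l<d. \<sigma> l (e j) * r l i) = (if j = i then 1 else 0)" if "i < d" "j < d" for i j
  proof -
    have "(S * T) $$ (j, i) = (\<Sum>l<d. \<sigma> l (e j) * r l i)"
      using that by (simp add: S_def T_def scalar_prod_def atLeast0LessThan)
    with \<open>S * T = 1\<^sub>m d\<close> that show ?thesis by simp
  qed
  have "(\<Sum>i<d. coord i (x * e i)) = (\<Sum>i<d. \<Sum>j<d. coord j (x * e i) * (if j = i then 1 else 0))"
    by (intro sum.cong refl) (simp add: if_distrib cong: if_cong)
  also have "\<dots> = (\<Sum>i<d. \<Sum>j<d. coord j (x * e i) * (\<Sum>l<d. \<sigma> l (e j) * r l i))"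
    using inv by (intro sum.cong refl) simp
  also have "\<dots> = (\<Sum>i<d. \<Sum>l<d. r l i * (\<Sum>j<d. coord j (x * e i) * \<sigma> l (e j)))"
    unfolding sum_distrib_left by (rule sum.cong[OF refl], subst sum.swap) (simp add: mult_ac)
  also have "\<dots> = (\<Sum>i<d. \<Sum>l<d. \<sigma> l x * (r l i * \<sigma> l (e i)))"
  proof (intro sum.cong refl)
    fix i l assume "i \<in> {..<d}" "l \<in> {..<d}"
    then have "(\<Sum>j<d. coord j (x * e i) * \<sigma> l (e j)) = \<sigma> l x * \<sigma> l (e i)"
      using \<sigma>_expand[OF K.mult[OF x e_in], of i l] \<sigma>_mult[OF x e_in, of i l] by simp
    then show "r l i * (\<Sum>j<d. coord j (x * e i) * \<sigma> l (e j)) = \<sigma> l x * (r l i * \<sigma> l (e i))"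
      by simp
  qed
  also have "\<dots> = (\<Sum>l<d. \<sigma> l x * (\<Sum>i<d. r l i * \<sigma> l (e i)))"
    unfolding sum_distrib_left by (rule sum.swap)
  also have "\<dots> = (\<Sum>l<d. \<sigma> l x)" using r by (intro sum.cong refl) simp
  finally show ?thesis .
qed

end

text \<open>Choose a real closed \<open>R\<close> above \<open>(k, P)\<close>.  The \<open>d\<close> orderings \<open>Q j\<close> give \<open>d\<close> embeddings of \<open>K\<close> into \<open>R\<close> over \<open>k\<close>.  They are
  different, since \<open>Q j\<close> is recovered from the embedding as the preimage of the nonnegative elements.
  So the trace of \<open>x\<^sup>2\<close> is a sum of nonzero squares in \<open>R\<close>.\<close>

theorem trace_of_square_positive:
  fixes K :: "'a::{alg_closed_field, field_char_0} set" and d :: nat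
  assumes kP: "ordered_subfield k P" and K: "subfield_set K" and kK: "k \<subseteq> K"
    and Q: "\<And>j. j < d \<Longrightarrow> ordered_subfield K (Q j)" "\<And>j. j < d \<Longrightarrow> Q j \<inter> k = P" "inj_on Q {..<d}"
    and e_in: "\<And>i. i < d \<Longrightarrow> e i \<in> K"
    and coord_in: "\<And>x i. x \<in> K \<Longrightarrow> i < d \<Longrightarrow> coord i x \<in> k"
    and expand: "\<And>x. x \<in> K \<Longrightarrow> x = (\<Sum>i<d. coord i x * e i)"
    and x: "x \<in> K" "x \<noteq> 0"
  shows "sgn_in P (\<Sum>i<d. coord i (x * x * e i)) = 1"
proof -
  interpret k: ordered_subfield k P by fact
  interpret K: subfield_set K by fact
  obtain R S where R: "k \<subseteq> R" "P \<subseteq> S" and "max_ordered_subfield R S"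
    using max_ordered_subfield_exists[OF kP] by blast
  interpret R: max_ordered_subfield R S by fact
  have PS: "y \<in> P \<longleftrightarrow> y \<in> S" if "y \<in> k" for y
    using that k.P_total[OF that] R R.P_antisym[of y] k.zero_P by blast
  have "(\<Sum>i<d. coord i 1 * e i) \<noteq> 0" using expand[OF K.one] by simp
  then obtain i0 where i0: "i0 < d" "e i0 \<noteq> 0"
    using sum.neutral[of "{..<d}" "\<lambda>i. coord i 1 * e i"] by fastforce
  have alg: "\<exists>p\<in>poly_over k. p \<noteq> 0 \<and> poly p y = 0" if "y \<in> K" for y
    by (rule finite_extension_algebraic[of k d "\<lambda>i j. coord j (y * e i)" y e i0])
      (use that k.subfield_set_axioms coord_in expand e_in K.mult i0 in auto)
  define emb where "emb j s \<longleftrightarrow> (\<forall>y\<in>k. s y = y) \<and>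
      (\<forall>y\<in>K. \<forall>z\<in>K. s (y + z) = s y + s z \<and> s (y * z) = s y * s z) \<and>
      (\<forall>y\<in>K. s y \<in> R \<and> (y \<in> Q j \<longleftrightarrow> s y \<in> S))" for j s
  have "\<exists>s. emb j s" if "j < d" for j
    unfolding emb_def
    by (rule order_embedding[OF \<open>max_ordered_subfield R S\<close> Q(1)[OF that] k.subfield_set_axioms kK R(1) _ alg])
      (use Q(2)[OF that] PS in auto)
  then obtain \<sigma> where emb: "\<And>j. j < d \<Longrightarrow> emb j (\<sigma> j)" by metis
  have \<sigma>: "\<And>j y. j < d \<Longrightarrow> y \<in> k \<Longrightarrow> \<sigma> j y = y"
      "\<And>j y z. j < d \<Longrightarrow> y \<in> K \<Longrightarrow> z \<in> K \<Longrightarrow> \<sigma> j (y + z) = \<sigma> j y + \<sigma> j z"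
      "\<And>j y z. j < d \<Longrightarrow> y \<in> K \<Longrightarrow> z \<in> K \<Longrightarrow> \<sigma> j (y * z) = \<sigma> j y * \<sigma> j z"
      "\<And>j y. j < d \<Longrightarrow> y \<in> K \<Longrightarrow> \<sigma> j y \<in> R"
      "\<And>j y. j < d \<Longrightarrow> y \<in> K \<Longrightarrow> y \<in> Q j \<longleftrightarrow> \<sigma> j y \<in> S"
    using emb unfolding emb_def by simp_all
  interpret E: field_embeddings K k d e coord \<sigma>
  proof (rule field_embeddings.intro)
    show "\<exists>y\<in>K. \<sigma> l y \<noteq> \<sigma> j y" if lj: "l < d" "j < d" "l \<noteq> j" for l j
    proof -
      have "Q l \<noteq> Q j" using lj Q(3) by (auto simp: inj_on_def)
      moreover have "Q l \<subseteq> K" "Q j \<subseteq> K" using Q(1) lj ordered_subfield.P_sub by blast+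
      ultimately obtain y where "y \<in> K" "(y \<in> Q l) \<noteq> (y \<in> Q j)" by blast
      then show ?thesis using \<sigma>(5) lj by (intro bexI[of _ y]) auto
    qed
    show "\<sigma> l 0 = 0" "\<sigma> l 1 = 1" if "l < d" for l
      using \<sigma>(1)[OF that] k.zero k.one by simp_all
  qed (fact K kK e_in coord_in expand | simp add: \<sigma>(1-3))+
  have xx: "x * x \<in> K" by (intro K.mult x)
  have nz: "\<sigma> l x \<noteq> 0" if "l < d" for l
  proof
    assume "\<sigma> l x = 0"
    then have "\<sigma> l (x * inverse x) = 0" using \<sigma>(3)[OF that x(1) K.inv[OF x(1)]] by simp
    then show False using x(2) E.\<sigma>_one[OF that] by simp
  qed
  have pos: "R.sg (\<sigma> l (x * x)) = 1" if "l < d" for l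
    using \<sigma>(3)[OF that x(1) x(1)] R.sg_mult[OF \<sigma>(4) \<sigma>(4), OF that x(1) that x(1)] nz[OF that]
      sgn_in_cases[of S "\<sigma> l x"] by auto
  have "(\<Sum>l<d. \<sigma> l (x * x)) = \<sigma> i0 (x * x) + (\<Sum>l\<in>{..<d} - {i0}. \<sigma> l (x * x))"
    using i0 by (intro sum.remove) auto
  moreover have "(\<Sum>l\<in>{..<d} - {i0}. \<sigma> l (x * x)) \<in> S"
    using pos R.sg_one_P by (intro R.sg_sum_nonneg) auto
  ultimately have "R.sg (\<Sum>l<d. \<sigma> l (x * x)) = 1" using R.sg_add_pos[OF pos[OF i0(1)]] by simp
  then have tr: "R.sg (\<Sum>i<d. coord i (x * x * e i)) = 1"
    using E.trace_eq_sum_embeddings[OF xx] by simp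
  have "(\<Sum>i<d. coord i (x * x * e i)) \<in> k" by (intro k.sum coord_in K.mult x e_in) auto
  with tr PS show ?thesis by (auto simp: sgn_in_def split: if_splits)
qed

section \<open>Countable fields of characteristic zero embed into the complex numbers\<close>

text \<open>A ring isomorphism between a subring of the complex numbers, the domain of \<open>G\<close>, and a subring of \<open>L\<close>.  It
  is directed from the complex numbers to \<open>L\<close> so that polynomials over its domain are polynomials over a
  subset of a type, and the theory above applies to them.\<close>

locale partial_embedding = field R for R (structure) +
  fixes L :: "'a set" and G :: "(complex \<times> 'a) set"
  assumes L_sub: "L \<subseteq> carrier R"
    and L_zero: "\<zero> \<in> L" and L_one: "\<one> \<in> L"
    and L_add: "x \<in> L \<Longrightarrow> y \<in> L \<Longrightarrow> x \<oplus> y \<in> L"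
    and L_mult: "x \<in> L \<Longrightarrow> y \<in> L \<Longrightarrow> x \<otimes> y \<in> L"
    and L_neg: "x \<in> L \<Longrightarrow> \<ominus> x \<in> L"
    and G_sub: "(z, x) \<in> G \<Longrightarrow> x \<in> L"
    and G_zero: "(0, \<zero>) \<in> G" and G_one: "(1, \<one>) \<in> G"
    and G_add: "(z, x) \<in> G \<Longrightarrow> (w, y) \<in> G \<Longrightarrow> (z + w, x \<oplus> y) \<in> G"
    and G_mult: "(z, x) \<in> G \<Longrightarrow> (w, y) \<in> G \<Longrightarrow> (z * w, x \<otimes> y) \<in> G"
    and G_neg: "(z, x) \<in> G \<Longrightarrow> (- z, \<ominus> x) \<in> G"
    and G_zero_iff: "(z, x) \<in> G \<Longrightarrow> z = 0 \<longleftrightarrow> x = \<zero>"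
begin

lemma L_car: "x \<in> L \<Longrightarrow> x \<in> carrier R"
  using L_sub by blast

lemma G_car: "(z, x) \<in> G \<Longrightarrow> x \<in> carrier R"
  using G_sub L_car by blast

lemma G_fun:
  assumes "(z, x) \<in> G" "(z, y) \<in> G"
  shows "x = y"
proof -
  have "(z + - z, x \<oplus> \<ominus> y) \<in> G" by (intro G_add G_neg assms)
  then have "x \<ominus> y = \<zero>" using G_zero_iff[of 0] by (simp add: a_minus_def)
  then show ?thesis using r_right_minus_eq G_car assms by blast
qed

lemma G_inj:
  assumes "(z, x) \<in> G" "(w, x) \<in> G"
  shows "z = w"
proof -
  have "(z + - w, x \<oplus> \<ominus> x) \<in> G" by (intro G_add G_neg assms)
  then show ?thesis using G_zero_iff[of "z - w"] G_car[OF assms(1)] by (simp add: r_neg)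
qed

sublocale C: subring_set "Domain G"
  by unfold_locales (auto intro: G_zero G_one G_add G_mult G_neg)

definition \<chi> :: "complex \<Rightarrow> 'a" where
  "\<chi> z = (THE x. (z, x) \<in> G)"

lemma \<chi>_eq: "(z, x) \<in> G \<Longrightarrow> \<chi> z = x"
  unfolding \<chi>_def using G_fun by blast

lemma \<chi>_in: "z \<in> Domain G \<Longrightarrow> (z, \<chi> z) \<in> G"
  using \<chi>_eq by blast

lemma \<chi>_zero [simp]: "\<chi> 0 = \<zero>"
  by (rule \<chi>_eq[OF G_zero])

lemma \<chi>_L: "z \<in> Domain G \<Longrightarrow> \<chi> z \<in> L"
  using \<chi>_in G_sub by blast

lemma \<chi>_car: "z \<in> Domain G \<Longrightarrow> \<chi> z \<in> carrier R"
  using \<chi>_in G_car by blast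

lemma \<chi>_add: "z \<in> Domain G \<Longrightarrow> w \<in> Domain G \<Longrightarrow> \<chi> (z + w) = \<chi> z \<oplus> \<chi> w"
  by (intro \<chi>_eq G_add \<chi>_in)

lemma \<chi>_mult: "z \<in> Domain G \<Longrightarrow> w \<in> Domain G \<Longrightarrow> \<chi> (z * w) = \<chi> z \<otimes> \<chi> w"
  by (intro \<chi>_eq G_mult \<chi>_in)

lemma \<chi>_eq_zero_iff: "z \<in> Domain G \<Longrightarrow> \<chi> z = \<zero> \<longleftrightarrow> z = 0"
  using G_zero_iff \<chi>_in by blast

text \<open>The value at \<open>a\<close> of the polynomial with the coefficients \<open>\<chi> c\<close>.\<close>

definition ev :: "'a \<Rightarrow> complex poly \<Rightarrow> 'a" where
  "ev a p = fold_coeffs (\<lambda>c x. \<chi> c \<oplus> (a \<otimes> x)) p \<zero>"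

context
  fixes a assumes a: "a \<in> L"
begin

lemma ev_0 [simp]: "ev a 0 = \<zero>"
  by (simp add: ev_def)

lemma ev_pCons: "ev a (pCons c p) = \<chi> c \<oplus> (a \<otimes> ev a p)"
  using L_car[OF a] by (cases "pCons c p = 0") (auto simp: ev_def)

lemma ev_L: "p \<in> poly_over (Domain G) \<Longrightarrow> ev a p \<in> L"
  by (induction p) (auto simp: C.poly_over_pCons ev_pCons L_zero intro!: L_add L_mult \<chi>_L a)

lemma ev_car: "p \<in> poly_over (Domain G) \<Longrightarrow> ev a p \<in> carrier R"
  using ev_L L_car by blast

lemma ev_add:
  "p \<in> poly_over (Domain G) \<Longrightarrow> q \<in> poly_over (Domain G) \<Longrightarrow> ev a (p + q) = ev a p \<oplus> ev a q"
proof (induction p q rule: poly_induct2)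
  case (pCons c p d q)
  then have m: "c \<in> Domain G" "d \<in> Domain G" "p \<in> poly_over (Domain G)" "q \<in> poly_over (Domain G)"
    by (simp_all add: C.poly_over_pCons)
  note m' = \<chi>_car[OF m(1)] \<chi>_car[OF m(2)] ev_car[OF m(3)] ev_car[OF m(4)] L_car[OF a]
  show ?case using pCons.IH[OF m(3,4)] m' by (simp add: ev_pCons \<chi>_add[OF m(1,2)] r_distr a_ac)
qed simp

lemma ev_smult:
  "c \<in> Domain G \<Longrightarrow> p \<in> poly_over (Domain G) \<Longrightarrow> ev a (smult c p) = \<chi> c \<otimes> ev a p"
proof (induction p)
  case 0
  then show ?case using \<chi>_car by simp
next
  case (pCons d p)
  then have m: "d \<in> Domain G" "p \<in> poly_over (Domain G)"
    by (simp_all add: C.poly_over_pCons)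
  note m' = \<chi>_car[OF pCons.prems(1)] \<chi>_car[OF m(1)] ev_car[OF m(2)] L_car[OF a]
  show ?case using pCons.IH[OF pCons.prems(1) m(2)] m'
    by (simp add: ev_pCons \<chi>_mult[OF pCons.prems(1) m(1)] r_distr m_ac)
qed

lemma ev_mult:
  "p \<in> poly_over (Domain G) \<Longrightarrow> q \<in> poly_over (Domain G) \<Longrightarrow> ev a (p * q) = ev a p \<otimes> ev a q"
proof (induction p)
  case 0
  then show ?case using ev_car by simp
next
  case (pCons c p)
  then have m: "c \<in> Domain G" "p \<in> poly_over (Domain G)" "p * q \<in> poly_over (Domain G)"
    by (simp_all add: C.poly_over_pCons C.poly_over_mult)
  have "smult c q \<in> poly_over (Domain G)" "pCons 0 (p * q) \<in> poly_over (Domain G)"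
    using m pCons.prems C.poly_over_smult by (simp_all add: C.poly_over_pCons C.zero)
  moreover have "ev a (pCons 0 (p * q)) = a \<otimes> ev a (p * q)"
    using ev_car[OF m(3)] L_car[OF a] by (simp add: ev_pCons)
  moreover note m' = \<chi>_car[OF m(1)] ev_car[OF m(2)] ev_car[OF pCons.prems(2)] L_car[OF a]
  ultimately show ?case
    using pCons.IH[OF m(2) pCons.prems(2)] ev_smult[OF m(1) pCons.prems(2)] m'
    by (simp add: ev_add ev_pCons l_distr m_assoc)
qed

lemma ev_const: "c \<in> Domain G \<Longrightarrow> ev a [:c:] = \<chi> c"
  using \<chi>_car L_car[OF a] by (simp add: ev_pCons)

text \<open>If \<open>a\<close> is algebraic over the range of \<open>G\<close>, let \<open>m\<close> be a relation of least degree and \<open>z\<close> a complex root of it;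
  no relation of smaller degree holds for \<open>z\<close>, since a least one would divide \<open>m\<close> up to a constant and one of the
  two factors would be a relation for \<open>a\<close>.  If \<open>a\<close> is transcendental, any \<open>z\<close> will do that is not a root of one of the countably many
  polynomials over the domain.\<close>

lemma matching_complex_number:
  assumes "countable L"
  shows "\<exists>z. \<forall>p\<in>poly_over (Domain G). ev a p = \<zero> \<longleftrightarrow> poly p z = 0"
proof (cases "\<exists>p\<in>poly_over (Domain G). p \<noteq> 0 \<and> ev a p = \<zero>")
  case True
  define alg where "alg p \<longleftrightarrow> p \<in> poly_over (Domain G) \<and> p \<noteq> 0 \<and> ev a p = \<zero>" for p
  obtain m where m: "alg m" and min: "\<And>p. alg p \<Longrightarrow> degree m \<le> degree p"
    using True exists_least_iff[of "\<lambda>n. \<exists>p. alg p \<and> degree p = n"] unfolding alg_def by (metis not_less)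
  have m': "m \<in> poly_over (Domain G)" "m \<noteq> 0" "ev a m = \<zero>" using m by (auto simp: alg_def)
  have "degree m > 0"
  proof (rule ccontr)
    assume "\<not> ?thesis"
    then obtain c where c: "m = [:c:]" using degree_eq_zeroE by blast
    then have "c \<in> Domain G" using m' by (simp add: C.poly_over_pCons)
    then show False using m' c ev_const \<chi>_eq_zero_iff by auto
  qed
  then obtain z where z: "poly m z = 0" using alg_closed_imp_poly_has_root by blast
  have small: "poly r z \<noteq> 0" if r: "r \<in> poly_over (Domain G)" "r \<noteq> 0" "degree r < degree m" for r
  proof
    assume "poly r z = 0"
    define van where "van p \<longleftrightarrow> p \<in> poly_over (Domain G) \<and> p \<noteq> 0 \<and> poly p z = 0" for p
    have "van r" using r \<open>poly r z = 0\<close> by (simp add: van_def)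
    then obtain n where n: "van n" and nmin: "\<And>p. van p \<Longrightarrow> degree n \<le> degree p"
      using exists_least_iff[of "\<lambda>k. \<exists>p. van p \<and> degree p = k"] by (metis not_less)
    have n': "n \<in> poly_over (Domain G)" "n \<noteq> 0" "poly n z = 0" using n by (auto simp: van_def)
    have dn: "degree n < degree m" using nmin[OF \<open>van r\<close>] r(3) by simp
    have dn0: "degree n > 0"
      using n' by (cases n rule: pCons_cases) (auto split: if_splits)
    obtain c q s where c: "c \<in> Domain G" "c \<noteq> 0" and qs: "q \<in> poly_over (Domain G)" "s \<in> poly_over (Domain G)"
      and e: "smult c m = n * q + s" and s: "s = 0 \<or> degree s < degree n"
      using C.poly_over_pseudo_division[OF n'(1,2) m'(1)] by blast
    have "poly s z = 0" using arg_cong[OF e, of "\<lambda>p. poly p z"] z n'(3) by simp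
    then have "s \<noteq> 0 \<Longrightarrow> van s" using qs by (simp add: van_def)
    then have "s = 0" using nmin[of s] s by (cases "s = 0") simp_all
    then have e': "smult c m = n * q" using e by simp
    have q0: "q \<noteq> 0" using e' c m' by auto
    have "degree m = degree n + degree q" using e' c degree_mult_eq[OF n'(2) q0] by (metis degree_smult_eq)
    then have dq: "degree q < degree m" using dn0 by simp
    have "ev a n \<otimes> ev a q = \<zero>"
      using ev_mult[OF n'(1) qs(1)] ev_smult[OF c(1) m'(1)] e' m'(3) \<chi>_car[OF c(1)] by simp
    then have "ev a n = \<zero> \<or> ev a q = \<zero>" using integral ev_car n'(1) qs(1) by blast
    then have "alg n \<or> alg q" using n' qs q0 by (auto simp: alg_def)
    then show False using min dn dq by fastforce
  qed
  have "ev a p = \<zero> \<longleftrightarrow> poly p z = 0" if p: "p \<in> poly_over (Domain G)" for p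
  proof -
    obtain c q r where c: "c \<in> Domain G" "c \<noteq> 0" and qr: "q \<in> poly_over (Domain G)" "r \<in> poly_over (Domain G)"
      and e: "smult c p = m * q + r" and r: "r = 0 \<or> degree r < degree m"
      using C.poly_over_pseudo_division[OF m'(1,2) p] by blast
    have pz: "poly p z = 0 \<longleftrightarrow> poly r z = 0" 
    proof -
      have "c * poly p z = poly r z" using arg_cong[OF e, of "\<lambda>p. poly p z"] z by simp
      with c(2) show ?thesis by (metis mult_eq_0_iff)
    qed
    have "\<chi> c \<otimes> ev a p = ev a r"
      using arg_cong[OF e, of "ev a"] ev_smult[OF c(1) p] ev_add[OF C.poly_over_mult[OF m'(1) qr(1)] qr(2)]
        ev_mult[OF m'(1) qr(1)] m'(3) ev_car[OF qr(1)] ev_car[OF qr(2)] by simp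
    then have ep: "ev a p = \<zero> \<longleftrightarrow> ev a r = \<zero>"
      using integral_iff[OF \<chi>_car[OF c(1)] ev_car[OF p]] \<chi>_eq_zero_iff[OF c(1)] c(2) by simp
    show ?thesis
    proof (cases "r = 0")
      case False
      then have "degree r < degree m" using r by simp
      moreover from this have "\<not> alg r" using min by fastforce
      ultimately show ?thesis using small[OF qr(2) False] False qr(2) pz ep by (auto simp: alg_def)
    qed (use pz ep in simp)
  qed
  then show ?thesis by blast
next
  case False
  have "countable (\<chi> ` Domain G)" by (rule countable_subset[OF _ assms]) (use \<chi>_L in auto)
  moreover have "inj_on \<chi> (Domain G)"
    using \<chi>_in G_inj by (metis inj_onI)
  ultimately have "countable (Domain G)" by (rule countable_image_inj_on)
  then have "countable (Poly ` lists (Domain G))" by simp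
  moreover have "poly_over (Domain G) \<subseteq> Poly ` lists (Domain G)"
  proof
    fix p assume p: "p \<in> poly_over (Domain G)"
    have "set (coeffs p) \<subseteq> Domain G" using p by (auto simp: coeffs_def poly_over_def)
    then show "p \<in> Poly ` lists (Domain G)" by (intro image_eqI[of _ _ "coeffs p"]) auto
  qed
  ultimately have "countable (poly_over (Domain G))" by (rule countable_subset[rotated])
  then have "countable (\<Union>p\<in>poly_over (Domain G) - {0}. {z. poly p z = 0})"
    by (intro countable_UN) (auto intro: countable_finite poly_roots_finite)
  then obtain z where z: "z \<notin> (\<Union>p\<in>poly_over (Domain G) - {0}. {z. poly p z = 0})"
    using uncountable_UNIV_complex by (metis UNIV_eq_I)
  have "ev a p = \<zero> \<longleftrightarrow> poly p z = 0" if "p \<in> poly_over (Domain G)" for p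
    using z False that by (cases "p = 0") auto
  then show ?thesis by blast
qed

lemma embedding_step:
  assumes "countable L"
  shows "\<exists>G'. partial_embedding R L G' \<and> G \<subseteq> G' \<and> a \<in> Range G'"
proof -
  obtain z where z: "\<And>p. p \<in> poly_over (Domain G) \<Longrightarrow> ev a p = \<zero> \<longleftrightarrow> poly p z = 0"
    using matching_complex_number[OF assms] by blast
  define G' where "G' = {(poly p z, ev a p) |p. p \<in> poly_over (Domain G)}"
  have I: "(poly p z, ev a p) \<in> G'" if "p \<in> poly_over (Domain G)" for p
    using that unfolding G'_def by blast
  have E: "\<exists>p\<in>poly_over (Domain G). w = poly p z \<and> x = ev a p" if "(w, x) \<in> G'" for w x
    using that unfolding G'_def by blast
  have incl: "G \<subseteq> G'"
  proof (rule subrelI)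
    fix w x assume wx: "(w, x) \<in> G"
    then have w: "w \<in> Domain G" by blast
    then have "[:w:] \<in> poly_over (Domain G)" by (simp add: C.poly_over_pCons C.poly_over_0)
    from I[OF this] show "(w, x) \<in> G'" using ev_const[OF w] \<chi>_eq[OF wx] by simp
  qed
  have "[:0, 1:] \<in> poly_over (Domain G)" by (simp add: C.poly_over_pCons C.poly_over_0 C.zero C.one)
  moreover have "ev a [:0, 1:] = a"
    using L_car[OF a] ev_const[OF C.one] \<chi>_eq[OF G_one] by (simp add: ev_pCons[of 0])
  ultimately have az: "(z, a) \<in> G'" using I by fastforce
  have "partial_embedding R L G'"
  proof unfold_locales
    fix w x v y assume "(w, x) \<in> G'" "(v, y) \<in> G'"
    then obtain p q where p: "p \<in> poly_over (Domain G)" "w = poly p z" "x = ev a p"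
      and q: "q \<in> poly_over (Domain G)" "v = poly q z" "y = ev a q" using E by meson
    show "(w + v, x \<oplus> y) \<in> G'" "(w * v, x \<otimes> y) \<in> G'"
      using I[OF C.poly_over_add[OF p(1) q(1)]] I[OF C.poly_over_mult[OF p(1) q(1)]] p q
      by (simp_all add: ev_add ev_mult)
  next
    fix w x assume "(w, x) \<in> G'"
    then obtain p where p: "p \<in> poly_over (Domain G)" "w = poly p z" "x = ev a p" using E by meson
    have "ev a (- p) \<oplus> ev a p = \<zero>"
      using ev_add[OF C.poly_over_uminus[OF p(1)] p(1)] by simp
    then have "\<ominus> ev a p = ev a (- p)"
      using ev_car[OF p(1)] ev_car[OF C.poly_over_uminus[OF p(1)]] by (rule minus_equality)
    then show "(- w, \<ominus> x) \<in> G'" using I[OF C.poly_over_uminus[OF p(1)]] p by simp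
    show "x \<in> L" using ev_L[OF p(1)] p(3) by simp
    show "w = 0 \<longleftrightarrow> x = \<zero>" using z[OF p(1)] p(2,3) by simp
  next
    show "(0, \<zero>) \<in> G'" "(1, \<one>) \<in> G'" using incl G_zero G_one by blast+
  qed (fact L_sub L_zero L_one L_add L_mult L_neg)+
  with incl az show ?thesis by blast
qed

end

lemma maximal_embedding:
  "\<exists>G'. partial_embedding R L G' \<and> (\<forall>H. partial_embedding R L H \<longrightarrow> G' \<subseteq> H \<longrightarrow> H = G')"
proof -
  define AA where "AA = {H. partial_embedding R L H}"
  have "\<exists>H\<in>AA. \<forall>V\<in>AA. H \<subseteq> V \<longrightarrow> V = H"
  proof (rule subset_Zorn_nonempty)
    show "AA \<noteq> {}" using partial_embedding_axioms unfolding AA_def by auto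
  next
    fix C assume "C \<noteq> {}" and C: "subset.chain AA C"
    have sub: "V \<subseteq> W \<or> W \<subseteq> V" if "V \<in> C" "W \<in> C" for V W
      using that C unfolding subset_chain_def by blast
    have inA: "partial_embedding R L V" if "V \<in> C" for V
      using C that unfolding subset_chain_def AA_def by auto
    have two: "\<exists>V\<in>C. p \<in> V \<and> q \<in> V" if "p \<in> \<Union>C" "q \<in> \<Union>C" for p q
      using that sub by (meson Union_iff subset_iff)
    obtain V0 where V0: "V0 \<in> C" using \<open>C \<noteq> {}\<close> by blast
    interpret V0: partial_embedding R L V0 by (rule inA[OF V0])
    have "partial_embedding R L (\<Union>C)"
    proof unfold_locales
      show "(0, \<zero>) \<in> \<Union>C" "(1, \<one>) \<in> \<Union>C" using V0 V0.G_zero V0.G_one by blast+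
    next
      fix x y x' y' assume "(x, y) \<in> \<Union>C" "(x', y') \<in> \<Union>C"
      then obtain V where V: "V \<in> C" "(x, y) \<in> V" "(x', y') \<in> V" using two by blast
      interpret V: partial_embedding R L V by (rule inA[OF V(1)])
      show "(x + x', y \<oplus> y') \<in> \<Union>C" "(x * x', y \<otimes> y') \<in> \<Union>C"
        using V.G_add[OF V(2,3)] V.G_mult[OF V(2,3)] V(1) by blast+
    next
      fix x y assume "(x, y) \<in> \<Union>C"
      then obtain V where V: "V \<in> C" "(x, y) \<in> V" by blast
      interpret V: partial_embedding R L V by (rule inA[OF V(1)])
      show "(- x, \<ominus> y) \<in> \<Union>C" "y \<in> L" "x = 0 \<longleftrightarrow> y = \<zero>"
        using V.G_neg[OF V(2)] V.G_sub[OF V(2)] V.G_zero_iff[OF V(2)] V(1) by blast+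
    qed (fact L_sub L_zero L_one L_add L_mult L_neg)+
    then show "\<Union>C \<in> AA" unfolding AA_def by blast
  qed
  then show ?thesis unfolding AA_def by blast
qed

lemma full_embedding:
  assumes "countable L"
  shows "\<exists>\<psi>. inj_on \<psi> L \<and> \<psi> \<one> = (1::complex) \<and>
    (\<forall>x\<in>L. \<forall>y\<in>L. \<psi> (x \<oplus> y) = \<psi> x + \<psi> y \<and> \<psi> (x \<otimes> y) = \<psi> x * \<psi> y)"
proof -
  obtain H where "partial_embedding R L H" and max: "\<And>H'. partial_embedding R L H' \<Longrightarrow> H \<subseteq> H' \<Longrightarrow> H' = H"
    using maximal_embedding by blast
  interpret H: partial_embedding R L H by fact
  have ran: "x \<in> Range H" if "x \<in> L" for x
    using H.embedding_step[OF that assms] max by blast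
  define \<psi> where "\<psi> x = (THE z. (z, x) \<in> H)" for x
  have eq: "\<psi> x = z" if "(z, x) \<in> H" for x z
    unfolding \<psi>_def using that H.G_inj by blast
  have \<psi>: "(\<psi> x, x) \<in> H" if "x \<in> L" for x using ran[OF that] eq by blast
  have "inj_on \<psi> L" using \<psi> H.G_fun by (metis inj_onI)
  moreover have "\<psi> \<one> = 1" by (rule eq[OF H.G_one])
  moreover have "\<psi> (x \<oplus> y) = \<psi> x + \<psi> y" "\<psi> (x \<otimes> y) = \<psi> x * \<psi> y" if "x \<in> L" "y \<in> L" for x y
    using that by (auto intro!: eq H.G_add H.G_mult \<psi>)
  ultimately show ?thesis by blast
qed

end

text \<open>In characteristic zero the integers in \<open>L\<close> provide a first partial embedding; a maximal one reaches
  every element of \<open>L\<close> by \<open>embedding_step\<close>.\<close>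

theorem (in field) countable_field_embeds_complex:
  assumes char0: "\<And>n. n > 0 \<Longrightarrow> add_pow R (n::nat) \<one> \<noteq> \<zero>"
    and L: "L \<subseteq> carrier R" "countable L" "\<zero> \<in> L" "\<one> \<in> L"
      "\<And>x y. x \<in> L \<Longrightarrow> y \<in> L \<Longrightarrow> x \<oplus> y \<in> L" "\<And>x y. x \<in> L \<Longrightarrow> y \<in> L \<Longrightarrow> x \<otimes> y \<in> L"
      "\<And>x. x \<in> L \<Longrightarrow> \<ominus> x \<in> L"
  shows "\<exists>\<psi>. inj_on \<psi> L \<and> \<psi> \<one> = (1::complex) \<and>
    (\<forall>x\<in>L. \<forall>y\<in>L. \<psi> (x \<oplus> y) = \<psi> x + \<psi> y \<and> \<psi> (x \<otimes> y) = \<psi> x * \<psi> y)"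
proof -
  define N where "N n = add_pow R (n::nat) \<one>" for n
  have N_0: "N 0 = \<zero>" and N_Suc: "N (Suc n) = N n \<oplus> \<one>" for n by (simp_all add: N_def)
  define \<iota> where "\<iota> m n = N m \<ominus> N n" for m n :: nat
  have natL: "N n \<in> L" for n
    by (induction n) (simp_all add: L N_0 N_Suc)
  have c: "N n \<in> carrier R" for n using natL L(1) by blast
  have nat_add: "N (m + n) = N m \<oplus> N n" for m n
    by (induction n) (simp_all add: c N_0 N_Suc a_assoc)
  have nat_mult: "N m \<otimes> N n = N (m * n)" for m n
    by (induction n) (simp_all add: c N_0 N_Suc nat_add r_distr a_comm)
  have zero_iff: "(of_nat m - of_nat n :: complex) = 0 \<longleftrightarrow> \<iota> m n = \<zero>" for m n
  proof -
    have "N m = N n \<Longrightarrow> m = n" for m n :: nat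
    proof (induction m n rule: linorder_wlog)
      case (le m n)
      have "N m \<oplus> N (n - m) = N m \<oplus> \<zero>"
        using le nat_add[of m "n - m"] c by simp
      then have "N (n - m) = \<zero>" using add.l_cancel[of "N m" "N (n - m)" \<zero>] c by simp
      then show ?case using char0[of "n - m"] le unfolding N_def by (cases "m = n") simp_all
    qed simp
    then show ?thesis unfolding \<iota>_def using r_right_minus_eq[OF c c] by auto
  qed
  define G where "G = {(of_nat m - of_nat n :: complex, \<iota> m n) |m n. True}"
  have I: "(of_nat m - of_nat n, \<iota> m n) \<in> G" for m n unfolding G_def by blast
  interpret partial_embedding R L G
  proof unfold_locales
    show "(0, \<zero>) \<in> G" using I[of 0 0] by (simp add: \<iota>_def a_minus_def N_0)
    show "(1, \<one>) \<in> G" using I[of 1 0] by (simp add: \<iota>_def a_minus_def N_0 N_Suc)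
  next
    fix z x w y assume "(z, x) \<in> G" "(w, y) \<in> G"
    then obtain m n m' n' where e: "z = of_nat m - of_nat n" "x = \<iota> m n" "w = of_nat m' - of_nat n'" "y = \<iota> m' n'"
      unfolding G_def by blast
    have "\<iota> m n \<oplus> \<iota> m' n' = \<iota> (m + m') (n + n')"
      unfolding \<iota>_def nat_add using c by (simp add: a_minus_def minus_add a_ac)
    then show "(z + w, x \<oplus> y) \<in> G" using I[of "m + m'" "n + n'"] by (simp add: e algebra_simps)
    have "\<iota> m n \<otimes> \<iota> m' n' = \<iota> (m * m' + n * n') (m * n' + n * m')"
      unfolding \<iota>_def nat_add nat_mult[symmetric] using c
      by (simp add: a_minus_def minus_add l_distr r_distr l_minus r_minus a_ac)
    then show "(z * w, x \<otimes> y) \<in> G"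
      using I[of "m * m' + n * n'" "m * n' + n * m'"] by (simp add: e algebra_simps)
  next
    fix z x assume "(z, x) \<in> G"
    then obtain m n where e: "z = of_nat m - of_nat n" "x = \<iota> m n" unfolding G_def by blast
    have "\<ominus> \<iota> m n = \<iota> n m" unfolding \<iota>_def using c by (simp add: a_minus_def minus_add a_ac)
    then show "(- z, \<ominus> x) \<in> G" using I[of n m] by (simp add: e)
    show "x \<in> L" unfolding e \<iota>_def a_minus_def by (intro L(5,7) natL)
    show "z = 0 \<longleftrightarrow> x = \<zero>" unfolding e by (rule zero_iff)
  qed (fact L)+
  show ?thesis by (rule full_embedding[OF L(2)])
qed

section \<open>Sums of squares in a field\<close>

context ring
begin

lemma sum_of_n_squares_0: "sum_of_n_squares R 0 x \<longleftrightarrow> x = \<zero>"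
  by (auto simp: sum_of_n_squares_def)

lemma sum_of_n_squares_Suc:
  "sum_of_n_squares R (Suc n) x \<longleftrightarrow> (\<exists>a\<in>carrier R. \<exists>y. sum_of_n_squares R n y \<and> x = a \<otimes> a \<oplus> y)"
proof
  assume "sum_of_n_squares R (Suc n) x"
  then obtain g where g: "g \<in> {..<Suc n} \<rightarrow> carrier R" "x = (\<Oplus>i\<in>{..<Suc n}. g i \<otimes> g i)"
    unfolding sum_of_n_squares_def by blast
  then have "x = g n \<otimes> g n \<oplus> (\<Oplus>i\<in>{..<n}. g i \<otimes> g i)"
    unfolding lessThan_Suc by (subst (asm) finsum_insert) (auto simp: Pi_iff)
  moreover have "g \<in> {..<n} \<rightarrow> carrier R" "g n \<in> carrier R" using g(1) by auto
  ultimately show "\<exists>a\<in>carrier R. \<exists>y. sum_of_n_squares R n y \<and> x = a \<otimes> a \<oplus> y"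
    unfolding sum_of_n_squares_def by blast
next
  assume "\<exists>a\<in>carrier R. \<exists>y. sum_of_n_squares R n y \<and> x = a \<otimes> a \<oplus> y"
  then obtain a g where a: "a \<in> carrier R" and g: "g \<in> {..<n} \<rightarrow> carrier R"
    and x: "x = a \<otimes> a \<oplus> (\<Oplus>i\<in>{..<n}. g i \<otimes> g i)"
    unfolding sum_of_n_squares_def by blast
  define h where "h = g(n := a)"
  have h: "h \<in> {..<Suc n} \<rightarrow> carrier R" using a g by (auto simp: h_def Pi_iff less_Suc_eq)
  have "(\<Oplus>i\<in>{..<n}. h i \<otimes> h i) = (\<Oplus>i\<in>{..<n}. g i \<otimes> g i)"
    by (intro finsum_cong') (use g in \<open>auto simp: h_def Pi_iff\<close>)
  moreover have "h n = a" by (simp add: h_def)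
  ultimately have "x = (\<Oplus>i\<in>{..<Suc n}. h i \<otimes> h i)"
    unfolding x lessThan_Suc using h by (subst finsum_insert) (auto simp: Pi_iff)
  with h show "sum_of_n_squares R (Suc n) x" unfolding sum_of_n_squares_def by blast
qed

lemma sum_of_n_squares_closed: "sum_of_n_squares R n x \<Longrightarrow> x \<in> carrier R"
  by (induction n arbitrary: x) (auto simp: sum_of_n_squares_0 sum_of_n_squares_Suc)

lemma sum_of_n_squares_add:
  "sum_of_n_squares R m x \<Longrightarrow> sum_of_n_squares R n y \<Longrightarrow> sum_of_n_squares R (m + n) (x \<oplus> y)"
proof (induction m arbitrary: x)
  case 0
  then show ?case using sum_of_n_squares_closed by (auto simp: sum_of_n_squares_0)
next
  case (Suc m)
  then obtain a z where az: "a \<in> carrier R" "sum_of_n_squares R m z" "x = a \<otimes> a \<oplus> z"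
    by (auto simp: sum_of_n_squares_Suc)
  then have "x \<oplus> y = a \<otimes> a \<oplus> (z \<oplus> y)"
    using sum_of_n_squares_closed Suc.prems by (simp add: a_assoc)
  with Suc.IH[OF az(2) Suc.prems(2)] az(1) show ?case by (auto simp: sum_of_n_squares_Suc)
qed

lemma sum_of_squares_add: "sum_of_squares R x \<Longrightarrow> sum_of_squares R y \<Longrightarrow> sum_of_squares R (x \<oplus> y)"
  unfolding sum_of_squares_def using sum_of_n_squares_add by blast

lemma sum_of_squares_square: "x \<in> carrier R \<Longrightarrow> sum_of_squares R (x \<otimes> x)"
  unfolding sum_of_squares_def
  by (rule exI[of _ "Suc 0"]) (auto simp: sum_of_n_squares_Suc sum_of_n_squares_0)

lemma sum_of_squares_closed: "sum_of_squares R x \<Longrightarrow> x \<in> carrier R"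
  unfolding sum_of_squares_def using sum_of_n_squares_closed by blast

end

context cring
begin

lemma sum_of_n_squares_square_mult:
  "b \<in> carrier R \<Longrightarrow> sum_of_n_squares R n x \<Longrightarrow> sum_of_n_squares R n (b \<otimes> b \<otimes> x)"
proof (induction n arbitrary: x)
  case (Suc n)
  then obtain a y where a: "a \<in> carrier R" and y: "sum_of_n_squares R n y" and x: "x = a \<otimes> a \<oplus> y"
    by (auto simp: sum_of_n_squares_Suc)
  have "b \<otimes> b \<otimes> x = (b \<otimes> a) \<otimes> (b \<otimes> a) \<oplus> b \<otimes> b \<otimes> y"
    unfolding x using a Suc.prems(1) sum_of_n_squares_closed[OF y] by (simp add: r_distr m_ac)
  with Suc.IH[OF Suc.prems(1) y] a Suc.prems(1) show ?case unfolding sum_of_n_squares_Suc by blast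
qed (simp add: sum_of_n_squares_0)

lemma sum_of_squares_mult:
  assumes "sum_of_squares R x" "sum_of_squares R y"
  shows "sum_of_squares R (x \<otimes> y)"
proof -
  obtain n where "sum_of_n_squares R n x" using assms(1) by (auto simp: sum_of_squares_def)
  then show ?thesis
  proof (induction n arbitrary: x)
    case 0
    then show ?case using sum_of_squares_closed[OF assms(2)]
      by (auto simp: sum_of_n_squares_0 sum_of_squares_def intro!: exI[of _ 0])
  next
    case (Suc n)
    then obtain a z where a: "a \<in> carrier R" and z: "sum_of_n_squares R n z" and x: "x = a \<otimes> a \<oplus> z"
      by (auto simp: sum_of_n_squares_Suc)
    have "x \<otimes> y = a \<otimes> a \<otimes> y \<oplus> z \<otimes> y"
      unfolding x using a sum_of_n_squares_closed[OF z] sum_of_squares_closed[OF assms(2)] by (simp add: l_distr)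
    moreover have "sum_of_squares R (a \<otimes> a \<otimes> y)"
      using assms(2) sum_of_n_squares_square_mult[OF a] by (auto simp: sum_of_squares_def)
    ultimately show ?case using sum_of_squares_add Suc.IH[OF z] by simp
  qed
qed

lemma field_ordering_square:
  assumes "field_ordering R P" "x \<in> carrier R"
  shows "x \<otimes> x \<in> P"
proof -
  have "x \<in> P \<or> \<ominus> x \<in> P" using assms by (auto simp: field_ordering_def)
  moreover have "\<ominus> x \<otimes> \<ominus> x = x \<otimes> x" using assms(2) by (simp add: l_minus r_minus)
  ultimately show ?thesis using assms(1) unfolding field_ordering_def by metis
qed

lemma field_ordering_sum_of_squares:
  assumes P: "field_ordering R P" and "sum_of_squares R x"
  shows "x \<in> P"
proof -
  have zero: "\<zero> \<in> P" using field_ordering_square[OF P, of \<zero>] by simp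
  obtain n where "sum_of_n_squares R n x" using assms(2) by (auto simp: sum_of_squares_def)
  then show ?thesis
  proof (induction n arbitrary: x)
    case (Suc n)
    then obtain a y where "a \<in> carrier R" "sum_of_n_squares R n y" "x = a \<otimes> a \<oplus> y"
      by (auto simp: sum_of_n_squares_Suc)
    then show ?case using Suc.IH field_ordering_square[OF P] P by (auto simp: field_ordering_def)
  qed (simp add: sum_of_n_squares_0 zero)
qed

end

context field
begin

lemma minus_one_not_in_ordering:
  assumes P: "field_ordering R P"
  shows "\<ominus> \<one> \<notin> P"
proof
  assume "\<ominus> \<one> \<in> P"
  moreover have "\<one> \<in> P" using field_ordering_square[OF P, of \<one>] by simp
  ultimately have "\<one> = \<zero>" using P unfolding field_ordering_def by blast
  then show False using one_not_zero by simp
qed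

text \<open>If \<open>a\<close> is not a sum of squares, then \<open>-a\<close> can be adjoined to the preordering of sums of squares: from
  \<open>-1 = s - a t\<close> one would get \<open>a = (s + 1) t (1/t)\<^sup>2\<close>.  An ordering that contains \<open>-a\<close> cannot contain \<open>a\<close> unless \<open>a = 0\<close>.\<close>

theorem artin:
  assumes real: "field_ordering R P0" and a: "a \<in> carrier R"
    and nonneg: "\<And>P. field_ordering R P \<Longrightarrow> a \<in> P"
  shows "sum_of_squares R a"
proof (rule ccontr)
  assume not: "\<not> sum_of_squares R a"
  let ?T = "{x. sum_of_squares R x}"
  have m1: "\<not> sum_of_squares R (\<ominus> \<one>)"
    using field_ordering_sum_of_squares[OF real] minus_one_not_in_ordering[OF real] by blast
  have T: "preordering ?T"
    unfolding preordering_def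
    using sum_of_squares_closed sum_of_squares_add sum_of_squares_mult sum_of_squares_square m1 by auto
  have ne: "\<ominus> \<one> \<noteq> s \<oplus> \<ominus> a \<otimes> t" if s: "s \<in> ?T" and t: "t \<in> ?T" for s t
  proof
    assume e: "\<ominus> \<one> = s \<oplus> \<ominus> a \<otimes> t"
    have c: "s \<in> carrier R" "t \<in> carrier R" using s t sum_of_squares_closed by auto
    show False
    proof (cases "t = \<zero>")
      case True
      then show False using e c a s m1 by simp
    next
      case False
      then have u: "inv t \<in> carrier R" "t \<otimes> inv t = \<one>" using c field_Units by auto
      have "s \<oplus> \<one> = s \<oplus> (\<ominus> (s \<oplus> \<ominus> a \<otimes> t))" using e by (metis minus_minus one_closed)
      also have "\<dots> = a \<otimes> t" using c a by (simp add: minus_add l_minus r_neg2)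
      finally have at: "a \<otimes> t = s \<oplus> \<one>" by simp
      have "a = a \<otimes> (t \<otimes> inv t) \<otimes> (t \<otimes> inv t)" using a u by simp
      also have "\<dots> = (a \<otimes> t) \<otimes> t \<otimes> (inv t \<otimes> inv t)" using a u(1) c by (simp add: m_ac)
      finally have "a = (s \<oplus> \<one>) \<otimes> t \<otimes> (inv t \<otimes> inv t)" unfolding at .
      moreover have "sum_of_squares R (s \<oplus> \<one>)"
        using s sum_of_squares_add sum_of_squares_square[of \<one>] by simp
      ultimately show False
        using not sum_of_squares_mult sum_of_squares_square[OF u(1)] t by auto
    qed
  qed
  obtain P where P: "field_ordering R P" "\<ominus> a \<in> P"
    using preordering_extends[OF preordering_adjoin(1)[OF T a_inv_closed[OF a] ne]]
      preordering_adjoin(3)[OF T a_inv_closed[OF a] ne] by blast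
  then have "a = \<zero>" using nonneg[OF P(1)] unfolding field_ordering_def by blast
  then show False using not sum_of_squares_square[of \<zero>] by simp
qed

end

section \<open>Subfields and coordinates\<close>

context field
begin

context
  fixes F assumes F: "subfield F R"
begin

lemma subfield_is_field: "field (R\<lparr>carrier := F\<rparr>)"
  using subfield_iff(2)[OF F] .

lemma subfield_subset: "F \<subseteq> carrier R"
  using F by (auto dest: subfieldE)

lemma subfield_closed:
  "\<zero> \<in> F" "\<one> \<in> F" "x \<in> F \<Longrightarrow> y \<in> F \<Longrightarrow> x \<oplus> y \<in> F" "x \<in> F \<Longrightarrow> y \<in> F \<Longrightarrow> x \<otimes> y \<in> F" "x \<in> F \<Longrightarrow> \<ominus> x \<in> F"
  using subringE[OF subfieldE(1)[OF F]] by auto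

lemma subfield_carrier: "x \<in> F \<Longrightarrow> x \<in> carrier R"
  using subfield_subset by blast

lemma subfield_inv: "x \<in> F \<Longrightarrow> x \<noteq> \<zero> \<Longrightarrow> inv x \<in> F"
  using subfield_m_inv(1)[OF F] by simp

lemma subfield_a_inv: "x \<in> F \<Longrightarrow> \<ominus>\<^bsub>R\<lparr>carrier := F\<rparr>\<^esub> x = \<ominus> x"
proof -
  assume x: "x \<in> F"
  interpret S: field "R\<lparr>carrier := F\<rparr>" by (rule subfield_is_field)
  show ?thesis
    by (rule S.minus_equality) (use x subfield_closed subfield_carrier[OF x] l_neg in auto)
qed

lemma subfield_ordering:
  assumes "field_ordering (R\<lparr>carrier := F\<rparr>) P"
  shows "P \<subseteq> F" "x \<in> P \<Longrightarrow> y \<in> P \<Longrightarrow> x \<oplus> y \<in> P" "x \<in> P \<Longrightarrow> y \<in> P \<Longrightarrow> x \<otimes> y \<in> P"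
    "x \<in> F \<Longrightarrow> x \<in> P \<or> \<ominus> x \<in> P" "x \<in> P \<Longrightarrow> \<ominus> x \<in> P \<Longrightarrow> x = \<zero>"
proof -
  from assms show sub: "P \<subseteq> F" by (simp add: field_ordering_def)
  from assms show "x \<in> P \<Longrightarrow> y \<in> P \<Longrightarrow> x \<oplus> y \<in> P" "x \<in> P \<Longrightarrow> y \<in> P \<Longrightarrow> x \<otimes> y \<in> P"
    by (simp_all add: field_ordering_def)
  from assms show "x \<in> F \<Longrightarrow> x \<in> P \<or> \<ominus> x \<in> P"
    using subfield_a_inv[of x] by (auto simp: field_ordering_def)
  from assms show "x \<in> P \<Longrightarrow> \<ominus> x \<in> P \<Longrightarrow> x = \<zero>"
    using subfield_a_inv[of x] sub by (auto simp: field_ordering_def)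
qed

lemma combine_eq_finsum:
  assumes "set Ks \<subseteq> carrier R" "set Us \<subseteq> carrier R" "length Ks = length Us"
  shows "combine Ks Us = (\<Oplus>i\<in>{..<length Us}. Ks ! i \<otimes> Us ! i)"
  using assms(3,1,2)
proof (induction Ks Us rule: list_induct2)
  case (Cons k Ks u Us)
  have c: "(\<lambda>i. (k # Ks) ! i \<otimes> (u # Us) ! i) \<in> {..<length (u # Us)} \<rightarrow> carrier R"
    using Cons.prems Cons.hyps nth_mem[of _ Ks] nth_mem[of _ Us]
    by (intro funcsetI m_closed) (auto simp: nth_Cons split: nat.splits)
  have c': "(\<lambda>i. Ks ! i \<otimes> Us ! i) \<in> {..<length Us} \<rightarrow> carrier R"
    using Cons.prems Cons.hyps nth_mem[of _ Ks] nth_mem[of _ Us] by (intro funcsetI m_closed) auto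
  have "{..<length (u # Us)} = insert 0 (Suc ` {..<length Us})"
    by (auto simp: lessThan_Suc_eq_insert_0)
  then have "(\<Oplus>i\<in>{..<length (u # Us)}. (k # Ks) ! i \<otimes> (u # Us) ! i) =
      (k \<otimes> u) \<oplus> (\<Oplus>i\<in>Suc ` {..<length Us}. (k # Ks) ! i \<otimes> (u # Us) ! i)"
    using c by (simp add: finsum_insert Pi_iff)
  also have "(\<Oplus>i\<in>Suc ` {..<length Us}. (k # Ks) ! i \<otimes> (u # Us) ! i) = (\<Oplus>i\<in>{..<length Us}. Ks ! i \<otimes> Us ! i)"
    using c' by (subst add.finprod_reindex) (auto simp: Pi_iff)
  finally show ?case using Cons by simp
qed simp

text \<open>The basis starts with \<open>1\<close>, so that the orthogonal basis obtained from it does so too, which makes the first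
  coefficient equal to \<open>1\<close>.\<close>

lemma linear_coordinates:
  assumes dim: "dimension d F (carrier R)"
  shows "\<exists>e coord. e 0 = \<one> \<and> d > 0 \<and> (\<forall>i<d. e i \<in> carrier R) \<and>
    (\<forall>x\<in>carrier R. \<forall>i. coord i x \<in> F) \<and>
    (\<forall>x\<in>carrier R. x = (\<Oplus>i\<in>{..<d}. coord i x \<otimes> e i)) \<and>
    (\<forall>x\<in>carrier R. \<forall>y\<in>carrier R. \<forall>i. coord i (x \<oplus> y) = coord i x \<oplus> coord i y) \<and>
    (\<forall>a\<in>F. \<forall>x\<in>carrier R. \<forall>i. coord i (a \<otimes> x) = a \<otimes> coord i x)"
proof -
  have "independent F [\<one>]"
    by (rule li_Cons) (auto simp: one_not_zero)
  then obtain Vs where Vs: "length (Vs @ [\<one>]) = d" "independent F (Vs @ [\<one>])" "Span F (Vs @ [\<one>]) = carrier R"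
    using complete_base[OF F dim, of "[\<one>]"] by auto
  define Us where "Us = \<one> # Vs"
  have len: "length Us = d" using Vs(1) by (simp add: Us_def)
  have "distinct (Vs @ [\<one>])" by (rule independent_distinct[OF F Vs(2)])
  then have ind: "independent F Us"
    using independent_same_set[OF F _ _ Vs(2), of Us] by (auto simp: Us_def)
  have Uc: "set Us \<subseteq> carrier R" by (rule independent_in_carrier[OF ind])
  have sp: "Span F Us = carrier R"
    using Span_same_set[OF F, of Us "Vs @ [\<one>]"] Uc Vs(3) by (auto simp: Us_def)
  have uni: "\<exists>!Ks. set Ks \<subseteq> F \<and> length Ks = length Us \<and> x = combine Ks Us" if "x \<in> carrier R" for x
    using unique_decomposition[OF F ind] that sp by simp
  define Ks where "Ks x = (THE Ks. set Ks \<subseteq> F \<and> length Ks = length Us \<and> x = combine Ks Us)" for x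
  have Ks: "set (Ks x) \<subseteq> F" "length (Ks x) = length Us" "x = combine (Ks x) Us" if "x \<in> carrier R" for x
    using theI'[OF uni[OF that]] unfolding Ks_def by blast+
  have KsI: "Ks x = L" if "x \<in> carrier R" "set L \<subseteq> F" "length L = length Us" "x = combine L Us" for x L
    using uni[OF that(1)] Ks[OF that(1)] that(2-) by blast
  define coord where "coord i x = (if i < d then Ks x ! i else \<zero>)" for i x
  have KsC: "set (Ks x) \<subseteq> carrier R" if "x \<in> carrier R" for x using Ks(1)[OF that] subfield_subset by blast
  have "coord i (x \<oplus> y) = coord i x \<oplus> coord i y" if x: "x \<in> carrier R" and y: "y \<in> carrier R" for i x y
  proof -
    have "Ks (x \<oplus> y) = map2 (\<oplus>) (Ks x) (Ks y)"
    proof (rule KsI)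
      show "set (map2 (\<oplus>) (Ks x) (Ks y)) \<subseteq> F"
      proof
        fix v assume "v \<in> set (map2 (\<oplus>) (Ks x) (Ks y))"
        then obtain p q where pq: "(p, q) \<in> set (zip (Ks x) (Ks y))" "v = p \<oplus> q" by auto
        then have "p \<in> F" "q \<in> F"
          using Ks(1)[OF x] Ks(1)[OF y] set_zip_leftD[OF pq(1)] set_zip_rightD[OF pq(1)] by blast+
        then show "v \<in> F" unfolding pq(2) by (rule subfield_closed(3))
      qed
      show "x \<oplus> y = combine (map2 (\<oplus>) (Ks x) (Ks y)) Us"
        using combine_add[OF Ks(2)[OF x] Ks(2)[OF y] KsC[OF x] KsC[OF y] Uc] Ks(3)[OF x] Ks(3)[OF y] by simp
    qed (use x y Ks(2) in auto)
    then show ?thesis using Ks(2)[OF x] Ks(2)[OF y] len by (simp add: coord_def)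
  qed
  moreover have "coord i (a \<otimes> x) = a \<otimes> coord i x" if x: "x \<in> carrier R" and a: "a \<in> F" for i x a
  proof -
    have "Ks (a \<otimes> x) = map ((\<otimes>) a) (Ks x)"
    proof (rule KsI)
      show "set (map ((\<otimes>) a) (Ks x)) \<subseteq> F" using Ks(1)[OF x] subfield_closed(4)[OF a] by auto
      show "a \<otimes> x = combine (map ((\<otimes>) a) (Ks x)) Us"
        using combine_r_distr[OF KsC[OF x] Uc subfield_carrier[OF a]] Ks(3)[OF x] by simp
    qed (use x subfield_carrier[OF a] Ks(2) in auto)
    then show ?thesis using Ks(2)[OF x] len subfield_carrier[OF a] by (simp add: coord_def)
  qed
  moreover have "x = (\<Oplus>i\<in>{..<d}. coord i x \<otimes> Us ! i)" if x: "x \<in> carrier R" for x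
  proof -
    have "x = (\<Oplus>i\<in>{..<d}. Ks x ! i \<otimes> Us ! i)"
      using combine_eq_finsum[OF KsC[OF x] Uc Ks(2)[OF x]] Ks(3)[OF x] len by simp
    also have "\<dots> = (\<Oplus>i\<in>{..<d}. coord i x \<otimes> Us ! i)"
      using KsC[OF x] Uc Ks(2)[OF x] len
      by (intro finsum_cong') (auto simp: coord_def intro!: m_closed dest: nth_mem)
    finally show ?thesis .
  qed
  moreover have "coord i x \<in> F" if x: "x \<in> carrier R" for i x
    using Ks(1,2)[OF x] len subfield_closed(1) unfolding coord_def by (auto simp: subset_code(1))
  moreover have "Us ! i \<in> carrier R" if "i < d" for i using Uc len that by (auto dest: nth_mem)
  moreover have "Us ! 0 = \<one>" "d > 0" using len by (auto simp: Us_def)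
  ultimately show ?thesis
    by (intro exI[of _ "\<lambda>i. Us ! i"] exI[of _ coord] conjI allI impI ballI) simp_all
qed

end

end

section \<open>Countable subsets closed under countably many operations\<close>

text \<open>The set \<open>L\<close> is reached by applying all operations countably often, starting from \<open>S\<close>.\<close>

lemma countable_closure:
  assumes "countable U" "countable B" "countable S"
  shows "\<exists>L. S \<subseteq> L \<and> countable L \<and> (\<forall>f\<in>U. \<forall>x\<in>L. f x \<in> L) \<and> (\<forall>g\<in>B. \<forall>x\<in>L. \<forall>y\<in>L. g x y \<in> L)"
proof -
  define T where "T A = A \<union> (\<Union>f\<in>U. f ` A) \<union> (\<Union>g\<in>B. (\<lambda>(x, y). g x y) ` (A \<times> A))" for A
  define L where "L = (\<Union>n. (T ^^ n) S)"
  have inc: "(T ^^ n) S \<subseteq> (T ^^ m) S" if "n \<le> m" for n m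
    using that by (induction m rule: dec_induct) (auto simp: T_def)
  have "countable ((T ^^ n) S)" for n
    by (induction n) (auto simp: T_def assms intro!: countable_Un countable_UN countable_image countable_SIGMA)
  then have "countable L" by (simp add: L_def)
  moreover have "S \<subseteq> L" unfolding L_def using UN_upper[of 0 UNIV "\<lambda>n. (T ^^ n) S"] by simp
  moreover have "f x \<in> L" if "f \<in> U" "x \<in> L" for f x
  proof -
    from that obtain n where "x \<in> (T ^^ n) S" by (auto simp: L_def)
    then have "f x \<in> (T ^^ Suc n) S" using that by (auto simp: T_def)
    then show ?thesis unfolding L_def by blast
  qed
  moreover have "g x y \<in> L" if "g \<in> B" "x \<in> L" "y \<in> L" for g x y
  proof -
    from that obtain n m where "x \<in> (T ^^ n) S" "y \<in> (T ^^ m) S" by (auto simp: L_def)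
    then have "x \<in> (T ^^ max n m) S" "y \<in> (T ^^ max n m) S"
      using inc[of n "max n m"] inc[of m "max n m"] by auto
    then have "g x y \<in> T ((T ^^ max n m) S)"
      unfolding T_def using that(1) by (intro UnI2 UN_I[OF that(1)] image_eqI[of _ _ "(x, y)"]) auto
    then have "g x y \<in> (T ^^ Suc (max n m)) S" by simp
    then show ?thesis unfolding L_def by blast
  qed
  ultimately show ?thesis by (intro exI[of _ L] conjI ballI)
qed

section \<open>Positivity of the trace form\<close>

context field
begin

context
  fixes L :: "'a set" and \<psi> :: "'a \<Rightarrow> complex"
  assumes L: "L \<subseteq> carrier R" and inj: "inj_on \<psi> L" and \<psi>_one: "\<psi> \<one> = 1"
    and hom: "\<And>x y. x \<in> L \<Longrightarrow> y \<in> L \<Longrightarrow> \<psi> (x \<oplus> y) = \<psi> x + \<psi> y"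
      "\<And>x y. x \<in> L \<Longrightarrow> y \<in> L \<Longrightarrow> \<psi> (x \<otimes> y) = \<psi> x * \<psi> y"
    and zero: "\<zero> \<in> L"
begin

lemma \<psi>_zero: "\<psi> \<zero> = 0"
  using hom(1)[OF zero zero] by simp

lemma \<psi>_zero_iff: "x \<in> L \<Longrightarrow> \<psi> x = 0 \<longleftrightarrow> x = \<zero>"
  using \<psi>_zero inj zero by (metis inj_onD)

lemma \<psi>_neg: "x \<in> L \<Longrightarrow> \<ominus> x \<in> L \<Longrightarrow> \<psi> (\<ominus> x) = - \<psi> x"
  using hom(1)[of x "\<ominus> x"] \<psi>_zero L by (simp add: r_neg subsetD eq_neg_iff_add_eq_0 add.commute)

lemma \<psi>_finsum:
  assumes add: "\<And>x y. x \<in> L \<Longrightarrow> y \<in> L \<Longrightarrow> x \<oplus> y \<in> L" and "finite I" "\<And>i. i \<in> I \<Longrightarrow> f i \<in> L"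
  shows "finsum R f I \<in> L \<and> \<psi> (finsum R f I) = (\<Sum>i\<in>I. \<psi> (f i))"
  using assms(2,3)
proof (induction I rule: finite_induct)
  case empty
  then show ?case by (simp add: zero \<psi>_zero)
next
  case (insert i I)
  then have "f \<in> I \<rightarrow> carrier R" "f i \<in> carrier R" using L by auto
  with insert show ?case by (simp add: finsum_insert add hom)
qed

lemma image_ordered_subfield:
  assumes M: "M \<subseteq> L" "\<zero> \<in> M" "\<one> \<in> M" "\<And>x y. x \<in> M \<Longrightarrow> y \<in> M \<Longrightarrow> x \<oplus> y \<in> M"
      "\<And>x y. x \<in> M \<Longrightarrow> y \<in> M \<Longrightarrow> x \<otimes> y \<in> M" "\<And>x. x \<in> M \<Longrightarrow> \<ominus> x \<in> M"
      "\<And>x. x \<in> M \<Longrightarrow> x \<noteq> \<zero> \<Longrightarrow> inv x \<in> M"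
    and Q: "Q \<subseteq> M" "\<And>x y. x \<in> Q \<Longrightarrow> y \<in> Q \<Longrightarrow> x \<oplus> y \<in> Q" "\<And>x y. x \<in> Q \<Longrightarrow> y \<in> Q \<Longrightarrow> x \<otimes> y \<in> Q"
      "\<And>x. x \<in> M \<Longrightarrow> x \<in> Q \<or> \<ominus> x \<in> Q" "\<And>x. x \<in> Q \<Longrightarrow> \<ominus> x \<in> Q \<Longrightarrow> x = \<zero>"
  shows "ordered_subfield (\<psi> ` M) (\<psi> ` Q)"
proof -
  have in_L: "x \<in> L" if "x \<in> M" for x using M(1) that by blast
  have in_M: "x \<in> M" if "x \<in> Q" for x using Q(1) that by blast
  have neg: "\<psi> (\<ominus> x) = - \<psi> x" if "x \<in> M" for x using \<psi>_neg[OF in_L in_L] that M(6) by blast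
  have inv: "\<psi> (inv x) = inverse (\<psi> x)" if x: "x \<in> M" "x \<noteq> \<zero>" for x
  proof -
    have "x \<in> Units R" using x in_L L field_Units by blast
    then have "\<psi> x * \<psi> (inv x) = 1"
      using hom(2)[OF in_L[OF x(1)] in_L[OF M(7)[OF x]]] \<psi>_one by simp
    then show ?thesis using inverse_unique by metis
  qed
  show ?thesis
  proof unfold_locales
    show "0 \<in> \<psi> ` M" "1 \<in> \<psi> ` M" using M(2,3) \<psi>_zero \<psi>_one by (metis imageI)+
    show "\<psi> ` Q \<subseteq> \<psi> ` M" using Q(1) by blast
  next
    fix u v assume "u \<in> \<psi> ` M" "v \<in> \<psi> ` M"
    then obtain x y where xy: "x \<in> M" "y \<in> M" "u = \<psi> x" "v = \<psi> y" by blast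
    have "u + v = \<psi> (x \<oplus> y)" "u * v = \<psi> (x \<otimes> y)" using xy hom in_L by auto
    then show "u + v \<in> \<psi> ` M" "u * v \<in> \<psi> ` M" using xy M(4,5) by auto
  next
    fix u assume "u \<in> \<psi> ` M"
    then obtain x where x: "x \<in> M" "u = \<psi> x" by blast
    have n: "- u = \<psi> (\<ominus> x)" using neg[OF x(1)] x by simp
    then show "- u \<in> \<psi> ` M" using M(6)[OF x(1)] by blast
    show "inverse u \<in> \<psi> ` M"
    proof (cases "x = \<zero>")
      case True
      then show ?thesis using x \<psi>_zero by auto
    next
      case False
      then have "inverse u = \<psi> (inv x)" using inv x by simp
      then show ?thesis using M(7)[OF x(1) False] by blast
    qed
    show "u \<in> \<psi> ` Q \<or> - u \<in> \<psi> ` Q" using Q(4)[OF x(1)] n x by auto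
  next
    fix u v assume "u \<in> \<psi> ` Q" "v \<in> \<psi> ` Q"
    then obtain x y where xy: "x \<in> Q" "y \<in> Q" "u = \<psi> x" "v = \<psi> y" by blast
    have "u + v = \<psi> (x \<oplus> y)" "u * v = \<psi> (x \<otimes> y)" using xy hom in_L in_M by auto
    then show "u + v \<in> \<psi> ` Q" "u * v \<in> \<psi> ` Q" using xy Q(2,3) by auto
  next
    fix u assume "u \<in> \<psi> ` Q" "- u \<in> \<psi> ` Q"
    then obtain x y where xy: "x \<in> Q" "y \<in> Q" "u = \<psi> x" "- u = \<psi> y" by blast
    have "\<psi> (\<ominus> x) = \<psi> y" using neg[OF in_M[OF xy(1)]] xy by simp
    then have "\<ominus> x = y" using inj in_L in_M M(6) xy(1,2) by (meson inj_onD)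
    then have "x = \<zero>" using Q(5) xy by blast
    then show "u = 0" using xy \<psi>_zero by simp
  qed
qed

end

lemma char_zero_of_ordering:
  assumes P: "field_ordering R P" and "n > 0"
  shows "add_pow R (n::nat) \<one> \<noteq> \<zero>"
proof
  assume z: "add_pow R n \<one> = \<zero>"
  obtain m where m: "n = Suc m" using assms(2) gr0_implies_Suc by blast
  have one: "\<one> \<in> P" using field_ordering_square[OF P, of \<one>] by simp
  have "add_pow R k \<one> \<in> P" for k :: nat
  proof (induction k)
    case 0
    then show ?case using field_ordering_square[OF P, of \<zero>] by simp
  next
    case (Suc k)
    then show ?case using P one by (simp add: field_ordering_def)
  qed
  moreover have "add_pow R m \<one> \<oplus> \<one> = \<zero>" using z m by simp
  then have "\<ominus> \<one> = add_pow R m \<one>" by (intro minus_equality) auto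
  ultimately show False using minus_one_not_in_ordering[OF P] by metis
qed

text \<open>The statement involves only \<open>x\<close>, the basis, and for each pair of orderings an element that
  distinguishes them.  These lie in a countable subfield \<open>L\<close> closed under the coordinate functions, so that
  \<open>e\<close> still generates \<open>L\<close> over \<open>L \<inter> F\<close> and the orderings stay different on \<open>L\<close>.  The image of \<open>L\<close> in the complex
  numbers satisfies the hypotheses of \<open>trace_of_square_positive\<close>.\<close>

theorem trace_form_positive:
  assumes F: "subfield F R" and P: "field_ordering (R\<lparr>carrier := F\<rparr>) P"
    and card: "card {Q. field_ordering R Q \<and> Q \<inter> F = P} = d" and d: "d > 0"
    and e: "\<And>i. i < d \<Longrightarrow> e i \<in> carrier R"
    and coord: "\<And>i x. x \<in> carrier R \<Longrightarrow> coord i x \<in> F"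
    and expand: "\<And>x. x \<in> carrier R \<Longrightarrow> x = (\<Oplus>i\<in>{..<d}. coord i x \<otimes> e i)"
    and x: "x \<in> carrier R" "x \<noteq> \<zero>"
  shows "(\<Oplus>i\<in>{..<d}. coord i (x \<otimes> x \<otimes> e i)) \<in> P - {\<zero>}"
proof -
  note Fc = subfield_closed[OF F] and Fs = subfield_subset[OF F] and Fi = subfield_inv[OF F] and FP = subfield_ordering[OF F P]
  let ?Q = "{Q. field_ordering R Q \<and> Q \<inter> F = P}"
  have "finite ?Q" using card d by (metis card.infinite less_nat_zero_code)
  then obtain Q where "bij_betw Q {0..<card ?Q} ?Q" using ex_bij_betw_nat_finite by blast
  then have bij: "bij_betw Q {..<d} ?Q" unfolding card by (simp add: atLeast0LessThan)
  have Q: "field_ordering R (Q j)" "Q j \<inter> F = P" if "j < d" for j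
    using bij_betwE[OF bij] that by auto
  have Qc: "Q j \<subseteq> carrier R" if "j < d" for j using Q(1)[OF that] by (simp add: field_ordering_def)
  have "\<exists>u. j < d \<and> l < d \<and> j \<noteq> l \<longrightarrow> u \<in> carrier R \<and> (u \<in> Q j) \<noteq> (u \<in> Q l)" for j l
  proof (cases "j < d \<and> l < d \<and> j \<noteq> l")
    case True
    then have "Q j \<noteq> Q l" using bij by (auto simp: bij_betw_def inj_on_def)
    then show ?thesis using Qc True by blast
  qed blast
  \<comment> \<open>\<open>u j l\<close> tells the orderings \<open>Q j\<close> and \<open>Q l\<close> apart.\<close>
  then obtain u where u: "\<And>j l. j < d \<Longrightarrow> l < d \<Longrightarrow> j \<noteq> l \<Longrightarrow> u j l \<in> carrier R \<and> (u j l \<in> Q j) \<noteq> (u j l \<in> Q l)"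
    by metis
  define S where "S = {\<zero>, \<one>, x} \<union> e ` {..<d} \<union> {u j l |j l. j < d \<and> l < d \<and> j \<noteq> l}"
  have SU: "{u j l |j l. j < d \<and> l < d \<and> j \<noteq> l} \<subseteq> (\<lambda>(j, l). u j l) ` ({..<d} \<times> {..<d})" by auto
  have "countable S" unfolding S_def using finite_subset[OF SU] by (auto intro: countable_finite)
  then have "\<exists>L. S \<subseteq> L \<and> countable L \<and>
      (\<forall>f\<in>insert (\<lambda>x. \<ominus> x) (insert (\<lambda>x. inv x) (range coord)). \<forall>x\<in>L. f x \<in> L) \<and>
      (\<forall>g\<in>{\<lambda>x y. x \<oplus> y, \<lambda>x y. x \<otimes> y}. \<forall>x\<in>L. \<forall>y\<in>L. g x y \<in> L)"
    by (intro countable_closure) auto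
  then obtain L0 where L0: "S \<subseteq> L0" "countable L0"
    and un0: "\<forall>f\<in>insert (\<lambda>x. \<ominus> x) (insert (\<lambda>x. inv x) (range coord)). \<forall>x\<in>L0. f x \<in> L0"
    and bi0: "\<forall>g\<in>{\<lambda>x y. x \<oplus> y, \<lambda>x y. x \<otimes> y}. \<forall>x\<in>L0. \<forall>y\<in>L0. g x y \<in> L0"
    by (elim exE conjE) (rule that)
  have un: "\<ominus> y \<in> L0" "inv y \<in> L0" "coord i y \<in> L0" if "y \<in> L0" for i y
    using un0 that by simp_all
  have bi: "y \<oplus> z \<in> L0" "y \<otimes> z \<in> L0" if "y \<in> L0" "z \<in> L0" for y z
    using bi0 that by simp_all
  define L where "L = L0 \<inter> carrier R"
  have Lc: "L \<subseteq> carrier R" and cL: "countable L" using L0(2) by (auto simp: L_def)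
  have Lcar: "y \<in> carrier R" if "y \<in> L" for y using that Lc by blast
  have SL: "S \<inter> carrier R \<subseteq> L" using L0(1) by (auto simp: L_def)
  have L01: "\<zero> \<in> L" "\<one> \<in> L" "x \<in> L" using SL x by (auto simp: S_def)
  have eL: "e i \<in> L" if "i < d" for i using SL e[OF that] that by (auto simp: S_def)
  have uL: "u j l \<in> L" if "j < d" "l < d" "j \<noteq> l" for j l
  proof -
    have "u j l \<in> S" unfolding S_def using that by blast
    then show ?thesis using SL u[OF that] by blast
  qed
  have Lneg: "\<ominus> y \<in> L" if "y \<in> L" for y
    using un(1)[of y] that by (simp add: L_def)
  have Linv: "inv y \<in> L" if "y \<in> L" "y \<noteq> \<zero>" for y
    using un(2)[of y] that field_Units by (simp add: L_def)
  have Ladd: "y \<oplus> z \<in> L" if "y \<in> L" "z \<in> L" for y z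
    using bi(1)[of y z] that by (simp add: L_def)
  have Lmult: "y \<otimes> z \<in> L" if "y \<in> L" "z \<in> L" for y z
    using bi(2)[of y z] that by (simp add: L_def)
  have Lcoord: "coord i y \<in> L \<inter> F" if "y \<in> L" for i y
    using un(3)[of y i] that coord[of y i] Fs by (auto simp: L_def)
  obtain \<psi> where inj: "inj_on \<psi> L" and \<psi>1: "\<psi> \<one> = (1::complex)"
    and h0: "\<forall>x\<in>L. \<forall>y\<in>L. \<psi> (x \<oplus> y) = \<psi> x + \<psi> y \<and> \<psi> (x \<otimes> y) = \<psi> x * \<psi> y"
    using countable_field_embeds_complex[OF char_zero_of_ordering[OF Q(1)[OF d]] Lc cL L01(1,2) Ladd Lmult Lneg] by blast
  have hom: "\<psi> (y \<oplus> z) = \<psi> y + \<psi> z" "\<psi> (y \<otimes> z) = \<psi> y * \<psi> z" if "y \<in> L" "z \<in> L" for y z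
    using h0 that by blast+
  note image = image_ordered_subfield[OF Lc inj \<psi>1 hom L01(1)]
  note fs = \<psi>_finsum[OF Lc inj \<psi>1 hom L01(1) Ladd]
  have ordk: "ordered_subfield (\<psi> ` (L \<inter> F)) (\<psi> ` (P \<inter> L))"
    by (rule image) (use FP Fc Fi L01 Ladd Lmult Lneg Linv in auto)
  have Qp: "y \<oplus> z \<in> Q j" "y \<otimes> z \<in> Q j" if "j < d" "y \<in> Q j" "z \<in> Q j" for j y z
    using Q(1)[OF that(1)] that by (auto simp: field_ordering_def)
  have Qt: "y \<in> Q j \<or> \<ominus> y \<in> Q j" if "j < d" "y \<in> carrier R" for j y
    using Q(1)[OF that(1)] that by (auto simp: field_ordering_def)
  have Qa: "y = \<zero>" if "j < d" "y \<in> Q j" "\<ominus> y \<in> Q j" for j y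
    using Q(1)[OF that(1)] that by (auto simp: field_ordering_def)
  have ordK: "ordered_subfield (\<psi> ` L) (\<psi> ` (Q j \<inter> L))" if j: "j < d" for j
  proof (rule image)
    show "y = \<zero>" if "y \<in> Q j \<inter> L" "\<ominus> y \<in> Q j \<inter> L" for y
      using Qa[OF j] that by blast
  qed (use Qp[OF j] Qt[OF j] Lcar L01 Ladd Lmult Lneg Linv in auto)
  interpret KK: ordered_subfield "\<psi> ` L" "\<psi> ` (Q 0 \<inter> L)" by (rule ordK[OF d])
  define \<psi>' where "\<psi>' = the_inv_into L \<psi>"
  have \<psi>': "\<psi>' (\<psi> y) = y" if "y \<in> L" for y unfolding \<psi>'_def by (rule the_inv_into_f_f[OF inj that])
  define c where "c i z = \<psi> (coord i (\<psi>' z))" for i z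
  have c: "c i (\<psi> y) = \<psi> (coord i y)" if "y \<in> L" for i y using \<psi>'[OF that] by (simp add: c_def)
  have "sgn_in (\<psi> ` (P \<inter> L)) (\<Sum>i<d. c i (\<psi> x * \<psi> x * \<psi> (e i))) = 1"
  proof (rule trace_of_square_positive[OF ordk KK.subfield_set_axioms _ ordK])
    show "\<psi> ` (L \<inter> F) \<subseteq> \<psi> ` L" by blast
    show "\<psi> ` (Q j \<inter> L) \<inter> \<psi> ` (L \<inter> F) = \<psi> ` (P \<inter> L)" if "j < d" for j
      using Q(2)[OF that] by (subst inj_on_image_Int[OF inj, symmetric]) (auto intro: arg_cong[of _ _ "image \<psi>"])
    show "inj_on (\<lambda>j. \<psi> ` (Q j \<inter> L)) {..<d}"
    proof (rule inj_onI)
      fix j l assume jl: "j \<in> {..<d}" "l \<in> {..<d}" "\<psi> ` (Q j \<inter> L) = \<psi> ` (Q l \<inter> L)"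
      then have eq: "Q j \<inter> L = Q l \<inter> L" using inj_on_image_eq_iff[OF inj, of "Q j \<inter> L" "Q l \<inter> L"] by blast
      show "j = l"
      proof (rule ccontr)
        assume "j \<noteq> l"
        then show False using u[of j l] uL[of j l] jl(1,2) eq by blast
      qed
    qed
    show "\<psi> (e i) \<in> \<psi> ` L" if "i < d" for i using eL[OF that] by blast
    show "c i z \<in> \<psi> ` (L \<inter> F)" if z: "z \<in> \<psi> ` L" for z i
    proof -
      obtain y where y: "y \<in> L" "z = \<psi> y" using z by blast
      show ?thesis unfolding y(2) c[OF y(1)] by (rule imageI[OF Lcoord[OF y(1)]])
    qed
    show "z = (\<Sum>i<d. c i z * \<psi> (e i))" if z: "z \<in> \<psi> ` L" for z
    proof -
      obtain y where y: "y \<in> L" "z = \<psi> y" using z by blast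
      have "\<psi> y = \<psi> (\<Oplus>i\<in>{..<d}. coord i y \<otimes> e i)" using expand[OF Lcar[OF y(1)]] by simp
      also have "\<dots> = (\<Sum>i<d. \<psi> (coord i y \<otimes> e i))"
        using fs[of "{..<d}" "\<lambda>i. coord i y \<otimes> e i"] Lcoord[OF y(1)] eL Lmult by auto
      also have "\<dots> = (\<Sum>i<d. c i z * \<psi> (e i))"
        using Lcoord[OF y(1)] eL by (intro sum.cong refl) (auto simp: hom y(2) c[OF y(1)])
      finally show ?thesis using y(2) by simp
    qed
    show "\<psi> x \<in> \<psi> ` L" using L01(3) by blast
    show "\<psi> x \<noteq> 0" using \<psi>_zero_iff[OF Lc inj \<psi>1 hom L01(1) L01(3)] x(2) by simp
  qed
  also have "(\<Sum>i<d. c i (\<psi> x * \<psi> x * \<psi> (e i))) = (\<Sum>i<d. \<psi> (coord i (x \<otimes> x \<otimes> e i)))"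
  proof (intro sum.cong refl)
    fix i assume "i \<in> {..<d}"
    then have i: "e i \<in> L" using eL by simp
    have "\<psi> x * \<psi> x * \<psi> (e i) = \<psi> (x \<otimes> x \<otimes> e i)" using i L01(3) Lmult by (simp add: hom)
    then show "c i (\<psi> x * \<psi> x * \<psi> (e i)) = \<psi> (coord i (x \<otimes> x \<otimes> e i))"
      using c[of "x \<otimes> x \<otimes> e i" i] i L01(3) Lmult by simp
  qed
  also have "\<dots> = \<psi> (\<Oplus>i\<in>{..<d}. coord i (x \<otimes> x \<otimes> e i))"
    using fs[of "{..<d}" "\<lambda>i. coord i (x \<otimes> x \<otimes> e i)"] Lcoord Lmult L01(3) eL by auto
  finally have pos: "sgn_in (\<psi> ` (P \<inter> L)) (\<psi> (\<Oplus>i\<in>{..<d}. coord i (x \<otimes> x \<otimes> e i))) = 1" .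
  have tL: "(\<Oplus>i\<in>{..<d}. coord i (x \<otimes> x \<otimes> e i)) \<in> L"
    using fs[of "{..<d}" "\<lambda>i. coord i (x \<otimes> x \<otimes> e i)"] Lcoord Lmult L01(3) eL by auto
  from pos have nz: "\<psi> (\<Oplus>i\<in>{..<d}. coord i (x \<otimes> x \<otimes> e i)) \<noteq> 0" by auto
  from pos nz have "\<psi> (\<Oplus>i\<in>{..<d}. coord i (x \<otimes> x \<otimes> e i)) \<in> \<psi> ` (P \<inter> L)"
    by (auto simp: sgn_in_def split: if_splits)
  then have "(\<Oplus>i\<in>{..<d}. coord i (x \<otimes> x \<otimes> e i)) \<in> P"
    using inj_on_image_mem_iff[OF inj tL, of "P \<inter> L"] by blast
  moreover have "(\<Oplus>i\<in>{..<d}. coord i (x \<otimes> x \<otimes> e i)) \<noteq> \<zero>"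
    using nz \<psi>_zero_iff[OF Lc inj \<psi>1 hom L01(1) L01(1)] by auto
  ultimately show ?thesis by simp
qed

end

section \<open>An orthogonal basis for the normalized trace form\<close>

lemma additive_finsum:
  assumes "abelian_group G" "abelian_group H"
    and h: "\<And>x. x \<in> carrier G \<Longrightarrow> h x \<in> carrier H"
    and add: "\<And>x y. x \<in> carrier G \<Longrightarrow> y \<in> carrier G \<Longrightarrow> h (x \<oplus>\<^bsub>G\<^esub> y) = h x \<oplus>\<^bsub>H\<^esub> h y"
    and "finite I" "f \<in> I \<rightarrow> carrier G"
  shows "h (\<Oplus>\<^bsub>G\<^esub>i\<in>I. f i) = (\<Oplus>\<^bsub>H\<^esub>i\<in>I. h (f i))"
proof -
  interpret G: abelian_group G by fact
  interpret H: abelian_group H by fact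
  have "h \<zero>\<^bsub>G\<^esub> \<oplus>\<^bsub>H\<^esub> h \<zero>\<^bsub>G\<^esub> = h \<zero>\<^bsub>G\<^esub> \<oplus>\<^bsub>H\<^esub> \<zero>\<^bsub>H\<^esub>"
    using add[of "\<zero>\<^bsub>G\<^esub>" "\<zero>\<^bsub>G\<^esub>"] h[of "\<zero>\<^bsub>G\<^esub>"] by simp
  then have h0: "h \<zero>\<^bsub>G\<^esub> = \<zero>\<^bsub>H\<^esub>"
    using H.add.l_cancel[of "h \<zero>\<^bsub>G\<^esub>" "h \<zero>\<^bsub>G\<^esub>" "\<zero>\<^bsub>H\<^esub>"] h[of "\<zero>\<^bsub>G\<^esub>"] by simp
  show ?thesis using assms(5,6)
  proof (induction I rule: finite_induct)
    case (insert i I)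
    then have "f \<in> I \<rightarrow> carrier G" "f i \<in> carrier G" by auto
    moreover from this have "(\<lambda>i. h (f i)) \<in> I \<rightarrow> carrier H" using h by auto
    ultimately show ?case using insert h add by (simp add: G.finsum_insert H.finsum_insert)
  qed (simp add: h0)
qed

lemma (in ring) finsum_single:
  assumes "finite I" "i \<in> I" "f i \<in> carrier R" "\<And>j. j \<in> I \<Longrightarrow> j \<noteq> i \<Longrightarrow> f j = \<zero>"
  shows "(\<Oplus>j\<in>I. f j) = f i"
proof -
  have f: "f \<in> I \<rightarrow> carrier R"
  proof
    fix j assume "j \<in> I"
    then show "f j \<in> carrier R" using assms(3,4) by (cases "j = i") auto
  qed
  have "(\<Oplus>j\<in>I. f j) = (\<Oplus>j\<in>I. if i = j then f j else \<zero>)"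
    by (intro finsum_cong') (use assms(4) f in auto)
  also have "\<dots> = f i" using assms(1,2) f by (intro finsum_singleton) auto
  finally show ?thesis .
qed

locale linear_functional = field R for R (structure) +
  fixes F :: "'a set" and t :: "'a \<Rightarrow> 'a"
  assumes F: "subfield F R"
    and t_in: "x \<in> carrier R \<Longrightarrow> t x \<in> F"
    and t_add: "x \<in> carrier R \<Longrightarrow> y \<in> carrier R \<Longrightarrow> t (x \<oplus> y) = t x \<oplus> t y"
    and t_smult: "a \<in> F \<Longrightarrow> x \<in> carrier R \<Longrightarrow> t (a \<otimes> x) = a \<otimes> t x"
begin

lemma Fcar: "x \<in> F \<Longrightarrow> x \<in> carrier R"
  by (rule subfield_carrier[OF F])

lemma t_car: "x \<in> carrier R \<Longrightarrow> t x \<in> carrier R"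
  using t_in Fcar by blast

lemma t_finsum: "f \<in> I \<rightarrow> carrier R \<Longrightarrow> finite I \<Longrightarrow> t (\<Oplus>i\<in>I. f i) = (\<Oplus>i\<in>I. t (f i))"
  by (rule additive_finsum[OF abelian_group_axioms abelian_group_axioms]) (auto simp: t_car t_add)

lemma t_zero: "t \<zero> = \<zero>"
  using t_finsum[of _ "{}"] by simp

lemma t_minus: "x \<in> carrier R \<Longrightarrow> y \<in> carrier R \<Longrightarrow> t (x \<ominus> y) = t x \<ominus> t y"
proof -
  assume x: "x \<in> carrier R" "y \<in> carrier R"
  have "t (\<ominus> y) \<oplus> t y = \<zero>" using t_add[of "\<ominus> y" y] x t_zero by (simp add: l_neg)
  then have "\<ominus> t y = t (\<ominus> y)" using x by (intro minus_equality) (auto simp: t_car)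
  then show ?thesis using x t_add[of x "\<ominus> y"] by (simp add: a_minus_def)
qed

end

text \<open>The functional is the trace divided by the trace of \<open>1\<close>.  The latter is the trace of a square, hence
  positive at every ordering \<open>P\<close>, and so is its inverse.\<close>

theorem (in field) normalized_trace_functional:
  assumes F: "subfield F R" and dim: "dimension d F (carrier R)"
    and real: "field_ordering (R\<lparr>carrier := F\<rparr>) P0"
    and card: "\<And>P. field_ordering (R\<lparr>carrier := F\<rparr>) P \<Longrightarrow> card {Q. field_ordering R Q \<and> Q \<inter> F = P} = d"
  shows "\<exists>t. linear_functional R F t \<and> t \<one> = \<one> \<and> (\<forall>x\<in>carrier R. x \<noteq> \<zero> \<longrightarrow> t (x \<otimes> x) \<noteq> \<zero>) \<and>
    (\<forall>x\<in>carrier R. sum_of_squares (R\<lparr>carrier := F\<rparr>) (t (x \<otimes> x)))"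
proof -
  interpret S: field "R\<lparr>carrier := F\<rparr>" by (rule subfield_is_field[OF F])
  note Fc = subfield_closed[OF F] and Fs = subfield_subset[OF F] and Fcar = subfield_carrier[OF F]
  obtain e coord where d: "d > 0" and e': "\<forall>i<d. e i \<in> carrier R"
    and coord': "\<forall>x\<in>carrier R. \<forall>i. coord i x \<in> F"
    and expand': "\<forall>x\<in>carrier R. x = (\<Oplus>i\<in>{..<d}. coord i x \<otimes> e i)"
    and coord_add': "\<forall>x\<in>carrier R. \<forall>y\<in>carrier R. \<forall>i. coord i (x \<oplus> y) = coord i x \<oplus> coord i y"
    and coord_smult': "\<forall>a\<in>F. \<forall>x\<in>carrier R. \<forall>i. coord i (a \<otimes> x) = a \<otimes> coord i x"
    using linear_coordinates[OF F dim] by (elim exE conjE) (rule that)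
  have e: "\<And>i. i < d \<Longrightarrow> e i \<in> carrier R"
    and coord: "\<And>x i. x \<in> carrier R \<Longrightarrow> coord i x \<in> F"
    and coord_add: "\<And>x y i. x \<in> carrier R \<Longrightarrow> y \<in> carrier R \<Longrightarrow> coord i (x \<oplus> y) = coord i x \<oplus> coord i y"
    and coord_smult: "\<And>a x i. a \<in> F \<Longrightarrow> x \<in> carrier R \<Longrightarrow> coord i (a \<otimes> x) = a \<otimes> coord i x"
    using e' coord' coord_add' coord_smult' by simp_all
  have expand: "\<And>x. x \<in> carrier R \<Longrightarrow> x = (\<Oplus>i\<in>{..<d}. coord i x \<otimes> e i)"
    by (rule bspec[OF expand'])
  define tr where "tr x = (\<Oplus>i\<in>{..<d}. coord i (x \<otimes> e i))" for x
  have cc: "coord i x \<in> carrier R" if "x \<in> carrier R" for i x using coord[OF that] Fcar by blast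
  have fc: "(\<lambda>i. coord i (x \<otimes> e i)) \<in> {..<d} \<rightarrow> carrier R" if "x \<in> carrier R" for x
    using that e cc by auto
  have Fsum: "finsum R f I \<in> F" if "finite I" "f \<in> I \<rightarrow> F" for f :: "nat \<Rightarrow> 'a" and I
    using that
  proof (induction I rule: finite_induct)
    case (insert i I)
    then have "f i \<in> F" "f \<in> I \<rightarrow> carrier R" using Fs by auto
    with insert show ?case by (simp add: finsum_insert Fc Fcar)
  qed (simp add: Fc)
  have trF: "tr x \<in> F" if "x \<in> carrier R" for x
    unfolding tr_def using that e coord by (intro Fsum) auto
  have tr_add: "tr (x \<oplus> y) = tr x \<oplus> tr y" if x: "x \<in> carrier R" and y: "y \<in> carrier R" for x y
  proof -
    have "tr (x \<oplus> y) = (\<Oplus>i\<in>{..<d}. coord i (x \<otimes> e i) \<oplus> coord i (y \<otimes> e i))"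
      unfolding tr_def using x y e fc by (intro finsum_cong') (auto simp: l_distr coord_add cc)
    also have "\<dots> = tr x \<oplus> tr y" unfolding tr_def using fc[OF x] fc[OF y] by (rule finsum_addf)
    finally show ?thesis .
  qed
  have tr_smult: "tr (a \<otimes> x) = a \<otimes> tr x" if a: "a \<in> F" and x: "x \<in> carrier R" for a x
  proof -
    have "tr (a \<otimes> x) = (\<Oplus>i\<in>{..<d}. a \<otimes> coord i (x \<otimes> e i))"
      unfolding tr_def using x e Fcar[OF a] coord_smult[OF a] fc[OF x]
      by (intro finsum_cong') (auto simp: m_assoc cc)
    also have "\<dots> = a \<otimes> tr x" unfolding tr_def using Fcar[OF a] fc[OF x] by (simp add: finsum_rdistr)
    finally show ?thesis .
  qed
  have pos: "tr (x \<otimes> x) \<in> P - {\<zero>}" if "field_ordering (R\<lparr>carrier := F\<rparr>) P" "x \<in> carrier R" "x \<noteq> \<zero>" for P x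
    unfolding tr_def by (rule trace_form_positive[OF F that(1) card[OF that(1)] d e coord expand that(2,3)])
  define c where "c = inv (tr \<one>)"
  have tr1: "tr \<one> \<in> F" "tr \<one> \<noteq> \<zero>" using trF pos[OF real one_closed one_not_zero] by auto
  have tr1P: "tr \<one> \<in> P" if "field_ordering (R\<lparr>carrier := F\<rparr>) P" for P
    using pos[OF that one_closed one_not_zero] by simp
  have c: "c \<in> F" "c \<otimes> tr \<one> = \<one>" "c \<noteq> \<zero>"
    using subfield_inv[OF F tr1] field_Units tr1 Fcar[OF tr1(1)] one_not_zero by (auto simp: c_def)
  have cP: "c \<in> P" if P: "field_ordering (R\<lparr>carrier := F\<rparr>) P" for P
  proof -
    have "c \<otimes> c \<in> P" using S.field_ordering_square[OF P, of c] c(1) by simp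
    then have "tr \<one> \<otimes> (c \<otimes> c) \<in> P" using tr1P[OF P] subfield_ordering(3)[OF F P] by blast
    moreover have "tr \<one> \<otimes> (c \<otimes> c) = (c \<otimes> tr \<one>) \<otimes> c" using Fcar[OF c(1)] Fcar[OF tr1(1)] by (simp add: m_ac del: c)
    ultimately show ?thesis using c Fcar[OF c(1)] by simp
  qed
  define t where "t x = c \<otimes> tr x" for x
  have "linear_functional R F t"
  proof (intro linear_functional.intro linear_functional_axioms.intro field_axioms F)
    fix x assume x: "x \<in> carrier R"
    note cc = Fcar[OF c(1)] Fcar[OF trF[OF x]]
    show "t x \<in> F" unfolding t_def by (rule Fc(4)[OF c(1) trF[OF x]])
    show "t (x \<oplus> y) = t x \<oplus> t y" if "y \<in> carrier R" for y
      using cc Fcar[OF trF[OF that]] by (simp add: t_def tr_add x that r_distr)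
    show "t (a \<otimes> x) = a \<otimes> t x" if "a \<in> F" for a
      unfolding t_def tr_smult[OF that x] using cc Fcar[OF that] by (simp add: m_lcomm)
  qed
  moreover have "t \<one> = \<one>" by (simp add: t_def c)
  moreover have "t (x \<otimes> x) \<noteq> \<zero>" if "x \<in> carrier R" "x \<noteq> \<zero>" for x
    using pos[OF real that] c Fcar trF that unfolding t_def by (auto simp: integral_iff)
  moreover have "sum_of_squares (R\<lparr>carrier := F\<rparr>) (t (x \<otimes> x))" if x: "x \<in> carrier R" for x
  proof (rule S.artin[OF real])
    show "t (x \<otimes> x) \<in> carrier (R\<lparr>carrier := F\<rparr>)"
      using x c(1) trF Fc by (simp add: t_def)
    fix P assume P: "field_ordering (R\<lparr>carrier := F\<rparr>) P"
    show "t (x \<otimes> x) \<in> P"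
    proof (cases "x = \<zero>")
      case True
      have "tr \<zero> = \<zero>" using tr_smult[of \<zero> \<one>] Fc Fcar[OF tr1(1)] by simp
      then have "t (x \<otimes> x) = \<zero>" using True Fcar[OF c(1)] by (simp add: t_def)
      then show ?thesis using S.field_ordering_square[OF P, of \<zero>] Fc by simp
    next
      case False
      then show ?thesis using pos[OF P x] cP[OF P] subfield_ordering(3)[OF F P] by (simp add: t_def)
    qed
  qed
  ultimately show ?thesis by blast
qed

locale anisotropic_functional = linear_functional +
  assumes anisotropic: "x \<in> carrier R \<Longrightarrow> x \<noteq> \<zero> \<Longrightarrow> t (x \<otimes> x) \<noteq> \<zero>"
begin

text \<open>The value \<open>0\<close> at the zero vector lets the orthogonalization run over families that may contain zero
  vectors.\<close>

definition weight :: "'a \<Rightarrow> 'a" where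
  "weight x = (if x = \<zero> then \<zero> else inv (t (x \<otimes> x)))"

lemma weight_F: "x \<in> carrier R \<Longrightarrow> weight x \<in> F"
  using subfield_inv[OF F t_in] anisotropic subfield_closed[OF F] by (auto simp: weight_def)

lemma weight_inverse: "x \<in> carrier R \<Longrightarrow> x \<noteq> \<zero> \<Longrightarrow> weight x \<otimes> t (x \<otimes> x) = \<one>"
  using anisotropic[of x] t_car[of "x \<otimes> x"] field_Units by (simp add: weight_def)

text \<open>The orthogonal projection to the span of \<open>u 0, \<dots>, u (n - 1)\<close>.\<close>

definition proj :: "(nat \<Rightarrow> 'a) \<Rightarrow> nat \<Rightarrow> 'a \<Rightarrow> 'a" where
  "proj u n x = (\<Oplus>i\<in>{..<n}. (weight (u i) \<otimes> t (x \<otimes> u i)) \<otimes> u i)"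

definition orthogonal :: "(nat \<Rightarrow> 'a) \<Rightarrow> nat \<Rightarrow> bool" where
  "orthogonal u n \<longleftrightarrow> (\<forall>i<n. u i \<in> carrier R) \<and> (\<forall>i<n. \<forall>j<n. i \<noteq> j \<longrightarrow> t (u i \<otimes> u j) = \<zero>)"

context
  fixes u n assumes u: "orthogonal u n"
begin

lemma u_car: "i < n \<Longrightarrow> u i \<in> carrier R"
  using u by (simp add: orthogonal_def)

lemma coeff_car: "x \<in> carrier R \<Longrightarrow> i < n \<Longrightarrow> weight (u i) \<otimes> t (x \<otimes> u i) \<in> F"
  using weight_F t_in u_car subfield_closed(4)[OF F] by simp

lemma terms_car: "x \<in> carrier R \<Longrightarrow> (\<lambda>i. (weight (u i) \<otimes> t (x \<otimes> u i)) \<otimes> u i) \<in> {..<n} \<rightarrow> carrier R"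
  by (intro funcsetI m_closed[OF Fcar[OF coeff_car]] u_car) auto

lemma proj_car: "x \<in> carrier R \<Longrightarrow> proj u n x \<in> carrier R"
  unfolding proj_def using terms_car by (rule finsum_closed)

lemma proj_add:
  assumes x: "x \<in> carrier R" and y: "y \<in> carrier R"
  shows "proj u n (x \<oplus> y) = proj u n x \<oplus> proj u n y"
proof -
  have "proj u n (x \<oplus> y) = (\<Oplus>i\<in>{..<n}. (weight (u i) \<otimes> t (x \<otimes> u i)) \<otimes> u i \<oplus> (weight (u i) \<otimes> t (y \<otimes> u i)) \<otimes> u i)"
    unfolding proj_def
  proof (intro finsum_cong')
    fix i assume "i \<in> {..<n}"
    then have i: "u i \<in> carrier R" "weight (u i) \<in> carrier R" using u_car weight_F Fcar by auto
    show "(weight (u i) \<otimes> t ((x \<oplus> y) \<otimes> u i)) \<otimes> u i =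
      (weight (u i) \<otimes> t (x \<otimes> u i)) \<otimes> u i \<oplus> (weight (u i) \<otimes> t (y \<otimes> u i)) \<otimes> u i"
      using i x y t_car by (simp add: l_distr t_add r_distr)
  qed (use terms_car[OF x] terms_car[OF y] in auto)
  also have "\<dots> = proj u n x \<oplus> proj u n y"
    unfolding proj_def using terms_car[OF x] terms_car[OF y] by (rule finsum_addf)
  finally show ?thesis .
qed

lemma proj_smult:
  assumes a: "a \<in> F" and x: "x \<in> carrier R"
  shows "proj u n (a \<otimes> x) = a \<otimes> proj u n x"
proof -
  have "proj u n (a \<otimes> x) = (\<Oplus>i\<in>{..<n}. a \<otimes> ((weight (u i) \<otimes> t (x \<otimes> u i)) \<otimes> u i))"
    unfolding proj_def
  proof (intro finsum_cong')
    fix i assume "i \<in> {..<n}"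
    then have i: "u i \<in> carrier R" "weight (u i) \<in> carrier R" using u_car weight_F Fcar by auto
    have "t ((a \<otimes> x) \<otimes> u i) = a \<otimes> t (x \<otimes> u i)" using i x Fcar[OF a] t_smult[OF a] by (simp add: m_assoc)
    then show "(weight (u i) \<otimes> t ((a \<otimes> x) \<otimes> u i)) \<otimes> u i = a \<otimes> ((weight (u i) \<otimes> t (x \<otimes> u i)) \<otimes> u i)"
      using i x Fcar[OF a] t_car by (simp add: m_ac)
  qed (use terms_car[OF x] Fcar[OF a] in auto)
  also have "\<dots> = a \<otimes> proj u n x"
    unfolding proj_def using terms_car[OF x] Fcar[OF a] by (simp add: finsum_rdistr)
  finally show ?thesis .
qed

lemma t_proj_mult:
  assumes x: "x \<in> carrier R" and v: "v \<in> carrier R"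
  shows "t (proj u n x \<otimes> v) = (\<Oplus>i\<in>{..<n}. (weight (u i) \<otimes> t (x \<otimes> u i)) \<otimes> t (u i \<otimes> v))"
proof -
  have "proj u n x \<otimes> v = (\<Oplus>i\<in>{..<n}. ((weight (u i) \<otimes> t (x \<otimes> u i)) \<otimes> u i) \<otimes> v)"
    unfolding proj_def using terms_car[OF x] v by (simp add: finsum_ldistr)
  then have "t (proj u n x \<otimes> v) = (\<Oplus>i\<in>{..<n}. t (((weight (u i) \<otimes> t (x \<otimes> u i)) \<otimes> u i) \<otimes> v))"
    using terms_car[OF x] v by (subst t_finsum[symmetric]) (auto simp: Pi_iff)
  also have "\<dots> = (\<Oplus>i\<in>{..<n}. (weight (u i) \<otimes> t (x \<otimes> u i)) \<otimes> t (u i \<otimes> v))"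
  proof (intro finsum_cong')
    fix i assume "i \<in> {..<n}"
    then have i: "u i \<in> carrier R" "weight (u i) \<otimes> t (x \<otimes> u i) \<in> F" using u_car coeff_car[OF x] by auto
    then show "t (((weight (u i) \<otimes> t (x \<otimes> u i)) \<otimes> u i) \<otimes> v) = (weight (u i) \<otimes> t (x \<otimes> u i)) \<otimes> t (u i \<otimes> v)"
      using v Fcar t_smult[OF i(2), of "u i \<otimes> v"] by (simp add: m_assoc)
  qed (use v u_car coeff_car[OF x] Fcar t_car in auto)
  finally show ?thesis .
qed

lemma t_proj_mult_member:
  assumes x: "x \<in> carrier R" and k: "k < n"
  shows "t (proj u n x \<otimes> u k) = t (x \<otimes> u k)"
proof -
  have "t (proj u n x \<otimes> u k) = (weight (u k) \<otimes> t (x \<otimes> u k)) \<otimes> t (u k \<otimes> u k)"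
    unfolding t_proj_mult[OF x u_car[OF k]]
    by (rule finsum_single)
      (use u k coeff_car[OF x] Fcar t_car u_car in \<open>auto simp: orthogonal_def\<close>)
  also have "\<dots> = t (x \<otimes> u k)"
  proof (cases "u k = \<zero>")
    case True
    then show ?thesis using x t_zero weight_F[OF u_car[OF k]] Fcar by simp
  next
    case False
    have "(weight (u k) \<otimes> t (x \<otimes> u k)) \<otimes> t (u k \<otimes> u k) = (weight (u k) \<otimes> t (u k \<otimes> u k)) \<otimes> t (x \<otimes> u k)"
      using x u_car[OF k] weight_F[OF u_car[OF k]] Fcar t_car by (simp add: m_ac)
    then show ?thesis using weight_inverse[OF u_car[OF k] False] x u_car[OF k] t_car by simp
  qed
  finally show ?thesis .
qed

end

text \<open>The span of the family is not mentioned; what is tracked instead are the elements that the projection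
  fixes.\<close>

lemma gram_schmidt_step:
  assumes u: "orthogonal u n" and e: "e \<in> carrier R"
  defines "u' \<equiv> u(n := e \<ominus> proj u n e)"
  shows "orthogonal u' (Suc n)" and "proj u' (Suc n) e = e"
    and "\<And>x. x \<in> carrier R \<Longrightarrow> proj u n x = x \<Longrightarrow> proj u' (Suc n) x = x"
proof -
  define v where "v = e \<ominus> proj u n e"
  have v: "v \<in> carrier R" using e proj_car[OF u e] by (simp add: v_def)
  have vu: "t (v \<otimes> u k) = \<zero>" "t (u k \<otimes> v) = \<zero>" if k: "k < n" for k
  proof -
    have "v \<otimes> u k = e \<otimes> u k \<ominus> proj u n e \<otimes> u k"
      using e proj_car[OF u e] u_car[OF u k] by (simp add: v_def a_minus_def l_distr l_minus)
    then have "t (v \<otimes> u k) = t (e \<otimes> u k) \<ominus> t (proj u n e \<otimes> u k)"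
      using t_minus e proj_car[OF u e] u_car[OF u k] by simp
    then show "t (v \<otimes> u k) = \<zero>"
      using t_proj_mult_member[OF u e k] t_car e u_car[OF u k] by (simp add: a_minus_def r_neg)
    then show "t (u k \<otimes> v) = \<zero>" using v u_car[OF u k] by (simp add: m_comm)
  qed
  have u'n: "u' n = v" and u'i: "\<And>i. i < n \<Longrightarrow> u' i = u i" by (auto simp: u'_def v_def)
  show orth: "orthogonal u' (Suc n)"
    unfolding orthogonal_def using u v vu by (auto simp: less_Suc_eq u'n u'i orthogonal_def)
  have Suc: "proj u' (Suc n) x = (weight v \<otimes> t (x \<otimes> v)) \<otimes> v \<oplus> proj u n x" if x: "x \<in> carrier R" for x
  proof -
    have "proj u' (Suc n) x = (weight (u' n) \<otimes> t (x \<otimes> u' n)) \<otimes> u' n \<oplus> (\<Oplus>i\<in>{..<n}. (weight (u' i) \<otimes> t (x \<otimes> u' i)) \<otimes> u' i)"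
      unfolding proj_def lessThan_Suc using terms_car[OF orth x] by (subst finsum_insert) (auto simp: Pi_iff)
    also have "(\<Oplus>i\<in>{..<n}. (weight (u' i) \<otimes> t (x \<otimes> u' i)) \<otimes> u' i) = proj u n x"
      unfolding proj_def using terms_car[OF u x] by (intro finsum_cong') (auto simp: u'i)
    finally show ?thesis by (simp add: u'n)
  qed
  have zero: "t (proj u n x \<otimes> v) = \<zero>" if x: "x \<in> carrier R" for x
    unfolding t_proj_mult[OF u x v]
  proof -
    have "(\<Oplus>i\<in>{..<n}. (weight (u i) \<otimes> t (x \<otimes> u i)) \<otimes> t (u i \<otimes> v)) = (\<Oplus>i\<in>{..<n}. \<zero>)"
      using vu coeff_car[OF u x] Fcar by (intro finsum_cong') auto
    then show "(\<Oplus>i\<in>{..<n}. (weight (u i) \<otimes> t (x \<otimes> u i)) \<otimes> t (u i \<otimes> v)) = \<zero>" by simp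
  qed
  show "proj u' (Suc n) x = x" if x: "x \<in> carrier R" and px: "proj u n x = x" for x
  proof -
    have "t (x \<otimes> v) = \<zero>" using zero[OF x] px by simp
    then show ?thesis using Suc[OF x] px x v weight_F[OF v] Fcar by simp
  qed
  have ev: "e = v \<oplus> proj u n e"
    using e proj_car[OF u e] by (simp add: v_def a_minus_def a_assoc l_neg)
  have "t (e \<otimes> v) = t (v \<otimes> v \<oplus> proj u n e \<otimes> v)"
    using e v proj_car[OF u e] by (subst ev) (simp add: l_distr)
  also have "\<dots> = t (v \<otimes> v)"
    using zero[OF e] v proj_car[OF u e] t_car by (simp add: t_add)
  finally have tv: "t (e \<otimes> v) = t (v \<otimes> v)" .
  have "(weight v \<otimes> t (e \<otimes> v)) \<otimes> v = v"
    using weight_inverse[OF v] weight_F[OF v] Fcar t_car v unfolding tv by (cases "v = \<zero>") auto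
  then show "proj u' (Suc n) e = e" using Suc[OF e] ev by simp
qed

lemma orthogonal_family:
  assumes e: "\<And>i. i < Suc n \<Longrightarrow> e i \<in> carrier R"
  shows "\<exists>u. u 0 = e 0 \<and> orthogonal u (Suc n) \<and> (\<forall>i<Suc n. proj u (Suc n) (e i) = e i)"
  using assms
proof (induction n)
  case 0
  have o: "orthogonal u 0" for u :: "nat \<Rightarrow> 'a" by (simp add: orthogonal_def)
  have p: "proj u 0 x = \<zero>" for u x by (simp add: proj_def)
  define u where "u = (\<lambda>_::nat. \<zero>)(0 := e 0 \<ominus> proj (\<lambda>_. \<zero>) 0 (e 0))"
  have "orthogonal u (Suc 0)" "proj u (Suc 0) (e 0) = e 0"
    unfolding u_def by (rule gram_schmidt_step[OF o], use 0[of 0] in simp)+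
  moreover have "u 0 = e 0" using 0[of 0] by (simp add: u_def p a_minus_def)
  ultimately show ?case by (intro exI[of _ u]) auto
next
  case (Suc n)
  then obtain u where u: "u 0 = e 0" "orthogonal u (Suc n)" "\<And>i. i < Suc n \<Longrightarrow> proj u (Suc n) (e i) = e i"
    by (metis less_Suc_eq)
  have en: "e (Suc n) \<in> carrier R" using Suc.prems by simp
  let ?u = "u(Suc n := e (Suc n) \<ominus> proj u (Suc n) (e (Suc n)))"
  have "proj ?u (Suc (Suc n)) (e i) = e i" if "i < Suc (Suc n)" for i
  proof (cases "i = Suc n")
    case False
    then have "i < Suc n" using that by simp
    then show ?thesis using gram_schmidt_step(3)[OF u(2) en Suc.prems[OF that] u(3)] by blast
  qed (use gram_schmidt_step(2)[OF u(2) en] in simp)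
  moreover have "?u 0 = e 0" using u(1) by simp
  ultimately show ?case using gram_schmidt_step(1)[OF u(2) en] by blast
qed

end

text \<open>The functions \<open>coord i\<close> are the coordinates in the orthogonal basis \<open>u\<close>.\<close>

locale orthogonal_functional = linear_functional +
  fixes d :: nat and u :: "nat \<Rightarrow> 'a" and coord :: "nat \<Rightarrow> 'a \<Rightarrow> 'a"
  assumes d: "d > 0" and u_in: "i < d \<Longrightarrow> u i \<in> carrier R" and u_0: "u 0 = \<one>" and t_one: "t \<one> = \<one>"
    and t_orth: "i < d \<Longrightarrow> j < d \<Longrightarrow> i \<noteq> j \<Longrightarrow> t (u i \<otimes> u j) = \<zero>"
    and t_sos: "i < d \<Longrightarrow> sum_of_squares (R\<lparr>carrier := F\<rparr>) (t (u i \<otimes> u i))"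
    and coord_lin: "i < d \<Longrightarrow> linear_functional R F (coord i)"
    and expand: "x \<in> carrier R \<Longrightarrow> x = (\<Oplus>i\<in>{..<d}. coord i x \<otimes> u i)"

theorem (in field) orthogonal_functional_exists:
  assumes F: "subfield F R" and dim: "dimension d F (carrier R)"
    and real: "field_ordering (R\<lparr>carrier := F\<rparr>) P0"
    and card: "\<And>P. field_ordering (R\<lparr>carrier := F\<rparr>) P \<Longrightarrow> card {Q. field_ordering R Q \<and> Q \<inter> F = P} = d"
  shows "\<exists>t u coord. orthogonal_functional R F t d u coord"
proof -
  obtain t where "linear_functional R F t" and t1: "t \<one> = \<one>" and nz: "\<And>x. x \<in> carrier R \<Longrightarrow> x \<noteq> \<zero> \<Longrightarrow> t (x \<otimes> x) \<noteq> \<zero>"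
    and sos: "\<And>x. x \<in> carrier R \<Longrightarrow> sum_of_squares (R\<lparr>carrier := F\<rparr>) (t (x \<otimes> x))"
    using normalized_trace_functional[OF F dim real card] by blast
  interpret linear_functional R F t by fact
  interpret anisotropic_functional R F t by unfold_locales (rule nz)
  obtain e c where e0: "e 0 = \<one>" and d: "d > 0" and e': "\<forall>i<d. e i \<in> carrier R"
    and c': "\<forall>x\<in>carrier R. \<forall>i. c i x \<in> F"
    and expand': "\<forall>x\<in>carrier R. x = (\<Oplus>i\<in>{..<d}. c i x \<otimes> e i)"
    using linear_coordinates[OF F dim] by (elim exE conjE) (rule that)
  have e: "\<And>i. i < d \<Longrightarrow> e i \<in> carrier R" and c: "\<And>x i. x \<in> carrier R \<Longrightarrow> c i x \<in> F"
    using e' c' by simp_all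
  have expand: "\<And>x. x \<in> carrier R \<Longrightarrow> x = (\<Oplus>i\<in>{..<d}. c i x \<otimes> e i)"
    by (rule bspec[OF expand'])
  obtain n where n: "d = Suc n" using d gr0_implies_Suc by blast
  obtain u where u0: "u 0 = e 0" and orth: "orthogonal u d" and pe: "\<And>i. i < d \<Longrightarrow> proj u d (e i) = e i"
    using orthogonal_family[of n e] e unfolding n by blast
  have uc: "u i \<in> carrier R" if "i < d" for i using orth that by (simp add: orthogonal_def)
  have p: "proj u d x = x" if x: "x \<in> carrier R" for x
  proof -
    have terms: "(\<lambda>i. c i x \<otimes> e i) \<in> {..<d} \<rightarrow> carrier R" using e c[OF x] Fcar by auto
    have "proj u d x = (\<Oplus>i\<in>{..<d}. proj u d (c i x \<otimes> e i))"
      by (subst expand[OF x], rule additive_finsum[OF abelian_group_axioms abelian_group_axioms])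
        (use proj_car[OF orth] proj_add[OF orth] terms in auto)
    also have "\<dots> = (\<Oplus>i\<in>{..<d}. c i x \<otimes> e i)"
      using terms e c[OF x] pe by (intro finsum_cong') (auto simp: proj_smult[OF orth])
    finally show ?thesis using expand[OF x] by simp
  qed
  define coord where "coord i x = weight (u i) \<otimes> t (x \<otimes> u i)" for i x
  have "linear_functional R F (coord i)" if i: "i < d" for i
  proof (intro linear_functional.intro linear_functional_axioms.intro field_axioms F)
    have w: "weight (u i) \<in> F" "weight (u i) \<in> carrier R" using weight_F[OF uc[OF i]] Fcar by auto
    fix x assume x: "x \<in> carrier R"
    show "coord i x \<in> F" using coeff_car[OF orth x i] by (simp add: coord_def)
    show "coord i (x \<oplus> y) = coord i x \<oplus> coord i y" if "y \<in> carrier R" for y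
      using that x uc[OF i] w t_car by (simp add: coord_def l_distr t_add r_distr)
    show "coord i (a \<otimes> x) = a \<otimes> coord i x" if a: "a \<in> F" for a
    proof -
      have "(a \<otimes> x) \<otimes> u i = a \<otimes> (x \<otimes> u i)" using x uc[OF i] Fcar[OF a] by (simp add: m_assoc)
      then have "t ((a \<otimes> x) \<otimes> u i) = a \<otimes> t (x \<otimes> u i)" using t_smult[OF a] x uc[OF i] by simp
      then show ?thesis using w(2) Fcar[OF a] t_car x uc[OF i] by (simp add: coord_def m_lcomm)
    qed
  qed
  moreover have "x = (\<Oplus>i\<in>{..<d}. coord i x \<otimes> u i)" if "x \<in> carrier R" for x
    using p[OF that] by (simp add: proj_def coord_def)
  ultimately have "orthogonal_functional R F t d u coord"
    using d uc u0 e0 t1 sos orth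
    by (intro orthogonal_functional.intro[OF linear_functional_axioms] orthogonal_functional_axioms.intro)
      (simp_all add: orthogonal_def)
  then show ?thesis by blast
qed

section \<open>Coordinates in the base change of an algebra\<close>

lemma (in abelian_group) finsum_swap:
  assumes "finite I" "finite J" "\<And>i j. i \<in> I \<Longrightarrow> j \<in> J \<Longrightarrow> f i j \<in> carrier G"
  shows "(\<Oplus>i\<in>I. \<Oplus>j\<in>J. f i j) = (\<Oplus>j\<in>J. \<Oplus>i\<in>I. f i j)"
  using assms(1,3)
proof (induction I rule: finite_induct)
  case (insert k I)
  have c: "(\<lambda>i. \<Oplus>j\<in>J. f i j) \<in> I \<rightarrow> carrier G" "(\<Oplus>j\<in>J. f k j) \<in> carrier G"
    using insert.prems by (auto intro!: finsum_closed)
  have c': "(\<lambda>j. f k j) \<in> J \<rightarrow> carrier G" "(\<lambda>j. \<Oplus>i\<in>I. f i j) \<in> J \<rightarrow> carrier G"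
    using insert.prems by (auto intro!: finsum_closed)
  have "(\<Oplus>i\<in>insert k I. \<Oplus>j\<in>J. f i j) = (\<Oplus>j\<in>J. f k j) \<oplus> (\<Oplus>j\<in>J. \<Oplus>i\<in>I. f i j)"
    using insert c by (simp add: finsum_insert)
  also have "\<dots> = (\<Oplus>j\<in>J. f k j \<oplus> (\<Oplus>i\<in>I. f i j))"
    using c' by (rule finsum_addf[symmetric])
  also have "\<dots> = (\<Oplus>j\<in>J. \<Oplus>i\<in>insert k I. f i j)"
    using insert by (intro finsum_cong') (auto simp: finsum_insert intro!: finsum_closed)
  finally show ?case .
qed (simp add: finsum_zero)

locale base_change_setting = orthogonal_functional R F t d u coord + A: algebra "R\<lparr>carrier := F\<rparr>" A
  for R :: "('a, 'm) ring_scheme" (structure) and F t d u coord and A :: "('a, 'b, 'n) module_scheme"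
begin

abbreviation (input) "E \<equiv> extension_algebra R"
abbreviation (input) "FA \<equiv> free_Abelian_group (carrier A \<times> carrier R)"

lemma E_simps [simp]: "carrier E = carrier R" "x \<oplus>\<^bsub>E\<^esub> y = x \<oplus> y" "x \<otimes>\<^bsub>E\<^esub> y = x \<otimes> y"
    "\<one>\<^bsub>E\<^esub> = \<one>" "r \<odot>\<^bsub>E\<^esub> x = r \<otimes> x"
  by (simp_all add: extension_algebra_def)

sublocale AP: algebra_pair "R\<lparr>carrier := F\<rparr>" A E
  by (intro algebra_pair.intro A.algebra_axioms algebra_extension_algebra field_axioms F)

lemma smult_closed: "r \<in> F \<Longrightarrow> a \<in> carrier A \<Longrightarrow> r \<odot>\<^bsub>A\<^esub> a \<in> carrier A"
  using A.smult_closed by simp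

lemma smult_finsum_left:
  assumes "finite I" "f \<in> I \<rightarrow> F" "v \<in> carrier A"
  shows "(\<Oplus>i\<in>I. f i) \<in> F \<and> (\<Oplus>i\<in>I. f i) \<odot>\<^bsub>A\<^esub> v = (\<Oplus>\<^bsub>A\<^esub>i\<in>I. f i \<odot>\<^bsub>A\<^esub> v)"
  using assms(1,2)
proof (induction I rule: finite_induct)
  case empty
  then show ?case using A.smult_l_null[OF assms(3)] subfield_closed(1)[OF F] by simp
next
  case (insert i I)
  then have m: "f i \<in> F" "f \<in> I \<rightarrow> F" "f \<in> I \<rightarrow> carrier R" using Fcar by auto
  then have "(\<lambda>i. f i \<odot>\<^bsub>A\<^esub> v) \<in> I \<rightarrow> carrier A"
    using assms(3) by (intro funcsetI smult_closed) auto
  with m insert show ?case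
    using A.smult_l_distr[of "f i" "\<Oplus>i\<in>I. f i" v] assms(3) subfield_closed[OF F] Fcar smult_closed
    by (simp add: finsum_insert)
qed

text \<open>This is \<open>id \<otimes> \<mu>\<close> before passing to the quotient: the additive map on formal sums with \<open>a \<otimes> x \<mapsto> \<mu>(x) a\<close>.  The
  universal property of the free abelian group provides it.\<close>

definition contract :: "('a \<Rightarrow> 'a) \<Rightarrow> ('b \<times> 'a \<Rightarrow>\<^sub>0 int) \<Rightarrow> 'b" where
  "contract \<mu> = (SOME h. h \<in> hom FA (add_monoid A) \<and>
     (\<forall>a\<in>carrier A. \<forall>x\<in>carrier R. h (frag_of (a, x)) = \<mu> x \<odot>\<^bsub>A\<^esub> a))"

context
  fixes \<mu> assumes \<mu>: "linear_functional R F \<mu>"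
begin

lemma \<mu>_in: "x \<in> carrier R \<Longrightarrow> \<mu> x \<in> F"
  using linear_functional.t_in[OF \<mu>] .

lemma contract_hom: "contract \<mu> \<in> hom FA (add_monoid A)"
  and contract_of: "a \<in> carrier A \<Longrightarrow> x \<in> carrier R \<Longrightarrow> contract \<mu> (frag_of (a, x)) = \<mu> x \<odot>\<^bsub>A\<^esub> a"
proof -
  have "(\<lambda>(a, x). \<mu> x \<odot>\<^bsub>A\<^esub> a) ` (carrier A \<times> carrier R) \<subseteq> carrier (add_monoid A)"
    using smult_closed \<mu>_in by auto
  then obtain h where "h \<in> hom FA (add_monoid A)"
    "\<And>p. p \<in> carrier A \<times> carrier R \<Longrightarrow> h (frag_of p) = (\<lambda>(a, x). \<mu> x \<odot>\<^bsub>A\<^esub> a) p"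
    using comm_group.free_Abelian_group_universal[OF A.a_comm_group, of _ "carrier A \<times> carrier R"] by blast
  then have "\<exists>h. h \<in> hom FA (add_monoid A) \<and>
     (\<forall>a\<in>carrier A. \<forall>x\<in>carrier R. h (frag_of (a, x)) = \<mu> x \<odot>\<^bsub>A\<^esub> a)" by (intro exI[of _ h]) auto
  from someI_ex[OF this] show "contract \<mu> \<in> hom FA (add_monoid A)"
    "a \<in> carrier A \<Longrightarrow> x \<in> carrier R \<Longrightarrow> contract \<mu> (frag_of (a, x)) = \<mu> x \<odot>\<^bsub>A\<^esub> a"
    unfolding contract_def by blast+
qed

lemma contract_closed: "Poly_Mapping.keys v \<subseteq> carrier A \<times> carrier R \<Longrightarrow> contract \<mu> v \<in> carrier A"
  using contract_hom by (auto simp: hom_def Pi_iff)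

lemma contract_add:
  "Poly_Mapping.keys v \<subseteq> carrier A \<times> carrier R \<Longrightarrow> Poly_Mapping.keys w \<subseteq> carrier A \<times> carrier R \<Longrightarrow>
   contract \<mu> (v + w) = contract \<mu> v \<oplus>\<^bsub>A\<^esub> contract \<mu> w"
  using hom_mult[OF contract_hom, of v w] by simp

lemma contract_0: "contract \<mu> 0 = \<zero>\<^bsub>A\<^esub>"
  using contract_add[of 0 0] contract_closed[of 0] A.add.l_cancel[of "contract \<mu> 0" "contract \<mu> 0" "\<zero>\<^bsub>A\<^esub>"]
  by simp

lemma contract_uminus:
  assumes "Poly_Mapping.keys v \<subseteq> carrier A \<times> carrier R"
  shows "contract \<mu> (- v) = \<ominus>\<^bsub>A\<^esub> contract \<mu> v"
proof -
  have "contract \<mu> (- v) \<oplus>\<^bsub>A\<^esub> contract \<mu> v = \<zero>\<^bsub>A\<^esub>"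
    using contract_add[of "- v" v] assms contract_0 by simp
  then show ?thesis using assms contract_closed[of v] contract_closed[of "- v"]
    by (metis A.minus_equality keys_minus)
qed

lemma contract_diff:
  assumes "Poly_Mapping.keys v \<subseteq> carrier A \<times> carrier R" "Poly_Mapping.keys w \<subseteq> carrier A \<times> carrier R"
  shows "contract \<mu> (v - w) = contract \<mu> v \<ominus>\<^bsub>A\<^esub> contract \<mu> w"
  using contract_add[of v "- w"] contract_uminus[OF assms(2)] assms by (simp add: a_minus_def)

text \<open>All relators of the tensor product are respected because \<open>\<mu>\<close> is linear, so \<open>contract \<mu>\<close> descends to \<open>A \<otimes> K\<close>.\<close>

lemma contract_tensor_ideal:
  assumes "v \<in> tensor_ideal (R\<lparr>carrier := F\<rparr>) A E"
  shows "contract \<mu> v = \<zero>\<^bsub>A\<^esub>"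
proof -
  interpret M: linear_functional R F \<mu> by (rule \<mu>)
  interpret G: group FA by simp
  have rel: "contract \<mu> v = \<zero>\<^bsub>A\<^esub>" if v: "v \<in> tensor_relators (R\<lparr>carrier := F\<rparr>) A E" for v
  proof -
    from v consider
      (1) a a' b where "v = frag_of (a \<oplus>\<^bsub>A\<^esub> a', b) - frag_of (a, b) - frag_of (a', b)"
         "a \<in> carrier A" "a' \<in> carrier A" "b \<in> carrier R"
      | (2) a b b' where "v = frag_of (a, b \<oplus> b') - frag_of (a, b) - frag_of (a, b')"
         "a \<in> carrier A" "b \<in> carrier R" "b' \<in> carrier R"
      | (3) r a b where "v = frag_of (r \<odot>\<^bsub>A\<^esub> a, b) - frag_of (a, r \<otimes> b)"
         "r \<in> F" "a \<in> carrier A" "b \<in> carrier R"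
      unfolding tensor_relators_def by auto
    then show ?thesis
    proof cases
      case 1
      have m: "\<mu> b \<in> F" by (rule \<mu>_in[OF 1(4)])
      have s: "\<mu> b \<odot>\<^bsub>A\<^esub> (a \<oplus>\<^bsub>A\<^esub> a') = \<mu> b \<odot>\<^bsub>A\<^esub> a \<oplus>\<^bsub>A\<^esub> \<mu> b \<odot>\<^bsub>A\<^esub> a'"
        using A.smult_r_distr[of "\<mu> b" a a'] m 1 by simp
      have "v = frag_of (a \<oplus>\<^bsub>A\<^esub> a', b) - (frag_of (a, b) + frag_of (a', b))" by (simp add: 1)
      then have "contract \<mu> v = \<mu> b \<odot>\<^bsub>A\<^esub> (a \<oplus>\<^bsub>A\<^esub> a') \<ominus>\<^bsub>A\<^esub> (\<mu> b \<odot>\<^bsub>A\<^esub> a \<oplus>\<^bsub>A\<^esub> \<mu> b \<odot>\<^bsub>A\<^esub> a')"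
        using 1(2-4) by (simp add: contract_diff contract_add contract_of subset_trans[OF keys_add])
      then show ?thesis unfolding s using m 1 smult_closed by (simp add: a_minus_def A.r_neg)
    next
      case 2
      have m: "\<mu> b \<in> F" "\<mu> b' \<in> F" using \<mu>_in 2 by auto
      have s: "\<mu> (b \<oplus> b') \<odot>\<^bsub>A\<^esub> a = \<mu> b \<odot>\<^bsub>A\<^esub> a \<oplus>\<^bsub>A\<^esub> \<mu> b' \<odot>\<^bsub>A\<^esub> a"
        using A.smult_l_distr[of "\<mu> b" "\<mu> b'" a] m 2 M.t_add by simp
      have "v = frag_of (a, b \<oplus> b') - (frag_of (a, b) + frag_of (a, b'))" by (simp add: 2)
      then have "contract \<mu> v = \<mu> (b \<oplus> b') \<odot>\<^bsub>A\<^esub> a \<ominus>\<^bsub>A\<^esub> (\<mu> b \<odot>\<^bsub>A\<^esub> a \<oplus>\<^bsub>A\<^esub> \<mu> b' \<odot>\<^bsub>A\<^esub> a)"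
        using 2(2-4) by (simp add: contract_diff contract_add contract_of subset_trans[OF keys_add])
      then show ?thesis unfolding s using m 2 smult_closed by (simp add: a_minus_def A.r_neg)
    next
      case 3
      have m: "\<mu> b \<in> F" using \<mu>_in 3 by auto
      have s: "\<mu> (r \<otimes> b) \<odot>\<^bsub>A\<^esub> a = \<mu> b \<odot>\<^bsub>A\<^esub> (r \<odot>\<^bsub>A\<^esub> a)"
        using A.smult_assoc1[of "\<mu> b" r a] m 3(2,3) M.t_smult[OF 3(2,4)] m_comm[OF Fcar[OF m] Fcar[OF 3(2)]] by simp
      have "contract \<mu> v = \<mu> b \<odot>\<^bsub>A\<^esub> (r \<odot>\<^bsub>A\<^esub> a) \<ominus>\<^bsub>A\<^esub> \<mu> (r \<otimes> b) \<odot>\<^bsub>A\<^esub> a"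
        using 3 Fcar smult_closed by (simp add: contract_diff contract_of)
      then show ?thesis unfolding s using m 3 smult_closed by (simp add: a_minus_def A.r_neg)
    qed
  qed
  have keys: "Poly_Mapping.keys v \<subseteq> carrier A \<times> carrier R"
    if "v \<in> tensor_relators (R\<lparr>carrier := F\<rparr>) A E" for v
    using subsetD[OF AP.tensor_relators_subset that] by simp
  have "v \<in> carrier FA \<and> contract \<mu> v = \<zero>\<^bsub>A\<^esub>"
    using assms unfolding tensor_ideal_def E_simps
  proof (induction v rule: generate.induct)
    case one
    then show ?case by (simp add: contract_0)
  next
    case (incl h)
    then show ?case using rel keys by simp
  next
    case (inv h)
    then show ?case using rel[OF inv] keys[OF inv] contract_uminus by simp
  next
    case (eng h1 h2)
    then show ?case using contract_add[of h1 h2] subset_trans[OF keys_add, of h1 h2] by simp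
  qed
  then show ?thesis by blast
qed

end

text \<open>The image under \<open>id \<otimes> \<mu>\<close> of the product of \<open>\<Sum>\<^sub>i a\<^sub>i \<otimes> u\<^sub>i\<close> and \<open>\<Sum>\<^sub>j b\<^sub>j \<otimes> u\<^sub>j\<close>.\<close>

definition bilin :: "('a \<Rightarrow> 'a) \<Rightarrow> (nat \<Rightarrow> 'b) \<Rightarrow> (nat \<Rightarrow> 'b) \<Rightarrow> 'b" where
  "bilin \<mu> a b = (\<Oplus>\<^bsub>A\<^esub>i\<in>{..<d}. \<Oplus>\<^bsub>A\<^esub>j\<in>{..<d}. \<mu> (u i \<otimes> u j) \<odot>\<^bsub>A\<^esub> (a i \<otimes>\<^bsub>A\<^esub> b j))"

context
  fixes \<mu> assumes \<mu>: "linear_functional R F \<mu>"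
begin

lemma bilin_terms:
  assumes "\<And>i. i < d \<Longrightarrow> a i \<in> carrier A" "\<And>j. j < d \<Longrightarrow> b j \<in> carrier A" "i < d" "j < d"
  shows "\<mu> (u i \<otimes> u j) \<odot>\<^bsub>A\<^esub> (a i \<otimes>\<^bsub>A\<^esub> b j) \<in> carrier A"
  using assms u_in \<mu>_in[OF \<mu>] by (intro smult_closed A.m_closed) auto

lemma bilin_inner:
  assumes "\<And>i. i < d \<Longrightarrow> a i \<in> carrier A" "\<And>j. j < d \<Longrightarrow> b j \<in> carrier A" "i < d"
  shows "(\<Oplus>\<^bsub>A\<^esub>j\<in>{..<d}. \<mu> (u i \<otimes> u j) \<odot>\<^bsub>A\<^esub> (a i \<otimes>\<^bsub>A\<^esub> b j)) \<in> carrier A"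
  using bilin_terms[OF assms(1,2,3)] by (intro A.finsum_closed) auto

lemma bilin_closed:
  assumes "\<And>i. i < d \<Longrightarrow> a i \<in> carrier A" "\<And>j. j < d \<Longrightarrow> b j \<in> carrier A"
  shows "bilin \<mu> a b \<in> carrier A"
  unfolding bilin_def using bilin_inner[OF assms] by (intro A.finsum_closed) auto

lemma bilin_add_left:
  assumes a: "\<And>i. i < d \<Longrightarrow> a i \<in> carrier A" and a': "\<And>i. i < d \<Longrightarrow> a' i \<in> carrier A"
    and b: "\<And>j. j < d \<Longrightarrow> b j \<in> carrier A"
  shows "bilin \<mu> (\<lambda>i. a i \<oplus>\<^bsub>A\<^esub> a' i) b = bilin \<mu> a b \<oplus>\<^bsub>A\<^esub> bilin \<mu> a' b"
proof -
  have "bilin \<mu> (\<lambda>i. a i \<oplus>\<^bsub>A\<^esub> a' i) b =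
     (\<Oplus>\<^bsub>A\<^esub>i\<in>{..<d}. (\<Oplus>\<^bsub>A\<^esub>j\<in>{..<d}. \<mu> (u i \<otimes> u j) \<odot>\<^bsub>A\<^esub> (a i \<otimes>\<^bsub>A\<^esub> b j)) \<oplus>\<^bsub>A\<^esub>
        (\<Oplus>\<^bsub>A\<^esub>j\<in>{..<d}. \<mu> (u i \<otimes> u j) \<odot>\<^bsub>A\<^esub> (a' i \<otimes>\<^bsub>A\<^esub> b j)))"
    unfolding bilin_def
  proof (intro A.finsum_cong')
    fix i assume i: "i \<in> {..<d}"
    then have "(\<Oplus>\<^bsub>A\<^esub>j\<in>{..<d}. \<mu> (u i \<otimes> u j) \<odot>\<^bsub>A\<^esub> ((a i \<oplus>\<^bsub>A\<^esub> a' i) \<otimes>\<^bsub>A\<^esub> b j)) =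
      (\<Oplus>\<^bsub>A\<^esub>j\<in>{..<d}. \<mu> (u i \<otimes> u j) \<odot>\<^bsub>A\<^esub> (a i \<otimes>\<^bsub>A\<^esub> b j) \<oplus>\<^bsub>A\<^esub> \<mu> (u i \<otimes> u j) \<odot>\<^bsub>A\<^esub> (a' i \<otimes>\<^bsub>A\<^esub> b j))"
      using assms bilin_terms[of a b, OF a b] bilin_terms[of a' b, OF a' b] \<mu>_in[OF \<mu>] u_in
      by (intro A.finsum_cong') (auto simp: A.l_distr A.smult_r_distr)
    also have "\<dots> = (\<Oplus>\<^bsub>A\<^esub>j\<in>{..<d}. \<mu> (u i \<otimes> u j) \<odot>\<^bsub>A\<^esub> (a i \<otimes>\<^bsub>A\<^esub> b j)) \<oplus>\<^bsub>A\<^esub>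
        (\<Oplus>\<^bsub>A\<^esub>j\<in>{..<d}. \<mu> (u i \<otimes> u j) \<odot>\<^bsub>A\<^esub> (a' i \<otimes>\<^bsub>A\<^esub> b j))"
      using i bilin_terms[of a b, OF a b] bilin_terms[of a' b, OF a' b] by (intro A.finsum_addf) auto
    finally show "(\<Oplus>\<^bsub>A\<^esub>j\<in>{..<d}. \<mu> (u i \<otimes> u j) \<odot>\<^bsub>A\<^esub> ((a i \<oplus>\<^bsub>A\<^esub> a' i) \<otimes>\<^bsub>A\<^esub> b j)) = \<dots>" .
  qed (use bilin_inner[of a b, OF a b] bilin_inner[of a' b, OF a' b] in auto)
  also have "\<dots> = bilin \<mu> a b \<oplus>\<^bsub>A\<^esub> bilin \<mu> a' b"
    unfolding bilin_def using bilin_inner[of a b, OF a b] bilin_inner[of a' b, OF a' b] by (intro A.finsum_addf) auto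
  finally show ?thesis .
qed

lemma functional_product:
  assumes x: "x \<in> carrier R" and y: "y \<in> carrier R"
  shows "\<mu> (x \<otimes> y) = (\<Oplus>i\<in>{..<d}. \<Oplus>j\<in>{..<d}. coord i x \<otimes> (coord j y \<otimes> \<mu> (u i \<otimes> u j)))"
proof -
  interpret M: linear_functional R F \<mu> by (rule \<mu>)
  have cF: "coord i z \<in> F" if "i < d" "z \<in> carrier R" for i z
    using linear_functional.t_in[OF coord_lin[OF that(1)] that(2)] .
  have c: "coord i z \<in> carrier R" if "i < d" "z \<in> carrier R" for i z using Fcar[OF cF[OF that]] .
  have right: "\<mu> (z \<otimes> y) = (\<Oplus>j\<in>{..<d}. coord j y \<otimes> \<mu> (z \<otimes> u j))" if z: "z \<in> carrier R" for z
  proof -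
    have "z \<otimes> y = z \<otimes> (\<Oplus>j\<in>{..<d}. coord j y \<otimes> u j)" using expand[OF y] by simp
    also have "\<dots> = (\<Oplus>j\<in>{..<d}. z \<otimes> (coord j y \<otimes> u j))"
      using z c[OF _ y] u_in by (intro finsum_rdistr) auto
    finally have "\<mu> (z \<otimes> y) = (\<Oplus>j\<in>{..<d}. \<mu> (z \<otimes> (coord j y \<otimes> u j)))"
      using z c[OF _ y] u_in M.t_finsum[of "\<lambda>j. z \<otimes> (coord j y \<otimes> u j)" "{..<d}"] by auto
    also have "\<dots> = (\<Oplus>j\<in>{..<d}. coord j y \<otimes> \<mu> (z \<otimes> u j))"
    proof (intro finsum_cong')
      fix j assume "j \<in> {..<d}"
      then have j: "j < d" by simp
      have "z \<otimes> (coord j y \<otimes> u j) = coord j y \<otimes> (z \<otimes> u j)" using z c[OF j y] u_in[OF j] by (simp add: m_lcomm)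
      then show "\<mu> (z \<otimes> (coord j y \<otimes> u j)) = coord j y \<otimes> \<mu> (z \<otimes> u j)"
        using M.t_smult[OF cF[OF j y]] z u_in[OF j] by simp
    qed (use z c[OF _ y] u_in M.t_car in auto)
    finally show ?thesis .
  qed
  have "x \<otimes> y = (\<Oplus>i\<in>{..<d}. coord i x \<otimes> u i) \<otimes> y" using expand[OF x] by simp
  also have "\<dots> = (\<Oplus>i\<in>{..<d}. (coord i x \<otimes> u i) \<otimes> y)"
    using y c[OF _ x] u_in by (intro finsum_ldistr) auto
  finally have "\<mu> (x \<otimes> y) = (\<Oplus>i\<in>{..<d}. \<mu> ((coord i x \<otimes> u i) \<otimes> y))"
    using y c[OF _ x] u_in M.t_finsum[of "\<lambda>i. (coord i x \<otimes> u i) \<otimes> y" "{..<d}"] by auto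
  also have "\<dots> = (\<Oplus>i\<in>{..<d}. \<Oplus>j\<in>{..<d}. coord i x \<otimes> (coord j y \<otimes> \<mu> (u i \<otimes> u j)))"
  proof (intro finsum_cong')
    fix i assume "i \<in> {..<d}"
    then have i: "i < d" by simp
    have "\<mu> ((coord i x \<otimes> u i) \<otimes> y) = coord i x \<otimes> \<mu> (u i \<otimes> y)"
      using M.t_smult[OF cF[OF i x], of "u i \<otimes> y"] c[OF i x] u_in[OF i] y by (simp add: m_assoc)
    also have "\<dots> = (\<Oplus>j\<in>{..<d}. coord i x \<otimes> (coord j y \<otimes> \<mu> (u i \<otimes> u j)))"
      unfolding right[OF u_in[OF i]] using c[OF i x] c[OF _ y] u_in i M.t_car by (intro finsum_rdistr) auto
    finally show "\<mu> ((coord i x \<otimes> u i) \<otimes> y) = (\<Oplus>j\<in>{..<d}. coord i x \<otimes> (coord j y \<otimes> \<mu> (u i \<otimes> u j)))" .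
  qed (use c x y u_in M.t_car in \<open>auto intro!: finsum_closed\<close>)
  finally show ?thesis .
qed

lemma bilin_cong:
  assumes "\<And>i. i < d \<Longrightarrow> a i \<in> carrier A" "\<And>j. j < d \<Longrightarrow> b j \<in> carrier A"
    and "\<And>i. i < d \<Longrightarrow> a i = a' i" "\<And>j. j < d \<Longrightarrow> b j = b' j"
  shows "bilin \<mu> a b = bilin \<mu> a' b'"
  unfolding bilin_def
proof (rule A.finsum_cong')
  have c: "\<And>i. i < d \<Longrightarrow> a' i \<in> carrier A" "\<And>i. i < d \<Longrightarrow> b' i \<in> carrier A"
    using assms by metis+
  show "(\<lambda>i. \<Oplus>\<^bsub>A\<^esub>j\<in>{..<d}. \<mu> (u i \<otimes> u j) \<odot>\<^bsub>A\<^esub> (a' i \<otimes>\<^bsub>A\<^esub> b' j)) \<in> {..<d} \<rightarrow> carrier A"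
    using bilin_inner[of a' b', OF c] by auto
  fix i assume "i \<in> {..<d}"
  then show "(\<Oplus>\<^bsub>A\<^esub>j\<in>{..<d}. \<mu> (u i \<otimes> u j) \<odot>\<^bsub>A\<^esub> (a i \<otimes>\<^bsub>A\<^esub> b j)) =
      (\<Oplus>\<^bsub>A\<^esub>j\<in>{..<d}. \<mu> (u i \<otimes> u j) \<odot>\<^bsub>A\<^esub> (a' i \<otimes>\<^bsub>A\<^esub> b' j))"
    using bilin_terms[of a' b', OF c] assms(3,4) by (intro A.finsum_cong') auto
qed simp

lemma bilin_commute:
  assumes a: "\<And>i. i < d \<Longrightarrow> a i \<in> carrier A" and b: "\<And>j. j < d \<Longrightarrow> b j \<in> carrier A"
  shows "bilin \<mu> a b = bilin \<mu> b a"
proof -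
  have "bilin \<mu> a b = (\<Oplus>\<^bsub>A\<^esub>j\<in>{..<d}. \<Oplus>\<^bsub>A\<^esub>i\<in>{..<d}. \<mu> (u i \<otimes> u j) \<odot>\<^bsub>A\<^esub> (a i \<otimes>\<^bsub>A\<^esub> b j))"
    unfolding bilin_def using bilin_terms[of a b, OF a b] by (intro A.finsum_swap) auto
  also have "\<dots> = bilin \<mu> b a"
    unfolding bilin_def
  proof (rule A.finsum_cong')
    fix j assume j: "j \<in> {..<d}"
    show "(\<Oplus>\<^bsub>A\<^esub>i\<in>{..<d}. \<mu> (u i \<otimes> u j) \<odot>\<^bsub>A\<^esub> (a i \<otimes>\<^bsub>A\<^esub> b j)) =
      (\<Oplus>\<^bsub>A\<^esub>i\<in>{..<d}. \<mu> (u j \<otimes> u i) \<odot>\<^bsub>A\<^esub> (b j \<otimes>\<^bsub>A\<^esub> a i))"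
    proof (rule A.finsum_cong')
      fix i assume i: "i \<in> {..<d}"
      show "\<mu> (u i \<otimes> u j) \<odot>\<^bsub>A\<^esub> (a i \<otimes>\<^bsub>A\<^esub> b j) = \<mu> (u j \<otimes> u i) \<odot>\<^bsub>A\<^esub> (b j \<otimes>\<^bsub>A\<^esub> a i)"
        using i j a b u_in m_comm[of "u i" "u j"] A.m_comm[of "a i" "b j"] by simp
    qed (use j bilin_terms[of b a, OF b a] in auto)
  qed (use bilin_inner[of b a, OF b a] in auto)
  finally show ?thesis .
qed

lemma bilin_diff_left:
  assumes a: "\<And>i. i < d \<Longrightarrow> a i \<in> carrier A" and a': "\<And>i. i < d \<Longrightarrow> a' i \<in> carrier A"
    and b: "\<And>j. j < d \<Longrightarrow> b j \<in> carrier A"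
  shows "bilin \<mu> (\<lambda>i. a i \<ominus>\<^bsub>A\<^esub> a' i) b = bilin \<mu> a b \<ominus>\<^bsub>A\<^esub> bilin \<mu> a' b"
proof -
  have c: "\<And>i. i < d \<Longrightarrow> a i \<ominus>\<^bsub>A\<^esub> a' i \<in> carrier A" using a a' by simp
  have "bilin \<mu> a b = bilin \<mu> (\<lambda>i. (a i \<ominus>\<^bsub>A\<^esub> a' i) \<oplus>\<^bsub>A\<^esub> a' i) b"
    using a a' b by (intro bilin_cong) (auto simp: a_minus_def A.a_assoc A.l_neg)
  also have "\<dots> = bilin \<mu> (\<lambda>i. a i \<ominus>\<^bsub>A\<^esub> a' i) b \<oplus>\<^bsub>A\<^esub> bilin \<mu> a' b"
    by (rule bilin_add_left[OF c a' b])
  finally show ?thesis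
    using bilin_closed[of _ b, OF c b] bilin_closed[of a' b, OF a' b]
    by (simp add: a_minus_def A.a_assoc A.r_neg)
qed

lemma bilin_diff_right:
  assumes a: "\<And>i. i < d \<Longrightarrow> a i \<in> carrier A" and b: "\<And>j. j < d \<Longrightarrow> b j \<in> carrier A"
    and b': "\<And>j. j < d \<Longrightarrow> b' j \<in> carrier A"
  shows "bilin \<mu> a (\<lambda>i. b i \<ominus>\<^bsub>A\<^esub> b' i) = bilin \<mu> a b \<ominus>\<^bsub>A\<^esub> bilin \<mu> a b'"
proof -
  have c: "\<And>i. i < d \<Longrightarrow> b i \<ominus>\<^bsub>A\<^esub> b' i \<in> carrier A" using b b' by simp
  show ?thesis
    using bilin_diff_left[OF b b' a] bilin_commute[of a _, OF a c] bilin_commute[of a b, OF a b]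
      bilin_commute[of a b', OF a b'] by simp
qed

lemma bilin_zero:
  assumes "\<And>i. i < d \<Longrightarrow> a i \<in> carrier A"
  shows "bilin \<mu> (\<lambda>i. \<zero>\<^bsub>A\<^esub>) a = \<zero>\<^bsub>A\<^esub>" "bilin \<mu> a (\<lambda>i. \<zero>\<^bsub>A\<^esub>) = \<zero>\<^bsub>A\<^esub>"
proof -
  show z: "bilin \<mu> (\<lambda>i. \<zero>\<^bsub>A\<^esub>) a = \<zero>\<^bsub>A\<^esub>"
    using bilin_diff_left[of a a a] bilin_closed[of a a] assms by (simp add: A.r_right_minus_eq a_minus_def A.r_neg cong: bilin_cong)
  show "bilin \<mu> a (\<lambda>i. \<zero>\<^bsub>A\<^esub>) = \<zero>\<^bsub>A\<^esub>" using bilin_commute[of a "\<lambda>_. \<zero>\<^bsub>A\<^esub>"] assms z by simp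
qed

lemma bilin_pure:
  assumes x: "x \<in> carrier R" and y: "y \<in> carrier R" and a: "a \<in> carrier A" and b: "b \<in> carrier A"
  shows "bilin \<mu> (\<lambda>i. coord i x \<odot>\<^bsub>A\<^esub> a) (\<lambda>j. coord j y \<odot>\<^bsub>A\<^esub> b) = \<mu> (x \<otimes> y) \<odot>\<^bsub>A\<^esub> (a \<otimes>\<^bsub>A\<^esub> b)"
proof -
  have cF: "coord i z \<in> F" if "i < d" "z \<in> carrier R" for i z
    using linear_functional.t_in[OF coord_lin[OF that(1)] that(2)] .
  have mF: "\<mu> (u i \<otimes> u j) \<in> F" if "i < d" "j < d" for i j using \<mu>_in[OF \<mu>] u_in that by simp
  have tF: "coord i x \<otimes> (coord j y \<otimes> \<mu> (u i \<otimes> u j)) \<in> F" if "i < d" "j < d" for i j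
    using cF mF x y that subfield_closed(4)[OF F] by simp
  have trm: "\<mu> (u i \<otimes> u j) \<odot>\<^bsub>A\<^esub> ((coord i x \<odot>\<^bsub>A\<^esub> a) \<otimes>\<^bsub>A\<^esub> (coord j y \<odot>\<^bsub>A\<^esub> b)) =
      (coord i x \<otimes> (coord j y \<otimes> \<mu> (u i \<otimes> u j))) \<odot>\<^bsub>A\<^esub> (a \<otimes>\<^bsub>A\<^esub> b)" if i: "i < d" and j: "j < d" for i j
  proof -
    note m = cF[OF i x] cF[OF j y] mF[OF i j]
    note mc = m[THEN Fcar]
    have "(coord i x \<odot>\<^bsub>A\<^esub> a) \<otimes>\<^bsub>A\<^esub> (coord j y \<odot>\<^bsub>A\<^esub> b) = coord i x \<odot>\<^bsub>A\<^esub> (a \<otimes>\<^bsub>A\<^esub> (coord j y \<odot>\<^bsub>A\<^esub> b))"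
      using A.smult_assoc2[of "coord i x" a "coord j y \<odot>\<^bsub>A\<^esub> b"] m a b smult_closed by simp
    also have "a \<otimes>\<^bsub>A\<^esub> (coord j y \<odot>\<^bsub>A\<^esub> b) = coord j y \<odot>\<^bsub>A\<^esub> (a \<otimes>\<^bsub>A\<^esub> b)"
      using A.smult_assoc2[of "coord j y" b a] m a b smult_closed by (simp add: A.m_comm)
    also have "coord i x \<odot>\<^bsub>A\<^esub> (coord j y \<odot>\<^bsub>A\<^esub> (a \<otimes>\<^bsub>A\<^esub> b)) = (coord i x \<otimes> coord j y) \<odot>\<^bsub>A\<^esub> (a \<otimes>\<^bsub>A\<^esub> b)"
      using A.smult_assoc1[of "coord i x" "coord j y" "a \<otimes>\<^bsub>A\<^esub> b"] m a b by simp
    also have "\<mu> (u i \<otimes> u j) \<odot>\<^bsub>A\<^esub> \<dots> = (\<mu> (u i \<otimes> u j) \<otimes> (coord i x \<otimes> coord j y)) \<odot>\<^bsub>A\<^esub> (a \<otimes>\<^bsub>A\<^esub> b)"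
      using A.smult_assoc1[of "\<mu> (u i \<otimes> u j)" "coord i x \<otimes> coord j y" "a \<otimes>\<^bsub>A\<^esub> b"] m a b subfield_closed(4)[OF F] by simp
    also have "\<mu> (u i \<otimes> u j) \<otimes> (coord i x \<otimes> coord j y) = coord i x \<otimes> (coord j y \<otimes> \<mu> (u i \<otimes> u j))"
      using mc by (simp add: m_ac)
    finally show ?thesis .
  qed
  have ab: "a \<otimes>\<^bsub>A\<^esub> b \<in> carrier A" using a b by simp
  have inner: "(\<Oplus>j\<in>{..<d}. coord i x \<otimes> (coord j y \<otimes> \<mu> (u i \<otimes> u j))) \<in> F \<and>
     (\<Oplus>j\<in>{..<d}. coord i x \<otimes> (coord j y \<otimes> \<mu> (u i \<otimes> u j))) \<odot>\<^bsub>A\<^esub> (a \<otimes>\<^bsub>A\<^esub> b) =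
     (\<Oplus>\<^bsub>A\<^esub>j\<in>{..<d}. \<mu> (u i \<otimes> u j) \<odot>\<^bsub>A\<^esub> ((coord i x \<odot>\<^bsub>A\<^esub> a) \<otimes>\<^bsub>A\<^esub> (coord j y \<odot>\<^bsub>A\<^esub> b)))" if i: "i < d" for i
  proof -
    have "(\<Oplus>\<^bsub>A\<^esub>j\<in>{..<d}. (coord i x \<otimes> (coord j y \<otimes> \<mu> (u i \<otimes> u j))) \<odot>\<^bsub>A\<^esub> (a \<otimes>\<^bsub>A\<^esub> b)) =
      (\<Oplus>\<^bsub>A\<^esub>j\<in>{..<d}. \<mu> (u i \<otimes> u j) \<odot>\<^bsub>A\<^esub> ((coord i x \<odot>\<^bsub>A\<^esub> a) \<otimes>\<^bsub>A\<^esub> (coord j y \<odot>\<^bsub>A\<^esub> b)))"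
      using i trm smult_closed[OF tF ab]
      by (intro A.finsum_cong') auto
    then show ?thesis using smult_finsum_left[OF _ _ ab, of "{..<d}" "\<lambda>j. coord i x \<otimes> (coord j y \<otimes> \<mu> (u i \<otimes> u j))"] tF[OF i] by auto
  qed
  have "\<mu> (x \<otimes> y) \<odot>\<^bsub>A\<^esub> (a \<otimes>\<^bsub>A\<^esub> b) =
     (\<Oplus>\<^bsub>A\<^esub>i\<in>{..<d}. (\<Oplus>j\<in>{..<d}. coord i x \<otimes> (coord j y \<otimes> \<mu> (u i \<otimes> u j))) \<odot>\<^bsub>A\<^esub> (a \<otimes>\<^bsub>A\<^esub> b))"
    unfolding functional_product[OF x y] using inner
    by (intro smult_finsum_left[OF _ _ ab, THEN conjunct2]) auto
  also have "\<dots> = bilin \<mu> (\<lambda>i. coord i x \<odot>\<^bsub>A\<^esub> a) (\<lambda>j. coord j y \<odot>\<^bsub>A\<^esub> b)"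
    unfolding bilin_def
  proof (intro A.finsum_cong')
    show "(\<lambda>i. \<Oplus>\<^bsub>A\<^esub>j\<in>{..<d}. \<mu> (u i \<otimes> u j) \<odot>\<^bsub>A\<^esub> ((coord i x \<odot>\<^bsub>A\<^esub> a) \<otimes>\<^bsub>A\<^esub> (coord j y \<odot>\<^bsub>A\<^esub> b))) \<in> {..<d} \<rightarrow> carrier A"
      using bilin_inner[of "\<lambda>i. coord i x \<odot>\<^bsub>A\<^esub> a" "\<lambda>j. coord j y \<odot>\<^bsub>A\<^esub> b"] cF x y a b smult_closed by simp
  qed (use inner in auto)
  finally show ?thesis by simp
qed

text \<open>Both sides are biadditive in \<open>v\<close> and \<open>w\<close>, so it suffices to compare them on pairs \<open>(a, x)\<close> and \<open>(b, y)\<close>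
  (\<open>bilin_pure\<close>), where it is the expansion of \<open>\<mu>(x y)\<close> in the coordinates of \<open>x\<close> and \<open>y\<close>.\<close>

theorem contract_mult:
  assumes v: "Poly_Mapping.keys v \<subseteq> carrier A \<times> carrier R" and w: "Poly_Mapping.keys w \<subseteq> carrier A \<times> carrier R"
  shows "contract \<mu> (pair_mult A E v w) = bilin \<mu> (\<lambda>i. contract (coord i) v) (\<lambda>j. contract (coord j) w)"
proof -
  note cl = contract_closed[OF coord_lin]
  have pm: "Poly_Mapping.keys (pair_mult A E v w) \<subseteq> carrier A \<times> carrier R"
    if "Poly_Mapping.keys v \<subseteq> carrier A \<times> carrier R" "Poly_Mapping.keys w \<subseteq> carrier A \<times> carrier R" for v w
    using AP.pair_mult_closed[of v w] that by simp
  have base: "contract \<mu> (pair_mult A E (frag_of p) w) = bilin \<mu> (\<lambda>i. contract (coord i) (frag_of p)) (\<lambda>j. contract (coord j) w)"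
    if p: "p \<in> carrier A \<times> carrier R" for p
  proof -
    have kp: "Poly_Mapping.keys (frag_of p) \<subseteq> carrier A \<times> carrier R" using p by simp
    have "Poly_Mapping.keys w \<subseteq> carrier A \<times> carrier R \<and> contract \<mu> (pair_mult A E (frag_of p) w) =
        bilin \<mu> (\<lambda>i. contract (coord i) (frag_of p)) (\<lambda>j. contract (coord j) w)"
      using w
    proof (induction w rule: frag_induction)
      case zero
      have "bilin \<mu> (\<lambda>i. contract (coord i) (frag_of p)) (\<lambda>j. contract (coord j) 0) =
          bilin \<mu> (\<lambda>i. contract (coord i) (frag_of p)) (\<lambda>j. \<zero>\<^bsub>A\<^esub>)"
        using cl[OF _ kp] by (intro bilin_cong) (auto simp: contract_0[OF coord_lin])
      then show ?case using bilin_zero(2)[of "\<lambda>i. contract (coord i) (frag_of p)"] cl[OF _ kp] contract_0[OF \<mu>] by simp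
    next
      case (one q)
      obtain a x b y where pq: "p = (a, x)" "q = (b, y)" by (metis surj_pair)
      then have m: "a \<in> carrier A" "x \<in> carrier R" "b \<in> carrier A" "y \<in> carrier R" using p one by auto
      have cF: "coord i z \<in> F" if "i < d" "z \<in> carrier R" for i z
        using linear_functional.t_in[OF coord_lin[OF that(1)] that(2)] .
      have "bilin \<mu> (\<lambda>i. contract (coord i) (frag_of p)) (\<lambda>j. contract (coord j) (frag_of q)) =
        bilin \<mu> (\<lambda>i. coord i x \<odot>\<^bsub>A\<^esub> a) (\<lambda>j. coord j y \<odot>\<^bsub>A\<^esub> b)"
        using m one cl[OF _ kp] cl[of _ "frag_of q"] by (intro bilin_cong) (auto simp: pq contract_of[OF coord_lin])
      then show ?case using bilin_pure[OF m(2,4,1,3)] m one by (simp add: pq contract_of[OF \<mu>])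
    next
      case (diff v w)
      then have k: "Poly_Mapping.keys v \<subseteq> carrier A \<times> carrier R" "Poly_Mapping.keys w \<subseteq> carrier A \<times> carrier R" by auto
      have "bilin \<mu> (\<lambda>i. contract (coord i) (frag_of p)) (\<lambda>j. contract (coord j) (v - w)) =
        bilin \<mu> (\<lambda>i. contract (coord i) (frag_of p)) (\<lambda>j. contract (coord j) v \<ominus>\<^bsub>A\<^esub> contract (coord j) w)"
        using cl[OF _ kp] cl[of _ "v - w"] k subset_trans[OF keys_diff, of v w]
        by (intro bilin_cong) (auto simp: contract_diff[OF coord_lin k])
      also have "\<dots> = contract \<mu> (pair_mult A E (frag_of p) v) \<ominus>\<^bsub>A\<^esub> contract \<mu> (pair_mult A E (frag_of p) w)"
        using diff bilin_diff_right[of "\<lambda>i. contract (coord i) (frag_of p)"] cl[OF _ kp] cl[OF _ k(1)] cl[OF _ k(2)] by simp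
      also have "\<dots> = contract \<mu> (pair_mult A E (frag_of p) (v - w))"
        using contract_diff[OF \<mu> pm[OF kp k(1)] pm[OF kp k(2)]] by (simp add: pair_mult_diff)
      finally show ?case using k subset_trans[OF keys_diff, of v w] by simp
    qed
    then show ?thesis by blast
  qed
  have "Poly_Mapping.keys v \<subseteq> carrier A \<times> carrier R \<and> contract \<mu> (pair_mult A E v w) =
        bilin \<mu> (\<lambda>i. contract (coord i) v) (\<lambda>j. contract (coord j) w)"
    using v
  proof (induction v rule: frag_induction)
    case zero
    have "bilin \<mu> (\<lambda>j. contract (coord j) 0) (\<lambda>i. contract (coord i) w) =
        bilin \<mu> (\<lambda>j. \<zero>\<^bsub>A\<^esub>) (\<lambda>i. contract (coord i) w)"
      using cl[OF _ w] by (intro bilin_cong) (auto simp: contract_0[OF coord_lin])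
    then show ?case using bilin_zero(1)[of "\<lambda>i. contract (coord i) w"] cl[OF _ w] contract_0[OF \<mu>] by simp
  next
    case (one q)
    then show ?case using base by simp
  next
    case (diff v1 v2)
    then have k: "Poly_Mapping.keys v1 \<subseteq> carrier A \<times> carrier R" "Poly_Mapping.keys v2 \<subseteq> carrier A \<times> carrier R" by auto
    have "bilin \<mu> (\<lambda>j. contract (coord j) (v1 - v2)) (\<lambda>i. contract (coord i) w) =
      bilin \<mu> (\<lambda>j. contract (coord j) v1 \<ominus>\<^bsub>A\<^esub> contract (coord j) v2) (\<lambda>i. contract (coord i) w)"
      using cl[OF _ w] cl[of _ "v1 - v2"] k subset_trans[OF keys_diff, of v1 v2]
      by (intro bilin_cong) (auto simp: contract_diff[OF coord_lin k])
    also have "\<dots> = contract \<mu> (pair_mult A E v1 w) \<ominus>\<^bsub>A\<^esub> contract \<mu> (pair_mult A E v2 w)"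
      using diff bilin_diff_left[of _ _ "\<lambda>i. contract (coord i) w"] cl[OF _ w] cl[OF _ k(1)] cl[OF _ k(2)] by simp
    also have "\<dots> = contract \<mu> (pair_mult A E (v1 - v2) w)"
      using contract_diff[OF \<mu> pm[OF k(1) w] pm[OF k(2) w]] by (simp add: pair_mult_diff)
    finally show ?case using k subset_trans[OF keys_diff, of v1 v2] by simp
  qed
  then show ?thesis by blast
qed

end

end

context base_change_setting
begin

abbreviation (input) "PR \<equiv> pair_ring A E"
abbreviation (input) "TI \<equiv> tensor_ideal (R\<lparr>carrier := F\<rparr>) A E"
abbreviation (input) "BC \<equiv> base_change R F A"

sublocale P: cring PR by (rule AP.cring_pair_ring)
sublocale I: ideal TI PR by (rule AP.ideal_tensor_ideal)
sublocale T: cring BC unfolding base_change_def by (rule AP.cring_tensor_ring)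

lemma P_carrier: "v \<in> carrier PR \<longleftrightarrow> Poly_Mapping.keys v \<subseteq> carrier A \<times> carrier R"
  by (simp add: pair_ring_def)

lemma P_ops: "v \<oplus>\<^bsub>PR\<^esub> w = v + w" "v \<otimes>\<^bsub>PR\<^esub> w = pair_mult A E v w" "\<zero>\<^bsub>PR\<^esub> = 0"
  by (simp_all add: pair_ring_def)

lemma P_minus:
  assumes "v \<in> carrier PR" "w \<in> carrier PR"
  shows "v \<ominus>\<^bsub>PR\<^esub> w = v - w"
proof -
  have "\<ominus>\<^bsub>PR\<^esub> w = - w"
    by (rule P.minus_equality) (use assms in \<open>auto simp: P_ops P_carrier\<close>)
  then show ?thesis by (simp add: a_minus_def P_ops)
qed

abbreviation cls :: "('b \<times> 'a \<Rightarrow>\<^sub>0 int) \<Rightarrow> ('b \<times> 'a \<Rightarrow>\<^sub>0 int) set" where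
  "cls v \<equiv> TI +>\<^bsub>PR\<^esub> v"

lemma cls_hom: "ring_hom_cring PR BC cls"
proof -
  have "cls \<in> Ring.ring_hom PR BC"
    using I.rcos_ring_hom by (simp add: base_change_def tensor_ring_def)
  then show ?thesis
    by (intro ring_hom_cring.intro ring_hom_cring_axioms.intro P.cring_axioms T.cring_axioms)
qed

sublocale cls: ring_hom_cring PR BC cls by (rule cls_hom)

lemma cls_eq_iff:
  assumes "v \<in> carrier PR" "w \<in> carrier PR"
  shows "cls v = cls w \<longleftrightarrow> v - w \<in> TI"
  using P.quotient_eq_iff_same_a_r_cos[OF I.ideal_axioms assms] unfolding P_minus[OF assms] by (rule sym)

lemma carrier_BC: "carrier BC = cls ` carrier PR"
proof -
  have "carrier BC = a_rcosets\<^bsub>PR\<^esub> TI"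
    by (simp only: base_change_def tensor_ring_def FactRing_def partial_object.simps)
  also have "\<dots> = cls ` carrier PR" unfolding A_RCOSETS_def' by (rule UNION_singleton_eq_range)
  finally show ?thesis .
qed

lemma to_base_change_eq: "to_base_change R F A a = cls (frag_of (a, \<one>))"
  by (simp add: to_base_change_def pure_tensor_def)

text \<open>Represent each square root \<open>g\<^sub>j\<close> by a formal sum and take its coordinates in \<open>A\<close>.  The equation is stated for
  all functionals \<open>\<mu>\<close> at once: the functional \<open>t\<close> yields the descent, and the coordinate functions \<open>coord r\<close>
  carry all the information of the equation in \<open>A\<^sub>K\<close>, see \<open>sum_of_squares_of_coordinates\<close>.\<close>

theorem coordinates_of_sum_of_squares:
  assumes f: "f \<in> carrier A" and sos: "sum_of_n_squares BC m (to_base_change R F A f)"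
  shows "\<exists>g. (\<forall>j i. i < d \<longrightarrow> g j i \<in> carrier A) \<and>
    (\<forall>\<mu>. linear_functional R F \<mu> \<longrightarrow> \<mu> \<one> \<odot>\<^bsub>A\<^esub> f = (\<Oplus>\<^bsub>A\<^esub>j\<in>{..<m}. bilin \<mu> (g j) (g j)))"
proof -
  obtain h where h: "h \<in> {..<m} \<rightarrow> carrier BC"
    and e: "to_base_change R F A f = (\<Oplus>\<^bsub>BC\<^esub>j\<in>{..<m}. h j \<otimes>\<^bsub>BC\<^esub> h j)"
    using sos unfolding sum_of_n_squares_def by blast
  have "\<exists>v. v \<in> carrier PR \<and> (j < m \<longrightarrow> h j = cls v)" for j
  proof (cases "j < m")
    case True
    then have "h j \<in> cls ` carrier PR" using h carrier_BC by auto
    then show ?thesis by auto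
  qed auto
  then obtain v where v: "\<And>j. v j \<in> carrier PR" "\<And>j. j < m \<Longrightarrow> h j = cls (v j)" by metis
  have vk: "Poly_Mapping.keys (v j) \<subseteq> carrier A \<times> carrier R" for j using v(1) by (simp add: P_carrier)
  let ?S = "\<Oplus>\<^bsub>PR\<^esub>j\<in>{..<m}. v j \<otimes>\<^bsub>PR\<^esub> v j"
  have S: "?S \<in> carrier PR" using v(1) by (intro P.finsum_closed) auto
  have f1: "frag_of (f, \<one>) \<in> carrier PR" using f by (simp add: P_carrier)
  have "cls (frag_of (f, \<one>)) = (\<Oplus>\<^bsub>BC\<^esub>j\<in>{..<m}. cls (v j) \<otimes>\<^bsub>BC\<^esub> cls (v j))"
    unfolding to_base_change_eq[symmetric] e using v by (intro T.finsum_cong') auto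
  also have "\<dots> = cls ?S"
    using v(1) cls.hom_finsum[of "\<lambda>j. v j \<otimes>\<^bsub>PR\<^esub> v j" "{..<m}"] by (simp add: comp_def)
  finally have D: "frag_of (f, \<one>) - ?S \<in> TI" using cls_eq_iff[OF f1 S] by simp
  define g where "g j i = contract (coord i) (v j)" for j i
  have "g j i \<in> carrier A" if "i < d" for j i
    unfolding g_def by (rule contract_closed[OF coord_lin[OF that] vk])
  moreover have "\<mu> \<one> \<odot>\<^bsub>A\<^esub> f = (\<Oplus>\<^bsub>A\<^esub>j\<in>{..<m}. bilin \<mu> (g j) (g j))" if \<mu>: "linear_functional R F \<mu>" for \<mu>
  proof -
    have c: "contract \<mu> w \<in> carrier A" if "w \<in> carrier PR" for w
      using contract_closed[OF \<mu>] that by (simp add: P_carrier)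
    have "\<mu> \<one> \<odot>\<^bsub>A\<^esub> f = contract \<mu> (frag_of (f, \<one>))" using contract_of[OF \<mu> f one_closed] by simp
    also have "\<dots> = contract \<mu> ((frag_of (f, \<one>) - ?S) + ?S)" by simp
    also have "\<dots> = contract \<mu> (frag_of (f, \<one>) - ?S) \<oplus>\<^bsub>A\<^esub> contract \<mu> ?S"
      using I.a_Hcarr[OF D] S by (intro contract_add[OF \<mu>]) (simp_all add: P_carrier)
    also have "\<dots> = contract \<mu> ?S"
      using contract_tensor_ideal[OF \<mu> D] c[OF S] by simp
    also have "\<dots> = (\<Oplus>\<^bsub>A\<^esub>j\<in>{..<m}. contract \<mu> (v j \<otimes>\<^bsub>PR\<^esub> v j))"
    proof (rule additive_finsum[OF P.abelian_group_axioms A.abelian_group_axioms])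
      show "contract \<mu> (x \<oplus>\<^bsub>PR\<^esub> y) = contract \<mu> x \<oplus>\<^bsub>A\<^esub> contract \<mu> y"
        if "x \<in> carrier PR" "y \<in> carrier PR" for x y
        using contract_add[OF \<mu>, of x y] that by (simp add: P_carrier P_ops)
    qed (use c v(1) in auto)
    also have "\<dots> = (\<Oplus>\<^bsub>A\<^esub>j\<in>{..<m}. bilin \<mu> (g j) (g j))"
    proof (rule A.finsum_cong')
      show "(\<lambda>j. bilin \<mu> (g j) (g j)) \<in> {..<m} \<rightarrow> carrier A"
        using bilin_closed[OF \<mu>] contract_closed[OF coord_lin vk] by (auto simp: g_def)
      show "contract \<mu> (v j \<otimes>\<^bsub>PR\<^esub> v j) = bilin \<mu> (g j) (g j)" for j
        unfolding P_ops g_def by (rule contract_mult[OF \<mu> vk vk])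
    qed simp
    finally show ?thesis .
  qed
  ultimately show ?thesis by blast
qed

definition pure :: "'b \<Rightarrow> 'a \<Rightarrow> ('b \<times> 'a \<Rightarrow>\<^sub>0 int) set" where
  "pure a x = cls (frag_of (a, x))"

lemma frag_P: "a \<in> carrier A \<Longrightarrow> x \<in> carrier R \<Longrightarrow> frag_of (a, x) \<in> carrier PR"
  by (simp add: P_carrier)

lemma pure_closed: "a \<in> carrier A \<Longrightarrow> x \<in> carrier R \<Longrightarrow> pure a x \<in> carrier BC"
  unfolding pure_def by (rule cls.hom_closed[OF frag_P])

lemma relator_TI: "v \<in> tensor_relators (R\<lparr>carrier := F\<rparr>) A E \<Longrightarrow> v \<in> TI"
  unfolding tensor_ideal_def E_simps by (rule generate.incl)

lemma pure_add_left:
  assumes "a \<in> carrier A" "a' \<in> carrier A" "x \<in> carrier R"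
  shows "pure (a \<oplus>\<^bsub>A\<^esub> a') x = pure a x \<oplus>\<^bsub>BC\<^esub> pure a' x"
proof -
  have "frag_of (a \<oplus>\<^bsub>A\<^esub> a', x) - frag_of (a, x) - frag_of (a', x) \<in> tensor_relators (R\<lparr>carrier := F\<rparr>) A E"
    unfolding tensor_relators_def E_simps using assms by blast
  then have "frag_of (a \<oplus>\<^bsub>A\<^esub> a', x) - (frag_of (a, x) \<oplus>\<^bsub>PR\<^esub> frag_of (a', x)) \<in> TI"
    using relator_TI by (simp add: P_ops diff_diff_eq)
  then have "cls (frag_of (a \<oplus>\<^bsub>A\<^esub> a', x)) = cls (frag_of (a, x) \<oplus>\<^bsub>PR\<^esub> frag_of (a', x))"
    using assms frag_P by (subst cls_eq_iff) auto
  then show ?thesis unfolding pure_def using assms frag_P by simp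
qed

lemma pure_add_right:
  assumes "a \<in> carrier A" "x \<in> carrier R" "x' \<in> carrier R"
  shows "pure a (x \<oplus> x') = pure a x \<oplus>\<^bsub>BC\<^esub> pure a x'"
proof -
  have "frag_of (a, x \<oplus> x') - frag_of (a, x) - frag_of (a, x') \<in> tensor_relators (R\<lparr>carrier := F\<rparr>) A E"
    unfolding tensor_relators_def E_simps using assms by blast
  then have "frag_of (a, x \<oplus> x') - (frag_of (a, x) \<oplus>\<^bsub>PR\<^esub> frag_of (a, x')) \<in> TI"
    using relator_TI by (simp add: P_ops diff_diff_eq)
  then have "cls (frag_of (a, x \<oplus> x')) = cls (frag_of (a, x) \<oplus>\<^bsub>PR\<^esub> frag_of (a, x'))"
    using assms frag_P by (subst cls_eq_iff) auto
  then show ?thesis unfolding pure_def using assms frag_P by simp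
qed

lemma pure_smult:
  assumes "r \<in> F" "a \<in> carrier A" "x \<in> carrier R"
  shows "pure (r \<odot>\<^bsub>A\<^esub> a) x = pure a (r \<otimes> x)"
proof -
  have "frag_of (r \<odot>\<^bsub>A\<^esub> a, x) - frag_of (a, r \<otimes> x) \<in> tensor_relators (R\<lparr>carrier := F\<rparr>) A E"
    unfolding tensor_relators_def E_simps using assms by auto
  then show ?thesis unfolding pure_def using assms Fcar smult_closed
    by (subst cls_eq_iff) (auto intro!: frag_P relator_TI)
qed

lemma pure_mult:
  assumes "a \<in> carrier A" "x \<in> carrier R" "b \<in> carrier A" "y \<in> carrier R"
  shows "pure a x \<otimes>\<^bsub>BC\<^esub> pure b y = pure (a \<otimes>\<^bsub>A\<^esub> b) (x \<otimes> y)"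
  unfolding pure_def using assms cls.hom_mult[OF frag_P frag_P, of a x b y] by (simp add: P_ops)

lemma pure_finsum_left:
  "f \<in> I \<rightarrow> carrier A \<Longrightarrow> finite I \<Longrightarrow> x \<in> carrier R \<Longrightarrow>
   pure (\<Oplus>\<^bsub>A\<^esub>i\<in>I. f i) x = (\<Oplus>\<^bsub>BC\<^esub>i\<in>I. pure (f i) x)"
  by (rule additive_finsum[OF A.abelian_group_axioms T.abelian_group_axioms, of "\<lambda>a. pure a x"])
    (auto simp: pure_closed pure_add_left)

lemma pure_finsum_right:
  "f \<in> I \<rightarrow> carrier R \<Longrightarrow> finite I \<Longrightarrow> a \<in> carrier A \<Longrightarrow>
   pure a (\<Oplus>i\<in>I. f i) = (\<Oplus>\<^bsub>BC\<^esub>i\<in>I. pure a (f i))"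
  by (rule additive_finsum[OF abelian_group_axioms T.abelian_group_axioms, of "pure a"])
    (auto simp: pure_closed pure_add_right)

lemma coord_F: "i < d \<Longrightarrow> x \<in> carrier R \<Longrightarrow> coord i x \<in> F"
  using linear_functional.t_in[OF coord_lin] .

lemma pure_expand:
  assumes a: "a \<in> carrier A" and x: "x \<in> carrier R"
  shows "pure a x = (\<Oplus>\<^bsub>BC\<^esub>r\<in>{..<d}. pure (coord r x \<odot>\<^bsub>A\<^esub> a) (u r))"
proof -
  have c: "(\<lambda>r. coord r x \<otimes> u r) \<in> {..<d} \<rightarrow> carrier R" using x coord_F Fcar u_in by auto
  have "pure a x = pure a (\<Oplus>r\<in>{..<d}. coord r x \<otimes> u r)" using expand[OF x] by simp
  also have "\<dots> = (\<Oplus>\<^bsub>BC\<^esub>r\<in>{..<d}. pure a (coord r x \<otimes> u r))" by (rule pure_finsum_right[OF c _ a]) simp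
  also have "\<dots> = (\<Oplus>\<^bsub>BC\<^esub>r\<in>{..<d}. pure (coord r x \<odot>\<^bsub>A\<^esub> a) (u r))"
    using a x coord_F Fcar u_in by (intro T.finsum_cong') (auto simp: pure_smult intro!: pure_closed)
  finally show ?thesis .
qed

lemma square_of_combination:
  assumes g: "\<And>i. i < d \<Longrightarrow> g i \<in> carrier A"
  defines "G \<equiv> \<Oplus>\<^bsub>BC\<^esub>i\<in>{..<d}. pure (g i) (u i)"
  shows "G \<otimes>\<^bsub>BC\<^esub> G = (\<Oplus>\<^bsub>BC\<^esub>r\<in>{..<d}. pure (bilin (coord r) g g) (u r))"
proof -
  have p: "(\<lambda>i. pure (g i) (u i)) \<in> {..<d} \<rightarrow> carrier BC" using g u_in by (auto simp: pure_closed)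
  have G: "G \<in> carrier BC" unfolding G_def using p by (rule T.finsum_closed)
  have ik: "g i \<otimes>\<^bsub>A\<^esub> g k \<in> carrier A" "u i \<otimes> u k \<in> carrier R" if "i < d" "k < d" for i k
    using g u_in that by auto
  have t: "coord r (u i \<otimes> u k) \<odot>\<^bsub>A\<^esub> (g i \<otimes>\<^bsub>A\<^esub> g k) \<in> carrier A" if "r < d" "i < d" "k < d" for r i k
    using ik[OF that(2,3)] coord_F[OF that(1)] smult_closed by blast
  have pt: "pure (coord r (u i \<otimes> u k) \<odot>\<^bsub>A\<^esub> (g i \<otimes>\<^bsub>A\<^esub> g k)) (u r) \<in> carrier BC" if "r < d" "i < d" "k < d" for r i k
    using pure_closed[OF t[OF that] u_in[OF that(1)]] .
  have "G \<otimes>\<^bsub>BC\<^esub> G = (\<Oplus>\<^bsub>BC\<^esub>i\<in>{..<d}. pure (g i) (u i) \<otimes>\<^bsub>BC\<^esub> G)"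
    by (subst (1) G_def) (use p G in \<open>simp add: T.finsum_ldistr\<close>)
  also have "\<dots> = (\<Oplus>\<^bsub>BC\<^esub>i\<in>{..<d}. \<Oplus>\<^bsub>BC\<^esub>r\<in>{..<d}. pure (\<Oplus>\<^bsub>A\<^esub>k\<in>{..<d}. coord r (u i \<otimes> u k) \<odot>\<^bsub>A\<^esub> (g i \<otimes>\<^bsub>A\<^esub> g k)) (u r))"
  proof (rule T.finsum_cong')
    fix i assume "i \<in> {..<d}"
    then have i: "i < d" by simp
    have "pure (g i) (u i) \<otimes>\<^bsub>BC\<^esub> G = (\<Oplus>\<^bsub>BC\<^esub>k\<in>{..<d}. pure (g i) (u i) \<otimes>\<^bsub>BC\<^esub> pure (g k) (u k))"
      unfolding G_def using p i g u_in pure_closed by (intro T.finsum_rdistr) auto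
    also have "\<dots> = (\<Oplus>\<^bsub>BC\<^esub>k\<in>{..<d}. \<Oplus>\<^bsub>BC\<^esub>r\<in>{..<d}. pure (coord r (u i \<otimes> u k) \<odot>\<^bsub>A\<^esub> (g i \<otimes>\<^bsub>A\<^esub> g k)) (u r))"
    proof (rule T.finsum_cong')
      fix k assume "k \<in> {..<d}"
      then have k: "k < d" by simp
      show "pure (g i) (u i) \<otimes>\<^bsub>BC\<^esub> pure (g k) (u k) =
         (\<Oplus>\<^bsub>BC\<^esub>r\<in>{..<d}. pure (coord r (u i \<otimes> u k) \<odot>\<^bsub>A\<^esub> (g i \<otimes>\<^bsub>A\<^esub> g k)) (u r))"
        unfolding pure_mult[OF g[OF i] u_in[OF i] g[OF k] u_in[OF k]]
        by (rule pure_expand[OF ik[OF i k]])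
    qed (use pt[OF _ i] in \<open>auto intro!: T.finsum_closed\<close>)
    also have "\<dots> = (\<Oplus>\<^bsub>BC\<^esub>r\<in>{..<d}. \<Oplus>\<^bsub>BC\<^esub>k\<in>{..<d}. pure (coord r (u i \<otimes> u k) \<odot>\<^bsub>A\<^esub> (g i \<otimes>\<^bsub>A\<^esub> g k)) (u r))"
      using pt[OF _ i] by (intro T.finsum_swap) auto
    also have "\<dots> = (\<Oplus>\<^bsub>BC\<^esub>r\<in>{..<d}. pure (\<Oplus>\<^bsub>A\<^esub>k\<in>{..<d}. coord r (u i \<otimes> u k) \<odot>\<^bsub>A\<^esub> (g i \<otimes>\<^bsub>A\<^esub> g k)) (u r))"
    proof (rule T.finsum_cong')
      fix r assume "r \<in> {..<d}"
      then have r: "r < d" by simp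
      show "(\<Oplus>\<^bsub>BC\<^esub>k\<in>{..<d}. pure (coord r (u i \<otimes> u k) \<odot>\<^bsub>A\<^esub> (g i \<otimes>\<^bsub>A\<^esub> g k)) (u r)) =
        pure (\<Oplus>\<^bsub>A\<^esub>k\<in>{..<d}. coord r (u i \<otimes> u k) \<odot>\<^bsub>A\<^esub> (g i \<otimes>\<^bsub>A\<^esub> g k)) (u r)"
        using t[OF r i] u_in[OF r] by (intro pure_finsum_left[symmetric]) auto
    qed (use t[OF _ i] u_in in \<open>auto intro!: pure_closed A.finsum_closed\<close>)
    finally show "pure (g i) (u i) \<otimes>\<^bsub>BC\<^esub> G = \<dots>" .
  qed (use t u_in in \<open>auto intro!: T.finsum_closed pure_closed A.finsum_closed\<close>)
  also have "\<dots> = (\<Oplus>\<^bsub>BC\<^esub>r\<in>{..<d}. \<Oplus>\<^bsub>BC\<^esub>i\<in>{..<d}. pure (\<Oplus>\<^bsub>A\<^esub>k\<in>{..<d}. coord r (u i \<otimes> u k) \<odot>\<^bsub>A\<^esub> (g i \<otimes>\<^bsub>A\<^esub> g k)) (u r))"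
    using t u_in by (intro T.finsum_swap) (auto intro!: pure_closed A.finsum_closed)
  also have "\<dots> = (\<Oplus>\<^bsub>BC\<^esub>r\<in>{..<d}. pure (bilin (coord r) g g) (u r))"
  proof (rule T.finsum_cong')
    fix r assume "r \<in> {..<d}"
    then have r: "r < d" by simp
    show "(\<Oplus>\<^bsub>BC\<^esub>i\<in>{..<d}. pure (\<Oplus>\<^bsub>A\<^esub>k\<in>{..<d}. coord r (u i \<otimes> u k) \<odot>\<^bsub>A\<^esub> (g i \<otimes>\<^bsub>A\<^esub> g k)) (u r)) =
        pure (bilin (coord r) g g) (u r)"
      unfolding bilin_def using t[OF r] u_in[OF r] by (intro pure_finsum_left[symmetric]) (auto intro!: A.finsum_closed)
  qed (use bilin_closed[OF coord_lin g g] u_in pure_closed in auto)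
  finally show ?thesis .
qed

text \<open>The elements \<open>\<Sum>\<^sub>i g\<^sub>j\<^sub>i \<otimes> u\<^sub>i\<close> have squares that add up to \<open>f \<otimes> 1\<close>, since the hypothesis compares the coefficients of
  each \<open>u\<^sub>r\<close>.  Only elements of \<open>A\<close> occur in the hypothesis, so it can be moved between \<open>A\<close> and its subalgebras.\<close>

theorem sum_of_squares_of_coordinates:
  assumes f: "f \<in> carrier A" and g: "\<And>j i. i < d \<Longrightarrow> g j i \<in> carrier A"
    and eq: "\<And>r. r < d \<Longrightarrow> coord r \<one> \<odot>\<^bsub>A\<^esub> f = (\<Oplus>\<^bsub>A\<^esub>j\<in>{..<m}. bilin (coord r) (g j) (g j))"
  shows "sum_of_n_squares BC m (to_base_change R F A f)"
proof -
  define G where "G j = (\<Oplus>\<^bsub>BC\<^esub>i\<in>{..<d}. pure (g j i) (u i))" for j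
  have G: "G j \<in> carrier BC" for j
    unfolding G_def using g u_in by (intro T.finsum_closed) (auto simp: pure_closed)
  have b: "bilin (coord r) (g j) (g j) \<in> carrier A" if "r < d" for r j
    by (rule bilin_closed[OF coord_lin[OF that] g g])
  have "(\<Oplus>\<^bsub>BC\<^esub>j\<in>{..<m}. G j \<otimes>\<^bsub>BC\<^esub> G j) = (\<Oplus>\<^bsub>BC\<^esub>j\<in>{..<m}. \<Oplus>\<^bsub>BC\<^esub>r\<in>{..<d}. pure (bilin (coord r) (g j) (g j)) (u r))"
  proof (rule T.finsum_cong')
    show "G j \<otimes>\<^bsub>BC\<^esub> G j = (\<Oplus>\<^bsub>BC\<^esub>r\<in>{..<d}. pure (bilin (coord r) (g j) (g j)) (u r))" for j
      unfolding G_def by (rule square_of_combination[OF g])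
  qed (use b u_in pure_closed in \<open>auto intro!: T.finsum_closed\<close>)
  also have "\<dots> = (\<Oplus>\<^bsub>BC\<^esub>r\<in>{..<d}. \<Oplus>\<^bsub>BC\<^esub>j\<in>{..<m}. pure (bilin (coord r) (g j) (g j)) (u r))"
    using b u_in pure_closed by (intro T.finsum_swap) auto
  also have "\<dots> = (\<Oplus>\<^bsub>BC\<^esub>r\<in>{..<d}. pure (coord r \<one> \<odot>\<^bsub>A\<^esub> f) (u r))"
  proof (rule T.finsum_cong')
    fix r assume "r \<in> {..<d}"
    then have r: "r < d" by simp
    show "(\<Oplus>\<^bsub>BC\<^esub>j\<in>{..<m}. pure (bilin (coord r) (g j) (g j)) (u r)) = pure (coord r \<one> \<odot>\<^bsub>A\<^esub> f) (u r)"
      unfolding eq[OF r] using b[OF r] u_in[OF r] by (intro pure_finsum_left[symmetric]) auto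
  qed (use f coord_F u_in in \<open>auto intro!: pure_closed smult_closed\<close>)
  also have "\<dots> = pure f \<one>" by (rule pure_expand[OF f one_closed, symmetric])
  finally have "to_base_change R F A f = (\<Oplus>\<^bsub>BC\<^esub>j\<in>{..<m}. G j \<otimes>\<^bsub>BC\<^esub> G j)"
    by (simp add: pure_def to_base_change_eq)
  then show ?thesis unfolding sum_of_n_squares_def using G by blast
qed

end

section \<open>Descent of sums of squares\<close>

lemma (in ring) sum_of_n_squares_finsum:
  assumes "finite I" "\<And>i. i \<in> I \<Longrightarrow> sum_of_n_squares R n (f i)"
  shows "sum_of_n_squares R (card I * n) (\<Oplus>i\<in>I. f i)"
  using assms
proof (induction I rule: finite_induct)
  case (insert i I)
  then have "f \<in> I \<rightarrow> carrier R" "f i \<in> carrier R" using sum_of_n_squares_closed by auto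
  with insert show ?case using sum_of_n_squares_add[of n "f i" "card I * n" "\<Oplus>i\<in>I. f i"]
    by (simp add: finsum_insert)
qed (simp add: sum_of_n_squares_0)

lemma sum_of_n_squares_smult:
  fixes S (structure)
  assumes "algebra S M" and "sum_of_n_squares S p c" and h: "sum_of_n_squares M m h"
  shows "sum_of_n_squares M (p * m) (c \<odot>\<^bsub>M\<^esub> h)"
proof -
  interpret M': algebra S M by fact
  show ?thesis using assms(2)
  proof (induction p arbitrary: c)
    case 0
    then show ?case using M'.sum_of_n_squares_closed[OF h]
      by (simp add: M'.R.sum_of_n_squares_0 M'.sum_of_n_squares_0)
  next
    case (Suc p)
    then obtain b c' where b: "b \<in> carrier S" and c': "sum_of_n_squares S p c'" and c: "c = b \<otimes> b \<oplus> c'"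
      by (auto simp: M'.R.sum_of_n_squares_Suc)
    have hc: "h \<in> carrier M" by (rule M'.sum_of_n_squares_closed[OF h])
    have one: "b \<odot>\<^bsub>M\<^esub> \<one>\<^bsub>M\<^esub> \<in> carrier M" using b by simp
    have "(b \<odot>\<^bsub>M\<^esub> \<one>\<^bsub>M\<^esub>) \<otimes>\<^bsub>M\<^esub> (b \<odot>\<^bsub>M\<^esub> \<one>\<^bsub>M\<^esub>) = b \<odot>\<^bsub>M\<^esub> (b \<odot>\<^bsub>M\<^esub> \<one>\<^bsub>M\<^esub>)"
      using M'.smult_assoc2[OF b _ one, of "\<one>\<^bsub>M\<^esub>"] one by simp
    then have "(b \<odot>\<^bsub>M\<^esub> \<one>\<^bsub>M\<^esub>) \<otimes>\<^bsub>M\<^esub> (b \<odot>\<^bsub>M\<^esub> \<one>\<^bsub>M\<^esub>) \<otimes>\<^bsub>M\<^esub> h = (b \<otimes> b) \<odot>\<^bsub>M\<^esub> h"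
      using M'.smult_assoc2[of "b \<otimes> b" "\<one>\<^bsub>M\<^esub>" h] b hc by (simp add: M'.smult_assoc1)
    then have "sum_of_n_squares M m ((b \<otimes> b) \<odot>\<^bsub>M\<^esub> h)"
      using M'.sum_of_n_squares_square_mult[OF one h] by simp
    then have "sum_of_n_squares M (m + p * m) ((b \<otimes> b) \<odot>\<^bsub>M\<^esub> h \<oplus>\<^bsub>M\<^esub> c' \<odot>\<^bsub>M\<^esub> h)"
      using Suc.IH[OF c'] by (rule M'.sum_of_n_squares_add)
    then show ?case
      unfolding c using M'.smult_l_distr[of "b \<otimes> b" c' h] b hc M'.R.sum_of_n_squares_closed[OF c'] by simp
  qed
qed

text \<open>A finite infimum of extended naturals is attained, by well-ordering.\<close>

lemma pythagoras_number_attained: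
  assumes "pythagoras_number R = enat p" "sum_of_squares R x"
  shows "sum_of_n_squares R p x"
proof -
  let ?A = "{enat p |p. \<forall>x. sum_of_squares R x \<longrightarrow> sum_of_n_squares R p x}"
  have inf: "Inf ?A = enat p" using assms(1) by (simp add: pythagoras_number_def)
  have ne: "?A \<noteq> {}"
  proof
    assume e: "?A = {}"
    have "Inf ?A = \<infinity>" by (subst e) (simp add: Inf_enat_def)
    with inf show False by simp
  qed
  then obtain x where "x \<in> ?A" by blast
  then have "(LEAST x. x \<in> ?A) \<in> ?A" by (rule LeastI)
  moreover have "Inf ?A = (LEAST x. x \<in> ?A)" unfolding Inf_enat_def using ne by (simp only: if_False)
  ultimately have "enat p \<in> ?A" using inf by simp
  then show ?thesis using assms(2) by auto
qed

context base_change_setting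
begin

lemma bilin_diagonal:
  assumes a: "\<And>i. i < d \<Longrightarrow> a i \<in> carrier A"
  shows "bilin t a a = (\<Oplus>\<^bsub>A\<^esub>i\<in>{..<d}. t (u i \<otimes> u i) \<odot>\<^bsub>A\<^esub> (a i \<otimes>\<^bsub>A\<^esub> a i))"
  unfolding bilin_def
proof (rule A.finsum_cong')
  note tm = bilin_terms[OF linear_functional_axioms, of a a, OF a a]
  show "(\<lambda>i. t (u i \<otimes> u i) \<odot>\<^bsub>A\<^esub> (a i \<otimes>\<^bsub>A\<^esub> a i)) \<in> {..<d} \<rightarrow> carrier A" using tm by auto
  fix i assume "i \<in> {..<d}"
  then have i: "i < d" by simp
  show "(\<Oplus>\<^bsub>A\<^esub>j\<in>{..<d}. t (u i \<otimes> u j) \<odot>\<^bsub>A\<^esub> (a i \<otimes>\<^bsub>A\<^esub> a j)) = t (u i \<otimes> u i) \<odot>\<^bsub>A\<^esub> (a i \<otimes>\<^bsub>A\<^esub> a i)"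
  proof (rule A.finsum_single)
    fix j assume "j \<in> {..<d}" "j \<noteq> i"
    then show "t (u i \<otimes> u j) \<odot>\<^bsub>A\<^esub> (a i \<otimes>\<^bsub>A\<^esub> a j) = \<zero>\<^bsub>A\<^esub>"
      using t_orth[OF i, of j] A.smult_l_null[of "a i \<otimes>\<^bsub>A\<^esub> a j"] a i by simp
  qed (use i tm in auto)
qed simp

text \<open>Apply \<open>id \<otimes> t\<close> to \<open>f \<otimes> 1 = \<Sum>\<^sub>j g\<^sub>j\<^sup>2\<close>; the mixed terms vanish by orthogonality.  The index is shifted because the coefficients are numbered
  from \<open>1\<close> and the basis from \<open>0\<close>.\<close>

theorem squares_descend_orthogonal:
  "squares_descend R F d (\<lambda>i. t (u (i - 1) \<otimes> u (i - 1))) A"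
  unfolding squares_descend_def
proof (intro allI ballI impI)
  fix m :: nat and f assume "m \<ge> 1" and f: "f \<in> carrier A"
    and sos: "sum_of_n_squares (base_change R F A) m (to_base_change R F A f)"
  obtain g where g: "\<And>j i. i < d \<Longrightarrow> g j i \<in> carrier A"
    and eq: "\<And>\<mu>. linear_functional R F \<mu> \<Longrightarrow> \<mu> \<one> \<odot>\<^bsub>A\<^esub> f = (\<Oplus>\<^bsub>A\<^esub>j\<in>{..<m}. bilin \<mu> (g j) (g j))"
    using coordinates_of_sum_of_squares[OF f sos] by blast
  define c where "c i = t (u i \<otimes> u i)" for i
  define h where "h i = (\<Oplus>\<^bsub>A\<^esub>j\<in>{..<m}. g j i \<otimes>\<^bsub>A\<^esub> g j i)" for i
  have c: "c i \<in> F" if "i < d" for i using t_in u_in that by (simp add: c_def)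
  have gg: "g j i \<otimes>\<^bsub>A\<^esub> g j i \<in> carrier A" if "i < d" for i j using g that by simp
  have h: "h i \<in> carrier A" if "i < d" for i unfolding h_def using gg[OF that] by (intro A.finsum_closed) auto
  have "f = t \<one> \<odot>\<^bsub>A\<^esub> f" using A.smult_one[OF f] by (simp add: t_one)
  also have "\<dots> = (\<Oplus>\<^bsub>A\<^esub>j\<in>{..<m}. bilin t (g j) (g j))" by (rule eq[OF linear_functional_axioms])
  also have "\<dots> = (\<Oplus>\<^bsub>A\<^esub>j\<in>{..<m}. \<Oplus>\<^bsub>A\<^esub>i\<in>{..<d}. c i \<odot>\<^bsub>A\<^esub> (g j i \<otimes>\<^bsub>A\<^esub> g j i))"
  proof (rule A.finsum_cong')
    show "bilin t (g j) (g j) = (\<Oplus>\<^bsub>A\<^esub>i\<in>{..<d}. c i \<odot>\<^bsub>A\<^esub> (g j i \<otimes>\<^bsub>A\<^esub> g j i))" for j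
      unfolding c_def by (rule bilin_diagonal[OF g])
  qed (use c gg in \<open>auto intro!: A.finsum_closed smult_closed\<close>)
  also have "\<dots> = (\<Oplus>\<^bsub>A\<^esub>i\<in>{..<d}. \<Oplus>\<^bsub>A\<^esub>j\<in>{..<m}. c i \<odot>\<^bsub>A\<^esub> (g j i \<otimes>\<^bsub>A\<^esub> g j i))"
    using c gg smult_closed by (intro A.finsum_swap) auto
  also have "\<dots> = (\<Oplus>\<^bsub>A\<^esub>i\<in>{..<d}. c i \<odot>\<^bsub>A\<^esub> h i)"
  proof (rule A.finsum_cong')
    fix i assume "i \<in> {..<d}"
    then have i: "i < d" by simp
    show "(\<Oplus>\<^bsub>A\<^esub>j\<in>{..<m}. c i \<odot>\<^bsub>A\<^esub> (g j i \<otimes>\<^bsub>A\<^esub> g j i)) = c i \<odot>\<^bsub>A\<^esub> h i"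
      unfolding h_def using A.finsum_smult_ldistr[of "{..<m}" "c i" "\<lambda>j. g j i \<otimes>\<^bsub>A\<^esub> g j i"] c[OF i] gg[OF i] by simp
  qed (use c h smult_closed in auto)
  also have "\<dots> = (\<Oplus>\<^bsub>A\<^esub>i\<in>Suc ` {..<d}. c (i - 1) \<odot>\<^bsub>A\<^esub> h (i - 1))"
    using c h smult_closed by (subst A.add.finprod_reindex) auto
  also have "Suc ` {..<d} = {1..d}" by (simp add: image_Suc_lessThan)
  finally have "f = (\<Oplus>\<^bsub>A\<^esub>i\<in>{1..d}. t (u (i - 1) \<otimes> u (i - 1)) \<odot>\<^bsub>A\<^esub> h (i - 1))" unfolding c_def .
  moreover have "sum_of_n_squares A m (h (i - 1))" if "i \<in> {1..d}" for i
    unfolding sum_of_n_squares_def h_def using that g by (intro bexI[of _ "\<lambda>j. g j (i - 1)"]) auto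
  ultimately show "\<exists>g\<in>{1..d} \<rightarrow> carrier A. (\<forall>i\<in>{1..d}. sum_of_n_squares A m (g i)) \<and>
     f = (\<Oplus>\<^bsub>A\<^esub>i\<in>{1..d}. t (u (i - 1) \<otimes> u (i - 1)) \<odot>\<^bsub>A\<^esub> g i)"
    using h by (intro bexI[of _ "\<lambda>i. h (i - 1)"]) auto
qed

end

section \<open>Transport of countably generated subalgebras\<close>

text \<open>The structure of the subalgebra \<open>B\<close> carried over to the image of \<open>B\<close> under the injection \<open>\<iota>\<close>.\<close>

definition transported_algebra ::
  "('a, 'b, 'n) module_scheme \<Rightarrow> 'b set \<Rightarrow> ('b \<Rightarrow> 'c) \<Rightarrow> ('a, 'c) module" where
  "transported_algebra A B \<iota> =
     \<lparr>carrier = \<iota> ` B,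
      monoid.mult = (\<lambda>x y. \<iota> (the_inv_into B \<iota> x \<otimes>\<^bsub>A\<^esub> the_inv_into B \<iota> y)), one = \<iota> \<one>\<^bsub>A\<^esub>,
      ring.zero = \<iota> \<zero>\<^bsub>A\<^esub>, ring.add = (\<lambda>x y. \<iota> (the_inv_into B \<iota> x \<oplus>\<^bsub>A\<^esub> the_inv_into B \<iota> y)),
      module.smult = (\<lambda>r x. \<iota> (r \<odot>\<^bsub>A\<^esub> the_inv_into B \<iota> x))\<rparr>"

locale transported_subalgebra = A: algebra S A
  for S :: "('a, 'm) ring_scheme" (structure) and A :: "('a, 'b, 'n) module_scheme" +
  fixes B :: "'b set" and \<iota> :: "'b \<Rightarrow> 'c"
  assumes B_sub: "B \<subseteq> carrier A" and B_zero: "\<zero>\<^bsub>A\<^esub> \<in> B" and B_one: "\<one>\<^bsub>A\<^esub> \<in> B"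
    and B_add: "x \<in> B \<Longrightarrow> y \<in> B \<Longrightarrow> x \<oplus>\<^bsub>A\<^esub> y \<in> B" and B_mult: "x \<in> B \<Longrightarrow> y \<in> B \<Longrightarrow> x \<otimes>\<^bsub>A\<^esub> y \<in> B"
    and B_smult: "r \<in> carrier S \<Longrightarrow> x \<in> B \<Longrightarrow> r \<odot>\<^bsub>A\<^esub> x \<in> B" and \<iota>_inj: "inj_on \<iota> B"
begin

abbreviation (input) "B' \<equiv> transported_algebra A B \<iota>"
abbreviation (input) "\<kappa> \<equiv> the_inv_into B \<iota>"

lemma Bc: "x \<in> B \<Longrightarrow> x \<in> carrier A"
  using B_sub by blast

lemma B_neg: "x \<in> B \<Longrightarrow> \<ominus>\<^bsub>A\<^esub> x \<in> B"
  using B_smult[of "\<ominus>\<^bsub>S\<^esub> \<one>\<^bsub>S\<^esub>" x] A.smult_l_minus[of "\<one>\<^bsub>S\<^esub>" x] Bc[of x] by simp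

lemma \<kappa>_\<iota> [simp]: "x \<in> B \<Longrightarrow> \<kappa> (\<iota> x) = x"
  by (rule the_inv_into_f_f[OF \<iota>_inj])

lemma B'_carrier: "carrier B' = \<iota> ` B"
  by (simp add: transported_algebra_def)

lemma \<kappa>_in: "y \<in> carrier B' \<Longrightarrow> \<kappa> y \<in> B"
  by (auto simp: B'_carrier)

lemma \<kappa>_inj: "y \<in> carrier B' \<Longrightarrow> z \<in> carrier B' \<Longrightarrow> \<kappa> y = \<kappa> z \<Longrightarrow> y = z"
  by (auto simp: B'_carrier)

lemma B'_ops:
  "x \<in> B \<Longrightarrow> y \<in> B \<Longrightarrow> \<iota> x \<otimes>\<^bsub>B'\<^esub> \<iota> y = \<iota> (x \<otimes>\<^bsub>A\<^esub> y)"
  "x \<in> B \<Longrightarrow> y \<in> B \<Longrightarrow> \<iota> x \<oplus>\<^bsub>B'\<^esub> \<iota> y = \<iota> (x \<oplus>\<^bsub>A\<^esub> y)"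
  "x \<in> B \<Longrightarrow> r \<odot>\<^bsub>B'\<^esub> \<iota> x = \<iota> (r \<odot>\<^bsub>A\<^esub> x)"
  "\<one>\<^bsub>B'\<^esub> = \<iota> \<one>\<^bsub>A\<^esub>" "\<zero>\<^bsub>B'\<^esub> = \<iota> \<zero>\<^bsub>A\<^esub>"
  by (simp_all add: transported_algebra_def)

lemma B'_cases: "y \<in> carrier B' \<Longrightarrow> (\<And>x. x \<in> B \<Longrightarrow> y = \<iota> x \<Longrightarrow> thesis) \<Longrightarrow> thesis"
  by (auto simp: B'_carrier)

lemma cring_B': "cring B'"
proof (intro cringI abelian_groupI comm_monoidI)
  fix x assume "x \<in> carrier B'"
  then obtain a where a: "a \<in> B" "x = \<iota> a" by (rule B'_cases)
  have "\<iota> (\<ominus>\<^bsub>A\<^esub> a) \<oplus>\<^bsub>B'\<^esub> x = \<zero>\<^bsub>B'\<^esub>" using a B_neg Bc by (simp add: B'_ops A.l_neg)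
  then show "\<exists>y\<in>carrier B'. y \<oplus>\<^bsub>B'\<^esub> x = \<zero>\<^bsub>B'\<^esub>" using B_neg[OF a(1)] B'_carrier by blast
  show "\<zero>\<^bsub>B'\<^esub> \<oplus>\<^bsub>B'\<^esub> x = x" "\<one>\<^bsub>B'\<^esub> \<otimes>\<^bsub>B'\<^esub> x = x" using a B_zero B_one Bc by (simp_all add: B'_ops)
  fix y assume "y \<in> carrier B'"
  then obtain b where b: "b \<in> B" "y = \<iota> b" by (rule B'_cases)
  show "x \<oplus>\<^bsub>B'\<^esub> y \<in> carrier B'" "x \<otimes>\<^bsub>B'\<^esub> y \<in> carrier B'"
    using a b B_add B_mult by (simp_all add: B'_ops B'_carrier)
  show "x \<oplus>\<^bsub>B'\<^esub> y = y \<oplus>\<^bsub>B'\<^esub> x" "x \<otimes>\<^bsub>B'\<^esub> y = y \<otimes>\<^bsub>B'\<^esub> x"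
    using a b Bc by (simp_all add: B'_ops A.a_comm A.m_comm)
  fix z assume "z \<in> carrier B'"
  then obtain c where c: "c \<in> B" "z = \<iota> c" by (rule B'_cases)
  show "x \<oplus>\<^bsub>B'\<^esub> y \<oplus>\<^bsub>B'\<^esub> z = x \<oplus>\<^bsub>B'\<^esub> (y \<oplus>\<^bsub>B'\<^esub> z)" "x \<otimes>\<^bsub>B'\<^esub> y \<otimes>\<^bsub>B'\<^esub> z = x \<otimes>\<^bsub>B'\<^esub> (y \<otimes>\<^bsub>B'\<^esub> z)"
    "(x \<oplus>\<^bsub>B'\<^esub> y) \<otimes>\<^bsub>B'\<^esub> z = x \<otimes>\<^bsub>B'\<^esub> z \<oplus>\<^bsub>B'\<^esub> y \<otimes>\<^bsub>B'\<^esub> z"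
    using a b c B_add B_mult Bc by (simp_all add: B'_ops A.a_assoc A.m_assoc A.l_distr)
qed (use B_zero B_one in \<open>simp_all add: B'_ops B'_carrier\<close>)

lemma algebra_B': "algebra S B'"
proof (rule algebraI)
  show "cring S" by (rule A.R.cring_axioms)
  show "cring B'" by (rule cring_B')
  fix x assume "x \<in> carrier B'"
  then obtain a where a: "a \<in> B" "x = \<iota> a" by (rule B'_cases)
  show "\<one>\<^bsub>S\<^esub> \<odot>\<^bsub>B'\<^esub> x = x" using a Bc by (simp add: B'_ops)
  fix r assume r: "r \<in> carrier S"
  show "r \<odot>\<^bsub>B'\<^esub> x \<in> carrier B'" using a r B_smult by (simp add: B'_ops B'_carrier)
  show "(r \<oplus>\<^bsub>S\<^esub> s) \<odot>\<^bsub>B'\<^esub> x = r \<odot>\<^bsub>B'\<^esub> x \<oplus>\<^bsub>B'\<^esub> s \<odot>\<^bsub>B'\<^esub> x" "(r \<otimes>\<^bsub>S\<^esub> s) \<odot>\<^bsub>B'\<^esub> x = r \<odot>\<^bsub>B'\<^esub> (s \<odot>\<^bsub>B'\<^esub> x)"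
    if "s \<in> carrier S" for s
    using that a r B_smult Bc by (simp_all add: B'_ops A.smult_l_distr A.smult_assoc1)
  fix y assume "y \<in> carrier B'"
  then obtain b where b: "b \<in> B" "y = \<iota> b" by (rule B'_cases)
  show "r \<odot>\<^bsub>B'\<^esub> (x \<oplus>\<^bsub>B'\<^esub> y) = r \<odot>\<^bsub>B'\<^esub> x \<oplus>\<^bsub>B'\<^esub> r \<odot>\<^bsub>B'\<^esub> y" "(r \<odot>\<^bsub>B'\<^esub> x) \<otimes>\<^bsub>B'\<^esub> y = r \<odot>\<^bsub>B'\<^esub> (x \<otimes>\<^bsub>B'\<^esub> y)"
    using a b r B_smult B_add B_mult Bc by (simp_all add: B'_ops A.smult_r_distr A.smult_assoc2)
qed

sublocale B': algebra S B' by (rule algebra_B')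

lemma \<kappa>_ops:
  assumes x: "x \<in> carrier B'"
  shows "r \<in> carrier S \<Longrightarrow> \<kappa> (r \<odot>\<^bsub>B'\<^esub> x) = r \<odot>\<^bsub>A\<^esub> \<kappa> x"
    and "y \<in> carrier B' \<Longrightarrow> \<kappa> (x \<oplus>\<^bsub>B'\<^esub> y) = \<kappa> x \<oplus>\<^bsub>A\<^esub> \<kappa> y"
    and "y \<in> carrier B' \<Longrightarrow> \<kappa> (x \<otimes>\<^bsub>B'\<^esub> y) = \<kappa> x \<otimes>\<^bsub>A\<^esub> \<kappa> y"
  using x B_add B_mult B_smult by (auto simp: B'_ops elim!: B'_cases)

lemma \<kappa>_finsum: "finite I \<Longrightarrow> f \<in> I \<rightarrow> carrier B' \<Longrightarrow> \<kappa> (\<Oplus>\<^bsub>B'\<^esub>i\<in>I. f i) = (\<Oplus>\<^bsub>A\<^esub>i\<in>I. \<kappa> (f i))"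
  by (rule additive_finsum[OF B'.abelian_group_axioms A.abelian_group_axioms])
    (use \<kappa>_in Bc \<kappa>_ops(2) in auto)

lemma \<kappa>_sum_of_squares:
  assumes "sum_of_n_squares B' m y"
  shows "sum_of_n_squares A m (\<kappa> y)"
proof -
  obtain g where g: "g \<in> {..<m} \<rightarrow> carrier B'" and y: "y = (\<Oplus>\<^bsub>B'\<^esub>i\<in>{..<m}. g i \<otimes>\<^bsub>B'\<^esub> g i)"
    using assms unfolding sum_of_n_squares_def by blast
  have "\<kappa> y = (\<Oplus>\<^bsub>A\<^esub>i\<in>{..<m}. \<kappa> (g i \<otimes>\<^bsub>B'\<^esub> g i))" unfolding y by (rule \<kappa>_finsum) (use g in auto)
  also have "\<dots> = (\<Oplus>\<^bsub>A\<^esub>i\<in>{..<m}. \<kappa> (g i) \<otimes>\<^bsub>A\<^esub> \<kappa> (g i))"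
  proof (rule A.finsum_cong')
    fix i assume "i \<in> {..<m}"
    then have "g i \<in> carrier B'" using g by blast
    then show "\<kappa> (g i \<otimes>\<^bsub>B'\<^esub> g i) = \<kappa> (g i) \<otimes>\<^bsub>A\<^esub> \<kappa> (g i)" by (intro \<kappa>_ops(3))
  qed (use g \<kappa>_in Bc in auto)
  finally show ?thesis unfolding sum_of_n_squares_def using g \<kappa>_in Bc by (intro bexI[of _ "\<lambda>i. \<kappa> (g i)"]) auto
qed

end

locale countably_generated = A: algebra S A
  for S :: "('a, 'm) ring_scheme" (structure) and A :: "('a, 'b, 'n) module_scheme" +
  fixes gen :: "nat \<Rightarrow> 'b"
  assumes gen_in: "gen k \<in> carrier A" and nontrivial: "\<one>\<^bsub>S\<^esub> \<noteq> \<zero>\<^bsub>S\<^esub>"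
begin

text \<open>The subalgebra generated by \<open>gen\<close> consists of the values of words: finite lists of terms, each made of a
  scalar and a list of indices of generators.\<close>

definition monomial :: "nat list \<Rightarrow> 'b" where
  "monomial ks = foldr (\<lambda>k x. gen k \<otimes>\<^bsub>A\<^esub> x) ks \<one>\<^bsub>A\<^esub>"

definition val :: "('a \<times> nat list) list \<Rightarrow> 'b" where
  "val w = foldr (\<lambda>(c, ks) x. (c \<odot>\<^bsub>A\<^esub> monomial ks) \<oplus>\<^bsub>A\<^esub> x) w \<zero>\<^bsub>A\<^esub>"

definition words :: "('a \<times> nat list) list set" where
  "words = {w. fst ` set w \<subseteq> carrier S}"

lemma monomial_simps: "monomial [] = \<one>\<^bsub>A\<^esub>" "monomial (k # ks) = gen k \<otimes>\<^bsub>A\<^esub> monomial ks"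
  by (simp_all add: monomial_def)

lemma monomial_in: "monomial ks \<in> carrier A"
  by (induction ks) (auto simp: monomial_simps gen_in)

lemma monomial_append: "monomial (ks @ ls) = monomial ks \<otimes>\<^bsub>A\<^esub> monomial ls"
  by (induction ks) (auto simp: monomial_simps gen_in monomial_in A.m_assoc)

lemma val_simps: "val [] = \<zero>\<^bsub>A\<^esub>" "val ((c, ks) # w) = (c \<odot>\<^bsub>A\<^esub> monomial ks) \<oplus>\<^bsub>A\<^esub> val w"
  by (simp_all add: val_def)

lemma words_simps: "[] \<in> words" "(c, ks) # w \<in> words \<longleftrightarrow> c \<in> carrier S \<and> w \<in> words"
    "w @ w' \<in> words \<longleftrightarrow> w \<in> words \<and> w' \<in> words"
  by (auto simp: words_def)

lemma val_in: "w \<in> words \<Longrightarrow> val w \<in> carrier A"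
  by (induction w) (auto simp: val_simps words_simps monomial_in)

lemma val_append: "w \<in> words \<Longrightarrow> w' \<in> words \<Longrightarrow> val (w @ w') = val w \<oplus>\<^bsub>A\<^esub> val w'"
  by (induction w) (auto simp: val_simps words_simps monomial_in val_in A.a_assoc)

lemma val_term_mult:
  "c \<in> carrier S \<Longrightarrow> w \<in> words \<Longrightarrow> \<exists>w'\<in>words. (c \<odot>\<^bsub>A\<^esub> monomial ks) \<otimes>\<^bsub>A\<^esub> val w = val w'"
proof (induction w)
  case Nil
  then show ?case by (intro bexI[of _ "[]"]) (auto simp: val_simps words_simps monomial_in)
next
  case (Cons p w)
  obtain c' ls where p: "p = (c', ls)" by (cases p)
  then have c': "c' \<in> carrier S" "w \<in> words" using Cons.prems by (auto simp: words_simps)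
  then obtain w' where w': "w' \<in> words" "(c \<odot>\<^bsub>A\<^esub> monomial ks) \<otimes>\<^bsub>A\<^esub> val w = val w'" using Cons by blast
  have m: "monomial ks \<in> carrier A" "monomial ls \<in> carrier A" by (rule monomial_in)+
  have "(c \<odot>\<^bsub>A\<^esub> monomial ks) \<otimes>\<^bsub>A\<^esub> (c' \<odot>\<^bsub>A\<^esub> monomial ls) = c \<odot>\<^bsub>A\<^esub> (monomial ks \<otimes>\<^bsub>A\<^esub> (c' \<odot>\<^bsub>A\<^esub> monomial ls))"
    using A.smult_assoc2[of c "monomial ks" "c' \<odot>\<^bsub>A\<^esub> monomial ls"] m c' Cons.prems by simp
  also have "monomial ks \<otimes>\<^bsub>A\<^esub> (c' \<odot>\<^bsub>A\<^esub> monomial ls) = c' \<odot>\<^bsub>A\<^esub> (monomial ks \<otimes>\<^bsub>A\<^esub> monomial ls)"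
    using A.smult_assoc2[of c' "monomial ls" "monomial ks"] m c' by (simp add: A.m_comm)
  also have "c \<odot>\<^bsub>A\<^esub> (c' \<odot>\<^bsub>A\<^esub> (monomial ks \<otimes>\<^bsub>A\<^esub> monomial ls)) = (c \<otimes>\<^bsub>S\<^esub> c') \<odot>\<^bsub>A\<^esub> monomial (ks @ ls)"
    using m c' Cons.prems by (simp add: A.smult_assoc1 monomial_append)
  finally have "(c \<odot>\<^bsub>A\<^esub> monomial ks) \<otimes>\<^bsub>A\<^esub> val (p # w) = val ((c \<otimes>\<^bsub>S\<^esub> c', ks @ ls) # w')"
    using m c' w' Cons.prems val_in[OF c'(2)] by (simp add: p val_simps A.r_distr)
  moreover have "(c \<otimes>\<^bsub>S\<^esub> c', ks @ ls) # w' \<in> words" using c' w' Cons.prems by (simp add: words_simps)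
  ultimately show ?case by blast
qed

lemma val_mult: "w \<in> words \<Longrightarrow> w' \<in> words \<Longrightarrow> \<exists>v\<in>words. val w \<otimes>\<^bsub>A\<^esub> val w' = val v"
proof (induction w)
  case Nil
  then show ?case by (intro bexI[of _ "[]"]) (auto simp: val_simps words_simps val_in)
next
  case (Cons p w)
  obtain c ks where p: "p = (c, ks)" by (cases p)
  then have c: "c \<in> carrier S" "w \<in> words" using Cons.prems by (auto simp: words_simps)
  obtain v where v: "v \<in> words" "val w \<otimes>\<^bsub>A\<^esub> val w' = val v" using Cons c by blast
  obtain v' where v': "v' \<in> words" "(c \<odot>\<^bsub>A\<^esub> monomial ks) \<otimes>\<^bsub>A\<^esub> val w' = val v'"
    using val_term_mult[OF c(1) Cons.prems(2)] by blast
  have "val (p # w) \<otimes>\<^bsub>A\<^esub> val w' = val (v' @ v)"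
    using v v' c monomial_in val_in Cons.prems by (simp add: p val_simps A.l_distr val_append)
  then show ?case using v v' words_simps(3) by blast
qed

lemma val_smult:
  assumes r: "r \<in> carrier S"
  shows "w \<in> words \<Longrightarrow> \<exists>v\<in>words. r \<odot>\<^bsub>A\<^esub> val w = val v"
proof (induction w)
  case Nil
  then show ?case using r by (intro bexI[of _ "[]"]) (auto simp: val_simps words_simps)
next
  case (Cons p w)
  obtain c ks where p: "p = (c, ks)" by (cases p)
  then have c: "c \<in> carrier S" "w \<in> words" using Cons.prems by (auto simp: words_simps)
  then obtain v where v: "v \<in> words" "r \<odot>\<^bsub>A\<^esub> val w = val v" using Cons by blast
  have "r \<odot>\<^bsub>A\<^esub> val (p # w) = val ((r \<otimes>\<^bsub>S\<^esub> c, ks) # v)"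
    using v r c monomial_in val_in by (simp add: p val_simps A.smult_r_distr A.smult_assoc1)
  then show ?case using v r c words_simps(2)[of "r \<otimes>\<^bsub>S\<^esub> c" ks v] by auto
qed

text \<open>A word as a sequence of scalars: the even places list the scalars of its terms, and a single \<open>1\<close> at one
  of the odd places marks the number that codes the lists of indices.  The length of the word is part
  of that code, so the default \<open>0\<close> behind the last scalar causes no ambiguity.\<close>

definition encode :: "('a \<times> nat list) list \<Rightarrow> nat \<Rightarrow> 'a" where
  "encode w k =
    (if even k then (if k div 2 < length w then fst (w ! (k div 2)) else \<zero>\<^bsub>S\<^esub>)
     else if k div 2 = list_encode (map (list_encode \<circ> snd) w) then \<one>\<^bsub>S\<^esub> else \<zero>\<^bsub>S\<^esub>)"

lemma encode_inj: "encode w = encode w' \<Longrightarrow> w = w'"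
proof -
  assume eq: "encode w = encode w'"
  let ?N = "\<lambda>w :: ('a \<times> nat list) list. list_encode (map (list_encode \<circ> snd) w)"
  have "encode w (2 * ?N w + 1) = \<one>\<^bsub>S\<^esub>" by (simp add: encode_def)
  then have "encode w' (2 * ?N w + 1) = \<one>\<^bsub>S\<^esub>" using eq by simp
  then have "?N w = ?N w'" using nontrivial by (simp add: encode_def split: if_splits)
  then have "map (list_encode \<circ> snd) w = map (list_encode \<circ> snd) w'"
    using inj_list_encode[of UNIV] by (simp add: list_encode_eq)
  then have len: "length w = length w'" and snd: "\<And>i. i < length w \<Longrightarrow> snd (w ! i) = snd (w' ! i)"
    using map_eq_imp_length_eq by (blast, metis comp_apply list_encode_eq map_eq_imp_length_eq nth_map)
  show "w = w'"
  proof (rule nth_equalityI[OF len])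
    fix i assume i: "i < length w"
    have "encode w (2 * i) = encode w' (2 * i)" using eq by simp
    then have "fst (w ! i) = fst (w' ! i)" using i len by (simp add: encode_def)
    then show "w ! i = w' ! i" using snd[OF i] by (simp add: prod_eq_iff)
  qed
qed

theorem generated_subalgebra:
  "\<exists>B rep. transported_subalgebra S A B (encode \<circ> rep) \<and> range gen \<subseteq> B"
proof -
  define B where "B = val ` words"
  define rep where "rep b = (SOME w. w \<in> words \<and> val w = b)" for b
  have rep: "rep b \<in> words" "val (rep b) = b" if "b \<in> B" for b
  proof -
    have "\<exists>w. w \<in> words \<and> val w = b" using that by (auto simp: B_def)
    from someI_ex[OF this] show "rep b \<in> words" "val (rep b) = b" by (simp_all add: rep_def)
  qed
  have "inj_on (encode \<circ> rep) B"
  proof (rule inj_onI)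
    fix x y assume "x \<in> B" "y \<in> B" "(encode \<circ> rep) x = (encode \<circ> rep) y"
    then show "x = y" using rep(2) encode_inj by (metis comp_apply)
  qed
  moreover have "gen k \<in> B" for k
  proof -
    have "val [(\<one>\<^bsub>S\<^esub>, [k])] = gen k" using gen_in by (simp add: val_simps monomial_simps)
    moreover have "[(\<one>\<^bsub>S\<^esub>, [k])] \<in> words" by (simp add: words_simps)
    ultimately show ?thesis unfolding B_def by (metis imageI)
  qed
  moreover have "\<one>\<^bsub>A\<^esub> \<in> B"
  proof -
    have "val [(\<one>\<^bsub>S\<^esub>, [])] = \<one>\<^bsub>A\<^esub>" by (simp add: val_simps monomial_simps)
    moreover have "[(\<one>\<^bsub>S\<^esub>, [])] \<in> words" by (simp add: words_simps)
    ultimately show ?thesis unfolding B_def by (metis imageI)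
  qed
  moreover have "\<zero>\<^bsub>A\<^esub> \<in> B" unfolding B_def using val_simps(1) words_simps(1) by (metis imageI)
  moreover have "x \<oplus>\<^bsub>A\<^esub> y \<in> B" if "x \<in> B" "y \<in> B" for x y
    using that unfolding B_def by (auto simp: val_append[symmetric] words_simps)
  moreover have "x \<otimes>\<^bsub>A\<^esub> y \<in> B" if "x \<in> B" "y \<in> B" for x y
    using that val_mult unfolding B_def by fastforce
  moreover have "r \<odot>\<^bsub>A\<^esub> x \<in> B" if "r \<in> carrier S" "x \<in> B" for r x
    using that val_smult unfolding B_def by fastforce
  moreover have "B \<subseteq> carrier A" unfolding B_def using val_in by blast
  ultimately have "transported_subalgebra S A B (encode \<circ> rep)"
    by (intro transported_subalgebra.intro transported_subalgebra_axioms.intro A.algebra_axioms)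
  then show ?thesis using \<open>\<And>k. gen k \<in> B\<close> by blast
qed

end

section \<open>Descent for algebras of every size\<close>

text \<open>The coordinates of the \<open>g\<^sub>j\<close> and the element \<open>f\<close> generate a subalgebra \<open>B\<close> of \<open>A\<close>, and by
  \<open>sum_of_squares_of_coordinates\<close> the image of \<open>f\<close> is a sum of \<open>m\<close> squares already over \<open>B\<close>.  The copy of \<open>B\<close> on
  functions from naturals to scalars is covered by the hypothesis, and its conclusion can be read in \<open>A\<close>.\<close>

theorem (in base_change_setting) squares_descend_all_types:
  assumes c: "\<And>i. i \<in> {1..d} \<Longrightarrow> c i \<in> F"
    and desc: "\<And>A' :: ('a, nat \<Rightarrow> 'a) module. algebra (R\<lparr>carrier := F\<rparr>) A' \<Longrightarrow> squares_descend R F d c A'"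
  shows "squares_descend R F d c A"
  unfolding squares_descend_def
proof (intro allI ballI impI)
  fix m :: nat and f assume m: "m \<ge> 1" and f: "f \<in> carrier A"
    and sos: "sum_of_n_squares (base_change R F A) m (to_base_change R F A f)"
  obtain g0 where g0: "\<And>j i. i < d \<Longrightarrow> g0 j i \<in> carrier A"
    and eq0: "\<And>\<mu>. linear_functional R F \<mu> \<Longrightarrow> \<mu> \<one> \<odot>\<^bsub>A\<^esub> f = (\<Oplus>\<^bsub>A\<^esub>j\<in>{..<m}. bilin \<mu> (g0 j) (g0 j))"
    using coordinates_of_sum_of_squares[OF f sos] by blast
  \<comment> \<open>The default \<open>f\<close> fills the places that code no coordinate.\<close>
  define gen where "gen k = (case k of 0 \<Rightarrow> f | Suc l \<Rightarrow>
    (if snd (prod_decode l) < d then g0 (fst (prod_decode l)) (snd (prod_decode l)) else f))" for k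
  have gen_f: "gen 0 = f" by (simp add: gen_def)
  have gen_g: "gen (Suc (prod_encode (j, i))) = g0 j i" if "i < d" for j i using that by (simp add: gen_def)
  interpret Gn: countably_generated "R\<lparr>carrier := F\<rparr>" A gen
    by (intro countably_generated.intro countably_generated_axioms.intro A.algebra_axioms)
      (use f g0 one_not_zero in \<open>auto simp: gen_def split: nat.splits\<close>)
  obtain B rep where "transported_subalgebra (R\<lparr>carrier := F\<rparr>) A B (Gn.encode \<circ> rep)" and genB: "range gen \<subseteq> B"
    using Gn.generated_subalgebra by blast
  moreover define \<iota> where "\<iota> = Gn.encode \<circ> rep"
  ultimately have "transported_subalgebra (R\<lparr>carrier := F\<rparr>) A B \<iota>" by simp
  interpret TB: transported_subalgebra "R\<lparr>carrier := F\<rparr>" A B \<iota> by fact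
  let ?B' = "transported_algebra A B \<iota>" and ?\<kappa> = "the_inv_into B \<iota>"
  interpret B': base_change_setting R F t d u coord ?B'
    by (intro base_change_setting.intro orthogonal_functional_axioms TB.algebra_B')
  have fB: "f \<in> B" using genB gen_f by (metis rangeI subsetD)
  have gB: "g0 j i \<in> B" if "i < d" for i j using genB gen_g[OF that] by (metis rangeI subsetD)
  have \<iota>B: "\<iota> x \<in> carrier ?B'" if "x \<in> B" for x using that by (simp add: TB.B'_carrier)
  have bil: "B'.bilin \<mu> (\<lambda>i. \<iota> (g0 j i)) (\<lambda>i. \<iota> (g0 j i)) \<in> carrier ?B' \<and>
      ?\<kappa> (B'.bilin \<mu> (\<lambda>i. \<iota> (g0 j i)) (\<lambda>i. \<iota> (g0 j i))) = bilin \<mu> (g0 j) (g0 j)"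
    if \<mu>: "linear_functional R F \<mu>" for \<mu> j
  proof
    let ?g = "\<lambda>i. \<iota> (g0 j i)"
    have gi: "\<And>i. i < d \<Longrightarrow> ?g i \<in> carrier ?B'" using \<iota>B gB by blast
    have g0i: "\<And>i. i < d \<Longrightarrow> g0 j i \<in> carrier A" by (rule g0)
    have tm: "\<mu> (u i \<otimes> u k) \<odot>\<^bsub>?B'\<^esub> (?g i \<otimes>\<^bsub>?B'\<^esub> ?g k) \<in> carrier ?B'" if "i < d" "k < d" for i k
      using B'.bilin_terms[of \<mu> ?g ?g] \<mu> gi that by blast
    have inn: "(\<Oplus>\<^bsub>?B'\<^esub>k\<in>{..<d}. \<mu> (u i \<otimes> u k) \<odot>\<^bsub>?B'\<^esub> (?g i \<otimes>\<^bsub>?B'\<^esub> ?g k)) \<in> carrier ?B'" if "i < d" for i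
      by (rule TB.B'.finsum_closed) (use tm[OF that] in auto)
    have tA: "\<mu> (u i \<otimes> u k) \<odot>\<^bsub>A\<^esub> (g0 j i \<otimes>\<^bsub>A\<^esub> g0 j k) \<in> carrier A" if "i < d" "k < d" for i k
      using bilin_terms[of \<mu> "g0 j" "g0 j"] \<mu> g0i that by blast
    have inA: "(\<Oplus>\<^bsub>A\<^esub>k\<in>{..<d}. \<mu> (u i \<otimes> u k) \<odot>\<^bsub>A\<^esub> (g0 j i \<otimes>\<^bsub>A\<^esub> g0 j k)) \<in> carrier A" if "i < d" for i
      by (rule A.finsum_closed) (use tA[OF that] in auto)
    show "B'.bilin \<mu> ?g ?g \<in> carrier ?B'" by (rule B'.bilin_closed[OF \<mu> gi gi])
    have tk: "?\<kappa> (\<mu> (u i \<otimes> u k) \<odot>\<^bsub>?B'\<^esub> (?g i \<otimes>\<^bsub>?B'\<^esub> ?g k)) = \<mu> (u i \<otimes> u k) \<odot>\<^bsub>A\<^esub> (g0 j i \<otimes>\<^bsub>A\<^esub> g0 j k)"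
      if "i < d" "k < d" for i k
      using that \<mu>_in[OF \<mu>, of "u i \<otimes> u k"] u_in gi gB TB.\<kappa>_ops(1)[of "?g i \<otimes>\<^bsub>?B'\<^esub> ?g k" "\<mu> (u i \<otimes> u k)"]
      by (simp add: TB.\<kappa>_ops(3) TB.\<kappa>_\<iota>)
    have "?\<kappa> (B'.bilin \<mu> ?g ?g) = (\<Oplus>\<^bsub>A\<^esub>i\<in>{..<d}. ?\<kappa> (\<Oplus>\<^bsub>?B'\<^esub>k\<in>{..<d}. \<mu> (u i \<otimes> u k) \<odot>\<^bsub>?B'\<^esub> (?g i \<otimes>\<^bsub>?B'\<^esub> ?g k)))"
      unfolding B'.bilin_def by (rule TB.\<kappa>_finsum) (use inn in auto)
    also have "\<dots> = bilin \<mu> (g0 j) (g0 j)"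
      unfolding bilin_def
    proof (rule A.finsum_cong')
      show "(\<lambda>i. \<Oplus>\<^bsub>A\<^esub>k\<in>{..<d}. \<mu> (u i \<otimes> u k) \<odot>\<^bsub>A\<^esub> (g0 j i \<otimes>\<^bsub>A\<^esub> g0 j k)) \<in> {..<d} \<rightarrow> carrier A"
        using inA by auto
      fix i assume "i \<in> {..<d}"
      then have i: "i < d" by simp
      have "?\<kappa> (\<Oplus>\<^bsub>?B'\<^esub>k\<in>{..<d}. \<mu> (u i \<otimes> u k) \<odot>\<^bsub>?B'\<^esub> (?g i \<otimes>\<^bsub>?B'\<^esub> ?g k)) =
        (\<Oplus>\<^bsub>A\<^esub>k\<in>{..<d}. ?\<kappa> (\<mu> (u i \<otimes> u k) \<odot>\<^bsub>?B'\<^esub> (?g i \<otimes>\<^bsub>?B'\<^esub> ?g k)))"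
        by (rule TB.\<kappa>_finsum) (use tm[OF i] in auto)
      also have "\<dots> = (\<Oplus>\<^bsub>A\<^esub>k\<in>{..<d}. \<mu> (u i \<otimes> u k) \<odot>\<^bsub>A\<^esub> (g0 j i \<otimes>\<^bsub>A\<^esub> g0 j k))"
        by (rule A.finsum_cong') (use tk[OF i] tA[OF i] in auto)
      finally show "?\<kappa> (\<Oplus>\<^bsub>?B'\<^esub>k\<in>{..<d}. \<mu> (u i \<otimes> u k) \<odot>\<^bsub>?B'\<^esub> (?g i \<otimes>\<^bsub>?B'\<^esub> ?g k)) = \<dots>" .
    qed simp
    finally show "?\<kappa> (B'.bilin \<mu> ?g ?g) = bilin \<mu> (g0 j) (g0 j)" .
  qed
  have "sum_of_n_squares (base_change R F ?B') m (to_base_change R F ?B' (\<iota> f))"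
  proof (rule B'.sum_of_squares_of_coordinates[of _ "\<lambda>j i. \<iota> (g0 j i)"])
    show "\<iota> f \<in> carrier ?B'" by (rule \<iota>B[OF fB])
    show "\<iota> (g0 j i) \<in> carrier ?B'" if "i < d" for j i by (rule \<iota>B[OF gB[OF that]])
    fix r assume r: "r < d"
    note lin = coord_lin[OF r]
    have l: "coord r \<one> \<odot>\<^bsub>?B'\<^esub> \<iota> f \<in> carrier ?B'"
      using B'.smult_closed[OF coord_F[OF r one_closed] \<iota>B[OF fB]] .
    have b: "(\<lambda>j. B'.bilin (coord r) (\<lambda>i. \<iota> (g0 j i)) (\<lambda>i. \<iota> (g0 j i))) \<in> {..<m} \<rightarrow> carrier ?B'"
      using bil[OF lin] by auto
    show "coord r \<one> \<odot>\<^bsub>?B'\<^esub> \<iota> f = (\<Oplus>\<^bsub>?B'\<^esub>j\<in>{..<m}. B'.bilin (coord r) (\<lambda>i. \<iota> (g0 j i)) (\<lambda>i. \<iota> (g0 j i)))"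
    proof (rule TB.\<kappa>_inj[OF l])
      show "(\<Oplus>\<^bsub>?B'\<^esub>j\<in>{..<m}. B'.bilin (coord r) (\<lambda>i. \<iota> (g0 j i)) (\<lambda>i. \<iota> (g0 j i))) \<in> carrier ?B'"
        using b by (rule TB.B'.finsum_closed)
      have "?\<kappa> (coord r \<one> \<odot>\<^bsub>?B'\<^esub> \<iota> f) = coord r \<one> \<odot>\<^bsub>A\<^esub> f"
        using TB.\<kappa>_ops(1)[OF \<iota>B[OF fB], of "coord r \<one>"] coord_F[OF r one_closed] fB by (simp add: TB.\<kappa>_\<iota>)
      also have "\<dots> = (\<Oplus>\<^bsub>A\<^esub>j\<in>{..<m}. bilin (coord r) (g0 j) (g0 j))" by (rule eq0[OF lin])
      also have "\<dots> = ?\<kappa> (\<Oplus>\<^bsub>?B'\<^esub>j\<in>{..<m}. B'.bilin (coord r) (\<lambda>i. \<iota> (g0 j i)) (\<lambda>i. \<iota> (g0 j i)))"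
        using TB.\<kappa>_finsum[OF _ b] bil[OF lin] by simp
      finally show "?\<kappa> (coord r \<one> \<odot>\<^bsub>?B'\<^esub> \<iota> f) = \<dots>" .
    qed
  qed
  then obtain h where h: "h \<in> {1..d} \<rightarrow> carrier ?B'" "\<forall>i\<in>{1..d}. sum_of_n_squares ?B' m (h i)"
    and fh: "\<iota> f = (\<Oplus>\<^bsub>?B'\<^esub>i\<in>{1..d}. c i \<odot>\<^bsub>?B'\<^esub> h i)"
    using desc[OF TB.algebra_B'] m \<iota>B[OF fB] unfolding squares_descend_def by blast
  have hi: "h i \<in> carrier ?B'" if "i \<in> {1..d}" for i using h(1) that by blast
  have ch: "(\<lambda>i. c i \<odot>\<^bsub>?B'\<^esub> h i) \<in> {1..d} \<rightarrow> carrier ?B'"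
    using B'.smult_closed c hi by blast
  have \<kappa>h: "?\<kappa> (h i) \<in> carrier A" if "i \<in> {1..d}" for i using TB.Bc[OF TB.\<kappa>_in[OF hi[OF that]]] .
  have "f = ?\<kappa> (\<iota> f)" using fB by (simp add: TB.\<kappa>_\<iota>)
  also have "\<dots> = (\<Oplus>\<^bsub>A\<^esub>i\<in>{1..d}. ?\<kappa> (c i \<odot>\<^bsub>?B'\<^esub> h i))"
    unfolding fh by (rule TB.\<kappa>_finsum[OF _ ch]) simp
  also have "\<dots> = (\<Oplus>\<^bsub>A\<^esub>i\<in>{1..d}. c i \<odot>\<^bsub>A\<^esub> ?\<kappa> (h i))"
  proof (rule A.finsum_cong')
    fix i assume i: "i \<in> {1..d}"
    show "?\<kappa> (c i \<odot>\<^bsub>?B'\<^esub> h i) = c i \<odot>\<^bsub>A\<^esub> ?\<kappa> (h i)"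
      using TB.\<kappa>_ops(1)[OF hi[OF i], of "c i"] c[OF i] by simp
  qed (use smult_closed c \<kappa>h in auto)
  finally have "f = (\<Oplus>\<^bsub>A\<^esub>i\<in>{1..d}. c i \<odot>\<^bsub>A\<^esub> ?\<kappa> (h i))" .
  then show "\<exists>g\<in>{1..d} \<rightarrow> carrier A. (\<forall>i\<in>{1..d}. sum_of_n_squares A m (g i)) \<and>
     f = (\<Oplus>\<^bsub>A\<^esub>i\<in>{1..d}. c i \<odot>\<^bsub>A\<^esub> g i)"
    using \<kappa>h h(2) TB.\<kappa>_sum_of_squares by (intro bexI[of _ "\<lambda>i. ?\<kappa> (h i)"]) auto
qed

theorem theorem1p2:
  fixes K :: "('k, 'm) ring_scheme" and F :: "'k set" and d :: nat
  assumes "real_field K" and "subfield F K" and "real_field (K\<lparr>carrier := F\<rparr>)"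
    and "ring.dimension K d F (carrier K)"
    and "\<forall>P. field_ordering (K\<lparr>carrier := F\<rparr>) P \<longrightarrow>
           card {Q. field_ordering K Q \<and> Q \<inter> F = P} = d"
  shows "(\<exists>c. descent_coefficients TYPE(nat \<Rightarrow> 'k) K F d c) \<and>
    (\<forall>c. descent_coefficients TYPE(nat \<Rightarrow> 'k) K F d c \<longrightarrow>
       descent_coefficients TYPE('a) K F d c) \<and>
    (\<forall>(A :: ('k, 'a) module) m f p.
       algebra (K\<lparr>carrier := F\<rparr>) A \<and> m \<ge> 1 \<and> f \<in> carrier A \<and>
       sum_of_n_squares (base_change K F A) m (to_base_change K F A f) \<and>
       pythagoras_number (K\<lparr>carrier := F\<rparr>) = enat p \<longrightarrow>
       sum_of_n_squares A (d * m * p) f)"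
proof -
  interpret K: field K using assms(1) by (simp add: real_field_def)
  obtain P0 where P0: "field_ordering (K\<lparr>carrier := F\<rparr>) P0" using assms(3) by (auto simp: real_field_def)
  interpret FF: field "K\<lparr>carrier := F\<rparr>" by (rule K.subfield_is_field[OF assms(2)])
  obtain t u coord where "orthogonal_functional K F t d u coord"
    using K.orthogonal_functional_exists[OF assms(2,4) P0] assms(5) by blast
  interpret O: orthogonal_functional K F t d u coord by fact
  have setting: "base_change_setting K F t d u coord A" if "algebra (K\<lparr>carrier := F\<rparr>) A" for A :: "('k, 'b) module"
    by (intro base_change_setting.intro O.orthogonal_functional_axioms that)
  define c where "c i = t (u (i - 1) \<otimes>\<^bsub>K\<^esub> u (i - 1))" for i :: nat
  have c1: "c 1 = \<one>\<^bsub>K\<^esub>" using O.u_0 O.t_one by (simp add: c_def)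
  have csos: "sum_of_squares (K\<lparr>carrier := F\<rparr>) (c i)" if "i \<in> {1..d}" for i
    unfolding c_def using that by (intro O.t_sos) auto
  have desc: "squares_descend K F d c A" if "algebra (K\<lparr>carrier := F\<rparr>) A" for A :: "('k, 'b) module"
    unfolding c_def by (rule base_change_setting.squares_descend_orthogonal[OF setting[OF that]])
  have "descent_coefficients TYPE(nat \<Rightarrow> 'k) K F d c"
    unfolding descent_coefficients_def using c1 csos desc by blast
  moreover have "descent_coefficients TYPE('a) K F d c'" if "descent_coefficients TYPE(nat \<Rightarrow> 'k) K F d c'" for c'
    unfolding descent_coefficients_def
  proof (intro conjI allI impI)
    have sos: "\<forall>i\<in>{1..d}. sum_of_squares (K\<lparr>carrier := F\<rparr>) (c' i)"
      using that by (simp add: descent_coefficients_def)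
    then have c': "c' i \<in> F" if "i \<in> {1..d}" for i using FF.sum_of_squares_closed[of "c' i"] that by simp
    show "c' 1 = \<one>\<^bsub>K\<^esub>" "\<forall>i\<in>{1..d}. sum_of_squares (K\<lparr>carrier := F\<rparr>) (c' i)"
      using that by (simp_all add: descent_coefficients_def)
    show "squares_descend K F d c' A" if "algebra (K\<lparr>carrier := F\<rparr>) A" for A :: "('k, 'a) module"
      by (rule base_change_setting.squares_descend_all_types[OF setting[OF that] c'])
        (use \<open>descent_coefficients TYPE(nat \<Rightarrow> 'k) K F d c'\<close> in \<open>simp_all add: descent_coefficients_def\<close>)
  qed
  moreover have "sum_of_n_squares A (d * m * p) f"
    if A: "algebra (K\<lparr>carrier := F\<rparr>) A" and m: "m \<ge> 1" and f: "f \<in> carrier A"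
      and sos: "sum_of_n_squares (base_change K F A) m (to_base_change K F A f)"
      and p: "pythagoras_number (K\<lparr>carrier := F\<rparr>) = enat p" for A :: "('k, 'a) module" and m f p
  proof -
    interpret A: algebra "K\<lparr>carrier := F\<rparr>" A by (rule A)
    obtain g where g: "\<forall>i\<in>{1..d}. sum_of_n_squares A m (g i)" "f = (\<Oplus>\<^bsub>A\<^esub>i\<in>{1..d}. c i \<odot>\<^bsub>A\<^esub> g i)"
      using desc[OF A] m f sos unfolding squares_descend_def by blast
    have "sum_of_n_squares A (p * m) (c i \<odot>\<^bsub>A\<^esub> g i)" if "i \<in> {1..d}" for i
      using sum_of_n_squares_smult[OF A pythagoras_number_attained[OF p csos[OF that]]] g(1) that by blast
    then have "sum_of_n_squares A (card {1..d} * (p * m)) f"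
      unfolding g(2) by (intro A.sum_of_n_squares_finsum) auto
    then show ?thesis by (simp add: mult_ac)
  qed
  ultimately show ?thesis by blast
qed

end
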